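(* Let $k$ be a field, let $V$ be a complex of $k$-vector spaces with $\sum_i \dim_k V^i<\infty$, and let $A$ be an associative unital $k$-algebra. (a) For any almost free resolutions $R_1\to A$ and $R_2\to A$ of $A$, there is a quasi-isomorphism $f:(R_1)_V\to (R_2)_V$. (b) The assignment $A\mapsto A_V^\bullet:=\mathrm{H}^\bullet(R_V)$, where $R\to A$ is an almost free resolution of $A$, defines a functor from the category of associative unital $k$-algebras to the category of graded commutative $k$-algebras, and this functor is independent of the choice of almost free resolution $R\to A$. (c) If $V$ is concentrated in degree $0$, then $A_V^0\cong A_V$, where $A_V$ is the commutative $k$-algebra obtained by applying the construction $R\mapsto R_V$ to $A$ viewed as a DG algebra concentrated in degree $0$ (equivalently, $A_V$ is the coordinate ring of the classical representation scheme $\mathrm{Rep}_V(A)$).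
   Context: All algebras are associative and unital over $k$. DG algebras (DGAs) are $\mathbb{Z}$-graded with differential of degree $+1$; "commutative" for DG or graded algebras means graded commutative, and all commutators are graded commutators. For $V$ as in the claim, $\mathrm{End}\,V$ denotes the graded endomorphism ring of $V$, which is a DG algebra. For a DG algebra $R$, let $R*_k\mathrm{End}\,V$ be the coproduct (free product) in the category of DG $k$-algebras, and let $$\sqrt[V]{R}:=(R*_k\mathrm{End}\,V)^{\mathrm{End}\,V}=\{w\in R*_k\mathrm{End}\,V : [w,m]=0\ \text{for all } m\in\mathrm{End}\,V\}.$$ For a DG algebra $S$, its abelianization is $S_\natural:=S/S[S,S]S$, the quotient by the two-sided ideal generated by graded commutators. Set $R_V:=(\sqrt[V]{R})_\natural$, a commutative DG algebra; $R\mapsto R_V$ is a functor from DG algebras to commutative DG algebras. An almost free resolution of an algebra $A$ is a quasi-isomorphism of DG algebras $R\to A$ ($A$ placed in degree $0$ with zero differential), where $R$ is a DG algebra whose underlying graded algebra is free and satisfies $R^i=0$ for all $i>0$. Given an algebra map $f:A\to B$ and almost free resolutions $R_1\to A$, $R_2\to B$, there is a DG algebra map $\tilde f:R_1\to R_2$, unique up to multiplicative homotopy, with $\mathrm{H}^0(\tilde f)=f$; the functor in (b) acts on morphisms through such lifts. When $V$ is concentrated in degree $0$, $\mathrm{Rep}_V(A)$ is the functor from commutative $k$-algebras to sets, $B\mapsto \mathrm{Hom}_{\mathrm{alg}}(A,B\otimes_k\mathrm{End}\,V)$.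
   Formalization: Parts (a) and (b) assume characteristic 0: in characteristic p, for V=A=k, the resolutions k and k<x,y> with dx=y give different cohomology (class of x^p). The coordinate-ring remark in (c) assumes V nonzero: for V=0, A_V=0 but Rep_V(A) is represented by k. *)

theory Defs
  imports "HOL-Algebra.QuotRing" "HOL-Algebra.Module" "HOL-Library.Poly_Mapping"
begin

section \<open>Algebras and DG algebras over a field\<close>

text \<open>
  The ground field is a type \<open>'k\<close> of class \<open>field\<close>; \<open>ground\<close> is the same field as a ring record,
  so that the locales \<open>module\<close> and \<open>submodule\<close> apply. A (not necessarily
  commutative) \<open>'k\<close>-algebra is a record of type \<open>('k, 'a) module\<close> with \<open>kalg\<close>.
\<close>

definition ground :: "'k::field ring" where
  "ground = \<lparr>carrier = UNIV, monoid.mult = (*), one = 1, ring.zero = 0, add = (+)\<rparr>"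

definition kalg :: "('k::field, 'a, 'm) module_scheme \<Rightarrow> bool" where
  "kalg A \<longleftrightarrow> ring A \<and> module ground A \<and>
     (\<forall>c. \<forall>x\<in>carrier A. \<forall>y\<in>carrier A.
        (c \<odot>\<^bsub>A\<^esub> x) \<otimes>\<^bsub>A\<^esub> y = c \<odot>\<^bsub>A\<^esub> (x \<otimes>\<^bsub>A\<^esub> y) \<and>
        x \<otimes>\<^bsub>A\<^esub> (c \<odot>\<^bsub>A\<^esub> y) = c \<odot>\<^bsub>A\<^esub> (x \<otimes>\<^bsub>A\<^esub> y))"

definition linear_map :: "('k, 'a, 'm) module_scheme \<Rightarrow> ('k, 'b, 'n) module_scheme \<Rightarrow> ('a \<Rightarrow> 'b) \<Rightarrow> bool" where
  "linear_map M N f \<longleftrightarrow> f \<in> carrier M \<rightarrow> carrier N \<and>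
     (\<forall>x\<in>carrier M. \<forall>y\<in>carrier M. f (x \<oplus>\<^bsub>M\<^esub> y) = f x \<oplus>\<^bsub>N\<^esub> f y) \<and>
     (\<forall>c. \<forall>x\<in>carrier M. f (c \<odot>\<^bsub>M\<^esub> x) = c \<odot>\<^bsub>N\<^esub> f x)"

definition alg_hom :: "('k::field, 'a, 'm) module_scheme \<Rightarrow> ('k, 'b, 'n) module_scheme \<Rightarrow> ('a \<Rightarrow> 'b) \<Rightarrow> bool" where
  "alg_hom A B f \<longleftrightarrow> kalg A \<and> kalg B \<and> f \<in> ring_hom A B \<and> linear_map A B f"

definition alg_iso :: "('k::field, 'a, 'm) module_scheme \<Rightarrow> ('k, 'b, 'n) module_scheme \<Rightarrow> ('a \<Rightarrow> 'b) \<Rightarrow> bool" where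
  "alg_iso A B f \<longleftrightarrow> alg_hom A B f \<and> bij_betw f (carrier A) (carrier B)"

text \<open>
  One record type serves for complexes (ignoring \<open>mult\<close> and \<open>one\<close>, as \<open>module\<close> does), for graded
  algebras (ignoring \<open>dif\<close>) and for DG algebras. The carrier is the total space, that is the direct
  sum of the homogeneous parts \<open>gr n\<close>.
\<close>

record ('k, 'a) dg = "('k, 'a) module" +
  gr :: "int \<Rightarrow> 'a set"
  dif :: "'a \<Rightarrow> 'a"

definition is_decomp :: "('k, 'a) dg \<Rightarrow> 'a \<Rightarrow> (int \<Rightarrow> 'a) \<Rightarrow> bool" where
  "is_decomp M x f \<longleftrightarrow> (\<forall>n. f n \<in> gr M n) \<and> finite {n. f n \<noteq> \<zero>\<^bsub>M\<^esub>} \<and>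
     x = (\<Oplus>\<^bsub>M\<^esub>n\<in>{n. f n \<noteq> \<zero>\<^bsub>M\<^esub>}. f n)"

definition homog_part :: "('k, 'a) dg \<Rightarrow> 'a \<Rightarrow> int \<Rightarrow> 'a" where
  "homog_part M x = (THE f. is_decomp M x f)"

definition supp :: "('k, 'a) dg \<Rightarrow> 'a \<Rightarrow> int set" where
  "supp M x = {n. homog_part M x n \<noteq> \<zero>\<^bsub>M\<^esub>}"

definition graded_module :: "('k::field, 'a) dg \<Rightarrow> bool" where
  "graded_module M \<longleftrightarrow> module ground M \<and> (\<forall>n. submodule (gr M n) ground M) \<and>
     (\<forall>x\<in>carrier M. \<exists>!f. is_decomp M x f)"

definition dg_complex :: "('k::field, 'a) dg \<Rightarrow> bool" where
  "dg_complex M \<longleftrightarrow> graded_module M \<and> linear_map M M (dif M) \<and>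
     (\<forall>n. dif M ` gr M n \<subseteq> gr M (n + 1)) \<and> (\<forall>x\<in>carrier M. dif M (dif M x) = \<zero>\<^bsub>M\<^esub>)"

definition ksgn :: "int \<Rightarrow> 'k::field" where
  "ksgn n = (if even n then 1 else - 1)"

definition galg :: "('k::field, 'a) dg \<Rightarrow> bool" where
  "galg R \<longleftrightarrow> kalg R \<and> graded_module R \<and> \<one>\<^bsub>R\<^esub> \<in> gr R 0 \<and>
     (\<forall>m n. \<forall>x\<in>gr R m. \<forall>y\<in>gr R n. x \<otimes>\<^bsub>R\<^esub> y \<in> gr R (m + n))"

text \<open>In characteristic 2 squares of odd elements are not required to vanish.\<close>

definition gcalg :: "('k::field, 'a) dg \<Rightarrow> bool" where
  "gcalg R \<longleftrightarrow> galg R \<and>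
     (\<forall>m n. \<forall>x\<in>gr R m. \<forall>y\<in>gr R n. x \<otimes>\<^bsub>R\<^esub> y = ksgn (m * n) \<odot>\<^bsub>R\<^esub> (y \<otimes>\<^bsub>R\<^esub> x))"

definition dga :: "('k::field, 'a) dg \<Rightarrow> bool" where
  "dga R \<longleftrightarrow> galg R \<and> dg_complex R \<and>
     (\<forall>m. \<forall>x\<in>gr R m. \<forall>y\<in>carrier R.
        dif R (x \<otimes>\<^bsub>R\<^esub> y) = dif R x \<otimes>\<^bsub>R\<^esub> y \<oplus>\<^bsub>R\<^esub> ksgn m \<odot>\<^bsub>R\<^esub> (x \<otimes>\<^bsub>R\<^esub> dif R y))"

definition galg_hom :: "('k::field, 'a) dg \<Rightarrow> ('k, 'b) dg \<Rightarrow> ('a \<Rightarrow> 'b) \<Rightarrow> bool" where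
  "galg_hom R S f \<longleftrightarrow> galg R \<and> galg S \<and> alg_hom R S f \<and> (\<forall>n. f ` gr R n \<subseteq> gr S n)"

definition dga_hom :: "('k::field, 'a) dg \<Rightarrow> ('k, 'b) dg \<Rightarrow> ('a \<Rightarrow> 'b) \<Rightarrow> bool" where
  "dga_hom R S f \<longleftrightarrow> dga R \<and> dga S \<and> galg_hom R S f \<and> (\<forall>x\<in>carrier R. f (dif R x) = dif S (f x))"

definition conc :: "('k, 'a, 'm) module_scheme \<Rightarrow> ('k, 'a) dg" where
  "conc A = \<lparr>carrier = carrier A, monoid.mult = monoid.mult A, one = one A,
     ring.zero = ring.zero A, add = add A, smult = smult A,
     gr = (\<lambda>n. if n = 0 then carrier A else {\<zero>\<^bsub>A\<^esub>}), dif = (\<lambda>_. \<zero>\<^bsub>A\<^esub>)\<rparr>"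

text \<open>The graded commutator, extended bilinearly from homogeneous elements.\<close>

definition gcomm :: "('k::field, 'a) dg \<Rightarrow> 'a \<Rightarrow> 'a \<Rightarrow> 'a" where
  "gcomm R x y = finsum R (\<lambda>(i, j).
       homog_part R x i \<otimes>\<^bsub>R\<^esub> homog_part R y j \<ominus>\<^bsub>R\<^esub>
       ksgn (i * j) \<odot>\<^bsub>R\<^esub> (homog_part R y j \<otimes>\<^bsub>R\<^esub> homog_part R x i))
     (supp R x \<times> supp R y)"


section \<open>Subobjects, quotients and cohomology\<close>

definition sub :: "('k, 'a) dg \<Rightarrow> 'a set \<Rightarrow> ('k, 'a) dg" where
  "sub R S = R\<lparr>carrier := S, gr := (\<lambda>n. gr R n \<inter> S)\<rparr>"

text \<open>
  The map on cosets induced by \<open>f\<close>, with values in the cosets of \<open>I\<close> in \<open>S\<close>; compare \<open>rcoset_mult\<close>.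
\<close>

definition coset_map :: "('b, 'n) ring_scheme \<Rightarrow> 'b set \<Rightarrow> ('a \<Rightarrow> 'b) \<Rightarrow> 'a set \<Rightarrow> 'b set" where
  "coset_map S I f X = (\<Union>x\<in>X. I +>\<^bsub>S\<^esub> f x)"

definition alg_quot :: "('k, 'a, 'm) module_scheme \<Rightarrow> 'a set \<Rightarrow> ('k, 'a set) module" where
  "alg_quot R I = \<lparr>carrier = carrier (R Quot I), monoid.mult = monoid.mult (R Quot I),
     one = one (R Quot I), ring.zero = ring.zero (R Quot I), add = add (R Quot I),
     smult = (\<lambda>c. coset_map R I (\<lambda>x. c \<odot>\<^bsub>R\<^esub> x))\<rparr>"

definition dg_quot :: "('k, 'a) dg \<Rightarrow> 'a set \<Rightarrow> ('k, 'a set) dg" where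
  "dg_quot R I = \<lparr>carrier = carrier (alg_quot R I), monoid.mult = monoid.mult (alg_quot R I),
     one = one (alg_quot R I), ring.zero = ring.zero (alg_quot R I), add = add (alg_quot R I),
     smult = smult (alg_quot R I),
     gr = (\<lambda>n. (\<lambda>x. I +>\<^bsub>R\<^esub> x) ` gr R n), dif = coset_map R I (dif R)\<rparr>"

definition cocycles :: "('k, 'a) dg \<Rightarrow> 'a set" where
  "cocycles R = {x \<in> carrier R. dif R x = \<zero>\<^bsub>R\<^esub>}"

definition coboundaries :: "('k, 'a) dg \<Rightarrow> 'a set" where
  "coboundaries R = dif R ` carrier R"

text \<open>The graded algebra of all cohomology groups; the induced differential is zero.\<close>

definition cohom :: "('k, 'a) dg \<Rightarrow> ('k, 'a set) dg" where
  "cohom R = dg_quot (sub R (cocycles R)) (coboundaries R)"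

definition cohom_map :: "('k, 'b) dg \<Rightarrow> ('a \<Rightarrow> 'b) \<Rightarrow> 'a set \<Rightarrow> 'b set" where
  "cohom_map S f = coset_map (sub S (cocycles S)) (coboundaries S) f"

definition quasi_iso :: "('k::field, 'a) dg \<Rightarrow> ('k, 'b) dg \<Rightarrow> ('a \<Rightarrow> 'b) \<Rightarrow> bool" where
  "quasi_iso R S f \<longleftrightarrow> dga_hom R S f \<and>
     bij_betw (cohom_map S f) (carrier (cohom R)) (carrier (cohom S))"


section \<open>Free algebras and almost free resolutions\<close>

text \<open>
  Elements of the free algebra on \<open>X\<close> are finitely supported functions on words,
  \<open>f :: 'x list \<Rightarrow>\<^sub>0 'k\<close> with \<open>keys f \<subseteq> lists X\<close>.
\<close>

definition lin_ext :: "('x \<Rightarrow> ('y \<Rightarrow>\<^sub>0 'k::field)) \<Rightarrow> ('x \<Rightarrow>\<^sub>0 'k) \<Rightarrow> ('y \<Rightarrow>\<^sub>0 'k)" where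
  "lin_ext \<phi> f = (\<Sum>u\<in>Poly_Mapping.keys f.
     Poly_Mapping.map (\<lambda>a. Poly_Mapping.lookup f u * a) (\<phi> u))"

definition basis_elt :: "'x \<Rightarrow> ('x \<Rightarrow>\<^sub>0 'k::field)" where
  "basis_elt u = Poly_Mapping.single u 1"

definition conv :: "('x \<Rightarrow> 'x \<Rightarrow> 'x) \<Rightarrow> ('x \<Rightarrow>\<^sub>0 'k::field) \<Rightarrow> ('x \<Rightarrow>\<^sub>0 'k) \<Rightarrow> ('x \<Rightarrow>\<^sub>0 'k)" where
  "conv opn f g = lin_ext (\<lambda>u. lin_ext (\<lambda>v. basis_elt (opn u v)) g) f"

definition free_eval :: "('k::field, 'a, 'm) module_scheme \<Rightarrow> ('a list \<Rightarrow>\<^sub>0 'k) \<Rightarrow> 'a" where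
  "free_eval R f = (\<Oplus>\<^bsub>R\<^esub>w\<in>Poly_Mapping.keys f.
     Poly_Mapping.lookup f w \<odot>\<^bsub>R\<^esub> foldr (\<lambda>x y. x \<otimes>\<^bsub>R\<^esub> y) w \<one>\<^bsub>R\<^esub>)"

text \<open>
  The underlying graded algebra of \<open>R\<close> is free: for some set \<open>X\<close> of homogeneous elements the canonical
  map from the free algebra on \<open>X\<close> to \<open>R\<close> is bijective.
\<close>

definition free_galg :: "('k::field, 'a) dg \<Rightarrow> bool" where
  "free_galg R \<longleftrightarrow> (\<exists>X \<subseteq> (\<Union>n. gr R n).
     bij_betw (free_eval R) {f. Poly_Mapping.keys f \<subseteq> lists X} (carrier R))"

definition almost_free_res ::
  "('k::field, 'a) module \<Rightarrow> ('k, 'r) dg \<times> ('r \<Rightarrow> 'a) \<Rightarrow> bool" where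
  "almost_free_res A Rp \<longleftrightarrow> kalg A \<and> quasi_iso (fst Rp) (conc A) (snd Rp) \<and>
     free_galg (fst Rp) \<and> (\<forall>i>0. gr (fst Rp) i = {\<zero>\<^bsub>fst Rp\<^esub>})"

text \<open>
  DG algebra maps of resolutions inducing \<open>f\<close> on \<open>H\<^sup>0\<close>. As all algebras are concentrated in
  non-positive degrees, this amounts to commutation with the augmentations.
\<close>

definition is_lift :: "('k::field, 'r) dg \<times> ('r \<Rightarrow> 'a) \<Rightarrow> ('k, 's) dg \<times> ('s \<Rightarrow> 'b) \<Rightarrow>
    ('a \<Rightarrow> 'b) \<Rightarrow> ('r \<Rightarrow> 's) \<Rightarrow> bool" where
  "is_lift Rp Sq f g \<longleftrightarrow> dga_hom (fst Rp) (fst Sq) g \<and>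
     (\<forall>x\<in>carrier (fst Rp). snd Sq (g x) = f (snd Rp x))"


section \<open>Complexes of finite total dimension and their endomorphisms\<close>

definition fin_dim :: "('k::field, 'v, 'm) module_scheme \<Rightarrow> 'v set \<Rightarrow> bool" where
  "fin_dim M W \<longleftrightarrow> (\<exists>B\<subseteq>W. finite B \<and> (\<forall>w\<in>W. \<exists>c. w = (\<Oplus>\<^bsub>M\<^esub>b\<in>B. c b \<odot>\<^bsub>M\<^esub> b)))"

definition fin_total_dim :: "('k::field, 'v) dg \<Rightarrow> bool" where
  "fin_total_dim V \<longleftrightarrow> (\<forall>n. fin_dim V (gr V n)) \<and> finite {n. gr V n \<noteq> {\<zero>\<^bsub>V\<^esub>}}"

text \<open>
  For \<open>V\<close> of finite total dimension the graded endomorphism ring consists of all linear endomorphisms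
  of the total space. Its differential is the graded commutator with the differential of \<open>V\<close>.
\<close>

definition graded_End :: "('k::field, 'v) dg \<Rightarrow> ('k, 'v \<Rightarrow> 'v) dg" where
  "graded_End V = (let E = {f \<in> extensional (carrier V). linear_map V V f} in
     \<lparr>carrier = E, monoid.mult = compose (carrier V), one = (\<lambda>x\<in>carrier V. x),
      ring.zero = (\<lambda>x\<in>carrier V. \<zero>\<^bsub>V\<^esub>), add = (\<lambda>f g. \<lambda>x\<in>carrier V. f x \<oplus>\<^bsub>V\<^esub> g x),
      smult = (\<lambda>c f. \<lambda>x\<in>carrier V. c \<odot>\<^bsub>V\<^esub> f x),
      gr = (\<lambda>n. {f \<in> E. \<forall>i. f ` gr V i \<subseteq> gr V (i + n)}),
      dif = (\<lambda>_. \<lambda>x\<in>carrier V. \<zero>\<^bsub>V\<^esub>)\<rparr>)"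

definition dg_End :: "('k::field, 'v) dg \<Rightarrow> ('k, 'v \<Rightarrow> 'v) dg" where
  "dg_End V = (graded_End V)\<lparr>dif := gcomm (graded_End V) (restrict (dif V) (carrier V))\<rparr>"


section \<open>The free product of DG algebras\<close>

text \<open>
  The coproduct of \<open>R\<close> and \<open>S\<close> is presented by one generator \<open>(n, x)\<close> for every \<open>n\<close> and every
  \<open>x \<in> gr n\<close> (so that each generator has a well-defined degree), modulo the relations which
  make \<open>x \<mapsto> (n, x)\<close> linear and multiplicative on either factor. Before passing to the
  quotient the differential need not square to zero.
\<close>

type_synonym ('r, 's) letter = "(int \<times> 'r) + (int \<times> 's)"

definition letters :: "('k, 'r) dg \<Rightarrow> ('k, 's) dg \<Rightarrow> ('r, 's) letter set" where
  "letters R S = Inl ` {(n, x). x \<in> gr R n} \<union> Inr ` {(n, y). y \<in> gr S n}"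

definition letter_deg :: "('r, 's) letter \<Rightarrow> int" where
  "letter_deg = case_sum fst fst"

definition letter_dif :: "('k, 'r) dg \<Rightarrow> ('k, 's) dg \<Rightarrow> ('r, 's) letter \<Rightarrow> ('r, 's) letter" where
  "letter_dif R S = map_sum (\<lambda>(n, x). (n + 1, dif R x)) (\<lambda>(n, y). (n + 1, dif S y))"

primrec word_dif :: "('k::field, 'r) dg \<Rightarrow> ('k, 's) dg \<Rightarrow>
    ('r, 's) letter list \<Rightarrow> (('r, 's) letter list \<Rightarrow>\<^sub>0 'k)" where
  "word_dif R S [] = 0"
| "word_dif R S (l # w) = basis_elt (letter_dif R S l # w) +
     conv (@) (Poly_Mapping.single [l] (ksgn (letter_deg l))) (word_dif R S w)"

definition free_dg :: "('k::field, 'r) dg \<Rightarrow> ('k, 's) dg \<Rightarrow> ('k, ('r, 's) letter list \<Rightarrow>\<^sub>0 'k) dg" where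
  "free_dg R S = \<lparr>carrier = {f. Poly_Mapping.keys f \<subseteq> lists (letters R S)},
     monoid.mult = conv (@), one = basis_elt [], ring.zero = 0, add = (+),
     smult = (\<lambda>c. Poly_Mapping.map (\<lambda>a. c * a)),
     gr = (\<lambda>n. {f. Poly_Mapping.keys f \<subseteq>
              {w \<in> lists (letters R S). sum_list (map letter_deg w) = n}}),
     dif = lin_ext (word_dif R S)\<rparr>"

definition factor_rels :: "(int \<times> 'a \<Rightarrow> 'x) \<Rightarrow> ('k::field, 'a) dg \<Rightarrow> ('x list \<Rightarrow>\<^sub>0 'k) set" where
  "factor_rels \<iota> R =
     {basis_elt [\<iota> (n, x \<oplus>\<^bsub>R\<^esub> y)] - basis_elt [\<iota> (n, x)] - basis_elt [\<iota> (n, y)] | n x y.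
        x \<in> gr R n \<and> y \<in> gr R n} \<union>
     {basis_elt [\<iota> (n, c \<odot>\<^bsub>R\<^esub> x)] - Poly_Mapping.single [\<iota> (n, x)] c | n c x. x \<in> gr R n} \<union>
     {basis_elt [\<iota> (m + n, x \<otimes>\<^bsub>R\<^esub> y)] - basis_elt [\<iota> (m, x), \<iota> (n, y)] | m n x y.
        x \<in> gr R m \<and> y \<in> gr R n} \<union>
     {basis_elt [\<iota> (0, \<one>\<^bsub>R\<^esub>)] - basis_elt []}"

definition fp_ideal :: "('k::field, 'r) dg \<Rightarrow> ('k, 's) dg \<Rightarrow> (('r, 's) letter list \<Rightarrow>\<^sub>0 'k) set" where
  "fp_ideal R S = genideal (free_dg R S) (factor_rels Inl R \<union> factor_rels Inr S)"

definition free_prod :: "('k::field, 'r) dg \<Rightarrow> ('k, 's) dg \<Rightarrow>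
    ('k, (('r, 's) letter list \<Rightarrow>\<^sub>0 'k) set) dg" where
  "free_prod R S = dg_quot (free_dg R S) (fp_ideal R S)"

definition fp_inr :: "('k::field, 'r) dg \<Rightarrow> ('k, 's) dg \<Rightarrow> 's \<Rightarrow> (('r, 's) letter list \<Rightarrow>\<^sub>0 'k) set" where
  "fp_inr R S y = fp_ideal R S +>\<^bsub>free_dg R S\<^esub>
     (\<Sum>n\<in>supp S y. basis_elt [Inr (n, homog_part S y n)])"

text \<open>The action of \<open>f * id\<close> on representatives.\<close>

definition fp_map :: "('r \<Rightarrow> 'r') \<Rightarrow> (('r, 's) letter list \<Rightarrow>\<^sub>0 'k::field) \<Rightarrow>
    (('r', 's) letter list \<Rightarrow>\<^sub>0 'k)" where
  "fp_map f = lin_ext (\<lambda>w. basis_elt (map (map_sum (apsnd f) id) w))"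


section \<open>The functor \<open>R \<mapsto> R\<^sub>V\<close>\<close>

definition root_alg :: "('k::field, 'v) dg \<Rightarrow> ('k, 'r) dg \<Rightarrow>
    ('k, (('r, 'v \<Rightarrow> 'v) letter list \<Rightarrow>\<^sub>0 'k) set) dg" where
  "root_alg V R = sub (free_prod R (dg_End V))
     {w \<in> carrier (free_prod R (dg_End V)). \<forall>m\<in>carrier (dg_End V).
        gcomm (free_prod R (dg_End V)) w (fp_inr R (dg_End V) m) = \<zero>\<^bsub>free_prod R (dg_End V)\<^esub>}"

definition comm_ideal :: "('k::field, 'a) dg \<Rightarrow> 'a set" where
  "comm_ideal S = genideal S {gcomm S x y | x y. x \<in> carrier S \<and> y \<in> carrier S}"

type_synonym ('k, 'v, 'r) rep_elt = "(('r, 'v \<Rightarrow> 'v) letter list \<Rightarrow>\<^sub>0 'k) set set"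

definition rep_alg :: "('k::field, 'v) dg \<Rightarrow> ('k, 'r) dg \<Rightarrow> ('k, ('k, 'v, 'r) rep_elt) dg" where
  "rep_alg V R = dg_quot (root_alg V R) (comm_ideal (root_alg V R))"

definition rep_map :: "('k::field, 'v) dg \<Rightarrow> ('k, 's) dg \<Rightarrow> ('r \<Rightarrow> 's) \<Rightarrow>
    ('k, 'v, 'r) rep_elt \<Rightarrow> ('k, 'v, 's) rep_elt" where
  "rep_map V S f = coset_map (root_alg V S) (comm_ideal (root_alg V S))
     (coset_map (free_dg S (dg_End V)) (fp_ideal S (dg_End V)) (fp_map f))"


section \<open>The functor \<open>A \<mapsto> H(R\<^sub>V)\<close>\<close>

text \<open>
  Morphisms are functions considered up to equality on the carrier of the source. The objects of the
  source category are all algebras with carrier in the (arbitrary) type \<open>'a\<close>.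
\<close>

definition gc_functor :: "(('k::field, 'a) module \<Rightarrow> ('k, 'x) dg) \<Rightarrow>
    (('k, 'a) module \<Rightarrow> ('k, 'a) module \<Rightarrow> ('a \<Rightarrow> 'a) \<Rightarrow> ('x \<Rightarrow> 'x)) \<Rightarrow> bool" where
  "gc_functor F Fm \<longleftrightarrow>
     (\<forall>A. kalg A \<longrightarrow> gcalg (F A)) \<and>
     (\<forall>A B f. alg_hom A B f \<longrightarrow> galg_hom (F A) (F B) (Fm A B f)) \<and>
     (\<forall>A B f f'. alg_hom A B f \<and> alg_hom A B f' \<and> (\<forall>a\<in>carrier A. f a = f' a) \<longrightarrow>
        (\<forall>x\<in>carrier (F A). Fm A B f x = Fm A B f' x)) \<and>
     (\<forall>A. kalg A \<longrightarrow> (\<forall>x\<in>carrier (F A). Fm A A id x = x)) \<and>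
     (\<forall>A B C f g. alg_hom A B f \<and> alg_hom B C g \<longrightarrow>
        (\<forall>x\<in>carrier (F A). Fm A C (g \<circ> f) x = Fm B C g (Fm A B f x)))"

definition gc_nat_iso :: "(('k::field, 'a) module \<Rightarrow> ('k, 'x) dg) \<Rightarrow>
    (('k, 'a) module \<Rightarrow> ('k, 'a) module \<Rightarrow> ('a \<Rightarrow> 'a) \<Rightarrow> ('x \<Rightarrow> 'x)) \<Rightarrow>
    (('k, 'a) module \<Rightarrow> ('k, 'y) dg) \<Rightarrow>
    (('k, 'a) module \<Rightarrow> ('k, 'a) module \<Rightarrow> ('a \<Rightarrow> 'a) \<Rightarrow> ('y \<Rightarrow> 'y)) \<Rightarrow>
    (('k, 'a) module \<Rightarrow> 'x \<Rightarrow> 'y) \<Rightarrow> bool" where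
  "gc_nat_iso F Fm G Gm \<eta> \<longleftrightarrow>
     (\<forall>A. kalg A \<longrightarrow> galg_hom (F A) (G A) (\<eta> A) \<and> bij_betw (\<eta> A) (carrier (F A)) (carrier (G A))) \<and>
     (\<forall>A B f. alg_hom A B f \<longrightarrow>
        (\<forall>x\<in>carrier (F A). \<eta> B (Fm A B f x) = Gm A B f (\<eta> A x)))"

type_synonym ('k, 'a, 'r) res_choice = "('k, 'a) module \<Rightarrow> ('k, 'r) dg \<times> ('r \<Rightarrow> 'a)"

definition res_choice :: "('k::field, 'a, 'r) res_choice \<Rightarrow> bool" where
  "res_choice Q \<longleftrightarrow> (\<forall>A. kalg A \<longrightarrow> almost_free_res A (Q A))"

definition AV :: "('k::field, 'v) dg \<Rightarrow> ('k, 'a, 'r) res_choice \<Rightarrow>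
    ('k, 'a) module \<Rightarrow> ('k, ('k, 'v, 'r) rep_elt set) dg" where
  "AV V Q A = cohom (rep_alg V (fst (Q A)))"

definition AV_lift_map :: "('k::field, 'v) dg \<Rightarrow> ('k, 's) dg \<Rightarrow> ('r \<Rightarrow> 's) \<Rightarrow>
    ('k, 'v, 'r) rep_elt set \<Rightarrow> ('k, 'v, 's) rep_elt set" where
  "AV_lift_map V S g = cohom_map (rep_alg V S) (rep_map V S g)"

definition AV_map :: "('k::field, 'v) dg \<Rightarrow> ('k, 'a, 'r) res_choice \<Rightarrow>
    ('k, 'a) module \<Rightarrow> ('k, 'a) module \<Rightarrow> ('a \<Rightarrow> 'a) \<Rightarrow>
    ('k, 'v, 'r) rep_elt set \<Rightarrow> ('k, 'v, 'r) rep_elt set" where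
  "AV_map V Q A B f = AV_lift_map V (fst (Q B)) (SOME g. is_lift (Q A) (Q B) f g)"


section \<open>The classical representation functor\<close>

text \<open>
  The tensor product of two algebras: the free vector space on the product of the carriers, modulo
  bilinearity. The span of the bilinearity relations is already a two-sided ideal.
\<close>

definition tensor_free :: "('k::field, 'b, 'm) module_scheme \<Rightarrow> ('k, 'c, 'n) module_scheme \<Rightarrow>
    ('k, 'b \<times> 'c \<Rightarrow>\<^sub>0 'k) module" where
  "tensor_free B C = \<lparr>carrier = {f. Poly_Mapping.keys f \<subseteq> carrier B \<times> carrier C},
     monoid.mult = conv (\<lambda>(b, c) (b', c'). (b \<otimes>\<^bsub>B\<^esub> b', c \<otimes>\<^bsub>C\<^esub> c')),
     one = basis_elt (\<one>\<^bsub>B\<^esub>, \<one>\<^bsub>C\<^esub>), ring.zero = 0, add = (+),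
     smult = (\<lambda>a. Poly_Mapping.map (\<lambda>t. a * t))\<rparr>"

definition tensor_ideal :: "('k::field, 'b, 'm) module_scheme \<Rightarrow> ('k, 'c, 'n) module_scheme \<Rightarrow>
    ('b \<times> 'c \<Rightarrow>\<^sub>0 'k) set" where
  "tensor_ideal B C = genideal (tensor_free B C)
     ({basis_elt (b \<oplus>\<^bsub>B\<^esub> b', c) - basis_elt (b, c) - basis_elt (b', c) | b b' c.
         b \<in> carrier B \<and> b' \<in> carrier B \<and> c \<in> carrier C} \<union>
      {basis_elt (b, c \<oplus>\<^bsub>C\<^esub> c') - basis_elt (b, c) - basis_elt (b, c') | b c c'.
         b \<in> carrier B \<and> c \<in> carrier C \<and> c' \<in> carrier C} \<union>
      {basis_elt (a \<odot>\<^bsub>B\<^esub> b, c) - Poly_Mapping.single (b, c) a | a b c.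
         b \<in> carrier B \<and> c \<in> carrier C} \<union>
      {basis_elt (b, a \<odot>\<^bsub>C\<^esub> c) - Poly_Mapping.single (b, c) a | a b c.
         b \<in> carrier B \<and> c \<in> carrier C})"

definition tensor :: "('k::field, 'b, 'm) module_scheme \<Rightarrow> ('k, 'c, 'n) module_scheme \<Rightarrow>
    ('k, ('b \<times> 'c \<Rightarrow>\<^sub>0 'k) set) module" where
  "tensor B C = alg_quot (tensor_free B C) (tensor_ideal B C)"

definition tensor_map :: "('k::field, 'b', 'm) module_scheme \<Rightarrow> ('k, 'c, 'n) module_scheme \<Rightarrow>
    ('b \<Rightarrow> 'b') \<Rightarrow> ('b \<times> 'c \<Rightarrow>\<^sub>0 'k) set \<Rightarrow> ('b' \<times> 'c \<Rightarrow>\<^sub>0 'k) set" where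
  "tensor_map B' C h = coset_map (tensor_free B' C) (tensor_ideal B' C)
     (lin_ext (\<lambda>(b, c). basis_elt (h b, c)))"

definition Hom_alg :: "('k::field, 'a, 'm) module_scheme \<Rightarrow> ('k, 'b, 'n) module_scheme \<Rightarrow> ('a \<Rightarrow> 'b) set" where
  "Hom_alg A B = {f \<in> extensional (carrier A). alg_hom A B f}"

definition Rep :: "('k::field, 'v) dg \<Rightarrow> ('k, 'a, 'm) module_scheme \<Rightarrow> ('k, 'b, 'n) module_scheme \<Rightarrow>
    ('a \<Rightarrow> ('b \<times> ('v \<Rightarrow> 'v) \<Rightarrow>\<^sub>0 'k) set) set" where
  "Rep V A B = Hom_alg A (tensor B (dg_End V))"

text \<open>
  \<open>C\<close> is a coordinate ring of \<open>Rep V A\<close>: a commutative algebra with bijections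
  \<open>\<Phi> B : Hom(C, B) \<rightarrow> Rep V A B\<close>, natural in the commutative algebra \<open>B\<close>.
\<close>

definition represents_Rep :: "('k::field, 'v) dg \<Rightarrow> ('k, 'a, 'm) module_scheme \<Rightarrow> ('k, 'c, 'n) module_scheme \<Rightarrow>
    (('k, 'b) module \<Rightarrow> ('c \<Rightarrow> 'b) \<Rightarrow> 'a \<Rightarrow> ('b \<times> ('v \<Rightarrow> 'v) \<Rightarrow>\<^sub>0 'k) set) \<Rightarrow> bool" where
  "represents_Rep V A C \<Phi> \<longleftrightarrow> algebra ground C \<and>
     (\<forall>B. algebra ground B \<longrightarrow> bij_betw (\<Phi> B) (Hom_alg C B) (Rep V A B)) \<and>
     (\<forall>B B' h. algebra ground B \<and> algebra ground B' \<and> h \<in> Hom_alg B B' \<longrightarrow>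
        (\<forall>f\<in>Hom_alg C B. \<Phi> B' (compose (carrier C) h f) =
           compose (carrier A) (tensor_map B' (dg_End V) h) (\<Phi> B f)))"

end

theory Submission
 imports Defs "HOL-Algebra.UnivPoly"
begin

text \<open>
 DG algebra maps out of an almost free algebra exist as soon as suitable values on the generators do, which are found by
 induction on the degree. Applied to the path object \<open>\<Omega>(T) = T[t] + dt T[t]\<close> this gives a homotopy between any two lifts.
 Since \<open>\<Omega>(T)\<^sub>V\<close> maps to \<open>\<Omega>(T\<^sub>V)\<close>, homotopic maps \<open>R \<rightarrow> T\<close> are the two ends of a map \<open>R\<^sub>V \<rightarrow> \<Omega>(T\<^sub>V)\<close>, and
 integration over \<open>t\<close>, which needs characteristic zero, shows that they agree on cohomology.
 If \<open>V\<close> sits in degree zero, matrix units identify \<open>R * End V\<close> with the matrices over the root algebra, and the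
 degree zero part of the kernel of \<open>R * End V \<rightarrow> A * End V\<close> is the image of the differential.
\<close>

\<comment> \<open>Abelianization does not preserve quasi-isomorphisms. In characteristic p,
  adjoining to R = k a free pair x, dx with x of degree -2 gives another resolution of k, but for V
  = k it creates the cocycle x^p in R_V, which is not a coboundary. So R_V cannot be compared
  through acyclic kernels; only homotopies survive, and the factors 1/(i+1) from integrating over t
  are where the characteristic enters. Commutators are harmless on the way because \<Omega> of a
  commutative algebra is again commutative, and the centralizer because commuting with constants is
  a condition on each coefficient of a path. Homotopies and lifts have the same shape: a value on
  each generator with prescribed differential, subject to a linear and multiplicative constraint
  whose fibre over zero is acyclic. For (c) the inverse of H^0(R * End V) -> A * End V comes from
  the universal property, and the operator x -> sum_k e_ki x e_ik, which is compatible with all maps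
  involved, carries preimages and primitives into the centralizer.\<close>
syntax "_index" :: "logic => index" ("\<^sub>_" [1000] 1000)

abbreviation "keys \<equiv> Poly_Mapping.keys"
abbreviation "single \<equiv> Poly_Mapping.single"
abbreviation "lookup \<equiv> Poly_Mapping.lookup"
abbreviation "scale c \<equiv> Poly_Mapping.map (%a. c * a)"

section \<open>Graded linear algebra and DG algebras with signs\<close>

section \<open>Modules over the ground field\<close>

lemma cring_ground: "cring (ground :: 'k::field ring)"
 unfolding ground_def
proof (rule cringI, goal_cases)
 case 1
 show ?case
 proof (rule abelian_groupI, goal_cases)
  case (6 x)
  then show ?case by (intro bexI[of _ "-x"]) auto
 qed (auto simp: algebra_simps)
next
 case 2
 show ?case by (rule comm_monoidI) (auto simp: algebra_simps)
qed (auto simp: algebra_simps)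

lemma ground_simps [simp]:
 "carrier (ground :: 'k::field ring) = UNIV"
 "monoid.mult (ground :: 'k ring) = (*)" "one (ground :: 'k ring) = 1"
 "ring.zero (ground :: 'k ring) = 0" "add (ground :: 'k ring) = (+)" by (simp_all add: ground_def)

lemma ground_minus [simp]: "\<ominus>\<^bsub>ground\<^esub> (c::'k::field) = - c"
proof -
 interpret cring "ground :: 'k ring" by (rule cring_ground)
 show ?thesis by (rule minus_equality) auto
qed

lemma module_groundI:
 fixes M :: "('k::field, 'a, 'm) module_scheme" (structure)
 assumes "abelian_group M"
  and "!!c x. x : carrier M ==> c \<odot> x : carrier M"
  and "!!c d x. x : carrier M ==> (c + d) \<odot> x = c \<odot> x \<oplus> d \<odot> x"
  and "!!c x y. x : carrier M ==> y : carrier M ==> c \<odot> (x \<oplus> y) = c \<odot> x \<oplus> c \<odot> y"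
  and "!!c d x. x : carrier M ==> (c * d) \<odot> x = c \<odot> (d \<odot> x)"
  and "!!x. x : carrier M ==> 1 \<odot> x = x"
 shows "module ground M" by (rule moduleI) (use assms cring_ground in auto)

text \<open>Since \<open>carrier ground\<close> is all of \<open>'k\<close>, the scalar laws of
  \<open>module ground\<close> need no membership premise for scalars; the locale restates them in
  that form.\<close>

locale kmod =
 fixes M :: "('k::field, 'a, 'm) module_scheme" (structure)
 assumes kmod: "module ground M"

sublocale kmod \<subseteq> abelian_group M using kmod by (simp add: module_def)

context kmod
begin

lemma sm_closed [simp, intro]: "x : carrier M ==> c \<odot> x : carrier M"
 using module.smult_closed[OF kmod, of c x] by simp

lemma sm_ladd: "x : carrier M ==> (c + d) \<odot> x = c \<odot> x \<oplus> d \<odot> x"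
 using module.smult_l_distr[OF kmod, of c d x] by simp

lemma sm_radd: "x : carrier M ==> y : carrier M ==> c \<odot> (x \<oplus> y) = c \<odot> x \<oplus> c \<odot> y"
 using module.smult_r_distr[OF kmod, of c x y] by simp

lemma sm_assoc [simp]: "x : carrier M ==> c \<odot> (d \<odot> x) = (c * d) \<odot> x"
 using module.smult_assoc1[OF kmod, of c d x] by simp

lemma sm_one [simp]: "x : carrier M ==> 1 \<odot> x = x"
 using module.smult_one[OF kmod, of x] by simp

lemma sm_0l [simp]: "x : carrier M ==> 0 \<odot> x = \<zero>"
 using module.smult_l_null[OF kmod, of x] by simp

lemma sm_0r [simp]: "c \<odot> \<zero> = \<zero>"
 using module.smult_r_null[OF kmod, of c] by simp

lemma sm_lneg: "x : carrier M ==> (- c) \<odot> x = \<ominus> (c \<odot> x)"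
 using module.smult_l_minus[OF kmod, of c x] by simp

lemma sm_rneg: "x : carrier M ==> c \<odot> (\<ominus> x) = \<ominus> (c \<odot> x)"
 using module.smult_r_minus[OF kmod, of c x] by simp

lemma sm_m1: "x : carrier M ==> (- 1) \<odot> x = \<ominus> x"
 by (simp add: sm_lneg)

lemma sm_rminus: "x : carrier M ==> y : carrier M ==> c \<odot> (x \<ominus> y) = c \<odot> x \<ominus> c \<odot> y"
 by (simp add: minus_eq sm_radd sm_rneg)

lemma sm_finsum: "f : A \<rightarrow> carrier M ==> c \<odot> (\<Oplus>x\<in>A. f x) = (\<Oplus>x\<in>A. c \<odot> f x)"
 by (induct A rule: infinite_finite_induct) (auto simp: sm_radd Pi_def)

lemma submoduleI':
 assumes "H <= carrier M" "\<zero> : H" "!!a b. a : H ==> b : H ==> a \<oplus> b : H"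
  "!!c x. x : H ==> c \<odot> x : H"
 shows "submodule H ground M"
proof (rule module.submoduleI[OF kmod])
 show "\<ominus> a : H" if "a : H" for a using assms(4)[OF that, of "-1"] assms(1) that by (auto simp: sm_m1)
qed (use assms in auto)

lemma submoduleD:
 assumes "submodule H ground M"
 shows "H <= carrier M" "\<zero> : H" "!!a b. a : H ==> b : H ==> a \<oplus> b : H"
  "!!c x. x : H ==> c \<odot> x : H" "!!a. a : H ==> \<ominus> a : H"
  "!!a b. a : H ==> b : H ==> a \<ominus> b : H"
proof -
 note E = module.submoduleE[OF kmod assms]
 show "H <= carrier M" "!!a b. a : H ==> b : H ==> a \<oplus> b : H" "!!c x. x : H ==> c \<odot> x : H"
  "!!a. a : H ==> \<ominus> a : H" "!!a b. a : H ==> b : H ==> a \<ominus> b : H" using E by (auto simp: minus_eq)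
 obtain h where "h : H" using E(2) by auto
 then show "\<zero> : H" using E(1) E(4)[of 0 h] by auto
qed

lemma finsum_mono_neutral:
 assumes "finite B" "A <= B" "!!i. i : B - A ==> h i = \<zero>" "h : B \<rightarrow> carrier M"
 shows "finsum M h A = finsum M h B" by (rule add.finprod_mono_neutral_cong_left) (use assms in auto)

lemma finsum_in_submodule:
 assumes "submodule H ground M" "!!i. i : A ==> f i : H"
 shows "finsum M f A : H" using assms(2)
proof (induct A rule: infinite_finite_induct)
 case (insert x F)
 then have "f : F \<rightarrow> carrier M" "f x : carrier M" using submoduleD(1)[OF assms(1)] by auto
 then show ?case using insert submoduleD(3)[OF assms(1)] by simp
qed (use submoduleD[OF assms(1)] in auto)

end

lemma additive_zero:
 assumes "abelian_group M" "abelian_group N" "f : carrier M \<rightarrow> carrier N"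
  "!!x y. x : carrier M ==> y : carrier M ==> f (x \<oplus>\<^sub>M y) = f x \<oplus>\<^sub>N f y"
 shows "f \<zero>\<^sub>M = \<zero>\<^sub>N"
proof -
 interpret M: abelian_group M by fact
 interpret N: abelian_group N by fact
 have "f \<zero>\<^sub>M \<oplus>\<^sub>N f \<zero>\<^sub>M = f \<zero>\<^sub>M" "f \<zero>\<^sub>M : carrier N" 
  using assms(3) assms(4)[of "\<zero>\<^sub>M" "\<zero>\<^sub>M"] by auto
 then show ?thesis by (metis N.add.l_cancel_one' N.add.one_closed)
qed

text \<open>Stated for additive maps of abelian groups, so that it serves linear maps as well as the
  inclusion of a subalgebra and the evaluation of endomorphisms at a vector.\<close>

lemma additive_finsum:
 assumes "abelian_group M" "abelian_group N" "f : carrier M \<rightarrow> carrier N"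
  "!!x y. x : carrier M ==> y : carrier M ==> f (x \<oplus>\<^sub>M y) = f x \<oplus>\<^sub>N f y"
  "g : A \<rightarrow> carrier M"
 shows "f (finsum M g A) = finsum N (%x. f (g x)) A"
proof -
 interpret M: abelian_group M by fact
 interpret N: abelian_group N by fact
 show ?thesis using assms(5) by (induct A rule: infinite_finite_induct)
   (use assms(3,4) additive_zero[OF assms(1-4)] in \<open>auto simp: Pi_def\<close>)
qed

lemma linear_mapI:
 assumes "!!x. x : carrier M ==> f x : carrier N"
  "!!x y. x : carrier M ==> y : carrier M ==> f (x \<oplus>\<^sub>M y) = f x \<oplus>\<^sub>N f y"
  "!!c x. x : carrier M ==> f (c \<odot>\<^sub>M x) = c \<odot>\<^sub>N f x"
 shows "linear_map M N f" using assms by (auto simp: linear_map_def)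

locale lin_map = M: kmod M + N: kmod N for M :: "('k::field, 'a, 'm) module_scheme"
  and N :: "('k, 'b, 'n) module_scheme" +
 fixes f
 assumes lin: "linear_map M N f"
begin

lemma closed [simp, intro]: "x : carrier M ==> f x : carrier N"
 using lin by (auto simp: linear_map_def)
lemma add: "x : carrier M ==> y : carrier M ==> f (x \<oplus>\<^sub>M y) = f x \<oplus>\<^sub>N f y"
 using lin by (auto simp: linear_map_def)
lemma smult: "x : carrier M ==> f (c \<odot>\<^sub>M x) = c \<odot>\<^sub>N f x"
 using lin by (auto simp: linear_map_def)
lemma zero [simp]: "f \<zero>\<^sub>M = \<zero>\<^sub>N"
 using smult[of "\<zero>\<^sub>M" 0] by simp
lemma neg: "x : carrier M ==> f (\<ominus>\<^sub>M x) = \<ominus>\<^sub>N f x"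
 using smult[of x "-1"] by (simp add: M.sm_m1 N.sm_m1)
lemma minus: "x : carrier M ==> y : carrier M ==> f (x \<ominus>\<^sub>M y) = f x \<ominus>\<^sub>N f y"
 by (simp add: M.minus_eq N.minus_eq add neg)
lemma finsum: "g : A \<rightarrow> carrier M ==> f (finsum M g A) = finsum N (%x. f (g x)) A"
 by (rule additive_finsum[OF M.abelian_group_axioms N.abelian_group_axioms]) (auto simp: add)

end

section \<open>Algebras\<close>

locale kalgebra =
 fixes A :: "('k::field, 'a, 'm) module_scheme" (structure)
 assumes kalg: "kalg A"

sublocale kalgebra \<subseteq> kmod A using kalg by (simp add: kalg_def kmod_def)
sublocale kalgebra \<subseteq> ring A using kalg by (simp add: kalg_def)

context kalgebra
begin
lemma sm_lmult [simp]: "x : carrier A ==> y : carrier A ==> (c \<odot> x) \<otimes> y = c \<odot> (x \<otimes> y)"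
 using kalg by (simp add: kalg_def)
lemma sm_rmult [simp]: "x : carrier A ==> y : carrier A ==> x \<otimes> (c \<odot> y) = c \<odot> (x \<otimes> y)"
 using kalg by (simp add: kalg_def)
lemma ideal_submodule:
 assumes "ideal I A"
 shows "submodule I ground A"
proof -
 interpret I: ideal I A by fact
 show ?thesis
 proof (rule submoduleI')
  show "c \<odot> x : I" if "x : I" for c x using I.I_l_closed[OF that, of "c \<odot> \<one>"] I.Icarr[OF that] by simp
 qed (use I.Icarr in auto)
qed

lemma ideal_of_submodule:
 assumes "submodule I ground A"
  and "!!a x. a : carrier A ==> x : I ==> a \<otimes> x : I"
  and "!!a x. a : carrier A ==> x : I ==> x \<otimes> a : I"
 shows "ideal I A" by (rule idealI[OF ring_axioms submodule.axioms(1)[OF assms(1)]]) (use assms in auto)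
end

lemma kalgI:
 fixes A :: "('k::field, 'a, 'm) module_scheme" (structure)
 assumes "module ground A" "monoid A"
  "!!x y z. x : carrier A ==> y : carrier A ==> z : carrier A ==> (x \<oplus> y) \<otimes> z = x \<otimes> z \<oplus> y \<otimes> z"
  "!!x y z. x : carrier A ==> y : carrier A ==> z : carrier A ==> z \<otimes> (x \<oplus> y) = z \<otimes> x \<oplus> z \<otimes> y"
  "!!c x y. x : carrier A ==> y : carrier A ==> (c \<odot> x) \<otimes> y = c \<odot> (x \<otimes> y)"
  "!!c x y. x : carrier A ==> y : carrier A ==> x \<otimes> (c \<odot> y) = c \<odot> (x \<otimes> y)"
 shows "kalg A" using assms by (auto simp: kalg_def module_def intro!: ringI)

lemma alg_homI:
 assumes "kalg A" "kalg B" "!!x. x : carrier A ==> f x : carrier B"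
  "!!x y. x : carrier A ==> y : carrier A ==> f (x \<oplus>\<^sub>A y) = f x \<oplus>\<^sub>B f y"
  "!!c x. x : carrier A ==> f (c \<odot>\<^sub>A x) = c \<odot>\<^sub>B f x"
  "!!x y. x : carrier A ==> y : carrier A ==> f (x \<otimes>\<^sub>A y) = f x \<otimes>\<^sub>B f y"
  "f \<one>\<^sub>A = \<one>\<^sub>B"
 shows "alg_hom A B f" using assms by (auto simp: alg_hom_def linear_map_def ring_hom_def)

locale alg_map =
 fixes A :: "('k::field, 'a, 'm) module_scheme" and B :: "('k, 'b, 'n) module_scheme" and f
 assumes ah: "alg_hom A B f"

sublocale alg_map \<subseteq> A: kalgebra A + B: kalgebra B using ah by (auto simp: alg_hom_def kalgebra_def)
sublocale alg_map \<subseteq> lin_map A B f by unfold_locales (use ah in \<open>auto simp: alg_hom_def\<close>)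

context alg_map
begin
lemma mult: "x : carrier A ==> y : carrier A ==> f (x \<otimes>\<^sub>A y) = f x \<otimes>\<^sub>B f y"
 using ah by (auto simp: alg_hom_def ring_hom_def)
lemma one [simp]: "f \<one>\<^sub>A = \<one>\<^sub>B"
 using ah by (auto simp: alg_hom_def ring_hom_def)
lemma kernel_ideal: "ideal {x : carrier A. f x = \<zero>\<^sub>B} A"
 by (rule A.ideal_of_submodule, rule A.submoduleI') (auto simp: add smult mult)
end

section \<open>Graded modules\<close>

lemma ksgn_simps [simp]:
 "ksgn 0 = 1" "ksgn n * ksgn n = 1" "ksgn n * (ksgn n * c) = c" "ksgn n ~= 0" by (auto simp: ksgn_def)
lemma ksgn_add: "ksgn (m + n) = ksgn m * ksgn n"
 by (auto simp: ksgn_def)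
lemma ksgn_Suc [simp]: "ksgn (n + 1) = - ksgn n" "ksgn (1 + n) = - ksgn n"
 by (auto simp: ksgn_def)
lemma ksgn_diff1 [simp]: "ksgn (n - 1) = - ksgn n"
 by (auto simp: ksgn_def)

locale gmod =
 fixes M :: "('k::field, 'a) dg" (structure)
 assumes gmod: "graded_module M"

sublocale gmod \<subseteq> kmod M using gmod by (simp add: graded_module_def kmod_def)

context gmod
begin

abbreviation "pr \<equiv> homog_part M"

lemma gr_submodule: "submodule (gr M n) ground M"
 using gmod by (simp add: graded_module_def)
lemma gr_carrier [simp, intro]: "x : gr M n ==> x : carrier M"
 using submoduleD(1)[OF gr_submodule] by blast
lemma gr_zero [simp, intro]: "\<zero> : gr M n"
 by (rule submoduleD(2)[OF gr_submodule])
lemma gr_add [simp, intro]: "x : gr M n ==> y : gr M n ==> x \<oplus> y : gr M n"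
 by (rule submoduleD(3)[OF gr_submodule])
lemma gr_smult [simp, intro]: "x : gr M n ==> c \<odot> x : gr M n"
 by (rule submoduleD(4)[OF gr_submodule])
lemma gr_neg [simp, intro]: "x : gr M n ==> \<ominus> x : gr M n"
 by (rule submoduleD(5)[OF gr_submodule])
lemma gr_minus [simp, intro]: "x : gr M n ==> y : gr M n ==> x \<ominus> y : gr M n"
 by (rule submoduleD(6)[OF gr_submodule])

lemma decompI:
 assumes "!!n. f n : gr M n" "finite A" "!!n. n \<notin> A ==> f n = \<zero>" "x = (\<Oplus>n\<in>A. f n)"
 shows "is_decomp M x f"
proof -
 have sub: "{n. f n ~= \<zero>} <= A" using assms(3) by auto
 have eq: "finsum M f {n. f n ~= \<zero>} = finsum M f A" by (rule finsum_mono_neutral[OF assms(2) sub]) (use assms(1) in auto)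
 show ?thesis unfolding is_decomp_def by (intro conjI allI assms(1) finite_subset[OF sub assms(2)]) (simp only: assms(4) eq)
qed

lemma decomp_pr: "x : carrier M ==> is_decomp M x (pr x)"
proof -
 assume "x : carrier M"
 then have "\<exists>!f. is_decomp M x f" using gmod unfolding graded_module_def by blast
 then show ?thesis unfolding homog_part_def by (rule theI')
qed

lemma pr_eqI:
 assumes "x : carrier M" "is_decomp M x f"
 shows "pr x = f"
proof -
 have "\<exists>!f. is_decomp M x f" using gmod assms(1) unfolding graded_module_def by blast
 then show ?thesis using assms decomp_pr by blast
qed

lemma pr_gr [simp, intro]: "x : carrier M ==> pr x n : gr M n"
 using decomp_pr by (simp add: is_decomp_def)
lemma pr_carrier [simp, intro]: "x : carrier M ==> pr x n : carrier M"
 using pr_gr by blast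
lemma finite_supp [simp]: "x : carrier M ==> finite (supp M x)"
 using decomp_pr by (simp add: is_decomp_def supp_def)
lemma pr_notin: "n \<notin> supp M x ==> pr x n = \<zero>"
 by (simp add: supp_def)
lemma finsum_pr:
 assumes "x : carrier M" "finite A" "supp M x <= A"
 shows "(\<Oplus>n\<in>A. pr x n) = x"
proof -
 have "x = (\<Oplus>n\<in>supp M x. pr x n)" using decomp_pr[OF assms(1)] unfolding is_decomp_def supp_def by blast
 also have "... = (\<Oplus>n\<in>A. pr x n)" by (rule finsum_mono_neutral) (use assms pr_notin in auto)
 finally show ?thesis by simp
qed

lemma pr_homog: "x : gr M n ==> pr x m = (if m = n then x else \<zero>)"
proof -
 assume x: "x : gr M n"
 have "pr x = (%m. if m = n then x else \<zero>)"
 proof (rule pr_eqI)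
  show "is_decomp M x (%m. if m = n then x else \<zero>)" by (rule decompI[of _ "{n}"]) (use x in auto)
 qed (use x in auto)
 then show ?thesis by simp
qed

lemma pr_add: 
 assumes x: "x : carrier M" and y: "y : carrier M"
 shows "pr (x \<oplus> y) n = pr x n \<oplus> pr y n"
proof -
 have "pr (x \<oplus> y) = (%n. pr x n \<oplus> pr y n)"
 proof (rule pr_eqI)
  have [simp]: "pr x n = \<zero>" "pr y n = \<zero>" if "n \<notin> supp M x \<union> supp M y" for n using that by (auto simp: pr_notin)
  show "is_decomp M (x \<oplus> y) (%n. pr x n \<oplus> pr y n)"
  proof (rule decompI[of _ "supp M x \<union> supp M y"])
   show "x \<oplus> y = (\<Oplus>n\<in>supp M x \<union> supp M y. pr x n \<oplus> pr y n)"
    by (subst finsum_addf) (use x y in \<open>auto simp: finsum_pr\<close>)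
  qed (use x y in auto)
 qed (use x y in auto)
 then show ?thesis by simp
qed

lemma pr_smult: 
 assumes x: "x : carrier M"
 shows "pr (c \<odot> x) n = c \<odot> pr x n"
proof -
 have "pr (c \<odot> x) = (%n. c \<odot> pr x n)"
 proof (rule pr_eqI)
  show "is_decomp M (c \<odot> x) (%n. c \<odot> pr x n)"
  proof (rule decompI[of _ "supp M x"], goal_cases)
   case (3 n)
   then show ?case by (simp add: pr_notin)
  next
   case 4
   show "c \<odot> x = (\<Oplus>n\<in>supp M x. c \<odot> pr x n)"
    by (subst sm_finsum[symmetric]) (use x in \<open>auto simp: finsum_pr\<close>)
  qed (use x in auto)
 qed (use x in auto)
 then show ?thesis by simp
qed

lemma pr_linear: "linear_map M M (%x. pr x n)"
 by (rule linear_mapI) (auto simp: pr_add pr_smult)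

lemma gr_induct [consumes 1, case_names homog add]:
 assumes "x : carrier M" "!!n x. x : gr M n ==> P x"
  "!!x y. x : carrier M ==> y : carrier M ==> P x ==> P y ==> P (x \<oplus> y)"
 shows "P x"
proof -
 have "finite A ==> P (\<Oplus>n\<in>A. pr x n)" for A
 proof (induct A rule: finite_induct)
  case (insert n F)
  have "P (pr x n)" using assms(1) by (intro assms(2)[of _ n]) auto
  then show ?case using insert assms(1) by (simp add: Pi_def assms(3))
 qed (use assms(2)[of _ 0] in auto)
 from this[OF finite_supp[OF assms(1)]] show ?thesis by (simp only: finsum_pr[OF assms(1) finite_supp[OF assms(1)] subset_refl])
qed

lemma gr_disj: "x : gr M m ==> x : gr M n ==> m ~= n ==> x = \<zero>"
 using pr_homog[of x m m] pr_homog[of x n m] by simp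

text \<open>The parity automorphism x -> (-1)^|x| x, extended linearly. With it the Leibniz rule and
  the sign rules of \<Omega> can be stated for inhomogeneous elements.\<close>

definition sg :: "'a => 'a" where
 "sg x = (\<Oplus>n\<in>supp M x. ksgn n \<odot> pr x n)"

lemma sg_eq: "x : carrier M ==> finite A ==> supp M x <= A ==> sg x = (\<Oplus>n\<in>A. ksgn n \<odot> pr x n)"
 unfolding sg_def by (rule finsum_mono_neutral) (auto simp: pr_notin)
lemma sg_closed [simp, intro]: "x : carrier M ==> sg x : carrier M"
 unfolding sg_def by auto
lemma sg_add: "x : carrier M ==> y : carrier M ==> sg (x \<oplus> y) = sg x \<oplus> sg y"
proof -
 assume a: "x : carrier M" "y : carrier M"
 let ?A = "supp M x \<union> supp M y"
 have sub: "supp M (x \<oplus> y) <= ?A" using a by (auto simp: supp_def pr_add)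
 have "sg (x \<oplus> y) = (\<Oplus>n\<in>?A. ksgn n \<odot> pr x n \<oplus> ksgn n \<odot> pr y n)"
  using sg_eq[OF _ _ sub] a by (simp add: pr_add sm_radd)
 also have "... = (\<Oplus>n\<in>?A. ksgn n \<odot> pr x n) \<oplus> (\<Oplus>n\<in>?A. ksgn n \<odot> pr y n)"
  by (rule finsum_addf) (use a in auto)
 also have "(\<Oplus>n\<in>?A. ksgn n \<odot> pr x n) = sg x" by (rule sg_eq[symmetric]) (use a in auto)
 also have "(\<Oplus>n\<in>?A. ksgn n \<odot> pr y n) = sg y" by (rule sg_eq[symmetric]) (use a in auto)
 finally show ?thesis .
qed
lemma sg_homog: "x : gr M n ==> sg x = ksgn n \<odot> x"
proof -
 assume a: "x : gr M n"
 then have "supp M x <= {n}" by (auto simp: supp_def pr_homog)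
 then show ?thesis using a by (simp add: sg_eq[of x "{n}"] pr_homog)
qed
lemma sg_smult: "x : carrier M ==> sg (c \<odot> x) = c \<odot> sg x"
proof (induct x rule: gr_induct)
 case (homog n x)
 then show ?case by (simp add: sg_homog[of _ n] mult.commute)
qed (simp add: sg_add sm_radd)
lemma sg_linear: "linear_map M M sg"
 by (rule linear_mapI) (auto simp: sg_add sg_smult)
lemma sg_sg [simp]: "x : carrier M ==> sg (sg x) = x"
proof (induct x rule: gr_induct)
 case (homog n x)
 then show ?case by (simp add: sg_homog[of _ n])
qed (simp add: sg_add)
lemma sg_gr [simp, intro]: "x : gr M n ==> sg x : gr M n"
 by (auto simp: sg_homog)
lemma pr_sg: "x : carrier M ==> pr (sg x) n = ksgn n \<odot> pr x n"
proof (induct x rule: gr_induct)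
 case (homog m x)
 then show ?case by (simp add: sg_homog[of _ m] pr_smult pr_homog[of _ m])
qed (simp add: sg_add pr_add sm_radd)

end

text \<open>Uniqueness of decompositions is free once there are linear projections \<open>P\<close>
  that act correctly on homogeneous elements: applying \<open>P\<close> to any decomposition returns
  its components. Only existence remains as a hypothesis.\<close>

lemma gmodI:
 fixes M :: "('k::field, 'a) dg" (structure)
 assumes M: "module ground M" and "!!n. submodule (gr M n) ground M"
  and P: "!!n. linear_map M M (%x. P x n)"
  and homog: "!!x n m. x : gr M n ==> P x m = (if m = n then x else \<zero>)"
  and decomp: "!!x. x : carrier M ==> \<exists>f. is_decomp M x f"
 shows "graded_module M"
proof -
 interpret kmod M using M by (rule kmod.intro)
 have "f = P x" if "x : carrier M" "is_decomp M x f" for x f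
 proof
  fix m
  let ?A = "{n. f n ~= \<zero>}"
  interpret p: lin_map M M "%x. P x m" by unfold_locales (rule P)
  have f: "!!n. f n : gr M n" "finite ?A" "x = (\<Oplus>n\<in>?A. f n)" using that by (auto simp: is_decomp_def)
  have fc: "f n : carrier M" for n using f(1)[of n] submoduleD(1)[OF assms(2)] by auto
  have "P x m = (\<Oplus>n\<in>?A. P (f n) m)" unfolding f(3) by (rule p.finsum) (use fc in auto)
  also have "... = (\<Oplus>n\<in>?A. if n = m then f n else \<zero>)" by (rule finsum_cong') (use homog[OF f(1)] fc in auto)
  also have "... = f m"
  proof (cases "m : ?A")
   case True
   then show ?thesis using add.finprod_singleton_swap[of m ?A f] f fc by (simp add: finsum_def)
  next
   case False
   then have "(\<Oplus>n\<in>?A. if n = m then f n else \<zero>) = (\<Oplus>n\<in>?A. \<zero>)" by (intro finsum_cong') auto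
   then show ?thesis using False by simp
  qed
  finally show "f m = P x m" ..
 qed
 then show ?thesis using assms unfolding graded_module_def by metis
qed

section \<open>Graded algebras\<close>

locale galgebra =
 fixes R :: "('k::field, 'a) dg" (structure)
 assumes galg: "galg R"

sublocale galgebra \<subseteq> kalgebra R using galg by (simp add: galg_def kalgebra_def)
sublocale galgebra \<subseteq> gmod R using galg by (simp add: galg_def gmod_def)

context galgebra
begin

lemma one_gr [simp, intro]: "\<one> : gr R 0"
 using galg by (simp add: galg_def)
lemma mult_gr [intro]: "x : gr R m ==> y : gr R n ==> x \<otimes> y : gr R (m + n)"
 using galg by (simp add: galg_def)

lemma pr_mult_l:
 assumes x: "x : gr R m" and "y : carrier R"
 shows "pr (x \<otimes> y) n = x \<otimes> pr y (n - m)" using assms(2)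
proof (induct y rule: gr_induct)
 case (homog k y)
 then show ?case using x by (auto simp: pr_homog[OF mult_gr[OF x homog]] pr_homog[OF homog])
next
 case (add y z)
 then show ?case using x by (simp add: r_distr pr_add)
qed

lemma pr_mult_r:
 assumes x: "x : gr R m" and "y : carrier R"
 shows "pr (y \<otimes> x) n = pr y (n - m) \<otimes> x" using assms(2)
proof (induct y rule: gr_induct)
 case (homog k y)
 then show ?case using x by (auto simp: pr_homog[OF mult_gr[OF homog x]] pr_homog[OF homog])
next
 case (add y z)
 then show ?case using x by (simp add: l_distr pr_add)
qed

lemma sg_mult:
 assumes "x : carrier R" "y : carrier R"
 shows "sg (x \<otimes> y) = sg x \<otimes> sg y" using assms(1)
proof (induct x rule: gr_induct)
 case (homog m x)
 note x = homog
 show ?case using assms(2)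
 proof (induct y rule: gr_induct)
  case (homog n y)
  then show ?case using x by (simp add: sg_homog[OF mult_gr[OF x homog]] sg_homog[OF homog] sg_homog[OF x] ksgn_add mult.commute)
 next
  case (add y z)
  then show ?case using x by (simp add: r_distr sg_add)
 qed
next
 case (add x z)
 then show ?case using assms by (simp add: l_distr sg_add)
qed

lemma sg_one [simp]: "sg \<one> = \<one>"
 using sg_homog[OF one_gr] by simp

text \<open>The n-th power of \<open>sg\<close>: the Koszul sign that arises when an element of
  degree n moves past x, for arbitrary x.\<close>

definition sgp :: "int => 'a => 'a" where
 "sgp n x = (if even n then x else sg x)"

lemma sgp_closed [simp, intro]: "x : carrier R ==> sgp n x : carrier R"
 by (simp add: sgp_def)
lemma sgp_add: "x : carrier R ==> y : carrier R ==> sgp n (x \<oplus> y) = sgp n x \<oplus> sgp n y"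
 by (simp add: sgp_def sg_add)
lemma sgp_mult: "x : carrier R ==> y : carrier R ==> sgp n (x \<otimes> y) = sgp n x \<otimes> sgp n y"
 by (simp add: sgp_def sg_mult)
lemma sgp_smult: "x : carrier R ==> sgp n (c \<odot> x) = c \<odot> sgp n x"
 by (simp add: sgp_def sg_smult)
lemma sgp_one [simp]: "sgp n \<one> = \<one>"
 by (simp add: sgp_def)
lemma sgp_homog: "x : gr R m ==> sgp n x = ksgn (n * m) \<odot> x"
 by (auto simp: sgp_def sg_homog ksgn_def)
lemma pr_sgp: "x : carrier R ==> pr (sgp n x) m = sgp n (pr x m)"
 by (simp add: sgp_def pr_sg sg_homog[OF pr_gr])

definition gcterm :: "'a => 'a => int \<times> int => 'a" where
 "gcterm x y = (%(i, j). pr x i \<otimes> pr y j \<ominus> ksgn (i * j) \<odot> (pr y j \<otimes> pr x i))"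

lemma gcterm_closed [simp, intro]: "x : carrier R ==> y : carrier R ==> gcterm x y p : carrier R"
 by (cases p) (simp add: gcterm_def)

lemma gcomm_eq:
 assumes "x : carrier R" "y : carrier R" "finite A" "finite B" "supp R x <= A" "supp R y <= B"
 shows "gcomm R x y = (\<Oplus>p\<in>A \<times> B. gcterm x y p)" unfolding gcomm_def gcterm_def[symmetric]
proof (rule finsum_mono_neutral)
 show "gcterm x y p = \<zero>" if "p : A \<times> B - supp R x \<times> supp R y" for p
 proof (cases p)
  case (Pair i j)
  with that have "pr x i = \<zero> \<or> pr y j = \<zero>" by (auto simp: supp_def)
  then show ?thesis using assms(1,2) Pair by (auto simp: gcterm_def minus_eq)
 qed
qed (use assms in auto)

lemma gcomm_closed [simp, intro]: "x : carrier R ==> y : carrier R ==> gcomm R x y : carrier R"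
 unfolding gcomm_def gcterm_def[symmetric] by auto

lemma add4: "a : carrier R ==> b : carrier R ==> c : carrier R ==> d : carrier R ==>
  (a \<oplus> b) \<ominus> (c \<oplus> d) = (a \<ominus> c) \<oplus> (b \<ominus> d)" by (simp add: minus_eq minus_add a_ac)

lemma gcomm_add_l:
 assumes "x : carrier R" "x' : carrier R" "y : carrier R"
 shows "gcomm R (x \<oplus> x') y = gcomm R x y \<oplus> gcomm R x' y"
proof -
 let ?A = "supp R x \<union> supp R x'" and ?B = "supp R y"
 have "supp R (x \<oplus> x') <= ?A" using assms by (auto simp: supp_def pr_add)
 then have "gcomm R (x \<oplus> x') y = (\<Oplus>p\<in>?A \<times> ?B. gcterm (x \<oplus> x') y p)" by (intro gcomm_eq) (use assms in auto)
 also have "... = (\<Oplus>p\<in>?A \<times> ?B. gcterm x y p \<oplus> gcterm x' y p)" by (rule finsum_cong')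
   (use assms in \<open>auto simp: gcterm_def pr_add l_distr r_distr sm_radd add4\<close>)
 also have "... = (\<Oplus>p\<in>?A \<times> ?B. gcterm x y p) \<oplus> (\<Oplus>p\<in>?A \<times> ?B. gcterm x' y p)"
  by (rule finsum_addf) (use assms in auto)
 also have "(\<Oplus>p\<in>?A \<times> ?B. gcterm x y p) = gcomm R x y" by (rule gcomm_eq[symmetric]) (use assms in auto)
 also have "(\<Oplus>p\<in>?A \<times> ?B. gcterm x' y p) = gcomm R x' y" by (rule gcomm_eq[symmetric]) (use assms in auto)
 finally show ?thesis .
qed

lemma gcomm_add_r:
 assumes "x : carrier R" "y : carrier R" "y' : carrier R"
 shows "gcomm R x (y \<oplus> y') = gcomm R x y \<oplus> gcomm R x y'"
proof -
 let ?B = "supp R y \<union> supp R y'" and ?A = "supp R x"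
 have "supp R (y \<oplus> y') <= ?B" using assms by (auto simp: supp_def pr_add)
 then have "gcomm R x (y \<oplus> y') = (\<Oplus>p\<in>?A \<times> ?B. gcterm x (y \<oplus> y') p)" by (intro gcomm_eq) (use assms in auto)
 also have "... = (\<Oplus>p\<in>?A \<times> ?B. gcterm x y p \<oplus> gcterm x y' p)" by (rule finsum_cong')
   (use assms in \<open>auto simp: gcterm_def pr_add l_distr r_distr sm_radd add4\<close>)
 also have "... = (\<Oplus>p\<in>?A \<times> ?B. gcterm x y p) \<oplus> (\<Oplus>p\<in>?A \<times> ?B. gcterm x y' p)"
  by (rule finsum_addf) (use assms in auto)
 also have "(\<Oplus>p\<in>?A \<times> ?B. gcterm x y p) = gcomm R x y" by (rule gcomm_eq[symmetric]) (use assms in auto)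
 also have "(\<Oplus>p\<in>?A \<times> ?B. gcterm x y' p) = gcomm R x y'" by (rule gcomm_eq[symmetric]) (use assms in auto)
 finally show ?thesis .
qed

lemma gcomm_homog:
 assumes "x : gr R m" "y : gr R n"
 shows "gcomm R x y = x \<otimes> y \<ominus> ksgn (m * n) \<odot> (y \<otimes> x)"
proof -
 have "gcomm R x y = (\<Oplus>p\<in>{m} \<times> {n}. gcterm x y p)"
  by (rule gcomm_eq) (use assms in \<open>auto simp: supp_def pr_homog\<close>)
 also have "... = gcterm x y (m, n)" using assms by simp
 finally show ?thesis by (simp add: gcterm_def pr_homog[OF assms(1)] pr_homog[OF assms(2)])
qed

text \<open>Once one argument is homogeneous, the double sum in \<open>gcomm\<close> collapses to an
  ordinary commutator twisted by \<open>sgp\<close>. Together with \<open>gcomm_r\<close> this is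
  the form in which commutators are computed.\<close>

lemma gcomm_l:
 assumes x: "x : gr R m" and "y : carrier R"
 shows "gcomm R x y = x \<otimes> y \<ominus> sgp m y \<otimes> x" using assms(2)
proof (induct y rule: gr_induct)
 case (homog n y)
 then show ?case using x by (simp add: gcomm_homog[OF x homog] sgp_homog[OF homog])
next
 case (add y z)
 then show ?case using x by (simp add: gcomm_add_r sgp_add l_distr r_distr add4)
qed

lemma gcomm_r:
 assumes x: "x : gr R m" and "y : carrier R"
 shows "gcomm R y x = y \<otimes> x \<ominus> x \<otimes> sgp m y" using assms(2)
proof (induct y rule: gr_induct)
 case (homog n y)
 then show ?case using x by (simp add: gcomm_homog[OF homog x] sgp_homog[OF homog] mult.commute)
next
 case (add y z)
 then show ?case using x by (simp add: gcomm_add_l sgp_add l_distr r_distr add4)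
qed

end

section \<open>Algebras with a graded derivation\<close>

text \<open>A DG algebra without d^2 = 0. The free algebra that presents a free product is in
  general only of this kind; d^2 vanishes after dividing by the relations.\<close>

definition pre_dga :: "('k::field, 'a) dg => bool" where
 "pre_dga R \<longleftrightarrow> galg R & linear_map R R (dif R) & (\<forall>n. dif R ` gr R n <= gr R (n + 1)) &
  (\<forall>m. \<forall>x\<in>gr R m. \<forall>y\<in>carrier R.
    dif R (x \<otimes>\<^sub>R y) = dif R x \<otimes>\<^sub>R y \<oplus>\<^sub>R ksgn m \<odot>\<^sub>R (x \<otimes>\<^sub>R dif R y))"

lemma dga_iff: "dga R \<longleftrightarrow> pre_dga R & (\<forall>x\<in>carrier R. dif R (dif R x) = \<zero>\<^sub>R)"
 by (auto simp: dga_def pre_dga_def dg_complex_def galg_def)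

locale predga =
 fixes R :: "('k::field, 'a) dg" (structure)
 assumes predga: "pre_dga R"

sublocale predga \<subseteq> galgebra R using predga by (simp add: pre_dga_def galgebra_def)
sublocale predga \<subseteq> d: lin_map R R "dif R" by unfold_locales (use predga in \<open>simp add: pre_dga_def\<close>)

context predga
begin

abbreviation "d \<equiv> dif R"

lemma d_gr: "x : gr R n ==> d x : gr R (n + 1)"
 using predga by (auto simp: pre_dga_def)
lemma leibniz_homog: "x : gr R m ==> y : carrier R ==> d (x \<otimes> y) = d x \<otimes> y \<oplus> ksgn m \<odot> (x \<otimes> d y)"
 using predga by (auto simp: pre_dga_def)

lemma leibniz:
 assumes "x : carrier R" "y : carrier R"
 shows "d (x \<otimes> y) = d x \<otimes> y \<oplus> sg x \<otimes> d y" using assms(1)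
proof (induct x rule: gr_induct)
 case (homog m x)
 then show ?case using assms by (simp add: leibniz_homog[OF homog] sg_homog[OF homog])
next
 case (add x z)
 then show ?case using assms by (simp add: d.add sg_add l_distr a_ac)
qed

lemma d_sg:
 assumes "x : carrier R"
 shows "d (sg x) = \<ominus> sg (d x)" using assms
proof (induct x rule: gr_induct)
 case (homog m x)
 then show ?case by (simp add: sg_homog[OF homog] sg_homog[OF d_gr[OF homog]] d.smult sm_lneg)
next
 case (add x z)
 then show ?case by (simp add: d.add sg_add minus_add)
qed

lemma d_sgp: "x : carrier R ==> d (sgp n x) = ksgn n \<odot> sgp n (d x)"
 by (auto simp: sgp_def ksgn_def d_sg sm_m1)

lemma d_one [simp]: "d \<one> = \<zero>"
proof -
 have "d \<one> = d \<one> \<oplus> d \<one>" using leibniz[of \<one> \<one>] by simp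
 then show ?thesis by (metis add.l_cancel_one' d.closed one_closed)
qed

lemma pr_d:
 assumes "x : carrier R"
 shows "pr (d x) n = d (pr x (n - 1))" using assms
proof (induct x rule: gr_induct)
 case (homog m x)
 then show ?case by (auto simp: pr_homog[OF homog] pr_homog[OF d_gr[OF homog]])
next
 case (add x z)
 then show ?case by (simp add: d.add pr_add)
qed

end

locale dgalgebra =
 fixes R :: "('k::field, 'a) dg" (structure)
 assumes dga: "dga R"

sublocale dgalgebra \<subseteq> predga R using dga by (simp add: dga_iff predga_def)

lemma (in dgalgebra) d_d [simp]: "x : carrier R ==> d (d x) = \<zero>"
 using dga by (simp add: dga_iff)

definition pdga_hom :: "('k::field, 'a) dg => ('k, 'b) dg => ('a => 'b) => bool" where
 "pdga_hom R S f \<longleftrightarrow> pre_dga R & pre_dga S & galg_hom R S f &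
  (\<forall>x\<in>carrier R. f (dif R x) = dif S (f x))"

lemma dga_hom_iff: "dga_hom R S f \<longleftrightarrow> dga R & dga S & pdga_hom R S f"
 by (auto simp: dga_hom_def pdga_hom_def dga_iff)

locale pdga_map =
 fixes R :: "('k::field, 'a) dg" and S :: "('k, 'b) dg" and f
 assumes pdga_hom: "pdga_hom R S f"

sublocale pdga_map \<subseteq> R: predga R + S: predga S using pdga_hom by (auto simp: pdga_hom_def predga_def)
sublocale pdga_map \<subseteq> alg_map R S f by unfold_locales (use pdga_hom in \<open>auto simp: pdga_hom_def galg_hom_def\<close>)

context pdga_map
begin
lemma gr: "x : gr R n ==> f x : gr S n"
 using pdga_hom by (auto simp: pdga_hom_def galg_hom_def)
lemma dif: "x : carrier R ==> f (dif R x) = dif S (f x)"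
 using pdga_hom by (auto simp: pdga_hom_def)
lemma pr: 
 assumes "x : carrier R"
 shows "f (homog_part R x n) = homog_part S (f x) n" using assms
proof (induct x rule: R.gr_induct)
 case (homog m x)
 then show ?case by (auto simp: R.pr_homog[OF homog] S.pr_homog[OF gr[OF homog]])
next
 case (add x z)
 then show ?case by (simp add: lin_map.add[OF lin_map_axioms] R.pr_add S.pr_add)
qed
lemma sg: "x : carrier R ==> f (R.sg x) = S.sg (f x)"
proof (induct x rule: R.gr_induct)
 case (homog m x)
 then show ?case by (auto simp: R.sg_homog[OF homog] S.sg_homog[OF gr[OF homog]] smult)
next
 case (add x z)
 then show ?case by (simp add: lin_map.add[OF lin_map_axioms] R.sg_add S.sg_add)
qed
lemma sgp: "x : carrier R ==> f (R.sgp n x) = S.sgp n (f x)"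
 by (simp add: R.sgp_def S.sgp_def sg)
lemma gcomm:
 assumes "x : carrier R" "y : carrier R"
 shows "f (gcomm R x y) = gcomm S (f x) (f y)" using assms(1)
proof (induct x rule: R.gr_induct)
 case (homog m x)
 then show ?case using assms by (simp add: R.gcomm_l[OF homog] S.gcomm_l[OF gr[OF homog]] minus mult sgp)
next
 case (add x z)
 then show ?case using assms by (simp add: lin_map.add[OF lin_map_axioms] R.gcomm_add_l S.gcomm_add_l)
qed
end

lemma pdga_homI:
 assumes "pre_dga R" "pre_dga S" "!!x. x : carrier R ==> f x : carrier S"
  "!!x y. x : carrier R ==> y : carrier R ==> f (x \<oplus>\<^sub>R y) = f x \<oplus>\<^sub>S f y"
  "!!c x. x : carrier R ==> f (c \<odot>\<^sub>R x) = c \<odot>\<^sub>S f x"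
  "!!x y. x : carrier R ==> y : carrier R ==> f (x \<otimes>\<^sub>R y) = f x \<otimes>\<^sub>S f y"
  "f \<one>\<^sub>R = \<one>\<^sub>S" "!!n x. x : gr R n ==> f x : gr S n"
  "!!x. x : carrier R ==> f (dif R x) = dif S (f x)"
 shows "pdga_hom R S f"
proof -
 interpret R: predga R + S: predga S using assms by (auto simp: predga_def)
 show ?thesis using assms R.galg S.galg R.kalg S.kalg by (auto simp: pdga_hom_def galg_hom_def intro!: alg_homI)
qed

lemma dga_homI:
 assumes "dga R" "dga S" "!!x. x : carrier R ==> f x : carrier S"
  "!!x y. x : carrier R ==> y : carrier R ==> f (x \<oplus>\<^sub>R y) = f x \<oplus>\<^sub>S f y"
  "!!c x. x : carrier R ==> f (c \<odot>\<^sub>R x) = c \<odot>\<^sub>S f x"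
  "!!x y. x : carrier R ==> y : carrier R ==> f (x \<otimes>\<^sub>R y) = f x \<otimes>\<^sub>S f y"
  "f \<one>\<^sub>R = \<one>\<^sub>S" "!!n x. x : gr R n ==> f x : gr S n"
  "!!x. x : carrier R ==> f (dif R x) = dif S (f x)"
 shows "dga_hom R S f" using pdga_homI[of R S f] assms by (simp add: dga_hom_iff dga_iff)

locale dga_map =
 fixes R :: "('k::field, 'a) dg" and S :: "('k, 'b) dg" and f
 assumes dga_hom: "dga_hom R S f"

sublocale dga_map \<subseteq> R: dgalgebra R + S: dgalgebra S using dga_hom by (auto simp: dga_hom_iff dgalgebra_def)
sublocale dga_map \<subseteq> pdga_map R S f by unfold_locales (use dga_hom in \<open>auto simp: dga_hom_iff\<close>)

lemma alg_hom_comp: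
 assumes "alg_hom R S f" "alg_hom S T g"
 shows "alg_hom R T (g \<circ> f)"
proof -
 interpret f: alg_map R S f using assms by unfold_locales
 interpret g: alg_map S T g using assms by unfold_locales
 show ?thesis by (rule alg_homI) (auto simp: f.A.kalg g.B.kalg f.add g.add f.smult g.smult f.mult g.mult)
qed

lemma dga_hom_comp:
 assumes "dga_hom R S f" "dga_hom S T g"
 shows "dga_hom R T (g \<circ> f)"
proof -
 interpret f: dga_map R S f using assms by unfold_locales
 interpret g: dga_map S T g using assms by unfold_locales
 show ?thesis using assms alg_hom_comp[of R S f T g] by (auto simp: dga_hom_def galg_hom_def image_subset_iff f.gr g.gr)
qed

lemma dga_hom_id: "dga R ==> dga_hom R R id"
 by (auto simp: dga_hom_def dga_def galg_hom_def galg_def intro!: alg_homI)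

section \<open>Subalgebras\<close>

lemma sub_simps [simp]:
 "carrier (sub R S) = S" "monoid.mult (sub R S) = monoid.mult R" "one (sub R S) = one R"
 "ring.zero (sub R S) = ring.zero R" "add (sub R S) = add R" "smult (sub R S) = smult R"
 "gr (sub R S) n = gr R n \<inter> S" "dif (sub R S) = dif R" by (simp_all add: sub_def)

lemma r_coset_sub [simp]: "I +>\<^bsub>sub R S\<^esub> x = I +>\<^sub>R x"
 by (simp add: a_r_coset_def r_coset_def)

text \<open>Closure under homogeneous parts (\<open>S_pr\<close>) is what makes the intersections
  with \<open>gr R n\<close> a grading: the decomposition in R then serves unchanged in S.\<close>

locale subgalg = galgebra +
 fixes S
 assumes S_sub: "S <= carrier R" and S_zero [simp]: "\<zero> : S"
  and S_add [simp]: "!!x y. x : S ==> y : S ==> x \<oplus> y : S"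
  and S_smult [simp]: "!!c x. x : S ==> c \<odot> x : S"
  and S_mult [simp]: "!!x y. x : S ==> y : S ==> x \<otimes> y : S"
  and S_one [simp]: "\<one> : S"
  and S_pr: "!!x n. x : S ==> homog_part R x n : S"
begin

lemma S_carrier: "x : S ==> x : carrier R"
 using S_sub by auto

context notes S_carrier [simp]
begin

lemma S_submodule: "submodule S ground R"
 by (rule submoduleI') (use S_sub in auto)
lemma S_neg [simp]: "x : S ==> \<ominus> x : S"
 using submoduleD(5)[OF S_submodule] .
lemma S_minus [simp]: "x : S ==> y : S ==> x \<ominus> y : S"
 using submoduleD(6)[OF S_submodule] .

lemma sub_module: "module ground (sub R S)"
proof (rule module_groundI)
 show "abelian_group (sub R S)"
 proof (rule abelian_groupI, goal_cases)
  case (6 x)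
  then show ?case by (intro bexI[of _ "\<ominus> x"]) (auto simp: l_neg)
 qed (auto simp: a_ac)
qed (auto simp: sm_ladd sm_radd)

lemma sub_kalg: "kalg (sub R S)"
 by (rule kalgI[OF sub_module]) (auto intro!: monoidI simp: m_assoc l_distr r_distr)

lemma sub_finsum: "f : A \<rightarrow> S ==> finsum (sub R S) f A = finsum R f A"
proof -
 assume f: "f : A \<rightarrow> S"
 interpret s: kalgebra "sub R S" by (rule kalgebra.intro[OF sub_kalg])
 show ?thesis using additive_finsum[OF s.abelian_group_axioms abelian_group_axioms, of "%x. x" f A] f by auto
qed

lemma sub_decomp: 
 assumes "x : S" 
 shows "is_decomp (sub R S) x (pr x)"
proof -
 have "finsum (sub R S) (pr x) {n. pr x n ~= \<zero>} = finsum R (pr x) {n. pr x n ~= \<zero>}"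
  by (rule sub_finsum) (use assms S_pr in auto)
 then show ?thesis using decomp_pr[of x] assms S_pr by (simp add: is_decomp_def)
qed

lemma sub_graded: "graded_module (sub R S)"
proof (rule gmodI[OF sub_module, where P = pr])
 interpret s: kalgebra "sub R S" by (rule kalgebra.intro[OF sub_kalg])
 show "submodule (gr (sub R S) n) ground (sub R S)" for n by (rule s.submoduleI') auto
 show "linear_map (sub R S) (sub R S) (%x. homog_part R x n)" for n by (rule linear_mapI) (auto simp: S_pr pr_add pr_smult)
 show "\<exists>f. is_decomp (sub R S) x f" if "x : carrier (sub R S)" for x using sub_decomp that by auto
 show "homog_part R x m = (if m = n then x else \<zero>\<^bsub>sub R S\<^esub>)" if "x : gr (sub R S) n" for x n m
  using that by (auto simp: pr_homog[of x n])
qed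

lemma sub_galg: "galg (sub R S)"
 using sub_kalg sub_graded mult_gr by (simp add: galg_def)

lemma sub_pr: "x : S ==> homog_part (sub R S) x = pr x"
 using gmod.pr_eqI[OF gmod.intro[OF sub_graded], of x "pr x"] sub_decomp by simp

lemma sub_neg: "x : S ==> \<ominus>\<^bsub>sub R S\<^esub> x = \<ominus> x"
proof -
 assume x: "x : S"
 interpret s: kalgebra "sub R S" by (rule kalgebra.intro[OF sub_kalg])
 show ?thesis using s.minus_equality[of "\<ominus> x" x] x by (simp add: l_neg)
qed

lemma sub_minus: "x : S ==> y : S ==> x \<ominus>\<^bsub>sub R S\<^esub> y = x \<ominus> y"
 by (simp add: a_minus_def sub_neg)

lemma sub_gcomm: 
 assumes "x : S" "y : S" 
 shows "gcomm (sub R S) x y = gcomm R x y"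
proof -
 interpret s: galgebra "sub R S" by (rule galgebra.intro[OF sub_galg])
 have *: "supp (sub R S) z = supp R z" if "z : S" for z using that by (simp add: supp_def sub_pr)
 have "gcomm (sub R S) x y = finsum (sub R S) (gcterm x y) (supp R x \<times> supp R y)" unfolding gcomm_def gcterm_def using assms 
  by (intro s.finsum_cong') (auto simp: * sub_pr S_pr sub_minus)
 also have "... = finsum R (gcterm x y) (supp R x \<times> supp R y)"
  by (rule sub_finsum) (use assms S_pr in \<open>auto simp: gcterm_def\<close>)
 finally show ?thesis unfolding gcomm_def gcterm_def .
qed

lemma sub_predga:
 assumes "pre_dga R" "!!x. x : S ==> dif R x : S"
 shows "pre_dga (sub R S)"
proof -
 interpret predga R using assms by unfold_locales
 show ?thesis using sub_galg assms(2) by (auto simp: pre_dga_def leibniz_homog d_gr d.add d.smult intro!: linear_mapI)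
qed

lemma sub_dga:
 assumes "dga R" "!!x. x : S ==> dif R x : S"
 shows "dga (sub R S)" using sub_predga assms by (auto simp: dga_iff)

end

end

lemma (in gmod) pr_zero [simp]: "pr \<zero> n = \<zero>"
 using pr_homog[OF gr_zero[of n], of n] by simp

lemma (in gmod) sg_zero [simp]: "sg \<zero> = \<zero>"
 using sg_homog[OF gr_zero[of 0]] by simp

section \<open>Quotients\<close>

lemma (in kmod) minus_eq_0_iff: "x : carrier M ==> y : carrier M ==> x \<ominus> y = \<zero> \<longleftrightarrow> x = y"
 by (metis a_inv_closed local.minus_eq local.minus_minus minus_equality r_neg)

text \<open>\<open>kalg\<close> reads only the algebra fields of a record; this carries it between
  records that differ in the remaining fields or in their type, such as A and
  \<open>conc A\<close>.\<close>

lemma kalg_cong: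
 fixes A :: "('k::field, 'a, 'm) module_scheme" and B :: "('k, 'a, 'n) module_scheme"
 assumes "kalg A" and [simp]: "carrier B = carrier A" "monoid.mult B = monoid.mult A" "one B = one A"
  "ring.zero B = ring.zero A" "add B = add A" "smult B = smult A"
 shows "kalg B"
proof -
 interpret kalgebra A by unfold_locales fact
 show ?thesis
 proof (rule kalgI)
  show "module ground B"
  proof (rule module_groundI)
   show "abelian_group B"
   proof (rule abelian_groupI, goal_cases)
    case (6 x)
    then show ?case by (intro bexI[of _ "\<ominus>\<^sub>A x"]) (auto simp: l_neg)
   qed (auto simp: a_ac)
  qed (auto simp: sm_ladd sm_radd)
  show "monoid B" by (rule monoidI) (auto simp: m_assoc)
 qed (auto simp: l_distr r_distr)
qed

lemma coset_map_eq: "X ~= {} ==> (!!y. y : X ==> J +>\<^sub>S f y = c) ==> coset_map S J f X = c"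
 by (auto simp: coset_map_def)

lemma quot_simps [simp]:
 "one (alg_quot R I) = I +>\<^sub>R \<one>\<^sub>R" "ring.zero (alg_quot R I) = I"
 "smult (alg_quot R I) = (%c. coset_map R I (%x. c \<odot>\<^sub>R x))"
 "carrier (dg_quot R' I') = carrier (alg_quot R' I')"
 "monoid.mult (dg_quot R' I') = monoid.mult (alg_quot R' I')" "one (dg_quot R' I') = one (alg_quot R' I')"
 "ring.zero (dg_quot R' I') = ring.zero (alg_quot R' I')" "add (dg_quot R' I') = add (alg_quot R' I')"
 "smult (dg_quot R' I') = smult (alg_quot R' I')"
 "gr (dg_quot R' I') n = (%x. I' +>\<^sub>R' x) ` gr R' n" "dif (dg_quot R' I') = coset_map R' I' (dif R')"
 by (simp_all add: alg_quot_def dg_quot_def FactRing_def)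

locale kquot = kalgebra R + ideal I R for R :: "('k::field, 'a, 'm) module_scheme" (structure) and I
begin

abbreviation "\<pi> \<equiv> (+>) I"

lemma I_submodule: "submodule I ground R"
 by (rule ideal_submodule) (rule ideal_axioms)

lemma \<pi>_eq_iff:
 assumes "x : carrier R" "y : carrier R"
 shows "\<pi> x = \<pi> y \<longleftrightarrow> x \<ominus> y : I"
proof
 assume "\<pi> x = \<pi> y"
 then have "x : \<pi> y" using a_rcos_self[OF assms(1)] by simp
 then show "x \<ominus> y : I" using a_rcos_module_imp[OF assms(2)] by (simp add: minus_eq)
next
 assume "x \<ominus> y : I"
 then have "x : \<pi> y" using a_rcos_module_rev[OF assms(2,1)] by (simp add: minus_eq)
 then show "\<pi> x = \<pi> y" using a_repr_independence' assms by blast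
qed

lemma \<pi>_self: "x : carrier R ==> x : \<pi> x"
 by (rule a_rcos_self)
lemma \<pi>_mem: "y : \<pi> x ==> x : carrier R ==> y : carrier R & \<pi> y = \<pi> x"
 using a_elemrcos_carrier a_repr_independence' by blast
lemma \<pi>_zero: "\<pi> \<zero> = I"
 by (rule a_rcos_const) simp
lemma \<pi>_eq_0: "x : carrier R ==> \<pi> x = I \<longleftrightarrow> x : I"
 using \<pi>_eq_iff[of x \<zero>] \<pi>_zero by (simp add: minus_eq)

lemma q_carrier: "carrier (alg_quot R I) = \<pi> ` carrier R"
 by (auto simp: alg_quot_def FactRing_def A_RCOSETS_defs a_r_coset_def)
lemma q_mult [simp]: "x : carrier R ==> y : carrier R ==> \<pi> x \<otimes>\<^bsub>alg_quot R I\<^esub> \<pi> y = \<pi> (x \<otimes> y)"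
 by (simp add: alg_quot_def FactRing_def rcoset_mult_add)
lemma q_add [simp]: "x : carrier R ==> y : carrier R ==> \<pi> x \<oplus>\<^bsub>alg_quot R I\<^esub> \<pi> y = \<pi> (x \<oplus> y)"
 by (simp add: alg_quot_def FactRing_def a_rcos_sum)

text \<open>\<open>coset_map\<close> is a union over all representatives, so it collapses to a
  single coset as soon as f sends congruent elements to the same coset.\<close>

lemma q_map:
 assumes "x : carrier R" "!!x y. x : carrier R ==> y : carrier R ==> x \<ominus> y : I ==> J +>\<^sub>S f x = J +>\<^sub>S f y"
 shows "coset_map S J f (\<pi> x) = J +>\<^sub>S f x"
proof (rule coset_map_eq)
 show "J +>\<^sub>S f y = J +>\<^sub>S f x" if "y : \<pi> x" for y using assms \<pi>_mem[OF that] \<pi>_eq_iff by blast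
qed (use \<pi>_self assms in blast)

lemma q_smult [simp]: 
 assumes "x : carrier R" 
 shows "coset_map R I (%x. c \<odot> x) (\<pi> x) = \<pi> (c \<odot> x)"
proof (rule q_map[OF assms])
 show "\<pi> (c \<odot> x) = \<pi> (c \<odot> y)" if "x : carrier R" "y : carrier R" "x \<ominus> y : I" for x y
  using that submoduleD(4)[OF I_submodule that(3), of c] by (simp add: \<pi>_eq_iff sm_rminus)
qed

lemma q_kalg: "kalg (alg_quot R I)"
proof -
 have ag: "abelian_group (alg_quot R I)"
 proof (rule abelian_groupI, goal_cases)
  case (6 X)
  then obtain x where "x : carrier R" "X = \<pi> x" by (auto simp: q_carrier)
  then show ?case by (intro bexI[of _ "\<pi> (\<ominus> x)"]) (auto simp: q_carrier l_neg \<pi>_zero)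
 next
  case 2
  show ?case by (auto simp: q_carrier \<pi>_zero intro!: image_eqI[of _ _ \<zero>])
 next
  case (5 X)
  then obtain x where "x : carrier R" "X = \<pi> x" by (auto simp: q_carrier)
  then show ?case using q_add[of \<zero> x] by (simp add: \<pi>_zero)
 qed (auto simp: q_carrier a_ac)
 show ?thesis
 proof (rule kalgI)
  show "module ground (alg_quot R I)" by (rule module_groundI) (auto simp: q_carrier sm_ladd sm_radd ag)
 next
  show "monoid (alg_quot R I)" by (rule monoidI) (auto simp: q_carrier m_assoc)
 qed (auto simp: q_carrier l_distr r_distr)
qed

lemma q_hom: "alg_hom R (alg_quot R I) \<pi>"
 by (rule alg_homI) (auto simp: kalg q_kalg q_carrier)

lemma q_lift:
 fixes T :: "('k, 'b, 'n) module_scheme"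
 assumes f: "alg_hom R T f" and I: "!!x. x : I ==> f x = \<zero>\<^sub>T"
 obtains g where "alg_hom (alg_quot R I) T g" "!!x. x : carrier R ==> g (\<pi> x) = f x"
proof -
 interpret f: alg_map R T f using f by unfold_locales
 define g where "g X = f (SOME x. x : X)" for X
 have g: "g (\<pi> x) = f x" if x: "x : carrier R" for x
 proof -
  define y where "y = (SOME y. y : \<pi> x)"
  have "y : \<pi> x" unfolding y_def using \<pi>_self[OF x] by (rule someI)
  then have y: "y : carrier R" "x \<ominus> y : I" using \<pi>_mem[of y x] \<pi>_eq_iff[of x y] x by auto
  then have "f x \<ominus>\<^sub>T f y = \<zero>\<^sub>T" using I x by (simp add: f.minus[symmetric])
  then have "f x = f y" using x y f.B.minus_eq_0_iff by auto
  then show ?thesis by (simp add: g_def y_def[symmetric])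
 qed
 show ?thesis by (rule that[OF alg_homI g]) (auto simp: q_kalg f.B.kalg q_carrier g f.add f.mult f.smult)
qed

end


locale dgquot = predga R + kquot R I for R :: "('k::field, 'a) dg" (structure) and I +
 assumes I_pr: "!!x n. x : I ==> homog_part R x n : I"
  and I_d: "!!x. x : I ==> dif R x : I"
begin

abbreviation "Q \<equiv> dg_quot R I"

lemma I_car: "x : I ==> x : carrier R"
 by (rule Icarr)

lemma Q_kalg: "kalg Q"
 by (rule kalg_cong[OF q_kalg]) simp_all

lemma Q_hom: "alg_hom R Q \<pi>"
 by (rule alg_homI) (auto simp: kalg Q_kalg q_carrier)

lemma Q_pr: "x : carrier R ==> coset_map R I (%x. pr x n) (\<pi> x) = \<pi> (pr x n)"
proof (rule q_map)
 show "\<pi> (pr x n) = \<pi> (pr y n)" if "x : carrier R" "y : carrier R" "x \<ominus> y : I" for x y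
 proof -
  interpret p: lin_map R R "%x. pr x n" by unfold_locales (rule pr_linear)
  show ?thesis using that I_pr[OF that(3), of n] by (simp add: \<pi>_eq_iff p.minus)
 qed
qed

lemma Q_dif [simp]: "x : carrier R ==> coset_map R I d (\<pi> x) = \<pi> (d x)"
 by (rule q_map) (use I_d in \<open>auto simp: \<pi>_eq_iff d.minus[symmetric]\<close>)

lemma Q_decomp:
 assumes "x : carrier R"
 shows "\<exists>f. is_decomp Q (\<pi> x) f"
proof -
 interpret q: alg_map R Q \<pi> by unfold_locales (rule Q_hom)
 have sub: "{n. \<pi> (pr x n) ~= \<zero>\<^sub>Q} <= supp R x" by (auto simp: supp_def \<pi>_zero)
 have "\<pi> x = \<pi> (\<Oplus>n\<in>supp R x. pr x n)" using finsum_pr[OF assms] assms by simp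
 also have "... = finsum Q (%n. \<pi> (pr x n)) (supp R x)" by (rule q.finsum) (use assms in auto)
 also have "... = finsum Q (%n. \<pi> (pr x n)) {n. \<pi> (pr x n) ~= \<zero>\<^sub>Q}"
  by (rule q.B.finsum_mono_neutral[symmetric, OF _ sub]) (use assms in \<open>auto simp: q_carrier\<close>)
 finally show ?thesis using finite_subset[OF sub] assms by (intro exI[of _ "%n. \<pi> (pr x n)"]) (simp add: is_decomp_def)
qed

lemma Q_graded: "graded_module Q"
proof (rule gmodI[where P = "%X n. coset_map R I (%x. pr x n) X"])
 interpret Q: kalgebra Q by unfold_locales (rule Q_kalg)
 show "module ground Q" by (rule Q.kmod)
 show "submodule (gr Q n) ground Q" for n
 proof (rule Q.submoduleI')
  show "\<zero>\<^sub>Q : gr Q n" using image_eqI[of I \<pi> \<zero> "gr R n"] by (simp add: \<pi>_zero)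
 qed (auto simp: q_carrier)
 show "linear_map Q Q (coset_map R I (%x. pr x n))" for n by (rule linear_mapI) (auto simp: q_carrier Q_pr pr_add pr_smult)
 show "coset_map R I (%x. pr x m) X = (if m = n then X else \<zero>\<^sub>Q)" if "X : gr Q n" for X n m
  using that by (auto simp: Q_pr pr_homog[of _ n] \<pi>_zero)
 show "\<exists>f. is_decomp Q X f" if "X : carrier Q" for X using that Q_decomp by (auto simp: q_carrier)
qed

lemma Q_galg: "galg Q"
 using Q_kalg Q_graded mult_gr by (auto simp: galg_def)

lemma Q_predga: "pre_dga Q"
 unfolding pre_dga_def using Q_galg by (auto simp: q_carrier d.add d.smult d_gr leibniz_homog intro!: linear_mapI)

lemma Q_dga: "(!!x. x : carrier R ==> d (d x) : I) ==> dga Q"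
 using Q_predga by (auto simp: dga_iff q_carrier \<pi>_eq_0)

lemma Q_pdga_hom: "pdga_hom R Q \<pi>"
 using Q_predga predga Q_galg galg Q_hom by (auto simp: pdga_hom_def galg_hom_def)

lemma Q_lift:
 assumes f: "pdga_hom R T f" and I: "!!x. x : I ==> f x = \<zero>\<^sub>T"
 obtains g where "pdga_hom Q T g" "!!x. x : carrier R ==> g (\<pi> x) = f x"
proof -
 interpret f: pdga_map R T f using f by unfold_locales
 obtain g where g: "alg_hom (alg_quot R I) T g" "!!x. x : carrier R ==> g (\<pi> x) = f x" using q_lift[OF f.ah I] by blast
 have "pdga_hom Q T g" by (rule pdga_homI) (use Q_predga f.S.predga g(2) f.gr in
    \<open>auto simp: q_carrier f.add f.smult f.mult f.dif\<close>)
 then show ?thesis using that g(2) by blast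
qed

end

lemma quot_map:
 assumes "dgquot R I" "dgquot S J" "pdga_hom R S f" "!!x. x : I ==> f x : J"
 shows "pdga_hom (dg_quot R I) (dg_quot S J) (coset_map S J f)"
  and "x : carrier R ==> coset_map S J f (I +>\<^sub>R x) = J +>\<^sub>S f x"
proof -
 interpret R: dgquot R I by fact
 interpret S: dgquot S J by fact
 interpret f: pdga_map R S f using assms by unfold_locales
 have *: "coset_map S J f (I +>\<^sub>R x) = J +>\<^sub>S f x" if "x : carrier R" for x
  by (rule R.q_map[OF that]) (use assms(4) in \<open>auto simp: S.\<pi>_eq_iff f.minus[symmetric]\<close>)
 then show "x : carrier R ==> coset_map S J f (I +>\<^sub>R x) = J +>\<^sub>S f x" .
 show "pdga_hom (dg_quot R I) (dg_quot S J) (coset_map S J f)" by (rule pdga_homI) (use R.Q_predga S.Q_predga in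
    \<open>auto simp: R.q_carrier S.q_carrier * f.add f.smult f.mult f.dif f.gr\<close>)
qed

section \<open>Cohomology\<close>

context dgalgebra
begin

lemma coboundariesD: "b : coboundaries R ==> b : carrier R & d b = \<zero>"
 by (auto simp: coboundaries_def)

lemma cocyclesD: "z : cocycles R ==> z : carrier R & d z = \<zero>"
 by (auto simp: cocycles_def)

lemma pr_cocycle: "x : cocycles R ==> pr x n : cocycles R"
 using pr_d[of x "n + 1"] by (auto simp: cocycles_def)

lemma cocycles_sub: "subgalg R (cocycles R)"
proof (unfold_locales, goal_cases)
 case (7 x n)
 then show ?case by (rule pr_cocycle)
qed (auto simp: cocycles_def d.add d.smult leibniz)

sublocale Z: subgalg R "cocycles R" by (rule cocycles_sub)

lemma coboundaries_cocycles: "b : coboundaries R ==> b : cocycles R"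
 by (auto simp: cocycles_def coboundaries_def)

lemma pr_coboundary: "b : coboundaries R ==> pr b n : coboundaries R"
 by (auto simp: coboundaries_def pr_d)

lemma cohom_dgquot: "dgquot (sub R (cocycles R)) (coboundaries R)"
proof -
 have Zp: "pre_dga (sub R (cocycles R))" by (rule Z.sub_predga[OF predga]) (auto simp: cocycles_def)
 interpret s: predga "sub R (cocycles R)" by (rule predga.intro[OF Zp])
 have "ideal (coboundaries R) (sub R (cocycles R))"
 proof (rule s.ideal_of_submodule)
  show "submodule (coboundaries R) ground (sub R (cocycles R))"
  proof (rule s.submoduleI')
   show "a \<oplus>\<^bsub>sub R (cocycles R)\<^esub> b : coboundaries R" if "a : coboundaries R" "b : coboundaries R" for a b
    using that by (auto simp: coboundaries_def d.add[symmetric])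
   show "\<zero>\<^bsub>sub R (cocycles R)\<^esub> : coboundaries R" by (auto simp: coboundaries_def intro!: image_eqI[of _ _ \<zero>])
   show "c \<odot>\<^bsub>sub R (cocycles R)\<^esub> b : coboundaries R" if "b : coboundaries R" for c b
    using that by (auto simp: coboundaries_def d.smult[symmetric])
  qed (auto intro: coboundaries_cocycles)
 next
  fix a b assume "a : carrier (sub R (cocycles R))" "b : coboundaries R"
  then obtain x where x: "a : carrier R" "d a = \<zero>" "x : carrier R" "b = d x" by (auto simp: cocycles_def coboundaries_def)
  \<comment> \<open>\<open>sg\<close> cancels the Leibniz sign in front of the second factor, and
    the other term vanishes with d a.\<close>
  have "d (sg a \<otimes> x) = a \<otimes> b" using x by (simp add: leibniz d_sg)
  then show "a \<otimes>\<^bsub>sub R (cocycles R)\<^esub> b : coboundaries R"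
   using x unfolding coboundaries_def by (intro image_eqI[of _ _ "sg a \<otimes> x"]) auto
  have "d (x \<otimes> a) = b \<otimes> a" using x by (simp add: leibniz)
  then show "b \<otimes>\<^bsub>sub R (cocycles R)\<^esub> a : coboundaries R"
   using x unfolding coboundaries_def by (intro image_eqI[of _ _ "x \<otimes> a"]) auto
 qed
 then interpret I: ideal "coboundaries R" "sub R (cocycles R)" .
 show ?thesis
 proof (unfold_locales, goal_cases)
  case (1 x n)
  then show ?case using Z.sub_pr[of x] by (simp add: coboundaries_cocycles pr_coboundary)
 next
  case (2 x)
  then have "dif R x = d \<zero>" using coboundariesD by simp
  then show ?case unfolding coboundaries_def by (metis imageI zero_closed sub_simps(8))
 qed
qed

text \<open>Cosets in the algebra of cocycles are cosets in R; the rewrite lets cohomology classes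
  be written with the latter.\<close>

sublocale H: dgquot "sub R (cocycles R)" "coboundaries R"
 rewrites "a_r_coset (sub R (cocycles R)) = a_r_coset R" by (rule cohom_dgquot) (simp add: fun_eq_iff)

lemma cohom_galg: "galg (cohom R)"
 unfolding cohom_def by (rule H.Q_galg)

lemma cohom_carrier: "carrier (cohom R) = (+>) (coboundaries R) ` cocycles R"
 unfolding cohom_def by (simp add: H.q_carrier)

lemma cohom_gr: "gr (cohom R) n = (+>) (coboundaries R) ` (gr R n \<inter> cocycles R)"
 unfolding cohom_def by simp

lemma cohom_class_eq: "x : cocycles R ==> y : cocycles R ==>
  coboundaries R +> x = coboundaries R +> y \<longleftrightarrow> x \<ominus> y : coboundaries R"
 by (simp add: H.\<pi>_eq_iff Z.sub_minus)

lemma cohom_ops: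
 assumes "x : cocycles R" "y : cocycles R"
 shows "(coboundaries R +> x) \<oplus>\<^bsub>cohom R\<^esub> (coboundaries R +> y) = coboundaries R +> (x \<oplus> y)"
  "(coboundaries R +> x) \<otimes>\<^bsub>cohom R\<^esub> (coboundaries R +> y) = coboundaries R +> (x \<otimes> y)"
 using assms unfolding cohom_def by simp_all

lemma cohom_smult: "x : cocycles R ==>
  c \<odot>\<^bsub>cohom R\<^esub> (coboundaries R +> x) = coboundaries R +> (c \<odot> x)"
 using H.q_smult[of x c] unfolding cohom_def by simp

lemma cohom_one: "\<one>\<^bsub>cohom R\<^esub> = coboundaries R +> \<one>"
 unfolding cohom_def by simp

lemma cohom_gcalg:
 assumes "gcalg R"
 shows "gcalg (cohom R)" unfolding gcalg_def
proof (intro conjI allI ballI)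
 fix m n X Y assume "X : gr (cohom R) m" "Y : gr (cohom R) n"
 then obtain x y where x: "x : gr R m" "x : cocycles R" "X = coboundaries R +> x"
  and y: "y : gr R n" "y : cocycles R" "Y = coboundaries R +> y" by (auto simp: cohom_gr)
 have e: "x \<otimes> y = ksgn (m * n) \<odot> (y \<otimes> x)" using assms x(1) y(1) unfolding gcalg_def by blast
 then show "X \<otimes>\<^bsub>cohom R\<^esub> Y = ksgn (m * n) \<odot>\<^bsub>cohom R\<^esub> (Y \<otimes>\<^bsub>cohom R\<^esub> X)"
  unfolding x(3) y(3) by (simp only: cohom_ops(2) x(2) y(2) e cohom_smult Z.S_mult[simplified sub_simps])
qed (rule cohom_galg)

end

context dga_map
begin

lemma cocycle: "z : cocycles R ==> f z : cocycles S"
 by (auto simp: cocycles_def dif[symmetric])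
lemma coboundary: "z : coboundaries R ==> f z : coboundaries S"
 by (auto simp: coboundaries_def dif)

lemma cohom_map_class:
 assumes "z : cocycles R"
 shows "cohom_map S f (coboundaries R +>\<^sub>R z) = coboundaries S +>\<^sub>S f z"
proof -
 have "pdga_hom (sub R (cocycles R)) (sub S (cocycles S)) f" by (rule pdga_homI[OF R.Z.sub_predga[OF R.predga] S.Z.sub_predga[OF S.predga]])
   (auto simp: cocycles_def dif[symmetric] add mult smult gr)
 from quot_map(2)[OF R.cohom_dgquot S.cohom_dgquot this coboundary, of z]
 show ?thesis using assms by (simp add: cohom_map_def)
qed

lemma cohom_map_hom: "galg_hom (cohom R) (cohom S) (cohom_map S f)"
 unfolding galg_hom_def
proof (intro conjI R.cohom_galg S.cohom_galg allI subsetI)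
 show "alg_hom (cohom R) (cohom S) (cohom_map S f)"
 proof (rule alg_homI)
  show "kalg (cohom R)" "kalg (cohom S)" using R.cohom_galg S.cohom_galg by (simp_all add: galg_def)
  show "cohom_map S f \<one>\<^bsub>cohom R\<^esub> = \<one>\<^bsub>cohom S\<^esub>" by (simp add: R.cohom_one S.cohom_one cohom_map_class)
 qed (auto simp: R.cohom_carrier S.cohom_carrier R.cohom_ops S.cohom_ops R.cohom_smult
    S.cohom_smult cohom_map_class cocycle add mult smult R.Z.S_carrier)
next
 show "Y : gr (cohom S) n" if "Y : cohom_map S f ` gr (cohom R) n" for Y n
  using that by (auto simp: R.cohom_gr S.cohom_gr cohom_map_class cocycle gr)
qed

end

section \<open>Free algebras with a derivation and the free product\<close>

section \<open>Linear algebra in free vector spaces\<close>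

lemma lookup_sc [simp]: "lookup (scale (c::'k::field) p) k = c * lookup p k"
 by (simp add: map.rep_eq when_def)

lemma sc_simps [simp]:
 fixes p q :: "'x \<Rightarrow>\<^sub>0 'k::field"
 shows "scale c (p + q) = scale c p + scale c q"
  "scale c (scale d p) = Poly_Mapping.map (%a. c * d * a) p"
  "scale 1 p = p" "scale 0 p = 0"
  "scale c (0 :: 'x \<Rightarrow>\<^sub>0 'k) = 0"
 by (rule poly_mapping_eqI, unfold lookup_sc lookup_add lookup_zero, simp add: distrib_left mult.assoc)+

lemma sc_simps' [simp]:
 fixes p :: "'x \<Rightarrow>\<^sub>0 'k::field"
 shows "Poly_Mapping.map (%a. a) p = p" "Poly_Mapping.map (%a. 0) p = (0 :: 'x \<Rightarrow>\<^sub>0 'k)"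
 by (rule poly_mapping_eqI; simp add: map.rep_eq when_def)+

lemma sc_comm: "scale c (scale d (p :: 'x \<Rightarrow>\<^sub>0 'k::field)) =
  scale d (scale c p)" by (simp only: sc_simps mult.commute[of c d])

lemma sc_add: "scale (c + d) (p :: 'x \<Rightarrow>\<^sub>0 'k::field) =
  scale c p + scale d p" by (rule poly_mapping_eqI) (unfold lookup_sc lookup_add, rule distrib_right)

lemma sc_single [simp]: "scale c (single u (b::'k::field)) = single u (c * b)"
 by (rule poly_mapping_eqI) (simp add: lookup_single when_def)

lemma keys_sc: "keys (scale (c::'k::field) p) <= keys p"
 by (auto simp: in_keys_iff)

lemma sc_basis [simp]: "scale c (basis_elt u) = single u c"
 by (simp add: basis_elt_def)

lemma pm_induct [consumes 1, case_names zero single add]: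
 assumes "keys p <= K" "P 0" "!!u c. u : K ==> P (single u (c::'k::field))"
  "!!p q. keys p <= K ==> keys q <= K ==> P p ==> P q ==> P (p + q)"
 shows "P p" using assms(1)
proof (induct p rule: update_induct)
 case (update f a b)
 have e: "Poly_Mapping.update a b f = f + single a b"
  using update(1) by (intro poly_mapping_eqI) (auto simp: lookup_update lookup_add lookup_single when_def in_keys_iff)
 have "keys f <= K" "a : K" using update by (auto simp: keys_update split: if_splits)
 then show ?case unfolding e using update assms by auto
qed (use assms in auto)

lemma lin_ext_eq: "finite A ==> keys f <= A ==>
  lin_ext \<phi> f = (\<Sum>u\<in>A. scale (lookup f u) (\<phi> u))"
 unfolding lin_ext_def by (rule sum.mono_neutral_left) (auto simp: in_keys_iff)

lemma lin_ext_0 [simp]: "lin_ext \<phi> 0 = 0"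
 by (simp add: lin_ext_def)
lemma lin_ext_add: "lin_ext \<phi> (f + g) = lin_ext \<phi> f + lin_ext \<phi> g"
proof -
 let ?A = "keys f \<union> keys g"
 have "keys (f + g) <= ?A" by (rule Poly_Mapping.keys_add)
 then show ?thesis by (simp add: lin_ext_eq[of ?A] lookup_add sc_add sum.distrib)
qed
lemma lin_ext_single [simp]: "lin_ext \<phi> (single u c) = scale c (\<phi> u)"
 by (simp add: lin_ext_eq[of "{u}"])
lemma lin_ext_basis [simp]: "lin_ext \<phi> (basis_elt u) = \<phi> u"
 by (simp add: basis_elt_def)
lemma lin_ext_sc: "lin_ext \<phi> (scale c f) = scale c (lin_ext \<phi> f)"
 by (induct f rule: pm_induct[OF subset_UNIV]) (auto simp: lin_ext_add)
lemma lin_ext_fun_add: "lin_ext (%u. \<phi> u + \<psi> u) f = lin_ext \<phi> f + lin_ext \<psi> f"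
 by (induct f rule: pm_induct[OF subset_UNIV]) (auto simp: lin_ext_add algebra_simps)
lemma lin_ext_fun_sc: "lin_ext (%u. scale c (\<phi> u)) f = scale c (lin_ext \<phi> f)"
proof (induct f rule: pm_induct[OF subset_UNIV])
 case (2 u b)
 show ?case by (simp only: lin_ext_single sc_comm[of b])
qed (auto simp: lin_ext_add)
lemma lin_ext_minus: "lin_ext \<phi> (f - g) = lin_ext \<phi> f - lin_ext \<phi> g"
 using lin_ext_add[of \<phi> "f - g" g] by (simp add: algebra_simps)
lemma keys_lin_ext:
 assumes "keys f <= K" "!!u. u : K ==> keys (\<phi> u) <= L"
 shows "keys (lin_ext \<phi> f) <= L" using assms(1)
proof (induct f rule: pm_induct)
 case (single u c)
 then show ?case using assms(2)[OF single] keys_sc[of c "\<phi> u"] by auto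
next
 case (add p q)
 then show ?case using Poly_Mapping.keys_add[of "lin_ext \<phi> p" "lin_ext \<phi> q"] by (auto simp: lin_ext_add)
qed auto

lemma conv_add_l: "conv opn (f + g) h = conv opn f h + conv opn g h"
 by (simp add: conv_def lin_ext_add)
lemma conv_add_r: "conv opn f (g + h) = conv opn f g + conv opn f h"
 by (simp add: conv_def lin_ext_add lin_ext_fun_add)
lemma conv_sc_l: "conv opn (scale c f) h = scale c (conv opn f h)"
 by (simp add: conv_def lin_ext_sc)
lemma conv_sc_r: "conv opn f (scale c h) = scale c (conv opn f h)"
 by (simp add: conv_def lin_ext_sc lin_ext_fun_sc)
lemma conv_single [simp]:
 "conv opn (single u a) (single v b) = single (opn u v) (a * b)" by (simp add: conv_def)
lemma conv_basis [simp]: "conv opn (basis_elt u) (basis_elt v) = basis_elt (opn u v)"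
 by (simp add: basis_elt_def)
lemma conv_0 [simp]: "conv opn 0 f = 0" "conv opn f 0 = 0"
 using conv_add_l[of opn 0 0 f] conv_add_r[of opn f 0 0] by auto
text \<open>Associativity of \<open>opn\<close> is demanded on K only: for tensor products the
  operation multiplies pairs of algebra elements and obeys no law outside the carriers.\<close>

lemma conv_assoc:
 assumes "keys f <= K" "keys g <= K" "keys h <= K"
  "!!u v w. u : K ==> v : K ==> w : K ==> opn (opn u v) w = opn u (opn v w)"
 shows "conv opn (conv opn f g) h = conv opn f (conv opn g h)" using assms(1)
proof (induct f rule: pm_induct)
 case u: (single u a)
 show ?case using assms(2)
 proof (induct g rule: pm_induct)
  case v: (single v b)
  show ?case using assms(3) by (induct h rule: pm_induct) (use u v assms(4) in \<open>auto simp: conv_add_r mult.assoc\<close>)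
 qed (auto simp: conv_add_l conv_add_r)
qed (auto simp: conv_add_l)

lemma conv_unit: "conv (@) (basis_elt []) f = f" "conv (@) f (basis_elt []) = f"
 by (induct f rule: pm_induct[OF subset_UNIV]; simp add: conv_add_r conv_add_l basis_elt_def)+

lemma keys_conv:
 assumes "keys f <= K" "keys g <= L" "!!u v. u : K ==> v : L ==> opn u v : N"
 shows "keys (conv opn f g) <= N" unfolding conv_def
 by (rule keys_lin_ext[OF assms(1)], rule keys_lin_ext[OF assms(2)]) (use assms(3) in \<open>auto simp: basis_elt_def\<close>)

section \<open>Linear extension into a module\<close>

context kmod
begin

text \<open>Linear extension with values in M. The facts about a fixed \<beta> suppose that all its
  values lie in the carrier, so that they hold for every f; maps defined on part of a type are first
  extended by zero, as in \<open>gen\<close>, \<open>cut\<close> and \<open>gval\<close>.\<close>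

definition lext :: "('x => 'a) => ('x \<Rightarrow>\<^sub>0 'k) => 'a" where
 "lext \<beta> f = (\<Oplus>u\<in>keys f. lookup f u \<odot> \<beta> u)"

context
 fixes \<beta> :: "'x => 'a"
 assumes \<beta> [simp]: "!!u. \<beta> u : carrier M"
begin

lemma lext_eq: "finite A ==> keys f <= A ==> lext \<beta> f = (\<Oplus>u\<in>A. lookup f u \<odot> \<beta> u)"
 unfolding lext_def by (rule finsum_mono_neutral) (auto simp: in_keys_iff)

lemma lext_closed [simp]: "lext \<beta> f : carrier M"
 unfolding lext_def by simp
lemma lext_0 [simp]: "lext \<beta> 0 = \<zero>"
 by (simp add: lext_def)
lemma lext_single [simp]: "lext \<beta> (single u c) = c \<odot> \<beta> u"
 by (simp add: lext_eq[of "{u}"])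
lemma lext_basis [simp]: "lext \<beta> (basis_elt u) = \<beta> u"
 by (simp add: basis_elt_def)
lemma lext_add: "lext \<beta> (f + g) = lext \<beta> f \<oplus> lext \<beta> g"
proof -
 let ?A = "keys f \<union> keys g"
 have "keys (f + g) <= ?A" by (rule Poly_Mapping.keys_add)
 then have "lext \<beta> (f + g) = (\<Oplus>u\<in>?A. lookup f u \<odot> \<beta> u \<oplus> lookup g u \<odot> \<beta> u)"
  by (simp add: lext_eq[of ?A] lookup_add sm_ladd)
 also have "... = lext \<beta> f \<oplus> lext \<beta> g" by (subst finsum_addf) (simp_all add: lext_eq[of ?A])
 finally show ?thesis .
qed
lemma lext_sc: "lext \<beta> (scale c f) = c \<odot> lext \<beta> f"
 by (induct f rule: pm_induct[OF subset_UNIV]) (auto simp: lext_add sm_radd)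
lemma lext_minus: "lext \<beta> (f - g) = lext \<beta> f \<ominus> lext \<beta> g"
proof -
 have "lext \<beta> f = lext \<beta> (f - g) \<oplus> lext \<beta> g" using lext_add[of "f - g" g] by simp
 then show ?thesis by (simp add: minus_eq a_assoc r_neg)
qed
end

lemma lext_cong: "(!!u. u : keys f ==> \<beta> u = \<beta>' u) ==> (!!u. \<beta>' u : carrier M) ==> lext \<beta> f = lext \<beta>' f"
 unfolding lext_def by (rule finsum_cong') auto

lemma lext_submodule:
 assumes "submodule H ground M" "!!u. u : keys f ==> \<beta> u : H"
 shows "lext \<beta> f : H" unfolding lext_def using assms submoduleD(4)[OF assms(1)] by (intro finsum_in_submodule) auto

end

lemma (in kalgebra) lext_conv:
 assumes "!!u. \<beta> u : carrier A" "keys f <= K" "keys g <= L"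
  "!!u v. u : K ==> v : L ==> \<beta> (opn u v) = \<beta> u \<otimes> \<beta> v"
 shows "lext \<beta> (conv opn f g) = lext \<beta> f \<otimes> lext \<beta> g" using assms(2)
proof (induct f rule: pm_induct)
 case (single u a)
 note u = single
 show ?case using assms(3)
 proof (induct g rule: pm_induct)
  case (single v b)
  then show ?case using assms(1,4) u by (simp add: mult.commute)
 next
  case (add p q)
  then show ?case using assms(1) by (simp add: conv_add_r lext_add r_distr)
 qed (use assms(1) in auto)
next
 case (add p q)
 then show ?case using assms(1) by (simp add: conv_add_l lext_add l_distr)
qed (use assms(1) in auto)

context kalgebra
begin

definition wval :: "('l => 'a) => 'l list => 'a" where
 "wval \<phi> w = foldr (%l y. \<phi> l \<otimes> y) w \<one>"

lemma wval_simps [simp]: "wval \<phi> [] = \<one>" "wval \<phi> (l # w) = \<phi> l \<otimes> wval \<phi> w"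
 by (simp_all add: wval_def)

lemma wval_closed [simp]: "(!!l. \<phi> l : carrier A) ==> wval \<phi> w : carrier A"
 by (induct w) auto

lemma wval_append: "(!!l. \<phi> l : carrier A) ==> wval \<phi> (u @ v) = wval \<phi> u \<otimes> wval \<phi> v"
 by (induct u) (auto simp: m_assoc)

lemma wval_cong: "(!!l. l : set w ==> \<phi> l = \<psi> l) ==> wval \<phi> w = wval \<psi> w"
 by (induct w) auto

end

section \<open>Constructing gradings and homogeneous ideals\<close>

text \<open>Existence of decompositions enters as an induction principle: it is enough that
  homogeneous elements generate the carrier under addition.\<close>

lemma gmodI_span:
 fixes M :: "('k::field, 'a) dg" (structure)
 assumes M: "module ground M" and gr: "!!n. submodule (gr M n) ground M"
  and P: "!!n. linear_map M M (%x. P x n)"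
  and homog: "!!x n m. x : gr M n ==> P x m = (if m = n then x else \<zero>)"
  and span: "!!x Q. x : carrier M ==> (!!n x. x : gr M n ==> Q x) ==>
   (!!x y. x : carrier M ==> y : carrier M ==> Q x ==> Q y ==> Q (x \<oplus> y)) ==> Q x"
 shows "graded_module M"
proof (rule gmodI[OF M gr P homog])
 interpret kmod M using M by (rule kmod.intro)
 have grc: "x : carrier M" if "x : gr M n" for x n using submoduleD(1)[OF gr] that by auto
 \<comment> \<open>Decompositions over any finite index set instead of the exact support: in this
   form two of them can be added over the union of their index sets.\<close>
 define D where "D x \<longleftrightarrow> (\<exists>f A. finite A & (\<forall>n. f n : gr M n) & (\<forall>n. n \<notin> A --> f n = \<zero>) & x = (\<Oplus>n\<in>A. f n))" for x
 have ext: "(\<Oplus>n\<in>A. f n) = (\<Oplus>n\<in>A \<union> B. f n)"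
  if "finite A" "finite B" "\<forall>n. f n : gr M n" "\<forall>n. n \<notin> A --> f n = \<zero>" for f and A B :: "int set"
  by (rule finsum_mono_neutral) (use that grc in auto)
 show "\<exists>f. is_decomp M x f" if x: "x : carrier M" for x
 proof -
  have "D x" using x
  proof (rule span)
   show "D x" if "x : gr M n" for x n unfolding D_def
   proof (intro exI conjI)
    show "x = (\<Oplus>m\<in>{n}. if m = n then x else \<zero>)" using grc[OF that] by simp
   qed (use that submoduleD(2)[OF gr] in auto)
   show "D (x \<oplus> y)" if xD: "D x" and yD: "D y" for x y
   proof -
    obtain f A where f: "finite A" "\<forall>n. f n : gr M n" "\<forall>n. n \<notin> A --> f n = \<zero>" "x = (\<Oplus>n\<in>A. f n)"
     using xD unfolding D_def by blast
    obtain g B where g: "finite B" "\<forall>n. g n : gr M n" "\<forall>n. n \<notin> B --> g n = \<zero>" "y = (\<Oplus>n\<in>B. g n)"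
     using yD unfolding D_def by blast
    have "x \<oplus> y = (\<Oplus>n\<in>A \<union> B. f n) \<oplus> (\<Oplus>n\<in>A \<union> B. g n)"
     using trans[OF f(4) ext[OF f(1) g(1) f(2,3)]] trans[OF g(4) ext[OF g(1) f(1) g(2,3)]] by (simp only: Un_commute[of B A])
    also have "... = (\<Oplus>n\<in>A \<union> B. f n \<oplus> g n)" by (rule finsum_addf[symmetric]) (use f(2) g(2) grc in auto)
    finally have e: "x \<oplus> y = (\<Oplus>n\<in>A \<union> B. f n \<oplus> g n)" .
    show ?thesis unfolding D_def by (intro exI[of _ "%n. f n \<oplus> g n"] exI[of _ "A \<union> B"] conjI e)
      (use f(1) g(1) in simp, use f(2) g(2) submoduleD(3)[OF gr] in blast, use f(3) g(3) in simp)
   qed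
  qed
  then obtain f A where f: "finite A" "\<forall>n. f n : gr M n" "\<forall>n. n \<notin> A --> f n = \<zero>" "x = (\<Oplus>n\<in>A. f n)"
   unfolding D_def by blast
  have sub: "{n. f n ~= \<zero>} <= A" using f(3) by auto
  have "(\<Oplus>n\<in>{n. f n ~= \<zero>}. f n) = (\<Oplus>n\<in>A. f n)"
   by (rule finsum_mono_neutral[OF f(1) sub]) (use f(2) grc in auto)
  then have "x = (\<Oplus>n\<in>{n. f n ~= \<zero>}. f n)" by (simp only: f(4))
  then show ?thesis using f(2) finite_subset[OF sub f(1)] unfolding is_decomp_def by blast
 qed
qed

context predga
begin

text \<open>The mixed terms cancel, so d^2 is an ordinary derivation of any \<open>pre_dga\<close>.
  That d^2 vanishes, or lands in an ideal, can therefore be checked on generators.\<close>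

lemma dd_mult: "x : carrier R ==> y : carrier R ==> d (d (x \<otimes> y)) = d (d x) \<otimes> y \<oplus> x \<otimes> d (d y)"
proof -
 assume x: "x : carrier R" "y : carrier R"
 have "d (d (x \<otimes> y)) = (d (d x) \<otimes> y \<oplus> sg (d x) \<otimes> d y) \<oplus> (\<ominus> (sg (d x) \<otimes> d y) \<oplus> x \<otimes> d (d y))"
  using x by (simp add: leibniz d.add d_sg l_minus)
 also have "... = d (d x) \<otimes> y \<oplus> x \<otimes> d (d y)" using x by (simp add: a_assoc r_neg1 r_neg2)
 finally show ?thesis .
qed

text \<open>The elements of the generated ideal whose homogeneous parts stay in it form an ideal
  \<open>J\<close>, those whose differentials stay in it an ideal \<open>K\<close>, and minimality
  does the rest. \<open>K\<close> comes second: the Leibniz rule for x \<otimes> a involves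
  \<open>sg x\<close>, which lies in the ideal because of the first half.\<close>

lemma genideal_dgquot:
 assumes G: "G <= carrier R" and pr: "!!g n. g : G ==> pr g n : genideal R G"
  and dG: "!!g. g : G ==> d g : genideal R G"
 shows "dgquot R (genideal R G)"
proof -
 interpret I: ideal "genideal R G" R by (rule genideal_ideal[OF G])
 note Ic = I.Icarr
 interpret q: kquot R "genideal R G" by unfold_locales
 note Is = q.I_submodule
 define J where "J = {x : genideal R G. \<forall>n. pr x n : genideal R G}"
 have "ideal J R"
 proof (rule ideal_of_submodule)
  show "submodule J ground R" by (rule submoduleI') (auto simp: J_def Ic pr_add pr_smult submoduleD(4)[OF Is])
  show "a \<otimes> x : J" if a: "a : carrier R" and x: "x : J" for a x using a
  proof (induct a rule: gr_induct)
   case (homog m a)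
   then show ?case using x Ic by (auto simp: J_def pr_mult_l[OF homog] I.I_l_closed)
  next
   case (add a b)
   moreover have "x : carrier R" using x Ic by (auto simp: J_def)
   ultimately show ?case by (auto simp: J_def l_distr pr_add)
  qed
  show "x \<otimes> a : J" if a: "a : carrier R" and x: "x : J" for a x using a
  proof (induct a rule: gr_induct)
   case (homog m a)
   then show ?case using x Ic by (auto simp: J_def pr_mult_r[OF homog] I.I_r_closed)
  next
   case (add a b)
   moreover have "x : carrier R" using x Ic by (auto simp: J_def)
   ultimately show ?case by (auto simp: J_def r_distr pr_add)
  qed
 qed
 then have "genideal R G <= J" by (rule genideal_minimal) (use genideal_self[OF G] pr in \<open>auto simp: J_def\<close>)
 then have prI: "pr x n : genideal R G" if "x : genideal R G" for x n using that by (auto simp: J_def)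
 have sgI: "sg x : genideal R G" if "x : genideal R G" for x
  unfolding sg_def by (rule finsum_in_submodule[OF Is]) (use that prI submoduleD(4)[OF Is] in auto)
 define K where "K = {x : genideal R G. d x : genideal R G}"
 have "ideal K R"
 proof (rule ideal_of_submodule)
  show "submodule K ground R" by (rule submoduleI') (auto simp: K_def Ic d.add d.smult submoduleD(4)[OF Is])
  show "a \<otimes> x : K" if "a : carrier R" "x : K" for a x using that Ic by (auto simp: K_def leibniz I.I_l_closed)
  show "x \<otimes> a : K" if "a : carrier R" "x : K" for a x using that Ic sgI by (auto simp: K_def leibniz I.I_r_closed)
 qed
 then have "genideal R G <= K" by (rule genideal_minimal) (use genideal_self[OF G] dG in \<open>auto simp: K_def\<close>)
 then show ?thesis by unfold_locales (use prI in \<open>auto simp: K_def\<close>)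
qed

end


section \<open>Free graded algebras with a derivation\<close>

text \<open>The derivation with value \<delta> on letters. The values may be arbitrary combinations
  of words, as the standard resolution requires; for the free product they are single
  letters.\<close>

primrec wdif :: "('x => int) => ('x => ('x list \<Rightarrow>\<^sub>0 'k::field)) => 'x list => ('x list \<Rightarrow>\<^sub>0 'k)" where
 "wdif ldeg \<delta> [] = 0"
| "wdif ldeg \<delta> (l # w) = conv (@) (\<delta> l) (basis_elt w) +
  conv (@) (single [l] (ksgn (ldeg l))) (wdif ldeg \<delta> w)"

definition free_alg :: "'x set => ('x => int) => ('x => ('x list \<Rightarrow>\<^sub>0 'k::field)) => ('k, 'x list \<Rightarrow>\<^sub>0 'k) dg" where
 "free_alg L ldeg \<delta> = \<lparr>carrier = {f. keys f <= lists L},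
  monoid.mult = conv (@), one = basis_elt [], ring.zero = 0, add = (+),
  smult = (%c. scale c),
  gr = (%n. {f. keys f <= {w : lists L. sum_list (map ldeg w) = n}}),
  dif = lin_ext (wdif ldeg \<delta>)\<rparr>"

lemma free_alg_simps [simp]:
 "carrier (free_alg L ldeg \<delta>) = {f. keys f <= lists L}"
 "monoid.mult (free_alg L ldeg \<delta>) = conv (@)" "one (free_alg L ldeg \<delta>) = basis_elt []"
 "ring.zero (free_alg L ldeg \<delta>) = 0" "add (free_alg L ldeg \<delta>) = (+)"
 "smult (free_alg L ldeg \<delta>) = (%c. scale c)"
 "gr (free_alg L ldeg \<delta>) n = {f. keys f <= {w : lists L. sum_list (map ldeg w) = n}}"
 "dif (free_alg L ldeg \<delta>) = lin_ext (wdif ldeg \<delta>)" by (simp_all add: free_alg_def)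

lemma keys_add_subset: "keys f <= K ==> keys g <= K ==> keys (f + g) <= K"
 using Poly_Mapping.keys_add[of f g] by auto
lemma keys_sc_subset: "keys f <= K ==> keys (scale (c::'k::field) f) <= K"
 using keys_sc[of c f] by auto
lemma keys_basis [simp]: "keys (basis_elt u) = {u}"
 by (simp add: basis_elt_def)
lemma keys_diff_subset: "keys f <= K ==> keys g <= K ==> keys (f - g :: 'x \<Rightarrow>\<^sub>0 'k::field) <= K"
proof
 fix x assume a: "keys f <= K" "keys g <= K" "x : keys (f - g)"
 then have "lookup f x ~= 0 \<or> lookup g x ~= 0" by (auto simp: in_keys_iff lookup_minus)
 then show "x : K" using a(1,2) by (auto simp: in_keys_iff)
qed

text \<open>Serves both the free algebra, with words under concatenation, and
  \<open>tensor_free\<close>, with pairs under componentwise multiplication.\<close>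

lemma conv_kalg:
 fixes A :: "('k::field, 'x \<Rightarrow>\<^sub>0 'k, 'm) module_scheme"
 assumes A: "carrier A = {f. keys f <= K}" "monoid.mult A = conv opn" "one A = basis_elt u"
   "ring.zero A = 0" "add A = (+)" "smult A = (%c. scale c)"
  and opn: "u : K" "!!v w. v : K ==> w : K ==> opn v w : K"
   "!!v w x. v : K ==> w : K ==> x : K ==> opn (opn v w) x = opn v (opn w x)"
   "!!v. v : K ==> opn u v = v" "!!v. v : K ==> opn v u = v"
 shows "kalg A"
proof (rule kalgI)
 show "module ground A"
 proof (rule module_groundI)
  show "abelian_group A"
  proof (rule abelian_groupI, goal_cases)
   case (6 x)
   then show ?case by (intro bexI[of _ "- x"]) (auto simp: A in_keys_iff)
  qed (auto simp: A algebra_simps keys_add_subset)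
 qed (simp_all only: A mem_Collect_eq keys_sc_subset sc_add sc_simps sc_simps')
 show "monoid A"
 proof (rule monoidI)
  show "x \<otimes>\<^sub>A y : carrier A" if "x : carrier A" "y : carrier A" for x y
   using keys_conv[of x K y K opn K] that opn(2) by (simp add: A)
  show "x \<otimes>\<^sub>A y \<otimes>\<^sub>A z = x \<otimes>\<^sub>A (y \<otimes>\<^sub>A z)" if "x : carrier A" "y : carrier A" "z : carrier A" for x y z
   using conv_assoc[of x K y z opn] that opn(3) by (simp add: A)
  fix x assume "x : carrier A"
  then have x: "keys x <= K" by (simp add: A)
  show "\<one>\<^sub>A \<otimes>\<^sub>A x = x" "x \<otimes>\<^sub>A \<one>\<^sub>A = x"
   using x by (induct x rule: pm_induct) (auto simp: A opn conv_add_r conv_add_l basis_elt_def)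
 qed (use opn in \<open>simp add: A\<close>)
qed (simp_all add: A conv_add_l conv_add_r conv_sc_l conv_sc_r)

locale free_diff =
 fixes L :: "'x set" and ldeg :: "'x => int" and \<delta> :: "'x => ('x list \<Rightarrow>\<^sub>0 'k::field)"
 assumes \<delta>: "l : L ==> keys (\<delta> l) <= {v : lists L. sum_list (map ldeg v) = ldeg l + 1}"
begin

abbreviation "F \<equiv> free_alg L ldeg \<delta>"
abbreviation "wdeg w \<equiv> sum_list (map ldeg w)"

lemma F_kalg: "kalg F"
 by (rule conv_kalg[of _ "lists L" "(@)" "[]"]) simp_all

sublocale F: kalgebra F by unfold_locales (rule F_kalg)

lemma F_graded: "graded_module F"
proof (rule gmodI_span[OF F.kmod])
 fix n
 show "submodule (gr F n) ground F" by (rule F.submoduleI') (auto simp: keys_add_subset keys_sc_subset)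
 show "linear_map F F (lin_ext (%w. if wdeg w = n then basis_elt w else 0))"
 proof (rule linear_mapI)
  show "lin_ext (%w. if wdeg w = n then basis_elt w else 0) x : carrier F" if "x : carrier F" for x
   using that keys_lin_ext[of x "lists (L)" "%w. if wdeg w = n then basis_elt w else 0" "lists (L)"] by simp
 qed (simp_all add: lin_ext_add lin_ext_sc)
next
 fix x n m assume "x : gr F n"
 then have "keys x <= {w : lists (L). wdeg w = n}" by simp
 then show "lin_ext (%w. if wdeg w = m then basis_elt w else 0) x = (if m = n then x else \<zero>\<^sub>F)"
  by (induct x rule: pm_induct) (auto simp: lin_ext_add)
next
 fix x Q
 assume x: "x : carrier F" and h: "!!n x. x : gr F n ==> Q x"
  and a: "!!x y. x : carrier F ==> y : carrier F ==> Q x ==> Q y ==> Q (x \<oplus>\<^sub>F y)"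
 have "keys x <= lists (L)" using x by simp
 then show "Q x"
 proof (induct x rule: pm_induct)
  case zero
  then show ?case by (rule h[of _ 0]) simp
 next
  case (single u c)
  then show ?case by (intro h[of _ "wdeg u"]) auto
 qed (use a in auto)
qed

lemma F_galg: "galg F"
 unfolding galg_def
proof (intro conjI F_kalg F_graded allI ballI)
 show "x \<otimes>\<^sub>F y : gr F (m + n)" if "x : gr F m" "y : gr F n" for x y m n
  using that keys_conv[of x "{w : lists (L). wdeg w = m}" y "{w : lists (L). wdeg w = n}"
   "(@)" "{w : lists (L). wdeg w = m + n}"] by simp
qed simp

lemma keys_wdif: "w : lists (L) ==>
  keys (wdif ldeg \<delta> w) <= {v : lists (L). wdeg v = wdeg w + 1}"
proof (induct w)
 case (Cons l w)
 have "keys (conv (@) (single [l] (ksgn (ldeg l))) (wdif ldeg \<delta> w)) \<subseteq>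
   {v : lists (L). wdeg v = wdeg (l # w) + 1}"
  by (rule keys_conv[of _ "{[l]}" _ "{v : lists (L). wdeg v = wdeg w + 1}"]) (use Cons in auto)
 moreover have "keys (conv (@) (\<delta> l) (basis_elt w)) <= {v : lists L. wdeg v = wdeg (l # w) + 1}"
  by (rule keys_conv[OF \<delta>, of _ _ "{w}"]) (use Cons in auto)
 ultimately show ?case unfolding wdif.simps by (intro keys_add_subset)
qed simp

lemma ksgn_wdeg: "single (l # w) (ksgn (wdeg (l # w))) =
  conv (@) (single [l] (ksgn (ldeg l))) (single w (ksgn (wdeg w)))" by (simp add: ksgn_add)

lemma wdif_append: "wdif ldeg \<delta> (u @ v) = conv (@) (wdif ldeg \<delta> u) (basis_elt v) +
  conv (@) (single u (ksgn (wdeg u))) (wdif ldeg \<delta> v)"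
proof (induct u)
 case Nil
 show ?case using conv_unit(1)[of "wdif ldeg \<delta> v"] by (simp add: basis_elt_def)
next
 case (Cons l u)
 show ?case unfolding ksgn_wdeg wdif.simps append_Cons Cons conv_add_l conv_add_r
  by (simp only: conv_assoc[OF subset_UNIV subset_UNIV subset_UNIV append_assoc] add.assoc conv_basis append_Cons)
qed

lemma F_predga: "pre_dga F"
 unfolding pre_dga_def
proof (intro conjI F_galg allI ballI subsetI)
 show "linear_map F F (dif F)"
 proof (rule linear_mapI)
  show "dif F x : carrier F" if "x : carrier F" for x
   using that keys_lin_ext[of x "lists (L)" "wdif ldeg \<delta>" "lists (L)"] keys_wdif by fastforce
 qed (simp_all add: lin_ext_add lin_ext_sc)
 show "y : gr F (n + 1)" if "y : dif F ` gr F n" for y n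
  using that keys_lin_ext[of _ "{w : lists (L). wdeg w = n}" "wdif ldeg \<delta>"
   "{w : lists (L). wdeg w = n + 1}"] keys_wdif by fastforce
 show "dif F (x \<otimes>\<^sub>F y) = dif F x \<otimes>\<^sub>F y \<oplus>\<^sub>F ksgn m \<odot>\<^sub>F (x \<otimes>\<^sub>F dif F y)"
  if "x : gr F m" "y : carrier F" for x y m
 proof -
  have "keys x <= {w : lists (L). wdeg w = m}" using that by simp
  then have "lin_ext (wdif ldeg \<delta>) (conv (@) x y) = conv (@) (lin_ext (wdif ldeg \<delta>) x) y +
    scale (ksgn m) (conv (@) x (lin_ext (wdif ldeg \<delta>) y))"
  proof (induct x rule: pm_induct)
   case (single u a)
   then have m: "m = wdeg u" by simp
   have bs: "single v b = scale b (basis_elt v)" for v :: "'x list" and b :: 'k by simp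
   show ?case
   proof (induct y rule: pm_induct[OF subset_UNIV])
    case (2 v b)
    have "conv (@) (single u (ksgn m)) (wdif ldeg \<delta> v) =
      scale (ksgn m) (conv (@) (basis_elt u) (wdif ldeg \<delta> v))" by (simp only: bs[of u "ksgn m"] conv_sc_l)
    then have e: "lin_ext (wdif ldeg \<delta>) (conv (@) (basis_elt u) (basis_elt v)) = conv (@) (wdif ldeg \<delta> u) (basis_elt v) +
      scale (ksgn m) (conv (@) (basis_elt u) (wdif ldeg \<delta> v))" by (simp only: conv_basis lin_ext_basis wdif_append m[symmetric])
    show ?case unfolding bs conv_sc_l conv_sc_r lin_ext_sc e lin_ext_basis sc_simps(1)
     by (simp only: sc_comm[of "ksgn m" a] sc_comm[of "ksgn m" b] sc_comm[of b a])
   qed (simp_all only: conv_add_r lin_ext_add sc_simps conv_0 lin_ext_0 add_0 add.assoc add.left_commute add.commute)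
  qed (simp_all only: conv_add_l lin_ext_add sc_simps conv_0 lin_ext_0 add_0 add.assoc add.left_commute)
  then show ?thesis by simp
 qed
qed

end


section \<open>The free product\<close>

lemma letters_iff [simp]: "Inl (n, x) : letters R S \<longleftrightarrow> x : gr R n" "Inr (n, y) : letters R S \<longleftrightarrow> y : gr S n"
 by (auto simp: letters_def)
lemma letter_deg_simps [simp]: "letter_deg (Inl p) = fst p" "letter_deg (Inr q) = fst q"
 by (simp_all add: letter_deg_def)
lemma letter_dif_simps [simp]: "letter_dif R S (Inl (n, x)) = Inl (n + 1, dif R x)"
 "letter_dif R S (Inr (n, y)) = Inr (n + 1, dif S y)" by (simp_all add: letter_dif_def)
lemma lettersE:
 assumes "l : letters R S"
 obtains n x where "l = Inl (n, x)" "x : gr R n" | n y where "l = Inr (n, y)" "y : gr S n" using assms by (auto simp: letters_def)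

lemma free_dg_simps [simp]:
 "carrier (free_dg R S) = {f. keys f <= lists (letters R S)}"
 "monoid.mult (free_dg R S) = conv (@)" "one (free_dg R S) = basis_elt []"
 "ring.zero (free_dg R S) = 0" "add (free_dg R S) = (+)"
 "smult (free_dg R S) = (%c. scale c)"
 "gr (free_dg R S) n = {f. keys f <= {w : lists (letters R S). sum_list (map letter_deg w) = n}}"
 "dif (free_dg R S) = lin_ext (word_dif R S)" by (simp_all add: free_dg_def)

text \<open>Makes the presentation of the free product an instance of \<open>free_alg\<close>, so
  that its Leibniz rule and grading need no separate proof.\<close>

lemma free_dg_eq: "free_dg R S = free_alg (letters R S) letter_deg (%l. basis_elt [letter_dif R S l])"
proof -
 have "word_dif R S = wdif letter_deg (%l. basis_elt [letter_dif R S l])"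
 proof
  show "word_dif R S w = wdif letter_deg (%l. basis_elt [letter_dif R S l]) w" for w by (induct w) auto
 qed
 then show ?thesis by (simp add: free_dg_def free_alg_def)
qed

locale two_dga = R: dgalgebra R + S: dgalgebra S for R :: "('k::field, 'r) dg" and S :: "('k, 's) dg"
begin

abbreviation "F \<equiv> free_dg R S"
abbreviation "wdeg w \<equiv> sum_list (map letter_deg w)"

lemma F_predga: "pre_dga F"
proof -
 interpret G: free_diff "letters R S" letter_deg "%l. basis_elt [letter_dif R S l]"
  by unfold_locales (auto elim!: lettersE simp: R.d_gr S.d_gr)
 show ?thesis unfolding free_dg_eq by (rule G.F_predga)
qed

sublocale F: kalgebra F using F_predga by unfold_locales (simp add: pre_dga_def galg_def)

end

lemma (in kmod) cancel4: "x : carrier M ==> y : carrier M ==> x \<oplus> (y \<oplus> (\<ominus> x \<oplus> \<ominus> y)) = \<zero>"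
 by (metis a_assoc a_closed a_inv_closed minus_add r_neg)

lemma dga_hom_cong:
 assumes "dga_hom R S f" "!!x. x : carrier R ==> g x = f x"
 shows "dga_hom R S g"
proof -
 interpret f: dga_map R S f by unfold_locales fact
 show ?thesis by (rule dga_homI) (auto simp: f.R.dga f.S.dga assms(2) f.add f.smult f.mult f.gr f.dif)
qed

text \<open>The letters of the free product carry their degree as a label, so the natural map on a
  factor is at first a family indexed by the degree (zero, for instance, has a letter in each
  degree). \<open>ext\<close> glues such a family to one DG algebra map.\<close>

locale graded_family = X: dgalgebra X + T: dgalgebra T for X :: "('k::field, 'x) dg" and T :: "('k, 't) dg" +
 fixes \<phi> :: "int => 'x => 't"
 assumes gr: "!!n x. x : gr X n ==> \<phi> n x : gr T n"
  and add: "!!n x y. x : gr X n ==> y : gr X n ==> \<phi> n (x \<oplus>\<^sub>X y) = \<phi> n x \<oplus>\<^sub>T \<phi> n y"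
  and smult: "!!n c x. x : gr X n ==> \<phi> n (c \<odot>\<^sub>X x) = c \<odot>\<^sub>T \<phi> n x"
  and mult: "!!m n x y. x : gr X m ==> y : gr X n ==> \<phi> (m + n) (x \<otimes>\<^sub>X y) = \<phi> m x \<otimes>\<^sub>T \<phi> n y"
  and one: "\<phi> 0 \<one>\<^sub>X = \<one>\<^sub>T"
  and dif: "!!n x. x : gr X n ==> dif T (\<phi> n x) = \<phi> (n + 1) (dif X x)"
begin

definition ext :: "'x => 't" where
 "ext x = (\<Oplus>\<^sub>T n\<in>supp X x. \<phi> n (homog_part X x n))"

lemma zero: "\<phi> n \<zero>\<^sub>X = \<zero>\<^sub>T"
proof -
 have "\<phi> n \<zero>\<^sub>X : carrier T" by (rule T.gr_carrier[OF gr]) simp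
 then show ?thesis using smult[of "\<zero>\<^sub>X" n 0] by simp
qed

lemma car: "x : carrier X ==> \<phi> n (homog_part X x n) : carrier T"
 by (rule T.gr_carrier[OF gr]) simp

lemma ext_eq: "x : carrier X ==> finite A ==> supp X x <= A ==> ext x = (\<Oplus>\<^sub>T n\<in>A. \<phi> n (homog_part X x n))"
 unfolding ext_def by (rule T.finsum_mono_neutral) (auto simp: X.pr_notin zero car)

lemma ext_homog: "x : gr X n ==> ext x = \<phi> n x"
proof -
 assume x: "x : gr X n"
 have "supp X x <= {n}" using x by (auto simp: supp_def X.pr_homog)
 then have "ext x = (\<Oplus>\<^sub>T m\<in>{n}. \<phi> m (homog_part X x m))" by (intro ext_eq) (use x in auto)
 also have "... = \<phi> n x" using x T.gr_carrier[OF gr[OF x]] by (simp add: X.pr_homog[OF x])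
 finally show ?thesis .
qed

lemma ext_closed: "x : carrier X ==> ext x : carrier T"
 unfolding ext_def by (rule T.finsum_closed) (auto simp: car)

lemma ext_add: "x : carrier X ==> y : carrier X ==> ext (x \<oplus>\<^sub>X y) = ext x \<oplus>\<^sub>T ext y"
proof -
 assume a: "x : carrier X" "y : carrier X"
 let ?A = "supp X x \<union> supp X y"
 have "supp X (x \<oplus>\<^sub>X y) <= ?A" using a by (auto simp: supp_def X.pr_add)
 then have "ext (x \<oplus>\<^sub>X y) = (\<Oplus>\<^sub>T n\<in>?A. \<phi> n (homog_part X (x \<oplus>\<^sub>X y) n))" by (intro ext_eq) (use a in auto)
 also have "... = (\<Oplus>\<^sub>T n\<in>?A. \<phi> n (homog_part X x n) \<oplus>\<^sub>T \<phi> n (homog_part X y n))"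
  by (rule T.finsum_cong') (use a in \<open>auto simp: X.pr_add add car\<close>)
 also have "... = (\<Oplus>\<^sub>T n\<in>?A. \<phi> n (homog_part X x n)) \<oplus>\<^sub>T (\<Oplus>\<^sub>T n\<in>?A. \<phi> n (homog_part X y n))"
  by (rule T.finsum_addf) (use a in \<open>auto simp: car\<close>)
 also have "(\<Oplus>\<^sub>T n\<in>?A. \<phi> n (homog_part X x n)) = ext x" by (rule ext_eq[symmetric]) (use a in auto)
 also have "(\<Oplus>\<^sub>T n\<in>?A. \<phi> n (homog_part X y n)) = ext y" by (rule ext_eq[symmetric]) (use a in auto)
 finally show ?thesis .
qed

lemma ext_hom: "dga_hom X T ext"
proof (rule dga_homI[OF X.dga T.dga])
 show "ext (c \<odot>\<^sub>X x) = c \<odot>\<^sub>T ext x" if "x : carrier X" for c x using that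
 proof (induct x rule: X.gr_induct)
  case (homog n x)
  then show ?case by (simp add: ext_homog[of _ n] smult)
 qed (simp add: X.sm_radd T.sm_radd ext_add ext_closed)
 show "ext (x \<otimes>\<^sub>X y) = ext x \<otimes>\<^sub>T ext y" if "x : carrier X" "y : carrier X" for x y using that(1)
 proof (induct x rule: X.gr_induct)
  case (homog m x)
  note x = homog
  show ?case using that(2)
  proof (induct y rule: X.gr_induct)
   case (homog n y)
   then show ?case using x by (simp add: ext_homog[of _ m] ext_homog[of _ n] ext_homog[OF X.mult_gr[OF x homog]] mult)
  next
   case (add y z)
   then show ?case using x by (simp add: X.r_distr T.r_distr ext_add ext_closed)
  qed
 next
  case (add y z)
  then show ?case using that by (simp add: X.l_distr T.l_distr ext_add ext_closed)
 qed
 show "ext (dif X x) = dif T (ext x)" if "x : carrier X" for x using that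
 proof (induct x rule: X.gr_induct)
  case (homog n x)
  then show ?case by (simp add: ext_homog[of _ n] ext_homog[OF X.d_gr[OF homog]] dif)
 qed (simp add: X.d.add T.d.add ext_add ext_closed)
 show "ext \<one>\<^sub>X = \<one>\<^sub>T" by (simp add: ext_homog[OF X.one_gr] one)
 show "ext x : gr T n" if "x : gr X n" for x n using that by (simp add: ext_homog gr)
qed (auto simp: ext_closed ext_add)

end

definition fp_inl :: "('k::field, 'r) dg => ('k, 's) dg => 'r => (('r, 's) letter list \<Rightarrow>\<^sub>0 'k) set" where
 "fp_inl R S x = fp_ideal R S +>\<^bsub>free_dg R S\<^esub> (\<Sum>n\<in>supp R x. basis_elt [Inl (n, homog_part R x n)])"

context two_dga
begin

sublocale F: predga F by unfold_locales (rule F_predga)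

abbreviation "rels \<equiv> factor_rels Inl R \<union> factor_rels Inr S"

lemma finsum_F: "g : A \<rightarrow> carrier F ==> finsum F g A = sum g A"
 by (induct A rule: infinite_finite_induct) (auto simp: Pi_def)

end

text \<open>One treatment of both factors: \<iota> becomes \<open>Inl\<close> for R and
  \<open>Inr\<close> for S.\<close>

locale factor = two_dga R S + X: dgalgebra X for R :: "('k::field, 'r) dg" and S :: "('k, 's) dg" and X :: "('k, 'x) dg" +
 fixes \<iota> :: "int \<times> 'x => ('r, 's) letter"
 assumes \<iota>_in: "!!n x. x : gr X n ==> \<iota> (n, x) : letters R S"
  and \<iota>_deg [simp]: "!!n x. letter_deg (\<iota> (n, x)) = n"
  and \<iota>_dif [simp]: "!!n x. letter_dif R S (\<iota> (n, x)) = \<iota> (n + 1, dif X x)"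
  and \<iota>_rels: "factor_rels \<iota> X <= rels"
begin

lemma relI:
 shows "x : gr X n ==> y : gr X n ==>
   basis_elt [\<iota> (n, x \<oplus>\<^sub>X y)] - basis_elt [\<iota> (n, x)] - basis_elt [\<iota> (n, y)] : (factor_rels \<iota> X :: (('r, 's) letter list \<Rightarrow>\<^sub>0 'k) set)"
  and "x : gr X n ==> basis_elt [\<iota> (n, c \<odot>\<^sub>X x)] - single [\<iota> (n, x)] c : factor_rels \<iota> X"
  and "x : gr X m ==> y : gr X n ==>
   basis_elt [\<iota> (m + n, x \<otimes>\<^sub>X y)] - basis_elt [\<iota> (m, x), \<iota> (n, y)] : (factor_rels \<iota> X :: (('r, 's) letter list \<Rightarrow>\<^sub>0 'k) set)"
  and "basis_elt [\<iota> (0, \<one>\<^sub>X)] - basis_elt [] : (factor_rels \<iota> X :: (('r, 's) letter list \<Rightarrow>\<^sub>0 'k) set)"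
 unfolding factor_rels_def by blast+

lemma relE:
 assumes "g : (factor_rels \<iota> X :: (('r, 's) letter list \<Rightarrow>\<^sub>0 'k) set)"
 obtains n x y where "x : gr X n" "y : gr X n"
   "g = basis_elt [\<iota> (n, x \<oplus>\<^sub>X y)] - basis_elt [\<iota> (n, x)] - basis_elt [\<iota> (n, y)]"
  | n c x where "x : gr X n" "g = basis_elt [\<iota> (n, c \<odot>\<^sub>X x)] - single [\<iota> (n, x)] c"
  | m n x y where "x : gr X m" "y : gr X n"
   "g = basis_elt [\<iota> (m + n, x \<otimes>\<^sub>X y)] - basis_elt [\<iota> (m, x), \<iota> (n, y)]"
  | "g = basis_elt [\<iota> (0, \<one>\<^sub>X)] - basis_elt []"
proof -
 show thesis using assms unfolding factor_rels_def
 proof (elim UnE CollectE exE conjE, goal_cases)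
 case (1 n x y)
 show ?case by (rule that(1)[OF 1(2,3,1)])
next
 case (2 n c x)
 show ?case by (rule that(2)[OF 2(2,1)])
next
 case (3 m n x y)
 show ?case by (rule that(3)[OF 3(2,3,1)])
next
 case 4
 then show ?case by (intro that(4)) simp
 qed
qed

lemma rel_homog: "g : factor_rels \<iota> X ==> \<exists>n. g : gr F n"
proof (elim relE)
 fix n x y assume "x : gr X n" "y : gr X n"
  "g = basis_elt [\<iota> (n, x \<oplus>\<^sub>X y)] - basis_elt [\<iota> (n, x)] - basis_elt [\<iota> (n, y)]"
 then have "g : gr F n" by (simp only: free_dg_simps mem_Collect_eq) (intro keys_diff_subset; simp add: \<iota>_in)
 then show ?thesis by blast
next
 fix n c x assume "x : gr X n" "g = basis_elt [\<iota> (n, c \<odot>\<^sub>X x)] - single [\<iota> (n, x)] c"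
 then have "g : gr F n" by (simp only: free_dg_simps mem_Collect_eq) (intro keys_diff_subset; simp add: \<iota>_in)
 then show ?thesis by blast
next
 fix m n x y assume "x : gr X m" "y : gr X n"
  "g = basis_elt [\<iota> (m + n, x \<otimes>\<^sub>X y)] - basis_elt [\<iota> (m, x), \<iota> (n, y)]"
 then have "g : gr F (m + n)" by (simp only: free_dg_simps mem_Collect_eq) (intro keys_diff_subset; simp add: \<iota>_in X.mult_gr)
 then show ?thesis by blast
next
 assume "g = basis_elt [\<iota> (0, \<one>\<^sub>X)] - basis_elt []"
 then have "g : gr F 0" by (simp only: free_dg_simps mem_Collect_eq) (intro keys_diff_subset; simp add: \<iota>_in)
 then show ?thesis by blast
qed

text \<open>This is the scalar relation for c = 0.\<close>

lemma basis_0_in: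
 assumes "submodule J ground F" "factor_rels \<iota> X <= J"
 shows "basis_elt [\<iota> (n, \<zero>\<^sub>X)] : J" using relI(2)[of "\<zero>\<^sub>X" n 0] assms(2) by auto

lemma rel_dif:
 assumes J: "submodule J ground F" "factor_rels \<iota> X <= J" and "g : factor_rels \<iota> X"
 shows "dif F g : J" using assms(3)
proof (rule relE)
 note rel = relI[THEN subsetD[OF J(2)]]
 note Jop = F.submoduleD(3,4)[OF J(1), simplified]
 {
  fix n x y assume "x : gr X n" "y : gr X n"
   and g: "g = basis_elt [\<iota> (n, x \<oplus>\<^sub>X y)] - basis_elt [\<iota> (n, x)] - basis_elt [\<iota> (n, y)]"
  then show ?thesis using rel(1)[OF X.d_gr X.d_gr, of x n y] by (simp add: lin_ext_minus X.d.add)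
 next
  fix n c x assume "x : gr X n" and g: "g = basis_elt [\<iota> (n, c \<odot>\<^sub>X x)] - single [\<iota> (n, x)] c"
  then show ?thesis using rel(2)[OF X.d_gr, of x n c] by (simp add: lin_ext_minus X.d.smult)
 next
  fix m n x y assume x: "x : gr X m" "y : gr X n"
   and g: "g = basis_elt [\<iota> (m + n, x \<otimes>\<^sub>X y)] - basis_elt [\<iota> (m, x), \<iota> (n, y)]"
  let ?k = "ksgn m" and ?N = "m + n + 1"
  let ?p = "dif X x \<otimes>\<^sub>X y" and ?r = "x \<otimes>\<^sub>X dif X y"
  have eN: "m + 1 + n = ?N" "m + (n + 1) = ?N" by auto
  have p: "?p : gr X ?N" "?r : gr X ?N"
   using X.mult_gr[OF X.d_gr[OF x(1)] x(2)] X.mult_gr[OF x(1) X.d_gr[OF x(2)]] by (simp_all only: eN)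
  have r1: "basis_elt [\<iota> (?N, ?p \<oplus>\<^sub>X ?k \<odot>\<^sub>X ?r)] - basis_elt [\<iota> (?N, ?p)] - basis_elt [\<iota> (?N, ?k \<odot>\<^sub>X ?r)] : J"
   by (rule rel(1)) (use p in auto)
  have r2: "basis_elt [\<iota> (?N, ?k \<odot>\<^sub>X ?r)] - single [\<iota> (?N, ?r)] ?k : J" by (rule rel(2)) (use p in auto)
  have r3: "basis_elt [\<iota> (?N, ?p)] - basis_elt [\<iota> (m + 1, dif X x), \<iota> (n, y)] : J"
   using rel(3)[OF X.d_gr[OF x(1)] x(2)] by (simp only: eN)
  have r4: "scale (?k) (basis_elt [\<iota> (?N, ?r)] - basis_elt [\<iota> (m, x), \<iota> (n + 1, dif X y)]) : J"
   using Jop(2)[OF rel(3)[OF x(1) X.d_gr[OF x(2)]], of ?k] by (simp only: eN)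
  \<comment> \<open>The differential of a product relation is a combination of an additive, a scalar
    and two product relations in degree m + n + 1. The scalar relation is needed because one of the
    signs (-1)^m sits inside a letter.\<close>
  have e: "dif F g = (basis_elt [\<iota> (?N, ?p \<oplus>\<^sub>X ?k \<odot>\<^sub>X ?r)] - basis_elt [\<iota> (?N, ?p)] - basis_elt [\<iota> (?N, ?k \<odot>\<^sub>X ?r)])
   + (basis_elt [\<iota> (?N, ?k \<odot>\<^sub>X ?r)] - single [\<iota> (?N, ?r)] ?k)
   + (basis_elt [\<iota> (?N, ?p)] - basis_elt [\<iota> (m + 1, dif X x), \<iota> (n, y)])
   + scale (?k) (basis_elt [\<iota> (?N, ?r)] - basis_elt [\<iota> (m, x), \<iota> (n + 1, dif X y)])"
  proof -
   have m: "scale (?k) (u - v) = scale (?k) u - scale (?k) v" for u v :: "('r, 's) letter list \<Rightarrow>\<^sub>0 'k"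
    using sc_simps(1)[of ?k "u - v" v] by simp
   have "conv (@) (single [\<iota> (m, x)] ?k) (basis_elt [\<iota> (n + 1, dif X y)]) =
     scale (?k) (basis_elt [\<iota> (m, x), \<iota> (n + 1, dif X y)])" by (simp add: basis_elt_def)
   then show ?thesis unfolding g m using x by (simp add: lin_ext_minus X.leibniz_homog[of x m])
  qed
  show ?thesis unfolding e by (intro Jop(1) r1 r2 r3 r4)
 next
  assume "g = basis_elt [\<iota> (0, \<one>\<^sub>X)] - basis_elt []"
  then show ?thesis using basis_0_in[OF J, of 1] by (simp add: lin_ext_minus)
 }
qed

lemma dd_letter:
 assumes "submodule J ground F" "factor_rels \<iota> X <= J" "x : gr X n"
 shows "dif F (dif F (basis_elt [\<iota> (n, x)])) : J" using basis_0_in[OF assms(1,2), of "n + 1 + 1"] assms(3) by simp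

end

context two_dga
begin

sublocale L: factor R S R Inl by unfold_locales auto
sublocale R: factor R S S Inr by unfold_locales auto

abbreviation "I \<equiv> fp_ideal R S"

lemma rels_homog: "g : rels ==> \<exists>n. g : gr F n"
 using L.rel_homog R.rel_homog by blast

lemma rels_carrier: "rels <= carrier F"
 using rels_homog F.gr_carrier by blast

lemma I_ideal: "ideal I F"
 unfolding fp_ideal_def by (rule F.genideal_ideal[OF rels_carrier])

lemma rels_I: "rels <= I"
 unfolding fp_ideal_def by (rule F.genideal_self[OF rels_carrier])

lemma I_submodule: "submodule I ground F"
 by (rule F.ideal_submodule[OF I_ideal])

sublocale Q: dgquot F I unfolding fp_ideal_def
proof (rule F.genideal_dgquot[OF rels_carrier])
 fix g n assume g: "g : rels"
 then obtain m where "g : gr F m" using rels_homog by blast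
 then have "homog_part F g n = (if n = m then g else 0)" by (simp only: F.pr_homog free_dg_simps)
 then show "homog_part F g n : genideal F rels" using rels_I g F.submoduleD(2)[OF I_submodule] by (auto simp: fp_ideal_def)
next
 fix g assume "g : rels"
 then show "dif F g : genideal F rels"
  using L.rel_dif[OF I_submodule, of g] R.rel_dif[OF I_submodule, of g] rels_I unfolding fp_ideal_def by blast
qed

abbreviation "T \<equiv> free_prod R S"

text \<open>By \<open>dd_mult\<close> only letters matter, and d^2 of a letter is a letter with
  entry zero.\<close>

lemma dd_I:
 assumes "f : carrier F"
 shows "dif F (dif F f) : I"
proof -
 have w: "dif F (dif F (basis_elt w)) : I" if "w : lists (letters R S)" for w using that
 proof (induct w)
  case Nil
  then show ?case using F.submoduleD(2)[OF I_submodule] by simp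
 next
  case (Cons l w)
  have l: "dif F (dif F (basis_elt [l])) : I" using Cons(1) L.dd_letter[OF I_submodule] R.dd_letter[OF I_submodule] rels_I
   by (elim lettersE) blast+
  have c: "basis_elt [l] : carrier F" "basis_elt w : carrier F" using Cons by auto
  have "basis_elt (l # w) = basis_elt [l] \<otimes>\<^sub>F basis_elt w" by simp
  then have "dif F (dif F (basis_elt (l # w))) =
    dif F (dif F (basis_elt [l])) \<otimes>\<^sub>F basis_elt w \<oplus>\<^sub>F basis_elt [l] \<otimes>\<^sub>F dif F (dif F (basis_elt w))"
   using F.dd_mult[OF c] by (simp only:)
  also have "... : I" by (intro Q.a_closed Q.I_l_closed Q.I_r_closed l Cons c)
  finally show ?case .
 qed
 have "keys f <= lists (letters R S)" using assms by simp
 then show ?thesis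
 proof (induct f rule: pm_induct)
  case zero
  then show ?case using F.submoduleD(2)[OF I_submodule] by simp
 next
  case (single u c)
  have "dif F (dif F (single u c)) = c \<odot>\<^sub>F dif F (dif F (basis_elt u))" by (simp add: lin_ext_sc)
  then show ?case using F.submoduleD(4)[OF I_submodule w[OF single]] by (simp only:)
 next
  case (add p q)
  then show ?case using F.submoduleD(3)[OF I_submodule add(3,4)] by (simp add: lin_ext_add)
 qed
qed

lemma T_dga: "dga T"
 unfolding free_prod_def by (rule Q.Q_dga) (rule dd_I)

sublocale T: dgalgebra T by unfold_locales (rule T_dga)

lemma T_carrier: "carrier T = Q.\<pi> ` carrier F"
 unfolding free_prod_def by (simp only: quot_simps Q.q_carrier)

lemma T_ops:
 assumes "x : carrier F"
 shows "c \<odot>\<^sub>T Q.\<pi> x = Q.\<pi> (c \<odot>\<^sub>F x)" "dif T (Q.\<pi> x) = Q.\<pi> (dif F x)"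
  "y : carrier F ==> Q.\<pi> x \<oplus>\<^sub>T Q.\<pi> y = Q.\<pi> (x \<oplus>\<^sub>F y)"
  "y : carrier F ==> Q.\<pi> x \<otimes>\<^sub>T Q.\<pi> y = Q.\<pi> (x \<otimes>\<^sub>F y)"
  "x : gr F n ==> Q.\<pi> x : gr T n"
 using assms Q.q_smult[OF assms, of c] Q.Q_dif[OF assms] Q.q_add[OF assms, of y] Q.q_mult[OF assms, of y]
 unfolding free_prod_def by (simp_all only: quot_simps image_eqI)

lemma T_one: "\<one>\<^sub>T = Q.\<pi> (basis_elt [])"
 unfolding free_prod_def by simp

lemma T_induct [consumes 1, case_names letter one add smult mult]:
 assumes "X : carrier T"
  and letter: "!!l. l : letters R S ==> P (Q.\<pi> (basis_elt [l]))"
  and one: "P \<one>\<^sub>T"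
  and add: "!!x y. x : carrier T ==> y : carrier T ==> P x ==> P y ==> P (x \<oplus>\<^sub>T y)"
  and smult: "!!c x. x : carrier T ==> P x ==> P (c \<odot>\<^sub>T x)"
  and mult: "!!x y. x : carrier T ==> y : carrier T ==> P x ==> P y ==> P (x \<otimes>\<^sub>T y)"
 shows "P X"
proof -
 have c: "Q.\<pi> f : carrier T" if "f : carrier F" for f using that by (auto simp: T_carrier)
 have w: "P (Q.\<pi> (basis_elt w))" if "w : lists (letters R S)" for w using that
 proof (induct w)
  case Nil
  then show ?case using one by (simp only: T_one)
 next
  case (Cons l w)
  have l: "basis_elt [l] : carrier F" "basis_elt w : carrier F" using Cons by auto
  have "Q.\<pi> (basis_elt (l # w)) = Q.\<pi> (basis_elt [l]) \<otimes>\<^sub>T Q.\<pi> (basis_elt w)" using T_ops(4)[OF l] by simp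
  then show ?case using mult[OF c[OF l(1)] c[OF l(2)] letter[OF Cons(1)] Cons(3)] by (simp only:)
 qed
 obtain f where f: "f : carrier F" "X = Q.\<pi> f" using assms(1) by (auto simp: T_carrier)
 have "keys f <= lists (letters R S)" using f by simp
 then have "P (Q.\<pi> f)"
 proof (induct f rule: pm_induct)
  case zero
  have "\<zero>\<^sub>T = Q.\<pi> 0" using Q.\<pi>_zero by (simp add: free_prod_def)
  moreover have "P (0 \<odot>\<^sub>T \<one>\<^sub>T)" by (rule smult[OF _ one]) simp
  ultimately show ?case by simp
 next
  case (single u a)
  have "basis_elt u : carrier F" using single by simp
  from smult[OF c[OF this] w[OF single], of a] show ?case using T_ops(1)[OF \<open>basis_elt u : carrier F\<close>, of a] by simp
 next
  case (add p q)
  then have pq: "p : carrier F" "q : carrier F" by auto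
  then show ?case using assms(4)[OF c[OF pq(1)] c[OF pq(2)] add(3,4)] T_ops(3)[OF pq] by simp
 qed
 then show ?thesis using f by simp
qed

end

context factor
begin

abbreviation "j n x \<equiv> I +>\<^sub>F basis_elt [\<iota> (n, x)]"

lemma b_in: "x : gr X n ==> basis_elt [\<iota> (n, x)] : carrier F"
 by (simp add: \<iota>_in)

lemma rels_in: "factor_rels \<iota> X <= I"
 using \<iota>_rels rels_I by blast

lemma F_minus: "x : carrier F ==> y : carrier F ==> x \<ominus>\<^sub>F y = x - y"
proof -
 assume x: "x : carrier F" "y : carrier F"
 have "\<ominus>\<^sub>F y = - y" by (rule F.minus_equality) (use x in \<open>auto simp: in_keys_iff\<close>)
 then show ?thesis using x by (simp add: F.minus_eq)
qed

lemma j_family: "graded_family X T j"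
proof
 fix n x y c assume x: "x : gr X n"
 have "basis_elt [\<iota> (n, x)] : gr F n" using x by (simp add: \<iota>_in)
 then show "j n x : gr T n" by (rule T_ops(5)[OF b_in[OF x]])
 show "dif T (j n x) = j (n + 1) (dif X x)" using T_ops(2)[OF b_in[OF x]] by simp
 have "j n (c \<odot>\<^sub>X x) = I +>\<^sub>F single [\<iota> (n, x)] c"
  using relI(2)[OF x, of c] rels_in x by (subst Q.\<pi>_eq_iff) (auto simp: F_minus \<iota>_in)
 then show "j n (c \<odot>\<^sub>X x) = c \<odot>\<^sub>T j n x" using T_ops(1)[OF b_in[OF x], of c] by simp
 assume y: "y : gr X n"
 have "j n (x \<oplus>\<^sub>X y) = I +>\<^sub>F (basis_elt [\<iota> (n, x)] + basis_elt [\<iota> (n, y)])"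
 proof (subst Q.\<pi>_eq_iff)
  show xy: "basis_elt [\<iota> (n, x)] + basis_elt [\<iota> (n, y)] : carrier F" using F.add.m_closed[OF b_in[OF x] b_in[OF y]] by simp
  show "basis_elt [\<iota> (n, x \<oplus>\<^sub>X y)] \<ominus>\<^sub>F (basis_elt [\<iota> (n, x)] + basis_elt [\<iota> (n, y)]) : I"
   using relI(1)[OF x y] rels_in by (subst F_minus[OF b_in xy]) (auto simp: x y algebra_simps)
 qed (use x y b_in in blast)
 then show "j n (x \<oplus>\<^sub>X y) = j n x \<oplus>\<^sub>T j n y" using T_ops(3)[OF b_in[OF x] b_in[OF y]] by simp
next
 fix m n x y assume x: "x : gr X m" and y: "y : gr X n"
 have "j (m + n) (x \<otimes>\<^sub>X y) = I +>\<^sub>F basis_elt [\<iota> (m, x), \<iota> (n, y)]"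
 proof (subst Q.\<pi>_eq_iff)
  show xy: "basis_elt [\<iota> (m, x), \<iota> (n, y)] : carrier F" using x y by (simp add: \<iota>_in)
  show "basis_elt [\<iota> (m + n, x \<otimes>\<^sub>X y)] \<ominus>\<^sub>F basis_elt [\<iota> (m, x), \<iota> (n, y)] : I"
   using relI(3)[OF x y] rels_in by (subst F_minus[OF b_in xy]) (auto simp: X.mult_gr x y)
 qed (use x y b_in X.mult_gr in blast)
 then show "j (m + n) (x \<otimes>\<^sub>X y) = j m x \<otimes>\<^sub>T j n y" using T_ops(4)[OF b_in[OF x] b_in[OF y]] by simp
next
 have "j 0 \<one>\<^sub>X = I +>\<^sub>F basis_elt []" using relI(4) rels_in by (subst Q.\<pi>_eq_iff) (auto simp: F_minus \<iota>_in)
 then show "j 0 \<one>\<^sub>X = \<one>\<^sub>T" by (simp only: T_one)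
qed

sublocale J: graded_family X T j by (rule j_family)

lemma ext_eq_coset:
 assumes "x : carrier X"
 shows "J.ext x = I +>\<^sub>F (\<Sum>n\<in>supp X x. basis_elt [\<iota> (n, homog_part X x n)])"
proof -
 interpret q: alg_map F "dg_quot F I" Q.\<pi> by unfold_locales (rule Q.Q_hom)
 have c: "(%n. basis_elt [\<iota> (n, homog_part X x n)]) : supp X x \<rightarrow> carrier F"
  using b_in[OF X.pr_gr[OF assms]] by blast
 show ?thesis unfolding J.ext_def finsum_F[OF c, symmetric] by (simp only: q.finsum[OF c]) (simp only: free_prod_def)
qed

end

context two_dga
begin

lemma fp_inl_ext: "x : carrier R ==> fp_inl R S x = L.J.ext x"
 unfolding fp_inl_def by (rule L.ext_eq_coset[symmetric])
lemma fp_inr_ext: "x : carrier S ==> fp_inr R S x = R.J.ext x"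
 unfolding fp_inr_def by (rule R.ext_eq_coset[symmetric])

lemma fp_inl_hom: "dga_hom R T (fp_inl R S)"
 by (rule dga_hom_cong[OF L.J.ext_hom fp_inl_ext])
lemma fp_inr_hom: "dga_hom S T (fp_inr R S)"
 by (rule dga_hom_cong[OF R.J.ext_hom fp_inr_ext])

lemma fp_inl_homog: "x : gr R n ==> fp_inl R S x = I +>\<^sub>F basis_elt [Inl (n, x)]"
 by (simp add: fp_inl_ext L.J.ext_homog R.gr_carrier)
lemma fp_inr_homog: "x : gr S n ==> fp_inr R S x = I +>\<^sub>F basis_elt [Inr (n, x)]"
 by (simp add: fp_inr_ext R.J.ext_homog S.gr_carrier)

lemma fp_induct [consumes 1, case_names inl inr add smult mult]:
 assumes "X : carrier T"
  and "!!n x. x : gr R n ==> P (fp_inl R S x)" "!!n y. y : gr S n ==> P (fp_inr R S y)"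
  and add: "!!x y. x : carrier T ==> y : carrier T ==> P x ==> P y ==> P (x \<oplus>\<^sub>T y)"
  and smult: "!!c x. x : carrier T ==> P x ==> P (c \<odot>\<^sub>T x)"
  and mult: "!!x y. x : carrier T ==> y : carrier T ==> P x ==> P y ==> P (x \<otimes>\<^sub>T y)"
 shows "P X" using assms(1)
proof (induct X rule: T_induct)
 case (letter l)
 then show ?case using assms(2,3) by (elim lettersE) (simp_all only: fp_inl_homog[symmetric] fp_inr_homog[symmetric])
next
 case one
 interpret i: dga_map R T "fp_inl R S" by unfold_locales (rule fp_inl_hom)
 show ?case using assms(2)[OF R.one_gr] by simp
qed (use assms in auto)

text \<open>The existence half of the universal property of the coproduct. On words the map is
  forced; \<phi> is zero off the letters so that \<open>lext\<close> applies. That f and g are DG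
  algebra maps is used to see that the map kills the relations and commutes with d on
  letters.\<close>

lemma fp_lift:
 assumes f: "dga_hom R U f" and g: "dga_hom S U g"
 obtains h where "dga_hom T U h" "!!x. x : carrier R ==> h (fp_inl R S x) = f x"
  "!!y. y : carrier S ==> h (fp_inr R S y) = g y"
proof -
 interpret f: dga_map R U f by unfold_locales fact
 interpret g: dga_map S U g by unfold_locales fact
 define \<phi> where "\<phi> = (%l. if l : letters R S then case_sum (f \<circ> snd) (g \<circ> snd) l else \<zero>\<^sub>U)"
 have \<phi>c [simp]: "\<phi> l : carrier U" for l by (auto simp: \<phi>_def elim!: lettersE)
 have \<phi>g: "l : letters R S ==> \<phi> l : gr U (letter_deg l)" for l by (auto simp: \<phi>_def f.gr g.gr elim!: lettersE)
 have \<phi>d: "l : letters R S ==> dif U (\<phi> l) = \<phi> (letter_dif R S l)" for l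
  by (erule lettersE) (simp_all add: \<phi>_def R.d_gr S.d_gr f.dif[symmetric] g.dif[symmetric])
 let ?w = "f.S.wval \<phi>"
 define e where "e = f.S.lext ?w"
 have wc [simp]: "?w w : carrier U" for w by simp
 have wg: "w : lists (letters R S) ==> ?w w : gr U (wdeg w)" for w by (induct w) (auto simp: \<phi>g f.S.mult_gr)
 have esimps: "e (basis_elt w) = ?w w" "e (single w c) = c \<odot>\<^sub>U ?w w" "e 0 = \<zero>\<^sub>U"
  "e (p + q) = e p \<oplus>\<^sub>U e q" "e (p - q) = e p \<ominus>\<^sub>U e q"
  "e (scale c p) = c \<odot>\<^sub>U e p" "e p : carrier U" for w c p q
  unfolding e_def by (simp_all add: f.S.lext_add f.S.lext_minus f.S.lext_sc)
 have econv: "e (conv (@) p q) = e p \<otimes>\<^sub>U e q" for p q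
  unfolding e_def by (rule f.S.lext_conv[of _ _ UNIV _ UNIV]) (auto simp: f.S.wval_append)
 have edif: "w : lists (letters R S) ==> e (word_dif R S w) = dif U (?w w)" for w
 proof (induct w)
  case Nil
  then show ?case by (simp add: esimps)
 next
  case (Cons l w)
  then show ?case by (simp add: esimps econv f.S.leibniz_homog[OF \<phi>g] \<phi>d)
 qed
 have eh: "pdga_hom F U e"
 proof (rule pdga_homI[OF F_predga f.S.predga])
  show "e x : gr U n" if "x : gr F n" for x n
   unfolding e_def by (rule f.S.lext_submodule[OF f.S.gr_submodule]) (use that wg in fastforce)
  show "e (dif F x) = dif U (e x)" if "x : carrier F" for x
  proof -
   have "keys x <= lists (letters R S)" using that by simp
   then show ?thesis by (induct x rule: pm_induct) (auto simp: esimps lin_ext_add edif f.S.d.smult f.S.d.add)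
  qed
 qed (simp_all add: esimps econv)
 interpret e: pdga_map F U e by unfold_locales (rule eh)
 have "rels <= {x : carrier F. e x = \<zero>\<^sub>U}"
 proof
  fix r assume r: "r : rels"
  have "e r = \<zero>\<^sub>U" using r
  proof
   assume "r : factor_rels Inl R"
   then show ?thesis by (elim L.relE)
     (auto simp: esimps \<phi>_def f.add f.smult f.mult R.mult_gr f.S.minus_add f.S.minus_eq f.S.a_ac f.S.cancel4 f.S.r_neg f.S.r_neg1 f.S.r_neg2)
  next
   assume "r : factor_rels Inr S"
   then show ?thesis by (elim R.relE)
     (auto simp: esimps \<phi>_def g.add g.smult g.mult S.mult_gr f.S.minus_add f.S.minus_eq f.S.a_ac f.S.cancel4 f.S.r_neg f.S.r_neg1 f.S.r_neg2)
  qed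
  then show "r : {x : carrier F. e x = \<zero>\<^sub>U}" using r rels_carrier by blast
 qed
 then have "I <= {x : carrier F. e x = \<zero>\<^sub>U}" unfolding fp_ideal_def by (rule F.genideal_minimal[OF e.kernel_ideal])
 then have "e x = \<zero>\<^sub>U" if "x : I" for x using that by blast
 from Q.Q_lift[OF eh this] obtain h where h: "pdga_hom T U h" "!!x. x : carrier F ==> h (Q.\<pi> x) = e x"
  unfolding free_prod_def by blast
 interpret h: pdga_map T U h by unfold_locales (rule h)
 interpret i: dga_map R T "fp_inl R S" by unfold_locales (rule fp_inl_hom)
 interpret i': dga_map S T "fp_inr R S" by unfold_locales (rule fp_inr_hom)
 show ?thesis
 proof
  show "dga_hom T U h" using h T_dga f.S.dga by (simp add: dga_hom_iff)
  show "h (fp_inl R S x) = f x" if "x : carrier R" for x using that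
  proof (induct x rule: R.gr_induct)
   case (homog n x)
   then show ?case by (simp add: fp_inl_homog[OF homog] h esimps \<phi>_def)
  next
   case (add x y)
   then show ?case by (simp add: i.add h.add f.add)
  qed
  show "h (fp_inr R S x) = g x" if "x : carrier S" for x using that
  proof (induct x rule: S.gr_induct)
   case (homog n x)
   then show ?case by (simp add: fp_inr_homog[OF homog] h esimps \<phi>_def)
  next
   case (add x y)
   then show ?case by (simp add: i'.add h.add g.add)
  qed
 qed
qed

text \<open>The uniqueness half is stated for algebra maps, since it is also applied to maps into B
  \<otimes> End V, which carries no differential.\<close>

lemma fp_ext:
 assumes "alg_hom T U h" "alg_hom T U h'"
  and "!!x. x : carrier R ==> h (fp_inl R S x) = h' (fp_inl R S x)"
  and "!!x. x : carrier S ==> h (fp_inr R S x) = h' (fp_inr R S x)"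
  and "X : carrier T"
 shows "h X = h' X"
proof -
 interpret h: alg_map T U h by unfold_locales fact
 interpret h': alg_map T U h' by unfold_locales fact
 show ?thesis using assms(5) by (induct X rule: fp_induct)
   (auto simp: assms(3,4) h.add h'.add h.smult h'.smult h.mult h'.mult R.gr_carrier S.gr_carrier)
qed

end

text \<open>The map given on representatives by \<open>fp_map\<close> is compared with the map h
  from the universal property; this shows at once that it does not depend on representatives and
  that it is a DG algebra map.\<close>

lemma fp_map_hom:
 assumes "dga_hom R R' f" and S: "dga S"
 defines "L \<equiv> coset_map (free_dg R' S) (fp_ideal R' S) (fp_map f)"
 shows "dga_hom (free_prod R S) (free_prod R' S) L"
  and "x : carrier R ==> L (fp_inl R S x) = fp_inl R' S (f x)"
  and "y : carrier S ==> L (fp_inr R S y) = fp_inr R' S y"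
proof -
 interpret f: dga_map R R' f by unfold_locales fact
 interpret D: two_dga R S by unfold_locales (rule S)
 interpret D': two_dga R' S by unfold_locales
 obtain h where h: "dga_hom D.T D'.T h" "!!x. x : carrier R ==> h (fp_inl R S x) = (fp_inl R' S \<circ> f) x"
  "!!y. y : carrier S ==> h (fp_inr R S y) = fp_inr R' S y"
  using D.fp_lift[OF dga_hom_comp[OF f.dga_hom D'.fp_inl_hom] D'.fp_inr_hom] by blast
 interpret h: dga_map D.T D'.T h by unfold_locales (rule h)
 let ?m = "map_sum (apsnd f) id"
 have m_in: "l : letters R S ==> ?m l : letters R' S" for l by (erule lettersE) (simp_all add: f.gr)
 have fw: "fp_map f (basis_elt w) = basis_elt (map ?m w)" for w by (simp add: fp_map_def)
 have hw: "h (D.Q.\<pi> (basis_elt w)) = D'.Q.\<pi> (basis_elt (map ?m w))" if "w : lists (letters R S)" for w using that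
 proof (induct w)
  case Nil
  then show ?case using h.one by (simp add: D.T_one D'.T_one)
 next
  case (Cons l w)
  have l: "h (D.Q.\<pi> (basis_elt [l])) = D'.Q.\<pi> (basis_elt [?m l])" using Cons(1)
  proof (rule lettersE)
   fix n x assume "l = Inl (n, x)" "x : gr R n"
   then show ?thesis using h(2)[of x] by (simp add: D.fp_inl_homog[symmetric] D'.fp_inl_homog[symmetric] f.gr f.R.gr_carrier)
  next
   fix n x assume "l = Inr (n, x)" "x : gr S n"
   then show ?thesis using h(3)[of x] by (simp add: D.fp_inr_homog[symmetric] D'.fp_inr_homog[symmetric] D.S.gr_carrier)
  qed
  have c: "basis_elt [l] : carrier D.F" "basis_elt w : carrier D.F"
   "basis_elt [?m l] : carrier D'.F" "basis_elt (map ?m w) : carrier D'.F" using Cons m_in by auto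
  have "h (D.Q.\<pi> (basis_elt [l]) \<otimes>\<^sub>D.T D.Q.\<pi> (basis_elt w)) =
    D'.Q.\<pi> (basis_elt [?m l]) \<otimes>\<^sub>D'.T D'.Q.\<pi> (basis_elt (map ?m w))"
  proof -
   have pc: "D.Q.\<pi> (basis_elt [l]) : carrier D.T" "D.Q.\<pi> (basis_elt w) : carrier D.T"
    using c unfolding D.T_carrier by blast+
   show ?thesis by (simp only: h.mult[OF pc] l Cons(3))
  qed
  then show ?case using D.T_ops(4)[OF c(1,2)] D'.T_ops(4)[OF c(3,4)]
   by (simp only: free_dg_simps conv_basis append_Cons append_Nil list.map)
 qed
 have hf: "fp_map f x : carrier D'.F & h (D.Q.\<pi> x) = D'.Q.\<pi> (fp_map f x)" if "x : carrier D.F" for x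
 proof -
  have "keys x <= lists (letters R S)" using that by simp
  then show ?thesis
  proof (induct x rule: pm_induct)
   case zero
   have "D.Q.\<pi> 0 = \<zero>\<^sub>D.T" "D'.Q.\<pi> 0 = \<zero>\<^sub>D'.T"
    using D.Q.\<pi>_zero D'.Q.\<pi>_zero by (simp_all add: free_prod_def)
   then show ?case by (simp add: fp_map_def)
  next
   case (single u a)
   have c: "basis_elt u : carrier D.F" "basis_elt (map ?m u) : carrier D'.F" using single m_in by auto
   have "h (a \<odot>\<^sub>D.T D.Q.\<pi> (basis_elt u)) = a \<odot>\<^sub>D'.T D'.Q.\<pi> (basis_elt (map ?m u))"
    using c by (subst h.smult) (auto simp: hw[OF single] D.T_carrier)
   then show ?case using D.T_ops(1)[OF c(1), of a] D'.T_ops(1)[OF c(2), of a] c by (simp add: fp_map_def)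
  next
   case (add p q)
   then have c: "p : carrier D.F" "q : carrier D.F" "fp_map f p : carrier D'.F" "fp_map f q : carrier D'.F" by auto
   have "h (D.Q.\<pi> p \<oplus>\<^sub>D.T D.Q.\<pi> q) = D'.Q.\<pi> (fp_map f p) \<oplus>\<^sub>D'.T D'.Q.\<pi> (fp_map f q)"
    using c add by (subst h.add) (auto simp: D.T_carrier)
   then show ?case using D.T_ops(3)[OF c(1,2)] D'.T_ops(3)[OF c(3,4)] D'.F.add.m_closed[OF c(3,4)] by (simp add: fp_map_def lin_ext_add)
  qed
 qed
 have Lh: "L X = h X" if XT: "X : carrier D.T" for X
 proof -
  obtain x where x: "x : carrier D.F" "X = D.Q.\<pi> x" using XT unfolding D.T_carrier by blast
  have "L (D.Q.\<pi> x) = D'.Q.\<pi> (fp_map f x)" unfolding L_def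
  proof (rule D.Q.q_map[OF x(1)])
   fix y z assume yz: "y : carrier D.F" "z : carrier D.F" "y \<ominus>\<^sub>D.F z : D.I"
   then have "D.Q.\<pi> y = D.Q.\<pi> z" using D.Q.\<pi>_eq_iff by blast
   then show "D'.Q.\<pi> (fp_map f y) = D'.Q.\<pi> (fp_map f z)" using hf yz by metis
  qed
  then show ?thesis using hf[OF x(1)] x by simp
 qed
 show "dga_hom D.T D'.T L" by (rule dga_hom_cong[OF h(1) Lh])
 interpret i: dga_map R D.T "fp_inl R S" by unfold_locales (rule D.fp_inl_hom)
 interpret i': dga_map S D.T "fp_inr R S" by unfold_locales (rule D.fp_inr_hom)
 show "x : carrier R ==> L (fp_inl R S x) = fp_inl R' S (f x)" using h(2)[of x] by (simp add: Lh)
 show "y : carrier S ==> L (fp_inr R S y) = fp_inr R' S y" using h(3)[of y] by (simp add: Lh)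
qed

section \<open>The endomorphism algebra, centralizers and the functor R_V\<close>

section \<open>Inner derivations and the endomorphism algebra\<close>

lemma dif_update_simps [simp]:
 fixes R :: "('k::field, 'a) dg"
 shows "finsum (R\<lparr>dif := h\<rparr>) = finsum R" "is_decomp (R\<lparr>dif := h\<rparr>) = is_decomp R"
  "homog_part (R\<lparr>dif := h\<rparr>) = homog_part R" "supp (R\<lparr>dif := h\<rparr>) = supp R"
proof -
 show 1: "finsum (R\<lparr>dif := h\<rparr>) = finsum R" by (simp add: finsum_def)
 show 2: "is_decomp (R\<lparr>dif := h\<rparr>) = is_decomp R" unfolding fun_eq_iff is_decomp_def 1 by simp
 show 3: "homog_part (R\<lparr>dif := h\<rparr>) = homog_part R" unfolding fun_eq_iff homog_part_def 2 by simp
 show "supp (R\<lparr>dif := h\<rparr>) = supp R" unfolding fun_eq_iff supp_def 3 by simp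
qed

lemma galg_dif_update:
 assumes "galg R"
 shows "galg (R\<lparr>dif := h\<rparr>)"
proof -
 interpret galgebra R by unfold_locales fact
 have k: "kalg (R\<lparr>dif := h\<rparr>)" by (rule kalg_cong[OF kalg]) simp_all
 then interpret k: kalgebra "R\<lparr>dif := h\<rparr>" by unfold_locales
 have "submodule (gr (R\<lparr>dif := h\<rparr>) n) ground (R\<lparr>dif := h\<rparr>)" for n by (rule k.submoduleI') auto
 then show ?thesis using k k.kmod gmod mult_gr by (auto simp: galg_def graded_module_def)
qed

context galgebra
begin

lemma gcomm_leibniz:
 assumes "\<delta> : gr R m" "x : carrier R" "y : carrier R"
 shows "gcomm R \<delta> (x \<otimes> y) = gcomm R \<delta> x \<otimes> y \<oplus> sgp m x \<otimes> gcomm R \<delta> y"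
proof -
 have d: "\<delta> : carrier R" using assms by auto
 have "gcomm R \<delta> x \<otimes> y \<oplus> sgp m x \<otimes> gcomm R \<delta> y =
   (\<delta> \<otimes> x \<ominus> sgp m x \<otimes> \<delta>) \<otimes> y \<oplus> sgp m x \<otimes> (\<delta> \<otimes> y \<ominus> sgp m y \<otimes> \<delta>)"
  using assms by (simp add: gcomm_l)
 also have "... = \<delta> \<otimes> (x \<otimes> y) \<oplus> (\<ominus> (sgp m x \<otimes> (\<delta> \<otimes> y)) \<oplus> (sgp m x \<otimes> (\<delta> \<otimes> y) \<ominus> (sgp m x \<otimes> (sgp m y \<otimes> \<delta>))))"
  using assms d by (simp add: minus_eq l_distr r_distr l_minus r_minus m_assoc a_assoc)
 also have "... = \<delta> \<otimes> (x \<otimes> y) \<ominus> sgp m (x \<otimes> y) \<otimes> \<delta>"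
  using assms d by (simp add: minus_eq r_neg2 r_neg1 sgp_mult m_assoc)
 finally show ?thesis using assms by (simp add: gcomm_l)
qed

text \<open>[\<delta>, -] is a graded derivation by \<open>gcomm_leibniz\<close>, and its square
  vanishes because \<delta>^2 = 0 leaves only two copies of \<delta> sg(x) \<delta> with opposite
  signs. With \<delta> the differential of V this is the differential of End V.\<close>

lemma inner_dga:
 assumes \<delta>: "\<delta> : gr R 1" and \<delta>2: "\<delta> \<otimes> \<delta> = \<zero>"
 shows "dga (R\<lparr>dif := gcomm R \<delta>\<rparr>)"
proof -
 have d: "\<delta> : carrier R" using \<delta> by auto
 have s1: "sgp 1 x = sg x" for x by (simp add: sgp_def)
 have gc: "gcomm R \<delta> x = \<delta> \<otimes> x \<ominus> sg x \<otimes> \<delta>" if "x : carrier R" for x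
  using gcomm_l[OF \<delta> that] by (simp add: s1)
 have sd: "sg \<delta> = \<ominus> \<delta>" using sg_homog[OF \<delta>] d by (simp add: ksgn_def sm_m1)
 have "pre_dga (R\<lparr>dif := gcomm R \<delta>\<rparr>)" unfolding pre_dga_def
 proof (intro conjI allI ballI subsetI)
  show "galg (R\<lparr>dif := gcomm R \<delta>\<rparr>)" by (rule galg_dif_update[OF galg])
  show "linear_map (R\<lparr>dif := gcomm R \<delta>\<rparr>) (R\<lparr>dif := gcomm R \<delta>\<rparr>) (dif (R\<lparr>dif := gcomm R \<delta>\<rparr>))"
   by (rule linear_mapI) (auto simp: d gcomm_add_r gc sg_smult sm_rminus)
  show "y : gr (R\<lparr>dif := gcomm R \<delta>\<rparr>) (n + 1)"
   if y: "y : dif (R\<lparr>dif := gcomm R \<delta>\<rparr>) ` gr (R\<lparr>dif := gcomm R \<delta>\<rparr>) n" for y n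
  proof -
   obtain x where x: "x : gr R n" "y = gcomm R \<delta> x" using y by auto
   have "\<delta> \<otimes> x : gr R (n + 1)" "sg x \<otimes> \<delta> : gr R (n + 1)"
    using mult_gr[OF \<delta> x(1)] mult_gr[OF sg_gr[OF x(1)] \<delta>] by (simp_all add: add.commute)
   then show ?thesis using x by (simp add: gc gr_carrier gr_minus)
  qed
  show "dif (R\<lparr>dif := gcomm R \<delta>\<rparr>) (x \<otimes>\<^bsub>R\<lparr>dif := gcomm R \<delta>\<rparr>\<^esub> y) =
    dif (R\<lparr>dif := gcomm R \<delta>\<rparr>) x \<otimes>\<^bsub>R\<lparr>dif := gcomm R \<delta>\<rparr>\<^esub> y \<oplus>\<^bsub>R\<lparr>dif := gcomm R \<delta>\<rparr>\<^esub>
    ksgn m \<odot>\<^bsub>R\<lparr>dif := gcomm R \<delta>\<rparr>\<^esub> (x \<otimes>\<^bsub>R\<lparr>dif := gcomm R \<delta>\<rparr>\<^esub> dif (R\<lparr>dif := gcomm R \<delta>\<rparr>) y)"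
   if x: "x : gr (R\<lparr>dif := gcomm R \<delta>\<rparr>) m" and y: "y : carrier (R\<lparr>dif := gcomm R \<delta>\<rparr>)" for x y m
   using gcomm_leibniz[OF \<delta>, of x y] x y d by (simp add: s1 sg_homog[of x m] gr_carrier)
 qed
 moreover have "gcomm R \<delta> (gcomm R \<delta> x) = \<zero>" if x: "x : carrier R" for x
 proof -
  have "gcomm R \<delta> (gcomm R \<delta> x) = \<delta> \<otimes> (\<delta> \<otimes> x \<ominus> sg x \<otimes> \<delta>) \<ominus> sg (\<delta> \<otimes> x \<ominus> sg x \<otimes> \<delta>) \<otimes> \<delta>"
   using x d by (simp add: gc)
  also have "sg (\<delta> \<otimes> x \<ominus> sg x \<otimes> \<delta>) = \<ominus> (\<delta> \<otimes> sg x) \<oplus> x \<otimes> \<delta>"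
   using x d by (simp add: minus_eq sg_add sg_mult sd l_minus r_minus
     lin_map.neg[OF lin_map.intro[OF kmod_axioms kmod_axioms lin_map_axioms.intro[OF sg_linear]]])
  also have "\<delta> \<otimes> (\<delta> \<otimes> x \<ominus> sg x \<otimes> \<delta>) = \<ominus> (\<delta> \<otimes> sg x \<otimes> \<delta>)"
   using x d \<delta>2 by (simp add: minus_eq r_distr r_minus m_assoc[symmetric])
  also have "(\<ominus> (\<delta> \<otimes> sg x) \<oplus> x \<otimes> \<delta>) \<otimes> \<delta> = \<ominus> (\<delta> \<otimes> sg x \<otimes> \<delta>)"
   using x d \<delta>2 by (simp add: l_distr l_minus m_assoc)
  finally show ?thesis using x d by (simp add: minus_eq r_neg l_neg)
 qed
 ultimately show ?thesis by (simp add: dga_iff)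
qed

end

lemma graded_End_simps [simp]:
 "carrier (graded_End V) = {f : extensional (carrier V). linear_map V V f}"
 "monoid.mult (graded_End V) = compose (carrier V)" "one (graded_End V) = (\<lambda>x\<in>carrier V. x)"
 "ring.zero (graded_End V) = (\<lambda>x\<in>carrier V. \<zero>\<^sub>V)" "add (graded_End V) = (%f g. \<lambda>x\<in>carrier V. f x \<oplus>\<^sub>V g x)"
 "smult (graded_End V) = (%c f. \<lambda>x\<in>carrier V. c \<odot>\<^sub>V f x)"
 "gr (graded_End V) n = {f : extensional (carrier V). linear_map V V f & (\<forall>i. f ` gr V i <= gr V (i + n))}"
 by (auto simp: graded_End_def Let_def)

locale fin_complex =
 fixes V :: "('k::field, 'v) dg" (structure)
 assumes V: "dg_complex V" and fin: "fin_total_dim V"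

sublocale fin_complex \<subseteq> gmod V using V by (simp add: gmod_def dg_complex_def)

context fin_complex
begin

abbreviation "E0 \<equiv> graded_End V"
abbreviation "E \<equiv> dg_End V"

lemma E0_I:
 assumes "!!x. x : carrier V ==> f x : carrier V"
  "!!x y. x : carrier V ==> y : carrier V ==> f (x \<oplus> y) = f x \<oplus> f y"
  "!!c x. x : carrier V ==> f (c \<odot> x) = c \<odot> f x"
 shows "(\<lambda>x\<in>carrier V. f x) : carrier E0" using assms by (auto intro!: linear_mapI)

lemma E0_D:
 assumes "f : carrier E0"
 shows "x : carrier V ==> f x : carrier V"
  "x : carrier V ==> y : carrier V ==> f (x \<oplus> y) = f x \<oplus> f y"
  "x : carrier V ==> f (c \<odot> x) = c \<odot> f x" using assms by (auto simp: linear_map_def)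

lemma E0_eqI:
 assumes "f : carrier E0" "g : carrier E0" "!!x. x : carrier V ==> f x = g x"
 shows "f = g" using assms by (auto intro: extensionalityI)

lemma E0_ops [simp]:
 assumes "f : carrier E0" "g : carrier E0"
 shows "f \<oplus>\<^sub>E0 g : carrier E0" "f \<otimes>\<^sub>E0 g : carrier E0" "c \<odot>\<^sub>E0 f : carrier E0"
  "\<zero>\<^sub>E0 : carrier E0" "\<one>\<^sub>E0 : carrier E0"
proof -
 show "f \<oplus>\<^sub>E0 g : carrier E0" unfolding graded_End_simps(5)
  by (rule E0_I) (auto simp: E0_D[OF assms(1)] E0_D[OF assms(2)] sm_radd a_ac)
 show "f \<otimes>\<^sub>E0 g : carrier E0" unfolding graded_End_simps(2) compose_def
  by (rule E0_I) (auto simp: E0_D[OF assms(1)] E0_D[OF assms(2)])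
 show "c \<odot>\<^sub>E0 f : carrier E0" unfolding graded_End_simps(6)
  by (rule E0_I) (auto simp: E0_D[OF assms(1)] sm_radd mult.commute)
 show "\<zero>\<^sub>E0 : carrier E0" unfolding graded_End_simps(4) by (rule E0_I) auto
 show "\<one>\<^sub>E0 : carrier E0" unfolding graded_End_simps(3) by (rule E0_I) auto
qed

lemma E0_app [simp]:
 "x : carrier V ==> (f \<oplus>\<^sub>E0 g) x = f x \<oplus> g x" "x : carrier V ==> (f \<otimes>\<^sub>E0 g) x = f (g x)"
 "x : carrier V ==> (c \<odot>\<^sub>E0 f) x = c \<odot> f x" "x : carrier V ==> \<zero>\<^sub>E0 x = \<zero>" "x : carrier V ==> \<one>\<^sub>E0 x = x"
 by (simp_all add: compose_def)

lemma E0_one_zero: "\<one>\<^sub>E0 : carrier E0" "\<zero>\<^sub>E0 : carrier E0"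
proof -
 show z: "\<zero>\<^sub>E0 : carrier E0" unfolding graded_End_simps(4) by (rule E0_I) auto
 show "\<one>\<^sub>E0 : carrier E0" by (rule E0_ops(5)[OF z z])
qed

context
 notes graded_End_simps [simp del]
begin

lemma E0_module: "module ground E0"
proof (rule module_groundI)
 show "abelian_group E0"
 proof (rule abelian_groupI, goal_cases)
  case (6 f)
  then show ?case by (intro bexI[of _ "(- 1) \<odot>\<^sub>E0 f"] E0_eqI) (auto simp: E0_D sm_m1 l_neg E0_one_zero)
 qed (auto intro!: E0_eqI simp: E0_D a_ac E0_one_zero)
qed (auto intro!: E0_eqI simp: E0_D sm_ladd sm_radd)

lemma E0_kalg: "kalg E0"
proof (rule kalgI[OF E0_module])
 show "monoid E0" by (rule monoidI) (auto intro!: E0_eqI simp: E0_D E0_one_zero)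
qed (auto intro!: E0_eqI simp: E0_D)

end

definition D :: "int set" where "D = {n. gr V n ~= {\<zero>}}"

lemma finite_D [simp]: "finite D"
 using fin by (simp add: D_def fin_total_dim_def)
lemma supp_D: "x : carrier V ==> supp V x <= D"
 using pr_gr by (fastforce simp: D_def supp_def)

text \<open>The component of degree n of an endomorphism, assembled from its blocks V^i ->
  V^(i+n).\<close>

definition EP :: "('v => 'v) => int => 'v => 'v" where
 "EP f n = (\<lambda>x\<in>carrier V. \<Oplus>i\<in>D. pr (f (pr x i)) (i + n))"

lemma EP_closed: "f : carrier E0 ==> EP f n : carrier E0"
 unfolding EP_def
proof (rule E0_I)
 assume f: "f : carrier E0"
 fix x y c assume x: "x : carrier V"
 show "(\<Oplus>i\<in>D. pr (f (pr x i)) (i + n)) : carrier V" using x f by (auto simp: E0_D(1)[OF f])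
 show "(\<Oplus>i\<in>D. pr (f (pr (c \<odot> x) i)) (i + n)) = c \<odot> (\<Oplus>i\<in>D. pr (f (pr x i)) (i + n))"
  using x f by (subst sm_finsum) (auto simp: E0_D[OF f] pr_smult)
 assume y: "y : carrier V"
 show "(\<Oplus>i\<in>D. pr (f (pr (x \<oplus> y) i)) (i + n)) =
   (\<Oplus>i\<in>D. pr (f (pr x i)) (i + n)) \<oplus> (\<Oplus>i\<in>D. pr (f (pr y i)) (i + n))"
  using x y f by (subst finsum_addf[symmetric]) (auto simp: E0_D[OF f] pr_add)
qed

lemma E0_finsum:
 assumes "F : A \<rightarrow> carrier E0" "x : carrier V"
 shows "finsum E0 F A x = (\<Oplus>i\<in>A. F i x)"
proof (rule additive_finsum[OF _ abelian_group_axioms _ _ assms(1), of "%f. f x"])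
 show "abelian_group E0" using E0_module by (simp add: module_def)
qed (use assms E0_D in auto)

lemma E0_gr: "f : gr E0 n \<longleftrightarrow> f : carrier E0 & (\<forall>i. \<forall>x\<in>gr V i. f x : gr V (i + n))"
 by auto

lemma E0_graded: "graded_module E0"
proof (rule gmodI_span[OF E0_module, where P = EP])
 interpret E0: kalgebra E0 by unfold_locales (rule E0_kalg)
 note [simp del] = graded_End_simps
 show "submodule (gr E0 n) ground E0" for n by (rule E0.submoduleI') (auto simp: E0_gr)
 show "linear_map E0 E0 (%f. EP f n)" for n
 proof (rule linear_mapI)
  show "EP f n : carrier E0" if "f : carrier E0" for f by (rule EP_closed[OF that])
  show "EP (f \<oplus>\<^sub>E0 g) n = EP f n \<oplus>\<^sub>E0 EP g n" if "f : carrier E0" "g : carrier E0" for f g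
  proof (rule E0_eqI)
   show "EP (f \<oplus>\<^sub>E0 g) n x = (EP f n \<oplus>\<^sub>E0 EP g n) x" if "x : carrier V" for x
    using that E0_D[OF \<open>f : carrier E0\<close>] E0_D[OF \<open>g : carrier E0\<close>]
    by (simp add: EP_def) (subst finsum_addf[symmetric], auto simp: pr_add)
  qed (use that EP_closed in auto)
  show "EP (c \<odot>\<^sub>E0 f) n = c \<odot>\<^sub>E0 EP f n" if "f : carrier E0" for c f
  proof (rule E0_eqI)
   show "EP (c \<odot>\<^sub>E0 f) n x = (c \<odot>\<^sub>E0 EP f n) x" if "x : carrier V" for x
    using that E0_D[OF \<open>f : carrier E0\<close>] by (simp add: EP_def) (subst sm_finsum, auto simp: pr_smult)
  qed (use that EP_closed in auto)
 qed
 show "EP f m = (if m = n then f else \<zero>\<^sub>E0)" if f: "f : gr E0 n" for f n m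
 proof (rule E0_eqI)
  have fc: "f : carrier E0" using f by (simp add: E0_gr)
  show "EP f m : carrier E0" "(if m = n then f else \<zero>\<^sub>E0) : carrier E0" using fc EP_closed by (auto simp: E0_one_zero)
  fix x assume x: "x : carrier V"
  interpret fl: lin_map V V f by unfold_locales (use fc in \<open>simp add: graded_End_simps\<close>)
  have fp: "f (pr x i) : gr V (i + n)" for i using f x by (auto simp: E0_gr)
  have "EP f m x = (\<Oplus>i\<in>D. if m = n then f (pr x i) else \<zero>)"
   unfolding EP_def using x by (auto intro!: finsum_cong' simp: pr_homog[OF fp])
  also have "... = (if m = n then f x else \<zero>)" using fl.finsum[of "pr x" D] x finsum_pr[OF x finite_D supp_D[OF x]] by auto
  finally show "EP f m x = (if m = n then f else \<zero>\<^sub>E0) x" using x by simp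
 qed
 fix f Q
 assume f: "f : carrier E0" and h: "!!n f. f : gr E0 n ==> Q f"
  and a: "!!f g. f : carrier E0 ==> g : carrier E0 ==> Q f ==> Q g ==> Q (f \<oplus>\<^sub>E0 g)"
 have sum: "Q (finsum E0 F A)" if "finite A" "F : A \<rightarrow> carrier E0" "!!i. i : A ==> Q (F i)" for F and A :: "int set"
  using that
 proof (induct A rule: finite_induct)
  case empty
  then show ?case by (auto intro!: h[of _ 0] simp: E0_gr E0_one_zero)
 next
  case (insert i A)
  then show ?case by (auto simp: Pi_def intro!: a E0.finsum_closed)
 qed
 interpret fl: lin_map V V f by unfold_locales (use f in \<open>simp add: graded_End_simps\<close>)
 \<comment> \<open>f is cut into blocks V^i -> V^j, each homogeneous of degree j - i. Summing over j
   here and over i afterwards, both in the finite set \<open>D\<close>, recovers f.\<close>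
 have "Q (\<lambda>x\<in>carrier V. f (pr x i))" for i
 proof -
  let ?g = "%j. \<lambda>x\<in>carrier V. pr (f (pr x i)) j"
  have g: "?g j : carrier E0" for j by (rule E0_I) (auto simp: pr_add pr_smult fl.add fl.smult)
  have "?g j : gr E0 (j - i)" for j unfolding E0_gr using g fl.zero by (auto simp: pr_homog)
  then have "Q (finsum E0 ?g D)" using g by (intro sum) (auto intro: h)
  moreover have "finsum E0 ?g D = (\<lambda>x\<in>carrier V. f (pr x i))"
  proof (rule E0_eqI)
   show "(\<lambda>x\<in>carrier V. f (pr x i)) : carrier E0" by (rule E0_I) (auto simp: pr_add pr_smult fl.add fl.smult)
   show "finsum E0 ?g D x = (\<lambda>x\<in>carrier V. f (pr x i)) x" if "x : carrier V" for x
    using that g finsum_pr[of "f (pr x i)" D] supp_D[of "f (pr x i)"] by (subst E0_finsum) auto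
  qed (use g in auto)
  ultimately show ?thesis by simp
 qed
 moreover have c: "(\<lambda>x\<in>carrier V. f (pr x i)) : carrier E0" for i
  by (rule E0_I) (auto simp: pr_add pr_smult fl.add fl.smult)
 ultimately have "Q (finsum E0 (%i. \<lambda>x\<in>carrier V. f (pr x i)) D)" by (intro sum) auto
 moreover have "finsum E0 (%i. \<lambda>x\<in>carrier V. f (pr x i)) D = f"
 proof (rule E0_eqI)
  show "finsum E0 (%i. \<lambda>x\<in>carrier V. f (pr x i)) D x = f x" if x: "x : carrier V" for x
   using x c fl.finsum[of "pr x" D] finsum_pr[OF x finite_D supp_D[OF x]] by (subst E0_finsum) auto
 qed (use c f in auto)
 ultimately show "Q f" by simp
qed

lemma E0_galg: "galg E0"
 unfolding galg_def
proof (intro conjI allI ballI E0_kalg E0_graded)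
 note [simp del] = graded_End_simps
 show "\<one>\<^sub>E0 : gr E0 0" by (auto simp: E0_gr E0_one_zero)
 show "f \<otimes>\<^sub>E0 g : gr E0 (m + n)" if "f : gr E0 m" "g : gr E0 n" for f g m n
 proof -
  have *: "i + (m + n) = i + n + m" for i :: int by simp
  show ?thesis using that unfolding E0_gr * by auto
 qed
qed

lemma V_dif: "linear_map V V (dif V)" "x : gr V n ==> dif V x : gr V (n + 1)"
 "x : carrier V ==> dif V (dif V x) = \<zero>" using V by (auto simp: dg_complex_def)

lemma E_dga: "dga E"
proof -
 interpret E0: galgebra E0 by unfold_locales (rule E0_galg)
 interpret d: lin_map V V "dif V" by unfold_locales (rule V_dif)
 let ?\<delta> = "restrict (dif V) (carrier V)"
 have c: "?\<delta> : carrier E0" by (rule E0_I) (auto simp: d.add d.smult)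
 have "?\<delta> : gr E0 1" unfolding E0_gr using c V_dif(2) by auto
 moreover have "?\<delta> \<otimes>\<^sub>E0 ?\<delta> = \<zero>\<^sub>E0"
 proof (rule E0_eqI)
  show "(?\<delta> \<otimes>\<^sub>E0 ?\<delta>) x = \<zero>\<^sub>E0 x" if "x : carrier V" for x
   using that V_dif(3) by (simp add: E0_app del: graded_End_simps)
 qed (use c E0_one_zero E0_ops in blast)+
 ultimately show ?thesis unfolding dg_End_def by (rule E0.inner_dga)
qed

end

section \<open>Centralizers and abelianization\<close>

locale centralizer = j: dga_map E T j for E :: "('k::field, 'e) dg" and T :: "('k, 't) dg" and j
begin

definition cent :: "'t set" where
 "cent = {w : carrier T. \<forall>m\<in>carrier E. gcomm T w (j m) = \<zero>\<^sub>T}"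

abbreviation "ET \<equiv> j.S.sgp"

text \<open>Commutators are biadditive, so homogeneous m suffice; \<open>sgp\<close> puts the sign
  on w, which may then be inhomogeneous.\<close>

lemma cent_iff: "w : cent \<longleftrightarrow> w : carrier T & (\<forall>n. \<forall>m\<in>gr E n. w \<otimes>\<^sub>T j m = j m \<otimes>\<^sub>T j.S.sgp n w)"
proof -
 have "(\<forall>m\<in>carrier E. gcomm T w (j m) = \<zero>\<^sub>T) \<longleftrightarrow> (\<forall>n. \<forall>m\<in>gr E n. gcomm T w (j m) = \<zero>\<^sub>T)" if w: "w : carrier T"
 proof safe
  fix m assume a: "\<forall>n. \<forall>m\<in>gr E n. gcomm T w (j m) = \<zero>\<^sub>T" and "m : carrier E"
  from this(2) show "gcomm T w (j m) = \<zero>\<^sub>T"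
   by (induct m rule: j.R.gr_induct) (use a w in \<open>auto simp: j.add j.S.gcomm_add_r\<close>)
 qed (auto simp: j.R.gr_carrier)
 moreover have "gcomm T w (j m) = \<zero>\<^sub>T \<longleftrightarrow> w \<otimes>\<^sub>T j m = j m \<otimes>\<^sub>T j.S.sgp n w"
  if "w : carrier T" "m : gr E n" for n m using that by (simp add: j.S.gcomm_r[OF j.gr] j.S.minus_eq_0_iff j.R.gr_carrier)
 ultimately show ?thesis unfolding cent_def by auto
qed

lemma cent_comm: "w : cent ==> m : gr E n ==> w \<otimes>\<^sub>T j m = j m \<otimes>\<^sub>T j.S.sgp n w"
 by (simp add: cent_iff)

lemma cent_sub: "subgalg T cent"
proof (unfold_locales, goal_cases)
 case 1
 show ?case by (auto simp: cent_def)
next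
 case 2
 then show ?case by (simp add: cent_iff j.R.gr_carrier j.S.sgp_def)
next
 case (3 x y)
 then show ?case by (auto simp: cent_iff j.R.gr_carrier j.S.l_distr j.S.r_distr j.S.sgp_add)
next
 case (4 c x)
 then show ?case by (auto simp: cent_iff j.R.gr_carrier j.S.sgp_smult)
next
 case (5 x y)
 then have c: "x : carrier T" "y : carrier T" by (auto simp: cent_def)
 have "x \<otimes>\<^sub>T y \<otimes>\<^sub>T j m = j m \<otimes>\<^sub>T j.S.sgp n (x \<otimes>\<^sub>T y)" if m: "m : gr E n" for m n
 proof -
  have jm: "j m : carrier T" using m by (auto simp: j.R.gr_carrier)
  have "x \<otimes>\<^sub>T y \<otimes>\<^sub>T j m = x \<otimes>\<^sub>T (j m \<otimes>\<^sub>T j.S.sgp n y)"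
   using c jm cent_comm[OF 5(2) m] by (simp add: j.S.m_assoc)
  also have "... = (j m \<otimes>\<^sub>T j.S.sgp n x) \<otimes>\<^sub>T j.S.sgp n y"
   using c jm cent_comm[OF 5(1) m] by (simp add: j.S.m_assoc[symmetric])
  finally show ?thesis using c jm by (simp add: j.S.m_assoc j.S.sgp_mult)
 qed
 then show ?case using c by (auto simp: cent_iff)
next
 case 6
 then show ?case by (simp add: cent_iff j.R.gr_carrier)
next
 case (7 x k)
 then have c: "x : carrier T" by (auto simp: cent_def)
 have "homog_part T x k \<otimes>\<^sub>T j m = j m \<otimes>\<^sub>T j.S.sgp n (homog_part T x k)" if m: "m : gr E n" for m n
 proof -
  \<comment> \<open>Multiplication by \<open>j m\<close> shifts degrees by n, so the parts of degree
    k + n of the two sides isolate the part of degree k of x.\<close>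
  have "homog_part T (x \<otimes>\<^sub>T j m) (k + n) = homog_part T (j m \<otimes>\<^sub>T j.S.sgp n x) (k + n)"
   using cent_comm[OF 7 m] by simp
  then show ?thesis using c by (simp add: j.S.pr_mult_l[OF j.gr[OF m]] j.S.pr_mult_r[OF j.gr[OF m]] j.S.pr_sgp)
 qed
 then show ?case using c by (auto simp: cent_iff)
qed

sublocale C: subgalg T cent by (rule cent_sub)

text \<open>Differentiating the commutation rule leaves, besides the wanted terms, products of w
  with d m; these cancel because d m again lies in E and \<open>sg w\<close> again lies in the
  centralizer.\<close>

lemma cent_d:
 assumes w: "w : cent"
 shows "dif T w : cent"
proof -
 have c: "w : carrier T" using w by (auto simp: cent_def)
 have "dif T w \<otimes>\<^sub>T j m = j m \<otimes>\<^sub>T j.S.sgp n (dif T w)" if m: "m : gr E n" for m n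
 proof -
  have jm: "j m : carrier T" using m by (auto simp: j.R.gr_carrier)
  have s: "j.S.sg w \<otimes>\<^sub>T dif T (j m) = dif T (j m) \<otimes>\<^sub>T j.S.sgp n w"
  proof -
   have sc: "j.S.sg w : cent" unfolding j.S.sg_def by (rule j.S.finsum_in_submodule[OF C.S_submodule]) (use w C.S_pr C.S_smult in blast)
   have "j.S.sg w \<otimes>\<^sub>T j (dif E m) = j (dif E m) \<otimes>\<^sub>T j.S.sgp (n + 1) (j.S.sg w)"
    by (rule cent_comm[OF sc j.R.d_gr[OF m]])
   moreover have "j.S.sgp (n + 1) (j.S.sg w) = j.S.sgp n w" using c by (simp add: j.S.sgp_def)
   ultimately show ?thesis using m by (simp add: j.dif j.R.gr_carrier)
  qed
  have "dif T w \<otimes>\<^sub>T j m \<oplus>\<^sub>T j.S.sg w \<otimes>\<^sub>T dif T (j m) =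
    dif T (j m) \<otimes>\<^sub>T j.S.sgp n w \<oplus>\<^sub>T ksgn n \<odot>\<^sub>T (j m \<otimes>\<^sub>T dif T (j.S.sgp n w))"
   using cent_comm[OF w m] c jm j.S.leibniz[of w "j m"] j.S.leibniz_homog[OF j.gr[OF m], of "j.S.sgp n w"] by simp
  also have "ksgn n \<odot>\<^sub>T (j m \<otimes>\<^sub>T dif T (j.S.sgp n w)) = j m \<otimes>\<^sub>T j.S.sgp n (dif T w)"
   using c jm by (simp add: j.S.d_sgp)
  finally show ?thesis using c jm unfolding s by (simp add: j.S.a_comm)
 qed
 then show ?thesis using c by (auto simp: cent_iff)
qed

lemma cent_dga: "dga (sub T cent)"
 by (rule C.sub_dga[OF j.S.dga cent_d])

end

context dgalgebra
begin

lemma d_gcomm: "x : gr R m ==> y : carrier R ==>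
  d (gcomm R x y) = gcomm R (d x) y \<oplus> ksgn m \<odot> gcomm R x (d y)"
proof -
 assume x: "x : gr R m" and y: "y : carrier R"
 have c: "x : carrier R" using x by auto
 have sg1: "sg (sgp m y) = sgp (m + 1) y" using y by (simp add: sgp_def)
 have "d (gcomm R x y) = (d x \<otimes> y \<oplus> ksgn m \<odot> (x \<otimes> d y)) \<ominus> (ksgn m \<odot> (sgp m (d y) \<otimes> x) \<oplus> sgp (m + 1) y \<otimes> d x)"
  using x y c by (simp add: gcomm_l[OF x] d.minus leibniz_homog[OF x] leibniz[of "sgp m y" x] d_sgp sg1)
 also have "... = (d x \<otimes> y \<oplus> ksgn m \<odot> (x \<otimes> d y)) \<ominus> (sgp (m + 1) y \<otimes> d x \<oplus> ksgn m \<odot> (sgp m (d y) \<otimes> x))"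
  using y c by (simp add: a_comm)
 also have "... = (d x \<otimes> y \<ominus> sgp (m + 1) y \<otimes> d x) \<oplus> ksgn m \<odot> (x \<otimes> d y \<ominus> sgp m (d y) \<otimes> x)"
  using y c by (subst add4) (auto simp: sm_rminus)
 finally show ?thesis using y by (simp add: gcomm_l[OF x] gcomm_l[OF d_gr[OF x]])
qed

abbreviation "GC \<equiv> {gcomm R x y | x y. x : carrier R & y : carrier R}"

text \<open>A commutator of homogeneous elements is homogeneous and its differential is a
  combination of commutators; the general case follows by biadditivity.\<close>

lemma comm_dgquot: "dgquot R (comm_ideal R)"
 unfolding comm_ideal_def
proof (rule genideal_dgquot)
 show G: "GC <= carrier R" by auto
 have self: "x : carrier R ==> y : carrier R ==> gcomm R x y : genideal R GC" for x y using genideal_self[OF G] by blast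
 note Is = ideal_submodule[OF genideal_ideal[OF G]]
 note Io = submoduleD[OF Is]
 fix g assume "g : GC"
 then obtain x y where xy: "x : carrier R" "y : carrier R" "g = gcomm R x y" by blast
 show "pr g n : genideal R GC" for n unfolding xy(3) using xy(1)
 proof (induct x rule: gr_induct)
  case (homog m x)
  note x = homog
  show ?case using xy(2)
  proof (induct y rule: gr_induct)
   case (homog k y)
   have "x \<otimes> y : gr R (m + k)" "y \<otimes> x : gr R (m + k)"
    using mult_gr[OF x homog] mult_gr[OF homog x] by (simp_all add: add.commute)
   then have "gcomm R x y : gr R (m + k)" by (simp add: gcomm_homog[OF x homog])
   then show ?case using self[of x y] x homog Io(2) by (simp add: pr_homog[of _ "m + k"] gr_carrier)
  next
   case (add y z)
   then show ?case using x Io(3) by (simp add: gcomm_add_r pr_add gr_carrier)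
  qed
 next
  case (add x z)
  then show ?case using xy Io(3) by (simp add: gcomm_add_l pr_add)
 qed
 show "d g : genideal R GC" unfolding xy(3) using xy(1)
 proof (induct x rule: gr_induct)
  case (homog m x)
  then show ?case using xy(2) by (simp add: d_gcomm[OF homog]) (intro Io(3,4) self; simp add: gr_carrier)
 next
  case (add x z)
  then show ?case using xy Io(3) by (simp add: gcomm_add_l d.add)
 qed
qed

sublocale A: dgquot R "comm_ideal R" by (rule comm_dgquot)

lemma gcomm_comm_ideal: "x : carrier R ==> y : carrier R ==> gcomm R x y : comm_ideal R"
 unfolding comm_ideal_def using genideal_self[of GC] by blast

lemma comm_ideal_minimal:
 assumes "ideal J R" "!!x y. x : carrier R ==> y : carrier R ==> gcomm R x y : J"
 shows "comm_ideal R <= J" unfolding comm_ideal_def by (rule genideal_minimal) (use assms in auto)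

lemma abel_dga: "dga (dg_quot R (comm_ideal R))"
 by (rule A.Q_dga) simp

lemma abel_gcalg: "gcalg (dg_quot R (comm_ideal R))"
 unfolding gcalg_def
proof (intro conjI allI ballI A.Q_galg)
 fix m n X Y assume "X : gr A.Q m" "Y : gr A.Q n"
 then obtain x y where x: "x : gr R m" "X = A.\<pi> x" and y: "y : gr R n" "Y = A.\<pi> y" by auto
 have c: "x : carrier R" "y : carrier R" using x y by auto
 have "A.\<pi> (x \<otimes> y) = A.\<pi> (ksgn (m * n) \<odot> (y \<otimes> x))"
  using gcomm_comm_ideal[OF c] c by (subst A.\<pi>_eq_iff) (auto simp: gcomm_homog[OF x(1) y(1)])
 then show "X \<otimes>\<^sub>A.Q Y = ksgn (m * n) \<odot>\<^sub>A.Q (Y \<otimes>\<^sub>A.Q X)" using c x y by simp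
qed

end

section \<open>The functor \<open>R \<mapsto> R\<^sub>V\<close>\<close>

text \<open>The preimage of an ideal is an ideal, and this one contains all commutators.\<close>

lemma dga_hom_comm_ideal:
 assumes "dga_hom A B f" "x : comm_ideal A"
 shows "f x : comm_ideal B"
proof -
 interpret f: dga_map A B f by unfold_locales fact
 have "ideal {x : carrier A. f x : comm_ideal B} A"
  using f.S.A.a_closed f.S.A.I_l_closed f.S.A.I_r_closed f.S.submoduleD(2,4)[OF f.S.A.I_submodule]
  by (intro f.R.ideal_of_submodule f.R.submoduleI') (auto simp: f.add f.smult f.mult)
 then have "comm_ideal A <= {x : carrier A. f x : comm_ideal B}"
  by (rule f.R.comm_ideal_minimal) (auto simp: f.gcomm f.S.gcomm_comm_ideal)
 then show ?thesis using assms by auto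
qed

lemma cent_map:
 assumes "centralizer E T j" "centralizer E T' j'" "dga_hom T T' H"
  and "!!m. m : carrier E ==> H (j m) = j' m" "w : centralizer.cent E T j"
 shows "H w : centralizer.cent E T' j'"
proof -
 interpret C: centralizer E T j by fact
 interpret C': centralizer E T' j' by fact
 interpret H: dga_map T T' H by unfold_locales fact
 show ?thesis unfolding C'.cent_def
 proof (intro CollectI conjI ballI)
  have w: "w : carrier T" "m : carrier E ==> gcomm T w (j m) = \<zero>\<^sub>T" for m using assms(5) by (auto simp: C.cent_def)
  show "H w : carrier T'" using w by simp
  show "gcomm T' (H w) (j' m) = \<zero>\<^sub>T'" if "m : carrier E" for m
   using H.gcomm[OF w(1), of "j m"] w(2)[OF that] assms(4)[OF that] that by simp
 qed
qed

locale rep_ctx = fin_complex V + R: dgalgebra R for V :: "('k::field, 'v) dg" (structure) and R :: "('k, 'r) dg"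

sublocale rep_ctx \<subseteq> E: dgalgebra "dg_End V" by unfold_locales (rule E_dga)
sublocale rep_ctx \<subseteq> P: two_dga R "dg_End V" by unfold_locales
sublocale rep_ctx \<subseteq> C: centralizer "dg_End V" "free_prod R (dg_End V)" "fp_inr R (dg_End V)" by unfold_locales (rule P.fp_inr_hom)

context rep_ctx
begin

lemma root_alg_eq: "root_alg V R = sub P.T C.cent"
 by (simp add: root_alg_def C.cent_def)

lemma root_dga: "dga (root_alg V R)"
 unfolding root_alg_eq by (rule C.cent_dga)

lemma root_carrier: "carrier (root_alg V R) = C.cent"
 by (simp add: root_alg_eq)

sublocale root: dgalgebra "root_alg V R" by unfold_locales (rule root_dga)

lemma rep_dga: "dga (rep_alg V R)"
 unfolding rep_alg_def by (rule root.abel_dga)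
lemma rep_gcalg: "gcalg (rep_alg V R)"
 unfolding rep_alg_def by (rule root.abel_gcalg)

abbreviation "\<rho> w \<equiv> comm_ideal (root_alg V R) +>\<^bsub>root_alg V R\<^esub> w"

lemma rep_carrier: "carrier (rep_alg V R) = \<rho> ` C.cent"
 unfolding rep_alg_def by (simp add: root.A.q_carrier root_carrier)

lemma rep_proj: "dga_hom (root_alg V R) (rep_alg V R) \<rho>"
 using root.A.Q_pdga_hom root_dga rep_dga by (simp add: dga_hom_iff rep_alg_def)

end

lemma rep_ctxI: "dg_complex V ==> fin_total_dim V ==> dga R ==> rep_ctx V R"
 by (simp add: rep_ctx_def fin_complex_def dgalgebra_def)

abbreviation fp_hom :: "('k::field, 's) dg => ('k, 'e) dg => ('r => 's) =>
  (('r, 'e) letter list \<Rightarrow>\<^sub>0 'k) set => (('s, 'e) letter list \<Rightarrow>\<^sub>0 'k) set" where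
 "fp_hom S E f \<equiv> coset_map (free_dg S E) (fp_ideal S E) (fp_map f)"

lemma dga_hom_sub:
 assumes "dga_hom T T' L" "dga (sub T A)" "dga (sub T' A')" "A <= carrier T" "!!x. x : A ==> L x : A'"
 shows "dga_hom (sub T A) (sub T' A') L"
proof -
 interpret L: dga_map T T' L by unfold_locales fact
 show ?thesis by (rule dga_homI) (use assms L.gr in \<open>auto simp: L.add L.smult L.mult L.dif subset_iff\<close>)
qed

text \<open>The action on morphisms is defined by representatives twice over, for the ideal of the
  free product and for the commutator ideal. Both descents are settled here;
  \<open>rep_map_class\<close> is the form used afterwards.\<close>

lemma
 assumes V: "dg_complex V" "fin_total_dim V" and f: "dga_hom R S f"
 shows root_map_hom: "dga_hom (root_alg V R) (root_alg V S) (fp_hom S (dg_End V) f)"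
  and rep_map_hom: "dga_hom (rep_alg V R) (rep_alg V S) (rep_map V S f)"
  and rep_map_class: "w : carrier (root_alg V R) ==>
   rep_map V S f (comm_ideal (root_alg V R) +>\<^bsub>root_alg V R\<^esub> w) =
   comm_ideal (root_alg V S) +>\<^bsub>root_alg V S\<^esub> fp_hom S (dg_End V) f w"
proof -
 interpret f: dga_map R S f by unfold_locales fact
 interpret R: rep_ctx V R by (rule rep_ctxI[OF V f.R.dga])
 interpret S: rep_ctx V S by (rule rep_ctxI[OF V f.S.dga])
 note L = fp_map_hom[OF f R.E_dga]
 have c: "w : R.C.cent ==> fp_hom S (dg_End V) f w : S.C.cent" for w
  by (rule cent_map[OF R.C.centralizer_axioms S.C.centralizer_axioms L(1,3)])
 show h: "dga_hom (root_alg V R) (root_alg V S) (fp_hom S (dg_End V) f)" unfolding R.root_alg_eq S.root_alg_eq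
  by (rule dga_hom_sub[OF L(1) R.C.cent_dga S.C.cent_dga _ c]) (auto simp: R.C.cent_def)
 then have p: "pdga_hom (root_alg V R) (root_alg V S) (fp_hom S (dg_End V) f)" by (simp add: dga_hom_iff)
 note q = quot_map[OF R.root.comm_dgquot S.root.comm_dgquot p dga_hom_comm_ideal[OF h]]
 show "dga_hom (rep_alg V R) (rep_alg V S) (rep_map V S f)"
  using q(1) R.rep_dga S.rep_dga by (simp add: dga_hom_iff rep_alg_def rep_map_def)
 show "w : carrier (root_alg V R) ==>
   rep_map V S f (comm_ideal (root_alg V R) +>\<^bsub>root_alg V R\<^esub> w) =
   comm_ideal (root_alg V S) +>\<^bsub>root_alg V S\<^esub> fp_hom S (dg_End V) f w" unfolding rep_map_def by (rule q(2))
qed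

lemma fp_hom_comp:
 assumes f: "dga_hom R S f" and g: "dga_hom S U g" and E: "dga E" and X: "X : carrier (free_prod R E)"
 shows "fp_hom U E (g \<circ> f) X = fp_hom U E g (fp_hom S E f X)"
proof -
 interpret f: dga_map R S f by unfold_locales fact
 interpret g: dga_map S U g by unfold_locales fact
 interpret D: two_dga R E by unfold_locales fact
 note gf = dga_hom_comp[OF f g]
 note Lf = fp_map_hom[OF f E] and Lg = fp_map_hom[OF g E] and L = fp_map_hom[OF gf E]
 show ?thesis using D.fp_ext[of _ "fp_hom U E (g \<circ> f)" "fp_hom U E g \<circ> fp_hom S E f", OF _ _ _ _ X]
   L dga_hom_comp[OF Lf(1) Lg(1)] Lf(2,3) Lg(2,3) by (auto simp: dga_hom_def galg_hom_def)
qed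

lemma fp_hom_id:
 assumes "dga R" and E: "dga E" and X: "X : carrier (free_prod R E)"
 shows "fp_hom R E id X = X"
proof -
 interpret D: two_dga R E by unfold_locales fact+
 note L = fp_map_hom[OF dga_hom_id[OF assms(1)] E]
 show ?thesis using D.fp_ext[of _ "fp_hom R E id" id, OF _ _ _ _ X] L dga_hom_id[OF D.T_dga] by (auto simp: dga_hom_def galg_hom_def)
qed

lemma rep_map_comp:
 assumes V: "dg_complex V" "fin_total_dim V" and f: "dga_hom R S f" and g: "dga_hom S U g"
  and X: "X : carrier (rep_alg V R)"
 shows "rep_map V U (g \<circ> f) X = rep_map V U g (rep_map V S f X)"
proof -
 interpret f: dga_map R S f by unfold_locales fact
 interpret R: rep_ctx V R by (rule rep_ctxI[OF V f.R.dga])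
 interpret L: dga_map "root_alg V R" "root_alg V S" "fp_hom S (dg_End V) f" by unfold_locales (rule root_map_hom[OF V f])
 obtain w where w: "w : carrier (root_alg V R)" "X = R.\<rho> w" using X by (auto simp: R.rep_carrier R.root_carrier)
 then have "w : carrier R.P.T" by (auto simp: R.root_carrier R.C.cent_def)
 then show ?thesis using w by (simp add: rep_map_class[OF V f] rep_map_class[OF V g]
   rep_map_class[OF V dga_hom_comp[OF f g]] fp_hom_comp[OF f g R.E_dga])
qed

lemma rep_map_id:
 assumes V: "dg_complex V" "fin_total_dim V" and R: "dga R" and X: "X : carrier (rep_alg V R)"
 shows "rep_map V R id X = X"
proof -
 interpret R: rep_ctx V R by (rule rep_ctxI[OF V R])
 obtain w where w: "w : carrier (root_alg V R)" "X = R.\<rho> w" using X by (auto simp: R.rep_carrier R.root_carrier)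
 then have "w : carrier R.P.T" by (auto simp: R.root_carrier R.C.cent_def)
 then show ?thesis using w by (simp add: rep_map_class[OF V dga_hom_id[OF R]] fp_hom_id[OF R R.E_dga])
qed

section \<open>Extending maps from the generators of an almost free algebra\<close>

section \<open>Lifting along acyclic relations\<close>

text \<open>
 A DG algebra map out of an almost free algebra is built by induction on the degrees of the
 generators. To treat lifts and homotopies at once, the values are constrained by a
 multiplicative relation rather than by a fibration.
\<close>

locale nonpos_free = dgalgebra R for R :: "('k::field, 'r) dg" (structure) +
 fixes X
 assumes X: "X <= (\<Union>n. gr R n)"
  and bij: "bij_betw (free_eval R) {f. keys f <= lists X} (carrier R)"
  and nonpos: "!!i. i > 0 ==> gr R i = {\<zero>}"
begin

definition gen :: "'r => 'r" where "gen x = (if x : X then x else \<zero>)"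

lemma X_carrier: "x : X ==> x : carrier R"
 using X by (auto simp: gr_carrier)
lemma gen_closed [simp]: "gen x : carrier R"
 by (simp add: gen_def X_carrier)
lemma gen_X [simp]: "x : X ==> gen x = x"
 by (simp add: gen_def)

lemma free_eval_eq:
 assumes "keys f <= lists X"
 shows "free_eval R f = lext (wval gen) f"
proof -
 have "free_eval R f = lext (%w. foldr (%x y. x \<otimes> y) w \<one>) f" by (simp add: free_eval_def lext_def)
 also have "... = lext (wval gen) f"
 proof (rule lext_cong)
  show "foldr (%x y. x \<otimes> y) u \<one> = wval gen u" if "u : keys f" for u
  proof -
   have "u : lists X" using that assms by auto
   then show ?thesis by (induct u) auto
  qed
 qed simp
 finally show ?thesis .
qed

definition coords :: "'r => ('r list \<Rightarrow>\<^sub>0 'k)" where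
 "coords r = inv_into {f. keys f <= lists X} (free_eval R) r"

lemma coords: "r : carrier R ==> keys (coords r) <= lists X"
 "r : carrier R ==> lext (wval gen) (coords r) = r"
proof -
 assume r: "r : carrier R"
 have img: "r : free_eval R ` {f. keys f <= lists X}" using bij r by (simp add: bij_betw_def)
 show k: "keys (coords r) <= lists X" using inv_into_into[OF img] by (simp add: coords_def)
 show "lext (wval gen) (coords r) = r" using f_inv_into_f[OF img] free_eval_eq[OF k] by (simp add: coords_def)
qed

lemma coords_unique:
 assumes "keys f <= lists X" "lext (wval gen) f = r"
 shows "coords r = f"
proof -
 have "free_eval R f = r" using assms by (simp add: free_eval_eq)
 then show ?thesis using bij assms(1) unfolding coords_def bij_betw_def by (metis inv_into_f_f mem_Collect_eq)
qed

lemma free_induct [consumes 1, case_names gen one add smult mult]: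
 assumes "r : carrier R" "!!x. x : X ==> P x" "P \<one>"
  "!!x y. x : carrier R ==> y : carrier R ==> P x ==> P y ==> P (x \<oplus> y)"
  "!!c x. x : carrier R ==> P x ==> P (c \<odot> x)"
  "!!x y. x : carrier R ==> y : carrier R ==> P x ==> P y ==> P (x \<otimes> y)"
 shows "P r"
proof -
 have w: "w : lists X ==> P (wval gen w)" for w
 proof (induct w)
  case (Cons l w)
  then show ?case using assms(6)[of l "wval gen w"] assms(2)[of l] X_carrier[of l] by simp
 qed (simp add: assms(3))
 have "keys f <= lists X ==> P (lext (wval gen) f)" for f
 proof (induct f rule: pm_induct)
  case zero
  have "P (0 \<odot> \<one>)" by (rule assms(5)[OF _ assms(3)]) simp
  then show ?case by simp
 next
  case (single u c)
  then show ?case by (simp add: w assms(5))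
 next
  case (add p q)
  then show ?case by (simp add: lext_add assms(4))
 qed
 from this[OF coords(1)[OF assms(1)]] show ?thesis by (simp add: coords(2)[OF assms(1)])
qed

definition dg :: "'r => int" where "dg x = (SOME n. x : gr R n)"
abbreviation "wdg w \<equiv> sum_list (map dg w)"

lemma dg_gr: "x : X ==> x : gr R (dg x)"
 unfolding dg_def by (rule someI_ex) (use X in auto)

text \<open>Were zero a generator, it would have two coordinate vectors, the one-letter word and 0.
  Since a generator is nonzero, it lies in one degree only, and that degree is not positive.\<close>

lemma X_nonzero: "x : X ==> x ~= \<zero>"
proof
 assume x: "x : X" "x = \<zero>"
 have "coords \<zero> = basis_elt [x]" by (rule coords_unique) (use x in auto)
 moreover have "coords \<zero> = 0" by (rule coords_unique) auto
 ultimately have "(basis_elt [x] :: _ \<Rightarrow>\<^sub>0 'k) = 0" by simp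
 then show False by (metis keys_basis keys_zero insert_not_empty)
qed

lemma dg_nonpos: "x : X ==> dg x \<le> 0"
 using dg_gr[of x] X_nonzero[of x] nonpos[of "dg x"] by force

lemma wval_gr: "w : lists X ==> wval gen w : gr R (wdg w)"
 by (induct w) (auto simp: dg_gr mult_gr)

text \<open>Discarding the words of other degrees from the coordinates of r gives coordinates of its
  part of degree n, which is r itself; coordinates are unique.\<close>

lemma coords_keys:
 assumes r: "r : gr R n"
 shows "keys (coords r) <= {w : lists X. wdg w = n}"
proof -
 define res :: "('r list \<Rightarrow>\<^sub>0 'k) => ('r list \<Rightarrow>\<^sub>0 'k)" where "res = lin_ext (%w. if wdg w = n then basis_elt w else 0)"
 have rc: "r : carrier R" using r by auto
 note k = coords(1)[OF rc]
 have kr: "keys (res (coords r)) <= {w : lists X. wdg w = n}" unfolding res_def by (rule keys_lin_ext[OF k]) auto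
 have "keys f <= lists X ==> lext (wval gen) (res f) = pr (lext (wval gen) f) n" for f
 proof (induct f rule: pm_induct)
  case (single u c)
  then show ?case by (auto simp: res_def pr_smult pr_homog[OF wval_gr[OF single]])
 next
  case (add p q)
  then show ?case by (simp add: res_def lin_ext_add lext_add pr_add)
 qed (simp add: res_def)
 from this[OF k] have "lext (wval gen) (res (coords r)) = r" by (simp add: coords(2)[OF rc] pr_homog[OF r])
 then have "coords r = res (coords r)" using kr by (intro coords_unique) auto
 then show ?thesis using kr by simp
qed

text \<open>All letters have nonpositive degree, so none has smaller degree than the word containing
  it. Hence d x involves only generators of degree above that of x, which is what makes induction on
  the degree possible.\<close>

lemma letter_dg: "w : lists X ==> l : set w ==> dg l \<ge> wdg w"
proof (induct w)
 case (Cons a w)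
 have "wdg w \<le> 0" using Cons(2) by (induct w) (auto dest: dg_nonpos)
 then show ?case using Cons dg_nonpos[of a] by fastforce
qed simp

end

locale free_target = nonpos_free R X + T: dgalgebra T for R :: "('k::field, 'r) dg" (structure) and X and T :: "('k, 't) dg"
begin

definition cut :: "('r => 't) => 'r => 't" where
 "cut \<phi> x = (if x : X & \<phi> x : carrier T then \<phi> x else \<zero>\<^sub>T)"

definition hext :: "('r => 't) => 'r => 't" where
 "hext \<phi> r = T.lext (T.wval (cut \<phi>)) (coords r)"

lemma cut_closed [simp]: "cut \<phi> x : carrier T"
 by (simp add: cut_def)

lemma hext_lext: 
 assumes "keys f <= lists X"
 shows "hext \<phi> (lext (wval gen) f) = T.lext (T.wval (cut \<phi>)) f" unfolding hext_def by (simp add: coords_unique[OF assms refl])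

lemma hext_wval: "w : lists X ==> hext \<phi> (wval gen w) = T.wval (cut \<phi>) w"
 using hext_lext[of "basis_elt w" \<phi>] by simp

lemma hext_closed [simp]: "hext \<phi> r : carrier T"
 by (simp add: hext_def)

lemma hext_alg: "alg_hom R T (hext \<phi>)"
proof (rule alg_homI[OF kalg T.kalg])
 show "hext \<phi> (x \<oplus> y) = hext \<phi> x \<oplus>\<^sub>T hext \<phi> y" if "x : carrier R" "y : carrier R" for x y
 proof -
  have "coords (x \<oplus> y) = coords x + coords y"
   by (rule coords_unique[OF keys_add_subset[OF coords(1)[OF that(1)] coords(1)[OF that(2)]]])
    (use that in \<open>simp add: lext_add coords\<close>)
  then show ?thesis by (simp add: hext_def T.lext_add)
 qed
 show "hext \<phi> (c \<odot> x) = c \<odot>\<^sub>T hext \<phi> x" if "x : carrier R" for c x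
 proof -
  have "coords (c \<odot> x) = scale c (coords x)" by (rule coords_unique[OF keys_sc_subset[OF coords(1)[OF that]]])
    (use that in \<open>simp add: lext_sc coords\<close>)
  then show ?thesis by (simp add: hext_def T.lext_sc)
 qed
 show "hext \<phi> (x \<otimes> y) = hext \<phi> x \<otimes>\<^sub>T hext \<phi> y" if "x : carrier R" "y : carrier R" for x y
 proof -
  have "coords (x \<otimes> y) = conv (@) (coords x) (coords y)"
  proof (rule coords_unique)
   show "keys (conv (@) (coords x) (coords y)) <= lists X" by (rule keys_conv[OF coords(1)[OF that(1)] coords(1)[OF that(2)]]) auto
   show "lext (wval gen) (conv (@) (coords x) (coords y)) = x \<otimes> y"
    using that by (subst lext_conv[of _ _ UNIV _ UNIV]) (auto simp: wval_append coords)
  qed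
  then show ?thesis unfolding hext_def by (simp only:) (rule T.lext_conv[of _ _ UNIV _ UNIV], auto simp: T.wval_append)
 qed
 have "coords \<one> = basis_elt []" by (rule coords_unique) auto
 then show "hext \<phi> \<one> = \<one>\<^sub>T" by (simp add: hext_def)
qed simp

lemma hext_gen: "x : X ==> \<phi> x : carrier T ==> hext \<phi> x = \<phi> x"
 using hext_wval[of "[x]" \<phi>] by (simp add: X_carrier cut_def)

lemma hext_cong:
 assumes "r : gr R n" "!!x. x : X ==> dg x \<ge> n ==> \<phi> x = \<psi> x"
 shows "hext \<phi> r = hext \<psi> r" unfolding hext_def
proof (rule T.lext_cong)
 fix u assume "u : keys (coords r)"
 then have u: "u : lists X" "wdg u = n" using coords_keys[OF assms(1)] by auto
 show "T.wval (cut \<phi>) u = T.wval (cut \<psi>) u"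
  by (rule T.wval_cong) (use u letter_dg[OF u(1)] assms(2) in \<open>auto simp: cut_def\<close>)
qed simp

lemma hext_gr:
 assumes "!!x. x : X ==> \<phi> x : gr T (dg x)" "r : gr R n"
 shows "hext \<phi> r : gr T n" unfolding hext_def
proof (rule T.lext_submodule[OF T.gr_submodule])
 fix u assume "u : keys (coords r)"
 then have u: "u : lists X" "wdg u = n" using coords_keys[OF assms(2)] by auto
 have "T.wval (cut \<phi>) u : gr T (wdg u)" using u(1) by (induct u) (auto simp: cut_def assms(1) T.mult_gr T.gr_carrier)
 then show "T.wval (cut \<phi>) u : gr T n" by (simp add: u)
qed

text \<open>Compatibility with d in degree n needs the differential condition only on generators of
  degree at least n, so it is available while the map is still being built.\<close>

lemma hext_dif:
 assumes "!!x. x : X ==> \<phi> x : gr T (dg x)" "!!x. x : X ==> dg x \<ge> n ==> dif T (\<phi> x) = hext \<phi> (dif R x)"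
  and r: "r : gr R n"
 shows "dif T (hext \<phi> r) = hext \<phi> (dif R r)"
proof -
 interpret h: alg_map R T "hext \<phi>" by unfold_locales (rule hext_alg)
 have w: "dif T (hext \<phi> (wval gen u)) = hext \<phi> (dif R (wval gen u))"
  if "u : lists X" "!!l. l : set u ==> dg l \<ge> n" for u using that
 proof (induct u)
  case (Cons l u)
  have l: "l : X" "l : carrier R" "\<phi> l : gr T (dg l)" using Cons X_carrier assms(1) by auto
  have hl: "hext \<phi> l = \<phi> l" using hext_gen[OF l(1)] l(3) T.gr_carrier by blast
  have dl: "dif T (\<phi> l) = hext \<phi> (dif R l)" using assms(2)[OF l(1)] Cons(4) by auto
  have IH: "dif T (hext \<phi> (wval gen u)) = hext \<phi> (dif R (wval gen u))" using Cons by auto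
  show ?case using l T.gr_carrier[OF l(3)]
   by (simp add: h.mult hl T.leibniz_homog[OF l(3)] leibniz_homog[OF dg_gr[OF l(1)]] dl IH h.add h.smult)
 qed simp
 have rc: "r : carrier R" using r by auto
 have k: "keys (coords r) <= {u : lists X. \<forall>l\<in>set u. dg l \<ge> n}" using coords_keys[OF r] letter_dg by fastforce
 have "keys f <= {u : lists X. \<forall>l\<in>set u. dg l \<ge> n} ==>
  dif T (hext \<phi> (lext (wval gen) f)) = hext \<phi> (dif R (lext (wval gen) f))" for f
 proof (induct f rule: pm_induct)
  case (single u c)
  then have "dif T (hext \<phi> (wval gen u)) = hext \<phi> (dif R (wval gen u))" by (intro w) auto
  then show ?case by (simp add: h.smult T.d.smult d.smult)
 next
  case (add p q)
  then show ?case by (simp add: lext_add h.add T.d.add d.add)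
 qed simp
 from this[OF k] show ?thesis by (simp add: coords(2)[OF rc])
qed

text \<open>C x y reads: y is an admissible value at x. Homogeneous elements have admissible values
  of their degree (\<open>C_ex\<close>), and the admissible values at zero form an acyclic complex
  (\<open>C_acyc\<close>). On a generator x, an admissible guess y has a defect d y - c against the
  value c already fixed for d x. The defect is a cycle admissible at zero, hence d u with u
  admissible at zero, and y - u is the corrected value.\<close>

lemma lift_exists:
 fixes C :: "'r => 't => bool"
 assumes C_add: "!!x y x' y'. x : carrier R ==> x' : carrier R ==> y : carrier T ==> y' : carrier T ==>
   C x y ==> C x' y' ==> C (x \<oplus> x') (y \<oplus>\<^sub>T y')"
  and C_smult: "!!c x y. x : carrier R ==> y : carrier T ==> C x y ==> C (c \<odot> x) (c \<odot>\<^sub>T y)"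
  and C_mult: "!!x y x' y'. x : carrier R ==> x' : carrier R ==> y : carrier T ==> y' : carrier T ==>
   C x y ==> C x' y' ==> C (x \<otimes> x') (y \<otimes>\<^sub>T y')"
  and C_one: "C \<one> \<one>\<^sub>T"
  and C_dif: "!!x y. x : carrier R ==> y : carrier T ==> C x y ==> C (dif R x) (dif T y)"
  and C_ex: "!!x n. x : gr R n ==> \<exists>y\<in>gr T n. C x y"
  and C_acyc: "!!z n. z : gr T n ==> C \<zero> z ==> dif T z = \<zero>\<^sub>T ==> \<exists>u\<in>gr T (n - 1). C \<zero> u & dif T u = z"
 shows "\<exists>h. dga_hom R T h & (\<forall>x\<in>carrier R. C x (h x))"
proof -
 have C_minus: "C (x \<ominus> x') (y \<ominus>\<^sub>T y')"
  if "x : carrier R" "x' : carrier R" "y : carrier T" "y' : carrier T" "C x y" "C x' y'" for x x' y y'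
  using C_add[OF that(1) _ that(3) _ that(5) C_smult[OF that(2,4,6), of "-1"]] that by (simp add: sm_m1 T.sm_m1 minus_eq T.minus_eq)
 have C_hext: "C r (hext \<phi> r)" if "r : carrier R" "!!x. x : X ==> \<phi> x : gr T (dg x) & C x (\<phi> x)" for \<phi> r
 proof -
  interpret h: alg_map R T "hext \<phi>" by unfold_locales (rule hext_alg)
  show ?thesis using that(1)
  proof (induct r rule: free_induct)
   case (gen x)
   then show ?case using that(2)[OF gen] hext_gen[OF gen] T.gr_carrier by metis
  qed (auto simp: C_one h.add h.smult h.mult C_add C_smult C_mult)
 qed
 \<comment> \<open>Stage m: all values are admissible, and the differential is right on generators
   of degree above -m. For m = 0 the second condition is empty.\<close>
 define OK where "OK m \<phi> \<longleftrightarrow> (\<forall>x\<in>X. \<phi> x : gr T (dg x) & C x (\<phi> x)) &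
  (\<forall>x\<in>X. dg x > - int m --> dif T (\<phi> x) = hext \<phi> (dif R x))" for m \<phi>
 define ext where "ext m \<phi> \<psi> \<longleftrightarrow> (\<forall>x\<in>X. dg x > - int m --> \<psi> x = \<phi> x)" for m and \<phi> \<psi> :: "'r => 't"
 have step: "\<exists>\<psi>. OK (Suc m) \<psi> & ext m \<phi> \<psi>" if ok: "OK m \<phi>" for m \<phi>
 proof -
  have g: "!!x. x : X ==> \<phi> x : gr T (dg x) & C x (\<phi> x)" using ok by (simp add: OK_def)
  interpret h: alg_map R T "hext \<phi>" by unfold_locales (rule hext_alg)
  have "\<exists>y. x : X & dg x = - int m --> y : gr T (dg x) & C x y & dif T y = hext \<phi> (dif R x)" for x
  proof (cases "x : X & dg x = - int m")
   case True
   then have x: "x : X" "x : gr R (dg x)" "x : carrier R" using dg_gr[of x] X_carrier by auto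
   have dx: "dif R x : gr R (dg x + 1)" by (rule d_gr[OF x(2)])
   let ?c = "hext \<phi> (dif R x)" and ?y = "\<phi> x"
   have y: "?y : gr T (dg x)" "?y : carrier T" "C x ?y" using g[OF x(1)] T.gr_carrier by auto
   have c: "?c : gr T (dg x + 1)" by (rule hext_gr[OF _ dx]) (use g in auto)
   have "dif T ?c = hext \<phi> (dif R (dif R x))" by (rule hext_dif[OF _ _ dx]) (use g ok True in \<open>auto simp: OK_def\<close>)
   then have dc: "dif T ?c = \<zero>\<^sub>T" using x by simp
   have Cc: "C (dif R x) ?c" by (rule C_hext) (use x g in auto)
   have "C (dif R x \<ominus> dif R x) (dif T ?y \<ominus>\<^sub>T ?c)" by (rule C_minus) (use x y Cc C_dif in auto)
   moreover have "dif R x \<ominus> dif R x = \<zero>" using x by (simp add: minus_eq r_neg)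
   moreover have "dif T ?y \<ominus>\<^sub>T ?c : gr T (dg x + 1)" using c T.d_gr[OF y(1)] by auto
   moreover have "dif T (dif T ?y \<ominus>\<^sub>T ?c) = \<zero>\<^sub>T" using y dc T.d.minus[of "dif T ?y" ?c] by (simp add: T.minus_eq)
   ultimately obtain u where u: "u : gr T (dg x)" "C \<zero> u" "dif T u = dif T ?y \<ominus>\<^sub>T ?c"
    using C_acyc[of "dif T ?y \<ominus>\<^sub>T ?c" "dg x + 1"] by auto
   have uc: "u : carrier T" using u by (simp add: T.gr_carrier)
   have "C (x \<ominus> \<zero>) (?y \<ominus>\<^sub>T u)" by (rule C_minus) (use x y u uc in auto)
   moreover have "x \<ominus> \<zero> = x" using x by (simp add: minus_eq)
   moreover have "dif T (?y \<ominus>\<^sub>T u) = ?c"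
   proof -
    have "dif T (?y \<ominus>\<^sub>T u) = dif T ?y \<ominus>\<^sub>T (dif T ?y \<ominus>\<^sub>T ?c)"
     using uc y u(3) T.d.minus[of ?y u] by simp
    then show ?thesis using y by (simp add: T.minus_eq T.minus_add T.a_assoc[symmetric] T.r_neg)
   qed
   ultimately show ?thesis using u y by (intro exI[of _ "?y \<ominus>\<^sub>T u"]) auto
  qed blast
  then obtain Y where Y: "!!x. x : X ==> dg x = - int m ==>
    Y x : gr T (dg x) & C x (Y x) & dif T (Y x) = hext \<phi> (dif R x)" by metis
  define \<psi> where "\<psi> x = (if dg x = - int m then Y x else \<phi> x)" for x
  \<comment> \<open>The correction touches generators of degree -m only, while d x lies here in
    degree above -m.\<close>
  have e: "hext \<psi> (dif R x) = hext \<phi> (dif R x)" if "x : X" "dg x > - int (Suc m)" for x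
   by (rule hext_cong[OF d_gr[OF dg_gr[OF that(1)]]]) (use that in \<open>auto simp: \<psi>_def\<close>)
  have "OK (Suc m) \<psi>" unfolding OK_def
  proof (intro conjI ballI impI)
   fix x assume x: "x : X"
   show "\<psi> x : gr T (dg x)" "C x (\<psi> x)" using Y[OF x] g[OF x] by (auto simp: \<psi>_def)
   assume "dg x > - int (Suc m)"
   then show "dif T (\<psi> x) = hext \<psi> (dif R x)"
    using Y[OF x] ok x e[OF x] by (cases "dg x = - int m") (auto simp: \<psi>_def OK_def)
  qed
  moreover have "ext m \<phi> \<psi>" by (auto simp: ext_def \<psi>_def)
  ultimately show ?thesis by blast
 qed
 have "\<exists>\<phi>. OK 0 \<phi>"
 proof -
  have "\<forall>x. \<exists>y. x : X --> y : gr T (dg x) & C x y" using C_ex[OF dg_gr] by blast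
  then obtain \<phi> where "\<forall>x. x : X --> \<phi> x : gr T (dg x) & C x (\<phi> x)" by metis
  then show ?thesis using dg_nonpos by (intro exI[of _ \<phi>]) (force simp: OK_def)
 qed
 then obtain F where F: "!!m. OK m (F m)" "!!m. ext m (F m) (F (Suc m))" using dependent_nat_choice[of OK ext] step by metis
 \<comment> \<open>From stage 1 - dg x on the value at x no longer changes; \<open>Suc\<close> is
   needed because stage m settles only degrees strictly above -m.\<close>
 define \<phi> where "\<phi> x = F (Suc (nat (- dg x))) x" for x
 have F\<phi>: "F (Suc (nat (- dg x)) + k) x = \<phi> x" if "x : X" for x k
 proof (induct k)
  case (Suc k)
  have "dg x > - int (Suc (nat (- dg x)) + k)" by simp
  then show ?case using F(2)[of "Suc (nat (- dg x)) + k"] Suc that by (simp add: ext_def)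
 qed (simp add: \<phi>_def)
 have g: "\<phi> x : gr T (dg x) & C x (\<phi> x)" if "x : X" for x
  using F(1)[of "Suc (nat (- dg x))"] that by (auto simp: OK_def \<phi>_def)
 have d: "dif T (\<phi> x) = hext \<phi> (dif R x)" if x: "x : X" for x
 proof -
  let ?M = "Suc (nat (- dg x))"
  have "hext (F ?M) (dif R x) = hext \<phi> (dif R x)"
  proof (rule hext_cong[OF d_gr[OF dg_gr[OF x]]])
   fix y assume y: "y : X" "dg y \<ge> dg x + 1"
   then have "?M = Suc (nat (- dg y)) + (nat (- dg x) - nat (- dg y))" by simp
   then show "F ?M y = \<phi> y" using F\<phi>[OF y(1)] by metis
  qed
  moreover have "dif T (F ?M x) = hext (F ?M) (dif R x)" using F(1)[of ?M] x by (auto simp: OK_def)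
  ultimately show ?thesis by (simp add: \<phi>_def)
 qed
 interpret h: alg_map R T "hext \<phi>" by unfold_locales (rule hext_alg)
 have "dga_hom R T (hext \<phi>)"
 proof (rule dga_homI[OF dga T.dga])
  show "hext \<phi> (dif R x) = dif T (hext \<phi> x)" if "x : carrier R" for x using that
  proof (induct x rule: gr_induct)
   case (homog n x)
   show ?case by (rule hext_dif[symmetric, OF _ _ homog]) (use g d in auto)
  next
   case (add x y)
   then show ?case by (simp add: h.add d.add T.d.add)
  qed
  show "hext \<phi> x : gr T n" if "x : gr R n" for x n by (rule hext_gr[OF _ that]) (use g in auto)
 qed (auto simp: h.add h.smult h.mult)
 then show ?thesis using C_hext g by blast
qed

end

section \<open>The polynomial path object and homotopies\<close>

section \<open>Polynomials over a DG algebra\<close>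

lemma ring_cong:
 assumes "ring A" and [simp]: "carrier B = carrier A" "monoid.mult B = monoid.mult A" "one B = one A"
  "ring.zero B = ring.zero A" "add B = add A"
 shows "ring B"
proof -
 interpret ring A by fact
 show ?thesis
 proof (rule ringI)
  show "abelian_group B"
  proof (rule abelian_groupI, goal_cases)
   case (6 x)
   then show ?case by (intro bexI[of _ "\<ominus>\<^sub>A x"]) (auto simp: l_neg)
  qed (auto simp: a_ac)
  show "monoid B" by (rule monoidI) (auto simp: m_assoc)
 qed (auto simp: l_distr r_distr)
qed

text \<open>T[t] with t central of degree 0. The ring operations are those of \<open>UP\<close>,
  whose ring laws hold over noncommutative coefficients.\<close>

definition poly_dg :: "('k::field, 'a) dg => ('k, nat => 'a) dg" where
 "poly_dg R = \<lparr>carrier = up R, monoid.mult = monoid.mult (UP R), one = one (UP R),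
  ring.zero = ring.zero (UP R), add = add (UP R), smult = (%c p i. c \<odot>\<^sub>R p i),
  gr = (%n. {p : up R. \<forall>i. p i : gr R n}), dif = (%p i. dif R (p i))\<rparr>"

definition pder :: "('k::field, 'a) dg => (nat => 'a) => nat => 'a" where
 "pder R p = (%i. of_nat (Suc i) \<odot>\<^sub>R p (Suc i))"

lemma upI: "(!!n. f n : carrier R) ==> (!!i. i > N ==> f i = \<zero>\<^sub>R) ==> f : up R"
 by (auto simp: up_def bound_def)
lemma upE:
 assumes "f : up R"
 obtains N where "!!i. i > N ==> f i = \<zero>\<^sub>R" using assms by (auto simp: up_def bound_def)

context dgalgebra
begin

abbreviation "PR \<equiv> poly_dg R"

lemma poly_carrier: "carrier PR = up R"
 by (simp add: poly_dg_def)
lemma up_car [simp]: "p : up R ==> p i : carrier R"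
 by (auto simp: up_def)

lemma poly_app:
 "p : up R ==> q : up R ==> (p \<otimes>\<^sub>PR q) n = (\<Oplus>i\<in>{..n}. p i \<otimes> q (n - i))"
 "p : up R ==> q : up R ==> (p \<oplus>\<^sub>PR q) n = p n \<oplus> q n"
 "(c \<odot>\<^sub>PR p) n = c \<odot> p n" "\<zero>\<^sub>PR n = \<zero>" "\<one>\<^sub>PR n = (if n = 0 then \<one> else \<zero>)" "dif PR p n = d (p n)"
 by (simp_all add: poly_dg_def UP_def)

lemma poly_gr: "p : gr PR n \<longleftrightarrow> p : up R & (\<forall>i. p i : gr R n)"
 by (simp add: poly_dg_def)

lemma up_map:
 assumes "p : up R" "!!x. x : carrier R ==> h x : carrier S" "h \<zero> = \<zero>\<^sub>S"
 shows "(%i. h (p i)) : up S"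
proof -
 obtain N where "!!i. i > N ==> p i = \<zero>" using upE[OF assms(1)] by blast
 then show ?thesis using assms by (intro upI[of _ _ N]) auto
qed

lemma poly_ring: "ring PR"
proof -
 interpret U: UP_ring R "UP R" by unfold_locales auto
 show ?thesis by (rule ring_cong[OF U.UP_ring]) (simp_all add: poly_dg_def UP_def)
qed

lemma poly_smult_closed: "p : up R ==> c \<odot>\<^sub>PR p : up R"
 using up_map[of p "%x. c \<odot> x" R] by (simp add: poly_dg_def)

lemma poly_kalg: "kalg PR"
proof -
 interpret P: ring PR by (rule poly_ring)
 note c = P.m_closed[unfolded poly_carrier] P.a_closed[unfolded poly_carrier]
 show ?thesis
 proof (rule kalgI[OF _ P.monoid_axioms])
  show "module ground PR" by (rule module_groundI[OF P.abelian_group_axioms])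
    (auto simp: poly_carrier poly_smult_closed poly_app c fun_eq_iff sm_ladd sm_radd)
  show "(a \<odot>\<^sub>PR x) \<otimes>\<^sub>PR y = a \<odot>\<^sub>PR (x \<otimes>\<^sub>PR y)" "x \<otimes>\<^sub>PR (a \<odot>\<^sub>PR y) = a \<odot>\<^sub>PR (x \<otimes>\<^sub>PR y)"
   if "x : carrier PR" "y : carrier PR" for a x y
   using that by (auto simp: poly_carrier poly_smult_closed poly_app fun_eq_iff sm_finsum)
 qed (auto simp: poly_carrier P.l_distr P.r_distr)
qed

sublocale PK: kalgebra PR by unfold_locales (rule poly_kalg)

lemma PK_closed [simp]:
 "p : up R ==> q : up R ==> p \<otimes>\<^sub>PR q : up R" "p : up R ==> q : up R ==> p \<oplus>\<^sub>PR q : up R"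
 "p : up R ==> c \<odot>\<^sub>PR p : up R" "\<zero>\<^sub>PR : up R" "\<one>\<^sub>PR : up R" "p : up R ==> dif PR p : up R"
 using PK.m_closed PK.a_closed PK.sm_closed PK.zero_closed PK.one_closed up_map[of p d R]
 by (auto simp: poly_carrier) (simp add: poly_dg_def)

definition mono :: "'a => nat => nat => 'a" where
 "mono c i = (%j. if j = i then c else \<zero>)"

lemma mono_up [simp]: "c : carrier R ==> mono c i : up R"
 by (rule upI[of _ _ i]) (auto simp: mono_def)

lemma poly_induct [consumes 1, case_names mono add]:
 assumes "p : up R" and m: "!!c i. c : carrier R ==> Q (mono c i)"
  and a: "!!p q. p : up R ==> q : up R ==> Q p ==> Q q ==> Q (p \<oplus>\<^sub>PR q)"
 shows "Q p"
proof -
 have "p : up R ==> (!!i. i \<ge> N ==> p i = \<zero>) ==> Q p" for N p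
 proof (induct N arbitrary: p)
  case 0
  then have "p = mono \<zero> 0" by (auto simp: mono_def fun_eq_iff)
  then show ?case using m[of \<zero> 0] by simp
 next
  case (Suc N)
  let ?q = "%i. if i = N then \<zero> else p i"
  have q: "?q : up R"
  proof (rule upI[of _ _ N])
   show "?q i = \<zero>" if "i > N" for i using Suc(3)[of i] that by simp
  qed (use Suc(2) in auto)
  have "?q i = \<zero>" if "i \<ge> N" for i using Suc(3)[of i] that by (cases "i = N") simp_all
  then have "Q ?q" by (rule Suc(1)[OF q])
  moreover have "p = ?q \<oplus>\<^sub>PR mono (p N) N"
  proof
   show "p j = (?q \<oplus>\<^sub>PR mono (p N) N) j" for j using Suc(2) by (subst poly_app(2)[OF q mono_up]) (auto simp: mono_def)
  qed
  ultimately show ?case using a[OF q, of "mono (p N) N"] m[of "p N" N] Suc(2) by simp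
 qed
 moreover obtain N where "!!i. i > N ==> p i = \<zero>" using upE[OF assms(1)] by blast
 ultimately show ?thesis using assms(1) Suc_le_lessD by blast
qed

lemma poly_graded: "graded_module PR"
proof (rule gmodI_span[OF PK.kmod, where P = "%p n i. pr (p i) n"])
 show "submodule (gr PR n) ground PR" for n by (rule PK.submoduleI') (auto simp: poly_gr poly_carrier poly_app)
 have c: "(%i. pr (p i) n) : up R" if "p : up R" for p n using up_map[OF that, of "%x. pr x n" R] by simp
 show "linear_map PR PR (%p i. pr (p i) n)" for n
  by (rule linear_mapI) (auto simp: poly_carrier c fun_eq_iff poly_app pr_add pr_smult)
 show "(%i. pr (p i) m) = (if m = n then p else \<zero>\<^sub>PR)" if "p : gr PR n" for p n m
  using that by (auto simp: poly_gr fun_eq_iff poly_app pr_homog[of _ n])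
 fix p Q
 assume p: "p : carrier PR" and h: "!!n x. x : gr PR n ==> Q x"
  and a: "!!x y. x : carrier PR ==> y : carrier PR ==> Q x ==> Q y ==> Q (x \<oplus>\<^sub>PR y)"
 have "p : up R" using p by (simp add: poly_carrier)
 then show "Q p"
 proof (induct p rule: poly_induct)
  case (mono c i)
  then show ?case
  proof (induct c rule: gr_induct)
   case (homog n c)
   have "mono c i : up R" using homog by (auto simp: gr_carrier)
   moreover have "mono c i j : gr R n" for j using homog by (simp add: mono_def)
   ultimately have "mono c i : gr PR n" by (simp add: poly_gr)
   then show ?case by (rule h)
  next
   case (add x y)
   then have "mono (x \<oplus> y) i = mono x i \<oplus>\<^sub>PR mono y i" by (auto simp: fun_eq_iff poly_app) (auto simp: mono_def)
   then show ?case using a[of "mono x i" "mono y i"] add by (simp add: poly_carrier)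
  qed
 qed (use a in \<open>auto simp: poly_carrier\<close>)
qed

lemma finsum_gr: "(!!i. i : A ==> f i : gr R n) ==> finsum R f A : gr R n"
 by (rule finsum_in_submodule[OF gr_submodule])

lemma poly_galg: "galg PR"
 unfolding galg_def
proof (intro conjI allI ballI poly_kalg poly_graded)
 show "\<one>\<^sub>PR : gr PR 0" by (auto simp: poly_gr poly_app)
 show "x \<otimes>\<^sub>PR y : gr PR (m + n)" if "x : gr PR m" "y : gr PR n" for x y m n
  using that by (auto simp: poly_gr poly_app intro!: finsum_gr mult_gr)
qed

lemma d_finsum: "f : A \<rightarrow> carrier R ==> d (finsum R f A) = finsum R (%i. d (f i)) A"
 by (rule d.finsum)

lemma poly_dga: "dga PR"
 unfolding dga_iff pre_dga_def
proof (intro conjI poly_galg allI ballI subsetI)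
 show "linear_map PR PR (dif PR)" by (rule linear_mapI) (auto simp: poly_carrier fun_eq_iff poly_app d.add d.smult)
 show "y : gr PR (n + 1)" if "y : dif PR ` gr PR n" for y n using that by (auto simp: poly_gr poly_app d_gr)
 show "dif PR (dif PR p) = \<zero>\<^sub>PR" if "p : carrier PR" for p using that by (auto simp: poly_carrier fun_eq_iff poly_app)
 fix m x y assume x: "x : gr PR m" and y: "y : carrier PR"
 then have c: "x : up R" "y : up R" and xg: "!!i. x i : gr R m" by (auto simp: poly_gr poly_carrier)
 show "dif PR (x \<otimes>\<^sub>PR y) = dif PR x \<otimes>\<^sub>PR y \<oplus>\<^sub>PR ksgn m \<odot>\<^sub>PR (x \<otimes>\<^sub>PR dif PR y)"
 proof
  fix n
  have "dif PR (x \<otimes>\<^sub>PR y) n = (\<Oplus>i\<in>{..n}. d (x i \<otimes> y (n - i)))" using c by (simp add: poly_app d_finsum)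
  also have "... = (\<Oplus>i\<in>{..n}. d (x i) \<otimes> y (n - i) \<oplus> ksgn m \<odot> (x i \<otimes> d (y (n - i))))"
   using c by (intro finsum_cong') (auto simp: leibniz_homog[OF xg])
  also have "... = (\<Oplus>i\<in>{..n}. d (x i) \<otimes> y (n - i)) \<oplus> (\<Oplus>i\<in>{..n}. ksgn m \<odot> (x i \<otimes> d (y (n - i))))"
   by (rule finsum_addf) (use c in auto)
  also have "... = (dif PR x \<otimes>\<^sub>PR y \<oplus>\<^sub>PR ksgn m \<odot>\<^sub>PR (x \<otimes>\<^sub>PR dif PR y)) n"
   using c by (simp add: poly_app sm_finsum)
  finally show "dif PR (x \<otimes>\<^sub>PR y) n = (dif PR x \<otimes>\<^sub>PR y \<oplus>\<^sub>PR ksgn m \<odot>\<^sub>PR (x \<otimes>\<^sub>PR dif PR y)) n" .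
 qed
qed

lemma pder_up: "p : up R ==> pder R p : up R"
proof -
 assume p: "p : up R"
 obtain N where "!!i. i > N ==> p i = \<zero>" using upE[OF p] by blast
 then show ?thesis using p by (intro upI[of _ _ N]) (auto simp: pder_def)
qed

text \<open>In the coefficient of t^n the factor n + 1 is split as i + (n + 1 - i). The first of the
  two sums then loses its first term and the second its last, the factor there being zero.\<close>

lemma pder_mult:
 assumes "p : up R" "q : up R"
 shows "pder R (p \<otimes>\<^sub>PR q) = pder R p \<otimes>\<^sub>PR q \<oplus>\<^sub>PR p \<otimes>\<^sub>PR pder R q"
proof
 fix n
 let ?f = "%i. p i \<otimes> q (Suc n - i)"
 have f: "?f i : carrier R" for i using assms by simp
 have "pder R (p \<otimes>\<^sub>PR q) n = (\<Oplus>i\<in>{..Suc n}. of_nat (Suc n) \<odot> ?f i)"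
  unfolding pder_def using assms by (subst poly_app(1)) (simp_all add: sm_finsum del: finsum_Suc)
 also have "... = (\<Oplus>i\<in>{..Suc n}. of_nat i \<odot> ?f i \<oplus> of_nat (Suc n - i) \<odot> ?f i)"
 proof (rule finsum_cong')
  fix i assume "i : {..Suc n}"
  then have "(of_nat (Suc n) :: 'k) = of_nat i + of_nat (Suc n - i)" by (simp add: of_nat_add[symmetric] del: of_nat_Suc)
  then show "of_nat (Suc n) \<odot> ?f i = of_nat i \<odot> ?f i \<oplus> of_nat (Suc n - i) \<odot> ?f i" using f by (simp only: sm_ladd)
 qed (use f in auto)
 also have "... = (\<Oplus>i\<in>{..Suc n}. of_nat i \<odot> ?f i) \<oplus> (\<Oplus>i\<in>{..Suc n}. of_nat (Suc n - i) \<odot> ?f i)"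
  by (rule finsum_addf) (use f in auto)
 also have "(\<Oplus>i\<in>{..Suc n}. of_nat i \<odot> ?f i) = (\<Oplus>i\<in>{..n}. of_nat (Suc i) \<odot> ?f (Suc i))"
  using f assms by (subst finsum_Suc2) (auto simp del: of_nat_Suc)
 also have "... = (pder R p \<otimes>\<^sub>PR q) n"
  using assms pder_up[OF assms(1)] by (subst poly_app(1)) (auto simp: pder_def intro!: finsum_cong')
 also have "(\<Oplus>i\<in>{..Suc n}. of_nat (Suc n - i) \<odot> ?f i) = (\<Oplus>i\<in>{..n}. of_nat (Suc n - i) \<odot> ?f i)"
  using f assms by (subst finsum_Suc) auto
 also have "... = (p \<otimes>\<^sub>PR pder R q) n" using assms pder_up[OF assms(2)]
  by (subst poly_app(1)) (auto simp: pder_def Suc_diff_le intro!: finsum_cong')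
 finally show "pder R (p \<otimes>\<^sub>PR q) n = (pder R p \<otimes>\<^sub>PR q \<oplus>\<^sub>PR p \<otimes>\<^sub>PR pder R q) n"
  using assms by (simp add: poly_app(2) pder_up)
qed

text \<open>Evaluation at t = 1; it is multiplicative because t is central.\<close>

definition ev1 :: "(nat => 'a) => 'a" where "ev1 p = finsum R p {i. p i ~= \<zero>}"

lemma ev1_eq: "p : up R ==> (!!i. i > N ==> p i = \<zero>) ==> ev1 p = (\<Oplus>i\<in>{..N}. p i)"
 unfolding ev1_def by (rule finsum_mono_neutral) (auto simp: not_less[symmetric])

lemma ev0_hom: "dga_hom PR R (%p. p 0)"
 by (rule dga_homI[OF poly_dga dga]) (auto simp: poly_carrier poly_app poly_gr)

lemma ev1_hom: "dga_hom PR R ev1"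
proof (rule dga_homI[OF poly_dga dga])
 have ex: "\<exists>N. (\<forall>i>N. p i = \<zero>) & (\<forall>i>N. q i = \<zero>)" if p: "p : up R" and q: "q : up R" for p q
 proof -
  obtain N where "!!i. i > N ==> p i = \<zero>" using upE[OF p] by blast
  moreover obtain M where "!!i. i > M ==> q i = \<zero>" using upE[OF q] by blast
  ultimately
  show ?thesis by (intro exI[of _ "max N M"]) auto
 qed
 show "ev1 x : carrier R" if "x : carrier PR" for x unfolding ev1_def using that by (intro finsum_closed) (auto simp: poly_carrier)
 show "ev1 (x \<oplus>\<^sub>PR y) = ev1 x \<oplus> ev1 y" if xy: "x : carrier PR" "y : carrier PR" for x y
 proof -
  obtain N where N: "\<forall>i>N. x i = \<zero>" "\<forall>i>N. y i = \<zero>" using ex[of x y] xy by (auto simp: poly_carrier)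
  then show ?thesis using xy by (simp add: poly_carrier ev1_eq[of _ N] poly_app finsum_addf Pi_def)
 qed
 show "ev1 (c \<odot>\<^sub>PR x) = c \<odot> ev1 x" if x: "x : carrier PR" for c x
 proof -
  obtain N where N: "\<forall>i>N. x i = \<zero>" using ex[of x x] x by (auto simp: poly_carrier)
  then show ?thesis using x by (simp add: poly_carrier ev1_eq[of _ N] poly_app sm_finsum Pi_def)
 qed
 show "ev1 (dif PR x) = d (ev1 x)" if x: "x : carrier PR" for x
 proof -
  obtain N where N: "\<forall>i>N. x i = \<zero>" using ex[of x x] x by (auto simp: poly_carrier)
  then show ?thesis using x by (simp add: poly_carrier ev1_eq[of _ N] poly_app d_finsum Pi_def)
 qed
 show "ev1 (x \<otimes>\<^sub>PR y) = ev1 x \<otimes> ev1 y" if xy: "x : carrier PR" "y : carrier PR" for x y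
 proof -
  obtain N where N: "\<forall>i>N. x i = \<zero>" "\<forall>i>N. y i = \<zero>" using ex[of x y] xy by (auto simp: poly_carrier)
  have c: "x : up R" "y : up R" using xy by (simp_all add: poly_carrier)
  have z: "(x \<otimes>\<^sub>PR y) k = \<zero>" if "k > N + N" for k
  proof -
   have "x i \<otimes> y (k - i) = \<zero>" for i using N that c by (cases "i > N") auto
   then show ?thesis using c by (simp add: poly_app)
  qed
  have "ev1 (x \<otimes>\<^sub>PR y) = (\<Oplus>k\<in>{..N + N}. \<Oplus>i\<in>{..k}. x i \<otimes> y (k - i))"
   using c z by (simp add: ev1_eq[of _ "N + N"] poly_app)
  also have "... = (\<Oplus>i\<in>{..N}. x i) \<otimes> (\<Oplus>i\<in>{..N}. y i)"
   by (rule cauchy_product) (use N c in \<open>auto simp: bound_def\<close>)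
  finally show ?thesis using c N by (simp add: ev1_eq[of _ N])
 qed
 show "ev1 \<one>\<^sub>PR = \<one>" by (simp add: ev1_eq[of _ 0] poly_app)
 show "ev1 x : gr R n" if "x : gr PR n" for x n unfolding ev1_def using that by (intro finsum_gr) (auto simp: poly_gr)
qed

lemma poly_gcalg:
 assumes "gcalg R"
 shows "gcalg PR" unfolding gcalg_def
proof (intro conjI allI ballI poly_galg)
 fix m n x y assume x: "x : gr PR m" and y: "y : gr PR n"
 then have c: "x : up R" "y : up R" by (auto simp: poly_gr)
 show "x \<otimes>\<^sub>PR y = ksgn (m * n) \<odot>\<^sub>PR (y \<otimes>\<^sub>PR x)"
 proof
  fix k
  have "(x \<otimes>\<^sub>PR y) k = (\<Oplus>i\<in>{..k}. ksgn (m * n) \<odot> (y (k - i) \<otimes> x i))" unfolding poly_app(1)[OF c]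
  proof (rule finsum_cong')
   fix i show "x i \<otimes> y (k - i) = ksgn (m * n) \<odot> (y (k - i) \<otimes> x i)"
    using assms x y unfolding gcalg_def poly_gr by blast
  qed (use c in auto)
  also have "... = (\<Oplus>i\<in>(%i. k - i) ` {..k}. ksgn (m * n) \<odot> (y i \<otimes> x (k - i)))"
   by (subst finsum_reindex) (use c in \<open>auto simp: inj_on_def intro!: finsum_cong'\<close>)
  also have "(%i. k - i) ` {..k} = {..k}"
  proof (intro equalityI subsetI)
   show "i : (%i. k - i) ` {..k}" if "i : {..k}" for i using that by (intro image_eqI[of _ _ "k - i"]) auto
  qed auto
  finally show "(x \<otimes>\<^sub>PR y) k = (ksgn (m * n) \<odot>\<^sub>PR (y \<otimes>\<^sub>PR x)) k"
   using c by (simp add: poly_app sm_finsum)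
 qed
qed

lemma const_hom: "dga_hom R PR (%x. mono x 0)"
proof (rule dga_homI[OF dga poly_dga])
 show "mono (x \<otimes> y) 0 = mono x 0 \<otimes>\<^sub>PR mono y 0" if "x : carrier R" "y : carrier R" for x y
 proof
  fix n
  have "(mono x 0 \<otimes>\<^sub>PR mono y 0) n = (\<Oplus>i\<in>{..n}. if i = 0 then x \<otimes> mono y 0 n else \<zero>)"
   unfolding poly_app(1)[OF mono_up[OF that(1)] mono_up[OF that(2)]] by (rule finsum_cong') (use that in \<open>auto simp: mono_def\<close>)
  also have "... = x \<otimes> mono y 0 n"
   using add.finprod_singleton_swap[of 0 "{..n}" "%_. x \<otimes> mono y 0 n"] that by (simp add: mono_def)
  finally show "mono (x \<otimes> y) 0 n = (mono x 0 \<otimes>\<^sub>PR mono y 0) n" using that by (simp add: mono_def)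
 qed
qed (auto simp: poly_carrier fun_eq_iff poly_app poly_gr, auto simp: mono_def gr_carrier)

end

section \<open>Polynomial differential forms on the line\<close>

text \<open>
 A pair \<open>(a, b)\<close> stands for \<open>a + dt b\<close>; the derivation \<open>D\<close> is \<open>d/dt\<close>.
\<close>

definition omega :: "('k::field, 'p) dg => ('p => 'p) => ('k, 'p \<times> 'p) dg" where
 "omega P D = \<lparr>carrier = carrier P \<times> carrier P,
  monoid.mult = (%(a, b) (a', b'). (a \<otimes>\<^sub>P a', b \<otimes>\<^sub>P a' \<oplus>\<^sub>P gmod.sg P a \<otimes>\<^sub>P b')),
  one = (\<one>\<^sub>P, \<zero>\<^sub>P), ring.zero = (\<zero>\<^sub>P, \<zero>\<^sub>P),
  add = (%(a, b) (a', b'). (a \<oplus>\<^sub>P a', b \<oplus>\<^sub>P b')),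
  smult = (%c (a, b). (c \<odot>\<^sub>P a, c \<odot>\<^sub>P b)),
  gr = (%n. gr P n \<times> gr P (n - 1)),
  dif = (%(a, b). (dif P a, D a \<ominus>\<^sub>P dif P b))\<rparr>"

lemma omega_simps [simp]:
 "carrier (omega P D) = carrier P \<times> carrier P"
 "(a, b) \<otimes>\<^bsub>omega P D\<^esub> (a', b') = (a \<otimes>\<^sub>P a', b \<otimes>\<^sub>P a' \<oplus>\<^sub>P gmod.sg P a \<otimes>\<^sub>P b')"
 "\<one>\<^bsub>omega P D\<^esub> = (\<one>\<^sub>P, \<zero>\<^sub>P)" "\<zero>\<^bsub>omega P D\<^esub> = (\<zero>\<^sub>P, \<zero>\<^sub>P)"
 "(a, b) \<oplus>\<^bsub>omega P D\<^esub> (a', b') = (a \<oplus>\<^sub>P a', b \<oplus>\<^sub>P b')"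
 "c \<odot>\<^bsub>omega P D\<^esub> (a, b) = (c \<odot>\<^sub>P a, c \<odot>\<^sub>P b)"
 "gr (omega P D) n = gr P n \<times> gr P (n - 1)"
 "dif (omega P D) (a, b) = (dif P a, D a \<ominus>\<^sub>P dif P b)" by (simp_all add: omega_def)

text \<open>In \<open>omega\<close> the differential is d(a + dt b) = d a + dt (D a - d b), where
  the minus sign comes from d passing dt; its square vanishes because D commutes with d. D has
  degree 0, hence no sign in its Leibniz rule.\<close>

locale derivation = dgalgebra P for P :: "('k::field, 'p) dg" (structure) +
 fixes D
 assumes D_lin: "linear_map P P D" and D_gr: "!!x n. x : gr P n ==> D x : gr P n"
  and D_mult: "!!x y. x : carrier P ==> y : carrier P ==> D (x \<otimes> y) = D x \<otimes> y \<oplus> x \<otimes> D y"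
  and D_d: "!!x. x : carrier P ==> D (dif P x) = dif P (D x)"

sublocale derivation \<subseteq> D: lin_map P P D by unfold_locales (rule D_lin)

context derivation
begin

abbreviation "Om \<equiv> omega P D"

lemma omega_module: "module ground Om"
proof (rule module_groundI)
 show "abelian_group Om"
 proof (rule abelian_groupI, goal_cases)
  case (6 x)
  then show ?case by (intro bexI[of _ "(\<ominus> fst x, \<ominus> snd x)"]) (auto simp: l_neg)
 qed (auto simp: a_ac)
qed (auto simp: sm_ladd sm_radd)

lemma omega_kalg: "kalg Om"
proof (rule kalgI[OF omega_module])
 show "monoid Om" by (rule monoidI) (auto simp: sg_mult l_distr r_distr m_assoc a_assoc)
qed (auto simp: sg_add sg_smult l_distr r_distr a_ac sm_radd)

sublocale O: kalgebra Om by unfold_locales (rule omega_kalg)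

lemma omega_graded: "graded_module Om"
proof (rule gmodI_span[OF omega_module, where P = "%x n. (pr (fst x) n, pr (snd x) (n - 1))"])
 show "submodule (gr Om n) ground Om" for n by (rule O.submoduleI') (auto simp: gr_carrier)
 show "linear_map Om Om (%x. (pr (fst x) n, pr (snd x) (n - 1)))" for n by (rule linear_mapI) (auto simp: pr_add pr_smult)
 show "(pr (fst x) m, pr (snd x) (m - 1)) = (if m = n then x else \<zero>\<^sub>Om)" if "x : gr Om n" for x n m
  using that by (auto simp: pr_homog[of _ n] pr_homog[of _ "n - 1"])
 fix x Q
 assume x: "x : carrier Om" and h: "!!n x. x : gr Om n ==> Q x"
  and a: "!!x y. x : carrier Om ==> y : carrier Om ==> Q x ==> Q y ==> Q (x \<oplus>\<^sub>Om y)"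
 obtain u v where uv: "x = (u, v)" "u : carrier P" "v : carrier P" using x by auto
 have "Q (u, \<zero>)" using uv(2)
 proof (induct u rule: gr_induct)
  case (homog n u)
  then show ?case by (intro h[of _ n]) auto
 next
  case (add y z)
  then show ?case using a[of "(y, \<zero>)" "(z, \<zero>)"] by simp
 qed
 moreover have "Q (\<zero>, v)" using uv(3)
 proof (induct v rule: gr_induct)
  case (homog n v)
  then show ?case by (intro h[of _ "n + 1"]) auto
 next
  case (add y z)
  then show ?case using a[of "(\<zero>, y)" "(\<zero>, z)"] by simp
 qed
 ultimately show "Q x" using a[of "(u, \<zero>)" "(\<zero>, v)"] uv by simp
qed

lemma omega_galg: "galg Om"
 unfolding galg_def
proof (intro conjI allI ballI omega_kalg omega_graded)
 show "\<one>\<^sub>Om : gr Om 0" by auto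
 show "x \<otimes>\<^sub>Om y : gr Om (m + n)" if x: "x : gr Om m" and y: "y : gr Om n" for x y m n
 proof -
  obtain a b where ab: "x = (a, b)" "a : gr P m" "b : gr P (m - 1)" using x by auto
  obtain a' b' where ab': "y = (a', b')" "a' : gr P n" "b' : gr P (n - 1)" using y by auto
  have e: "m - 1 + n = m + n - 1" "m + (n - 1) = m + n - 1" by auto
  have "b \<otimes> a' : gr P (m + n - 1)" "sg a \<otimes> b' : gr P (m + n - 1)"
   using mult_gr[OF ab(3) ab'(2)] mult_gr[OF sg_gr[OF ab(2)] ab'(3)] by (simp_all only: e)
  then show ?thesis using mult_gr[OF ab(2) ab'(2)] by (simp add: ab ab')
 qed
qed

lemma omega_dga: "dga Om"
 unfolding dga_iff pre_dga_def
proof (intro conjI omega_galg allI ballI subsetI)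
 show "linear_map Om Om (dif Om)" by (rule linear_mapI) (auto simp: D.add D.smult d.add d.smult add4 sm_rminus)
 show "y : gr Om (n + 1)" if y: "y : dif Om ` gr Om n" for y n
 proof -
  obtain a b where ab: "a : gr P n" "b : gr P (n - 1)" "y = dif Om (a, b)" using y by auto
  have "dif P b : gr P n" using d_gr[OF ab(2)] by simp
  then show ?thesis using ab d_gr[OF ab(1)] D_gr[OF ab(1)] by auto
 qed
 show "dif Om (dif Om x) = \<zero>\<^sub>Om" if "x : carrier Om" for x
  using that by (cases x) (auto simp: D_d d.minus, simp add: minus_eq r_neg)
 fix m x y assume x: "x : gr Om m" and y: "y : carrier Om"
 obtain a b where ab: "x = (a, b)" "a : gr P m" "b : gr P (m - 1)" using x by auto
 obtain a' b' where ab': "y = (a', b')" "a' : carrier P" "b' : carrier P" using y by auto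
 have c: "a : carrier P" "b : carrier P" using ab by (auto simp: gr_carrier)
 let ?k = "ksgn m :: 'k"
 have ka: "?k \<odot> a = sg a" using ab by (simp add: sg_homog)
 have kb: "?k \<odot> b = \<ominus> sg b" using ab c by (simp add: sg_homog[OF ab(3)] sm_lneg)
 have ksa: "?k \<odot> sg a = a" using ab c by (simp add: sg_homog[OF ab(2)])
 have s1: "dif P (a \<otimes> a') = dif P a \<otimes> a' \<oplus> ?k \<odot> (a \<otimes> dif P a')"
  using ab ab' by (simp add: leibniz_homog)
 have sb: "?k \<odot> (b \<otimes> dif P a') = \<ominus> (sg b \<otimes> dif P a')"
  using kb c ab' sm_lmult[of b "dif P a'" ?k] by (simp add: l_minus)
 have sa: "?k \<odot> (sg a \<otimes> z) = a \<otimes> z" if "z : carrier P" for z using ksa c that sm_lmult[of "sg a" z ?k] by simp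
 \<comment> \<open>Up to sign these six products make up the dt components of the two sides. The
   left side is A + B - C - E + F - G; the two summands on the right are A - C + F and - E + B -
   G.\<close>
 let ?A = "D a \<otimes> a'" and ?B = "a \<otimes> D a'" and ?C = "dif P b \<otimes> a'" and ?E = "sg b \<otimes> dif P a'"
  and ?F = "sg (dif P a) \<otimes> b'" and ?G = "a \<otimes> dif P b'"
 have cl: "?A : carrier P" "?B : carrier P" "?C : carrier P" "?E : carrier P" "?F : carrier P" "?G : carrier P"
  using c ab' by auto
 have "dif P (b \<otimes> a' \<oplus> sg a \<otimes> b') = (?C \<oplus> ?E) \<oplus> (\<ominus> ?F \<oplus> ?G)"
  using c ab' by (simp add: d.add leibniz d_sg l_minus)
 then have "D (a \<otimes> a') \<ominus> dif P (b \<otimes> a' \<oplus> sg a \<otimes> b') = (?A \<oplus> ?B) \<ominus> ((?C \<oplus> ?E) \<oplus> (\<ominus> ?F \<oplus> ?G))"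
  using c ab' by (simp add: D_mult)
 also have "... = ((?A \<ominus> ?C) \<oplus> ?F) \<oplus> (\<ominus> ?E \<oplus> (?B \<ominus> ?G))"
  using cl by (simp add: minus_eq minus_add a_ac)
 also have "(?A \<ominus> ?C) \<oplus> ?F = (D a \<ominus> dif P b) \<otimes> a' \<oplus> sg (dif P a) \<otimes> b'"
  using c ab' by (simp add: minus_eq l_distr l_minus)
 also have "\<ominus> ?E \<oplus> (?B \<ominus> ?G) = ?k \<odot> (b \<otimes> dif P a' \<oplus> sg a \<otimes> (D a' \<ominus> dif P b'))"
  using c ab' by (simp add: sm_radd sb sa minus_eq r_distr r_minus sm_rneg)
 finally show "dif Om (x \<otimes>\<^sub>Om y) = dif Om x \<otimes>\<^sub>Om y \<oplus>\<^sub>Om ksgn m \<odot>\<^sub>Om (x \<otimes>\<^sub>Om dif Om y)"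
  using ab ab' s1 by simp
qed

sublocale O: dgalgebra Om by unfold_locales (rule omega_dga)

text \<open>The coefficient of dt has degree one less than the whole, hence the opposite
  parity.\<close>

lemma omega_sg: "x : carrier Om ==> O.sg x = (sg (fst x), \<ominus> sg (snd x))"
proof (induct x rule: O.gr_induct)
 case (homog n x)
 then obtain a b where "x = (a, b)" "a : gr P n" "b : gr P (n - 1)" by auto
 then show ?case using O.sg_homog[OF homog] by (simp add: sg_homog[of a n] sg_homog[of b "n - 1"] sm_lneg gr_carrier)
next
 case (add x y)
 then show ?case using O.sg_add[OF add(1,2)] by (cases x; cases y) (simp add: sg_add minus_add)
qed

lemma omega_gcalg:
 assumes "gcalg P"
 shows "gcalg Om" unfolding gcalg_def
proof (intro conjI allI ballI omega_galg)
 fix m n x y assume x: "x : gr Om m" and y: "y : gr Om n"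
 obtain a b where ab: "x = (a, b)" "a : gr P m" "b : gr P (m - 1)" using x by auto
 obtain a' b' where ab': "y = (a', b')" "a' : gr P n" "b' : gr P (n - 1)" using y by auto
 have comm: "u \<otimes> v = ksgn (i * j) \<odot> (v \<otimes> u)" if "u : gr P i" "v : gr P j" for u v i j
  using assms that unfolding gcalg_def by blast
 have c: "a : carrier P" "b : carrier P" "a' : carrier P" "b' : carrier P" using ab ab' by (auto simp: gr_carrier)
 have k: "(ksgn ((m - 1) * n) :: 'k) = ksgn (m * n) * ksgn n" "(ksgn m * ksgn (m * (n - 1)) :: 'k) = ksgn (m * n)" by (auto simp: ksgn_def)
 have 1: "b \<otimes> a' = ksgn (m * n) \<odot> (sg a' \<otimes> b)" using comm[OF ab(3) ab'(2)] c by (simp add: sg_homog[OF ab'(2)] k)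
 have 2: "sg a \<otimes> b' = ksgn (m * n) \<odot> (b' \<otimes> a)" using comm[OF ab(2) ab'(3)] c by (simp add: sg_homog[OF ab(2)] k)
 show "x \<otimes>\<^sub>Om y = ksgn (m * n) \<odot>\<^sub>Om (y \<otimes>\<^sub>Om x)"
  using ab(1) ab'(1) comm[OF ab(2) ab'(2)] 1 2 c by (simp add: sm_radd a_comm)
qed

lemma omega_fst: "dga_hom P T e ==> dga_hom Om T (%x. e (fst x))"
proof -
 assume "dga_hom P T e"
 then interpret e: dga_map P T e by unfold_locales
 show ?thesis by (rule dga_homI[OF omega_dga e.S.dga]) (auto simp: e.add e.smult e.mult e.gr e.dif)
qed

lemma omega_incl:
 assumes "dga_hom S P j" "!!x. x : carrier S ==> D (j x) = \<zero>"
 shows "dga_hom S Om (%x. (j x, \<zero>))"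
proof -
 interpret j: dga_map S P j by unfold_locales fact
 show ?thesis by (rule dga_homI[OF j.R.dga omega_dga]) (auto simp: j.add j.smult j.mult j.gr j.dif assms(2) minus_eq)
qed

end

lemma omega_map:
 assumes "derivation P D" "derivation P' D'" "dga_hom P P' f" "!!x. x : carrier P ==> f (D x) = D' (f x)"
 shows "dga_hom (omega P D) (omega P' D') (map_prod f f)"
proof -
 interpret P: derivation P D by fact
 interpret P': derivation P' D' by fact
 interpret f: dga_map P P' f by unfold_locales fact
 show ?thesis by (rule dga_homI[OF P.omega_dga P'.omega_dga]) (auto simp: f.add f.smult f.mult f.gr f.dif f.minus f.sg assms(4))
qed

section \<open>Path objects and homotopies\<close>

lemma (in galgebra) gcomm_zero:
 assumes "gcalg R" "x : carrier R" "y : carrier R"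
 shows "gcomm R x y = \<zero>" using assms(2)
proof (induct x rule: gr_induct)
 case (homog m x)
 note x = homog
 show ?case using assms(3)
 proof (induct y rule: gr_induct)
  case (homog n y)
  then have e: "x \<otimes> y = ksgn (m * n) \<odot> (y \<otimes> x)" using assms(1) x unfolding gcalg_def by blast
  show ?case using x homog by (subst gcomm_homog[OF x homog], subst e) (simp add: minus_eq r_neg gr_carrier)
 qed (use x in \<open>simp add: gcomm_add_r gr_carrier\<close>)
qed (use assms in \<open>simp add: gcomm_add_l\<close>)

context dgalgebra
begin

lemma pder_derivation: "derivation PR (pder R)"
proof (rule derivation.intro[OF _ derivation_axioms.intro])
 show "dgalgebra PR" by (rule dgalgebra.intro[OF poly_dga])
 show "linear_map PR PR (pder R)"
  by (rule linear_mapI) (auto simp: poly_carrier pder_up fun_eq_iff poly_app, auto simp: pder_def poly_app sm_radd mult.commute)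
 show "pder R x : gr PR n" if "x : gr PR n" for x n using that by (auto simp: poly_gr pder_up) (auto simp: pder_def)
 show "pder R (x \<otimes>\<^sub>PR y) = pder R x \<otimes>\<^sub>PR y \<oplus>\<^sub>PR x \<otimes>\<^sub>PR pder R y"
  if "x : carrier PR" "y : carrier PR" for x y using that by (simp add: poly_carrier pder_mult)
 show "pder R (dif PR x) = dif PR (pder R x)" if "x : carrier PR" for x
  using that by (auto simp: poly_carrier fun_eq_iff poly_app) (simp add: pder_def poly_app d.smult)
qed

end

definition path_dg :: "('k::field, 'a) dg => ('k, (nat => 'a) \<times> (nat => 'a)) dg" where
 "path_dg R = omega (poly_dg R) (pder R)"

context dgalgebra
begin

lemma path_gcalg:
 assumes "gcalg R"
 shows "gcalg (path_dg R)"
proof -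
 interpret D: derivation PR "pder R" by (rule pder_derivation)
 show ?thesis unfolding path_dg_def by (rule D.omega_gcalg[OF poly_gcalg[OF assms]])
qed
lemma path_ev0: "dga_hom (path_dg R) R (%x. fst x 0)"
proof -
 interpret D: derivation PR "pder R" by (rule pder_derivation)
 show ?thesis unfolding path_dg_def by (rule D.omega_fst[OF ev0_hom])
qed
lemma path_ev1: "dga_hom (path_dg R) R (%x. ev1 (fst x))"
proof -
 interpret D: derivation PR "pder R" by (rule pder_derivation)
 show ?thesis unfolding path_dg_def by (rule D.omega_fst[OF ev1_hom])
qed
lemma path_const: "dga_hom R (path_dg R) (%x. (mono x 0, \<zero>\<^sub>PR))"
proof -
 interpret D: derivation PR "pder R" by (rule pder_derivation)
 show ?thesis unfolding path_dg_def by (rule D.omega_incl[OF const_hom]) (auto simp: fun_eq_iff poly_app, simp add: pder_def mono_def)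
qed
lemma path_carrier: "carrier (path_dg R) = up R \<times> up R"
 by (simp add: path_dg_def poly_carrier)
lemma path_gr: "x : gr (path_dg R) n \<longleftrightarrow> fst x : up R & snd x : up R &
  (\<forall>i. fst x i : gr R n) & (\<forall>i. snd x i : gr R (n - 1))" by (cases x) (auto simp: path_dg_def poly_gr)

lemma poly_minus_app:
 assumes "p : up R" "q : up R"
 shows "(p \<ominus>\<^sub>PR q) n = p n \<ominus> q n"
proof -
 have "p = (p \<ominus>\<^sub>PR q) \<oplus>\<^sub>PR q"
 proof -
  have "p : carrier PR" "q : carrier PR" using assms by (simp_all add: poly_carrier)
  then show ?thesis by (simp add: PK.minus_eq PK.a_assoc PK.l_neg)
 qed
 moreover have "p \<ominus>\<^sub>PR q : up R" using assms PK.minus_closed by (simp add: poly_carrier)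
 ultimately have "p n = (p \<ominus>\<^sub>PR q) n \<oplus> q n" using assms by (metis poly_app(2))
 then show ?thesis using assms \<open>p \<ominus>\<^sub>PR q : up R\<close> by (simp add: minus_eq a_assoc r_neg)
qed

lemma ev1_mono: "c : carrier R ==> ev1 (mono c 0) = c"
proof -
 assume c: "c : carrier R"
 have "ev1 (mono c 0) = (\<Oplus>i\<in>{..0}. mono c 0 i)" by (rule ev1_eq[OF mono_up[OF c]]) (simp add: mono_def)
 then show ?thesis using c by (simp add: mono_def)
qed

lemma path_dif: "a : up R ==> b : up R ==> dif (path_dg R) (a, b) =
  (%i. d (a i), %i. of_nat (Suc i) \<odot> a (Suc i) \<ominus> d (b i))"
 by (auto simp: path_dg_def fun_eq_iff poly_app poly_minus_app pder_up) (simp add: pder_def)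

lemma poly_sg: "p : up R ==> gmod.sg PR p i = sg (p i)"
proof -
 interpret D: derivation PR "pder R" by (rule pder_derivation)
 assume "p : up R"
 then have "p : carrier PR" by (simp add: poly_carrier)
 then show ?thesis
 proof (induct p rule: D.gr_induct)
  case (homog n p)
  then show ?case using D.sg_homog[OF homog] by (simp add: poly_app poly_gr sg_homog[of _ n])
 next
  case (add x y)
  have u: "x : up R" "y : up R" "D.sg x : up R" "D.sg y : up R"
   using add(1,2) D.sg_closed[of x] D.sg_closed[of y] by (simp_all add: poly_carrier)
  then show ?case unfolding D.sg_add[OF add(1,2)] by (simp add: poly_app(2) add(3,4) sg_add)
 qed
qed

text \<open>Integration over t. For a cocycle a + dt b the dt component gives (i + 1) a_(i+1) = d
  b_i, so the difference of the ends, which is the sum of the a_(i+1), is the differential of the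
  sum of the b_i / (i + 1). Characteristic zero permits the divisions.\<close>

lemma path_cohom:
 assumes char: "CHAR('k) = 0" and K: "dga_hom X (path_dg R) K" and z: "z : cocycles X"
 shows "ev1 (fst (K z)) \<ominus> fst (K z) 0 : coboundaries R"
proof -
 interpret K: dga_map X "path_dg R" K by unfold_locales (rule K)
 have Kz: "K z : carrier (path_dg R)" "dif (path_dg R) (K z) = \<zero>\<^bsub>path_dg R\<^esub>"
  using z by (auto simp: cocycles_def K.dif[symmetric])
 obtain a b where ab: "K z = (a, b)" "a : up R" "b : up R" using Kz(1) by (auto simp: path_carrier)
 have "(%i. of_nat (Suc i) \<odot> a (Suc i) \<ominus> d (b i)) = \<zero>\<^sub>PR"
  using Kz(2) unfolding ab(1) path_dif[OF ab(2,3)] by (simp only: path_dg_def omega_simps prod.inject)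
 then have e: "of_nat (Suc i) \<odot> a (Suc i) \<ominus> d (b i) = \<zero>" for i using fun_cong[of _ _ i] by (fastforce simp: poly_app(4))
 have a: "a (Suc i) = d (inverse (of_nat (Suc i)) \<odot> b i)" for i
 proof -
  have n: "(of_nat (Suc i) :: 'k) ~= 0" using char by (metis CHAR_eq0_iff zero_less_Suc)
  have "of_nat (Suc i) \<odot> a (Suc i) = d (b i)" using e[of i] ab by (subst (asm) minus_eq_0_iff) auto
  then have "inverse (of_nat (Suc i)) \<odot> (of_nat (Suc i) \<odot> a (Suc i)) = inverse (of_nat (Suc i)) \<odot> d (b i)" by simp
  then show ?thesis using ab n by (simp add: d.smult del: of_nat_Suc)
 qed
 obtain N where N: "!!i. i > N ==> a i = \<zero>" using upE[OF ab(2)] by blast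
 let ?u = "\<Oplus>i\<in>{..N}. inverse (of_nat (Suc i)) \<odot> b i"
 have "ev1 a = (\<Oplus>i\<in>{..Suc N}. a i)" by (rule ev1_eq) (use ab N in auto)
 also have "... = (\<Oplus>i\<in>{..N}. a (Suc i)) \<oplus> a 0" by (rule finsum_Suc2) (use ab in auto)
 also have "(\<Oplus>i\<in>{..N}. a (Suc i)) = d ?u" using ab by (simp add: d_finsum a)
 finally have "ev1 a \<ominus> a 0 = d ?u" using ab by (simp add: minus_eq a_assoc r_neg)
 then show ?thesis using ab by (auto simp: coboundaries_def)
qed

end

lemma poly_map:
 assumes "dga_hom R S f"
 shows "dga_hom (poly_dg R) (poly_dg S) (%p i. f (p i))"
proof -
 interpret f: dga_map R S f by unfold_locales fact
 have c: "(%i. f (p i)) : up S" if "p : up R" for p by (rule f.R.up_map[OF that]) auto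
 show ?thesis
 proof (rule dga_homI[OF f.R.poly_dga f.S.poly_dga])
  show "(%i. f ((x \<otimes>\<^bsub>poly_dg R\<^esub> y) i)) = (%i. f (x i)) \<otimes>\<^bsub>poly_dg S\<^esub> (%i. f (y i))"
   if "x : carrier (poly_dg R)" "y : carrier (poly_dg R)" for x y
   using that c by (auto simp: f.R.poly_carrier fun_eq_iff f.R.poly_app f.S.poly_app f.finsum f.mult)
 qed (auto simp: f.R.poly_carrier f.S.poly_carrier c fun_eq_iff f.R.poly_app f.S.poly_app
   f.add f.smult f.dif f.R.poly_gr f.S.poly_gr f.gr)
qed

lemma up_sub: "C <= carrier T ==> p : up (sub T C) \<longleftrightarrow> p : up T & (\<forall>i. p i : C)"
 by (auto simp: up_def Pi_iff)

abbreviation path_map :: "('a => 'b) => (nat => 'a) \<times> (nat => 'a) => (nat => 'b) \<times> (nat => 'b)" where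
 "path_map f \<equiv> map_prod (%p i. f (p i)) (%p i. f (p i))"

lemma path_map_hom:
 assumes "dga_hom R S f"
 shows "dga_hom (path_dg R) (path_dg S) (path_map f)"
proof -
 interpret f: dga_map R S f by unfold_locales fact
 show ?thesis unfolding path_dg_def by (rule omega_map[OF f.R.pder_derivation f.S.pder_derivation poly_map[OF assms]])
   (auto simp: f.R.poly_carrier pder_def fun_eq_iff f.smult)
qed

lemma path_map_ev:
 assumes "dga_hom R S f" "x : carrier (path_dg R)"
 shows "fst (path_map f x) 0 = f (fst x 0)"
  "dgalgebra.ev1 S (fst (path_map f x)) = f (dgalgebra.ev1 R (fst x))"
proof -
 interpret f: dga_map R S f by unfold_locales fact
 obtain a b where ab: "x = (a, b)" "a : up R" "b : up R" using assms(2) by (auto simp: f.R.path_carrier)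
 then show "fst (path_map f x) 0 = f (fst x 0)" by simp
 obtain N where N: "!!i. i > N ==> a i = \<zero>\<^sub>R" using upE[OF ab(2)] by blast
 have "(%i. f (a i)) : up S" by (rule f.R.up_map[OF ab(2)]) auto
 then show "dgalgebra.ev1 S (fst (path_map f x)) = f (dgalgebra.ev1 R (fst x))"
  using ab N by (simp add: f.S.ev1_eq[of _ N] f.R.ev1_eq[of _ N] f.finsum)
qed

text \<open>Meant for the path object of the centralizer inside the path object of the free product:
  the inclusion is the identity map, and the last premise says that the grading of A is induced from
  B.\<close>

lemma dga_hom_restrict:
 assumes "dga_hom A B (%x. x)" "dga_hom X B H" "!!x. x : carrier X ==> H x : carrier A"
  "!!n. gr B n \<inter> carrier A <= gr A n"
 shows "dga_hom X A H"
proof -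
 interpret i: dga_map A B "%x. x" by unfold_locales fact
 interpret H: dga_map X B H by unfold_locales fact
 show ?thesis by (rule dga_homI[OF H.R.dga i.R.dga])
   (use assms(3,4) H.gr in \<open>auto simp: H.add H.smult H.mult H.dif i.add i.smult i.mult i.dif
    H.R.gr_carrier intro!: subsetD[OF assms(4)]\<close>)
qed

context centralizer
begin

text \<open>Multiplication by the constant path at \<open>j m\<close> acts on each coefficient
  separately, so commuting with constants is a condition on the coefficients. This is why paths in T
  that centralize E are paths in the centralizer.\<close>

lemma path_cent:
 assumes "x : centralizer.cent E (path_dg T) ((%x. (j.S.mono x 0, \<zero>\<^bsub>poly_dg T\<^esub>)) \<circ> j)"
 shows "fst x i : cent" "snd x i : cent"
proof -
 interpret c: dga_map E "path_dg T" "(%x. (j.S.mono x 0, \<zero>\<^bsub>poly_dg T\<^esub>)) \<circ> j"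
  by unfold_locales (rule dga_hom_comp[OF j.dga_hom j.S.path_const])
 interpret C': centralizer E "path_dg T" "(%x. (j.S.mono x 0, \<zero>\<^bsub>poly_dg T\<^esub>)) \<circ> j" ..
 interpret D: derivation "poly_dg T" "pder T" by (rule j.S.pder_derivation)
 obtain a b where ab: "x = (a, b)" "a : up T" "b : up T" using assms by (auto simp: C'.cent_def j.S.path_carrier)
 have sg: "c.S.sg x = (D.sg a, \<ominus>\<^bsub>poly_dg T\<^esub> D.sg b)"
  using D.omega_sg[of x] ab by (simp add: path_dg_def j.S.poly_carrier)
 have sga: "D.sg a : up T" "D.sg b : up T" using ab D.sg_closed by (auto simp: j.S.poly_carrier)
 have neg: "\<ominus>\<^bsub>poly_dg T\<^esub> p : up T" "(\<ominus>\<^bsub>poly_dg T\<^esub> p) k = \<ominus>\<^sub>T p k" if "p : up T" for p k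
  using that j.S.PK.a_inv_closed[of p] j.S.poly_app(3)[of "-1" p] j.S.PK.sm_m1[of p] j.S.sm_m1[of "p k"] by (auto simp: j.S.poly_carrier)
 have mono: "(j.S.mono u 0 \<otimes>\<^bsub>poly_dg T\<^esub> p) k = u \<otimes>\<^sub>T p k" "(p \<otimes>\<^bsub>poly_dg T\<^esub> j.S.mono u 0) k = p k \<otimes>\<^sub>T u"
  if "u : carrier T" "p : up T" for u p k
 proof -
  have "(j.S.mono u 0 \<otimes>\<^bsub>poly_dg T\<^esub> p) k = (\<Oplus>\<^sub>T i\<in>{..k}. if i = 0 then u \<otimes>\<^sub>T p k else \<zero>\<^sub>T)"
   unfolding j.S.poly_app(1)[OF j.S.mono_up[OF that(1)] that(2)]
   by (rule j.S.finsum_cong') (use that in \<open>auto simp: j.S.mono_def\<close>)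
  also have "... = u \<otimes>\<^sub>T p k"
   using j.S.add.finprod_singleton_swap[of 0 "{..k}" "%_. u \<otimes>\<^sub>T p k"] that by simp
  finally show "(j.S.mono u 0 \<otimes>\<^bsub>poly_dg T\<^esub> p) k = u \<otimes>\<^sub>T p k" .
  have "(p \<otimes>\<^bsub>poly_dg T\<^esub> j.S.mono u 0) k = (\<Oplus>\<^sub>T i\<in>{..k}. if i = k then p k \<otimes>\<^sub>T u else \<zero>\<^sub>T)"
   unfolding j.S.poly_app(1)[OF that(2) j.S.mono_up[OF that(1)]]
   by (rule j.S.finsum_cong') (use that in \<open>auto simp: j.S.mono_def\<close>)
  also have "... = p k \<otimes>\<^sub>T u"
   using j.S.add.finprod_singleton_swap[of k "{..k}" "%_. p k \<otimes>\<^sub>T u"] that by simp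
  finally show "(p \<otimes>\<^bsub>poly_dg T\<^esub> j.S.mono u 0) k = p k \<otimes>\<^sub>T u" .
 qed
 have "a i \<otimes>\<^sub>T j m = j m \<otimes>\<^sub>T j.S.sgp n (a i) & b i \<otimes>\<^sub>T j m = j m \<otimes>\<^sub>T j.S.sgp n (b i)"
  if m: "m : gr E n" for m n
 proof -
  have mc: "m : carrier E" "j m : carrier T" using m by (auto simp: j.R.gr_carrier)
  have mu: "j.S.mono (j m) 0 : up T" using mc by simp
  have smono: "D.sg (j.S.mono (j m) 0) = ksgn n \<odot>\<^bsub>poly_dg T\<^esub> j.S.mono (j m) 0"
   by (rule D.sg_homog) (use j.gr[OF m] mu in \<open>auto simp: j.S.poly_gr, auto simp: j.S.mono_def\<close>)
  have zero: "\<zero>\<^bsub>poly_dg T\<^esub> \<otimes>\<^bsub>poly_dg T\<^esub> p = \<zero>\<^bsub>poly_dg T\<^esub>" "p \<otimes>\<^bsub>poly_dg T\<^esub> \<zero>\<^bsub>poly_dg T\<^esub> = \<zero>\<^bsub>poly_dg T\<^esub>"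
   "\<zero>\<^bsub>poly_dg T\<^esub> \<oplus>\<^bsub>poly_dg T\<^esub> p = p" "p \<oplus>\<^bsub>poly_dg T\<^esub> \<zero>\<^bsub>poly_dg T\<^esub> = p" if "p : up T" for p
   using that by (simp_all add: j.S.poly_carrier)
  have eq: "x \<otimes>\<^bsub>path_dg T\<^esub> (j.S.mono (j m) 0, \<zero>\<^bsub>poly_dg T\<^esub>) =
    (j.S.mono (j m) 0, \<zero>\<^bsub>poly_dg T\<^esub>) \<otimes>\<^bsub>path_dg T\<^esub> c.S.sgp n x"
   using C'.cent_comm[OF assms m] by simp
  show ?thesis
  proof (cases "even n")
   case True
   then have "c.S.sgp n x = (a, b)" "(ksgn n :: 'k) = 1" using ab by (simp_all add: c.S.sgp_def ksgn_def)
   with eq have "a \<otimes>\<^bsub>poly_dg T\<^esub> j.S.mono (j m) 0 = j.S.mono (j m) 0 \<otimes>\<^bsub>poly_dg T\<^esub> a"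
    "b \<otimes>\<^bsub>poly_dg T\<^esub> j.S.mono (j m) 0 = j.S.mono (j m) 0 \<otimes>\<^bsub>poly_dg T\<^esub> b"
    using ab mu sga by (simp_all add: path_dg_def zero smono j.S.poly_carrier)
   then show ?thesis using True mono[OF mc(2) ab(2), of i] mono[OF mc(2) ab(3), of i] by (simp add: j.S.sgp_def)
  next
   \<comment> \<open>For odd n the minus sign in the dt component of \<open>c.S.sg\<close> meets the
     one from moving dt past the constant \<open>j m\<close>, and they cancel.\<close>
   case False
   then have "c.S.sgp n x = (D.sg a, \<ominus>\<^bsub>poly_dg T\<^esub> D.sg b)" "(ksgn n :: 'k) = - 1"
    using sg by (simp_all add: c.S.sgp_def ksgn_def)
   with eq have "a \<otimes>\<^bsub>poly_dg T\<^esub> j.S.mono (j m) 0 = j.S.mono (j m) 0 \<otimes>\<^bsub>poly_dg T\<^esub> D.sg a"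
    "b \<otimes>\<^bsub>poly_dg T\<^esub> j.S.mono (j m) 0 = j.S.mono (j m) 0 \<otimes>\<^bsub>poly_dg T\<^esub> D.sg b" using ab mu sga neg
    by (simp_all add: path_dg_def zero smono j.S.poly_carrier j.S.PK.sm_m1 j.S.PK.l_minus j.S.PK.r_minus)
   then show ?thesis using False mono[OF mc(2) ab(2), of i] mono[OF mc(2) ab(3), of i]
     mono[OF mc(2) sga(1), of i] mono[OF mc(2) sga(2), of i] ab by (simp add: j.S.sgp_def j.S.poly_sg)
  qed
 qed
 then show "fst x i : cent" "snd x i : cent" using ab by (auto simp: cent_iff)
qed

end

text \<open>h extends to R * End V by sending End V to constant paths. The extension restricts to
  centralizers by \<open>path_cent\<close>, and after projection to \<open>rep_alg V S\<close> it
  kills commutators, because the path object of a graded commutative algebra is graded commutative.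
  The two ends are identified by \<open>fp_ext\<close>, as each is determined by its values on the
  factors.\<close>

lemma rep_homotopy:
 assumes V: "dg_complex V" "fin_total_dim V" and S: "dga S" and h: "dga_hom R (path_dg S) h"
 obtains K where "dga_hom (rep_alg V R) (path_dg (rep_alg V S)) K"
  "!!X. X : carrier (rep_alg V R) ==> fst (K X) 0 = rep_map V S (%x. fst (h x) 0) X"
  "!!X. X : carrier (rep_alg V R) ==>
   dgalgebra.ev1 (rep_alg V S) (fst (K X)) = rep_map V S (%x. dgalgebra.ev1 S (fst (h x))) X"
proof -
 interpret h: dga_map R "path_dg S" h by unfold_locales (rule h)
 interpret R: rep_ctx V R by (rule rep_ctxI[OF V h.R.dga])
 interpret S: rep_ctx V S by (rule rep_ctxI[OF V S])
 have TS: "dgalgebra S.P.T" by (rule dgalgebra.intro[OF S.P.T_dga])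
 interpret rS: dgalgebra "rep_alg V S" by unfold_locales (rule S.rep_dga)
 let ?g0 = "%x. fst (h x) 0" and ?g1 = "%x. S.R.ev1 (fst (h x))"
 have g0: "dga_hom R S ?g0" using dga_hom_comp[OF h S.R.path_ev0] by (simp add: comp_def)
 have g1: "dga_hom R S ?g1" using dga_hom_comp[OF h S.R.path_ev1] by (simp add: comp_def)
 let ?c = "(%x. (dgalgebra.mono S.P.T x 0, \<zero>\<^bsub>poly_dg S.P.T\<^esub>)) \<circ> fp_inr S R.E"
 obtain H where H: "dga_hom R.P.T (path_dg S.P.T) H"
  "!!x. x : carrier R ==> H (fp_inl R R.E x) = path_map (fp_inl S R.E) (h x)"
  "!!y. y : carrier R.E ==> H (fp_inr R R.E y) = ?c y" using R.P.fp_lift[OF dga_hom_comp[OF h path_map_hom[OF S.P.fp_inl_hom]]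
    dga_hom_comp[OF S.P.fp_inr_hom dgalgebra.path_const[OF TS]]] by (auto simp: comp_def)
 interpret H: dga_map R.P.T "path_dg S.P.T" H by unfold_locales (rule H)
 interpret iR: dga_map R R.P.T "fp_inl R R.E" by unfold_locales (rule R.P.fp_inl_hom)
 interpret jR: dga_map R.E R.P.T "fp_inr R R.E" by unfold_locales (rule R.P.fp_inr_hom)
 interpret jS: dga_map R.E S.P.T "fp_inr S R.E" by unfold_locales (rule S.P.fp_inr_hom)
 have alg: "dga_hom A B f ==> alg_hom A B f" for A B f by (simp add: dga_hom_def galg_hom_def)
 note L0 = fp_map_hom[OF g0 R.E_dga] and L1 = fp_map_hom[OF g1 R.E_dga]
 have e0: "fst (H w) 0 = fp_hom S R.E ?g0 w" if w: "w : carrier R.P.T" for w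
 proof -
  have "((%x. fst x 0) \<circ> H) w = fp_hom S R.E ?g0 w"
  proof (rule R.P.fp_ext[OF alg[OF dga_hom_comp[OF H(1) dgalgebra.path_ev0[OF TS]]] alg[OF L0(1)] _ _ w])
   show "((%x. fst x 0) \<circ> H) (fp_inl R R.E x) = fp_hom S R.E ?g0 (fp_inl R R.E x)" if "x : carrier R" for x
    using that path_map_ev(1)[OF S.P.fp_inl_hom h.closed[OF that]] by (simp add: H(2) L0(2))
   show "((%x. fst x 0) \<circ> H) (fp_inr R R.E y) = fp_hom S R.E ?g0 (fp_inr R R.E y)" if "y : carrier R.E" for y
    using that by (simp add: H(3) L0(3) dgalgebra.mono_def[OF TS])
  qed
  then show ?thesis by simp
 qed
 have e1: "dgalgebra.ev1 S.P.T (fst (H w)) = fp_hom S R.E ?g1 w" if w: "w : carrier R.P.T" for w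
 proof -
  have "((%x. dgalgebra.ev1 S.P.T (fst x)) \<circ> H) w = fp_hom S R.E ?g1 w"
  proof (rule R.P.fp_ext[OF alg[OF dga_hom_comp[OF H(1) dgalgebra.path_ev1[OF TS]]] alg[OF L1(1)] _ _ w])
   show "((%x. dgalgebra.ev1 S.P.T (fst x)) \<circ> H) (fp_inl R R.E x) = fp_hom S R.E ?g1 (fp_inl R R.E x)" if "x : carrier R" for x
    using that path_map_ev(2)[OF S.P.fp_inl_hom h.closed[OF that]] by (simp add: H(2) L1(2))
   show "((%x. dgalgebra.ev1 S.P.T (fst x)) \<circ> H) (fp_inr R R.E y) = fp_hom S R.E ?g1 (fp_inr R R.E y)" if y: "y : carrier R.E" for y
   proof -
    have "dgalgebra.ev1 S.P.T (dgalgebra.mono S.P.T (fp_inr S R.E y) 0) = fp_inr S R.E y"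
     using dgalgebra.ev1_mono[OF TS, of "fp_inr S R.E y"] y by simp
    then show ?thesis using y by (simp add: H(3) L1(3))
   qed
  qed
  then show ?thesis by simp
 qed
 have Hc: "fst (H w) i : S.C.cent" "snd (H w) i : S.C.cent" if w: "w : R.C.cent" for w i
 proof -
  have cS: "dga_hom R.E (path_dg S.P.T) ?c" by (rule dga_hom_comp[OF S.P.fp_inr_hom dgalgebra.path_const[OF TS]])
  interpret c: dga_map R.E "path_dg S.P.T" ?c by unfold_locales (rule cS)
  have "H w : centralizer.cent R.E (path_dg S.P.T) ?c" by (rule cent_map[OF R.C.centralizer_axioms _ H(1) H(3) w]) (unfold_locales)
  from S.C.path_cent[OF this] show "fst (H w) i : S.C.cent" "snd (H w) i : S.C.cent" by auto
 qed
 have inc: "dga_hom (root_alg V S) S.P.T (%x. x)" unfolding S.root_alg_eq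
  by (rule dga_homI[OF S.C.cent_dga S.P.T_dga]) (auto simp: S.C.C.S_carrier)
 have incR: "dga_hom (root_alg V R) R.P.T (%x. x)" unfolding R.root_alg_eq
  by (rule dga_homI[OF R.C.cent_dga R.P.T_dga]) (auto simp: R.C.C.S_carrier)
 have Hroot: "dga_hom (root_alg V R) (path_dg (root_alg V S)) H"
 proof (rule dga_hom_restrict)
  have "path_map (%x. x) = (%x. x :: (nat => _) \<times> (nat => _))" by (auto simp: fun_eq_iff)
  then show "dga_hom (path_dg (root_alg V S)) (path_dg S.P.T) (%x. x)" using path_map_hom[OF inc] by simp
  show "dga_hom (root_alg V R) (path_dg S.P.T) H" using dga_hom_comp[OF incR H(1)] by (simp add: comp_def)
  show "H x : carrier (path_dg (root_alg V S))" if "x : carrier (root_alg V R)" for x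
  proof -
   have x: "x : R.C.cent" using that by (simp add: R.root_carrier)
   then have "H x : carrier (path_dg S.P.T)" by (intro H.closed) (auto simp: R.C.cent_def)
   then have "fst (H x) : up S.P.T" "snd (H x) : up S.P.T" by (auto simp: dgalgebra.path_carrier[OF TS])
   then show ?thesis unfolding S.root.path_carrier mem_Times_iff unfolding S.root_alg_eq up_sub[OF S.C.C.S_sub] using Hc[OF x] by blast
  qed
  show "gr (path_dg S.P.T) n \<inter> carrier (path_dg (root_alg V S)) <= gr (path_dg (root_alg V S)) n" for n
   unfolding S.root.path_carrier subset_iff Int_iff mem_Times_iff S.root.path_gr dgalgebra.path_gr[OF TS]
   unfolding S.root_alg_eq up_sub[OF S.C.C.S_sub] sub_simps by blast
 qed
 have K1: "dga_hom (root_alg V R) (path_dg (rep_alg V S)) (path_map S.\<rho> \<circ> H)"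
  by (rule dga_hom_comp[OF Hroot path_map_hom[OF S.rep_proj]])
 interpret K1: dga_map "root_alg V R" "path_dg (rep_alg V S)" "path_map S.\<rho> \<circ> H" by unfold_locales (rule K1)
 have gc: "gcomm (path_dg (rep_alg V S)) x y = \<zero>\<^bsub>path_dg (rep_alg V S)\<^esub>"
  if "x : carrier (path_dg (rep_alg V S))" "y : carrier (path_dg (rep_alg V S))" for x y
  by (rule K1.S.gcomm_zero[OF rS.path_gcalg[OF S.rep_gcalg] that])
 have "comm_ideal (root_alg V R) <= {x : carrier (root_alg V R). (path_map S.\<rho> \<circ> H) x = \<zero>\<^bsub>path_dg (rep_alg V S)\<^esub>}"
 proof (rule R.root.comm_ideal_minimal[OF K1.kernel_ideal])
  fix x y assume "x : carrier (root_alg V R)" "y : carrier (root_alg V R)"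
  then show "gcomm (root_alg V R) x y : {x : carrier (root_alg V R). (path_map S.\<rho> \<circ> H) x = \<zero>\<^bsub>path_dg (rep_alg V S)\<^esub>}"
   using K1.gcomm[of x y] gc K1.closed by auto
 qed
 then have "(path_map S.\<rho> \<circ> H) x = \<zero>\<^bsub>path_dg (rep_alg V S)\<^esub>" if "x : comm_ideal (root_alg V R)" for x
  using that by blast
 from R.root.A.Q_lift[OF K1.pdga_hom this] obtain K where K: "pdga_hom (rep_alg V R) (path_dg (rep_alg V S)) K"
  "!!w. w : carrier (root_alg V R) ==> K (R.\<rho> w) = (path_map S.\<rho> \<circ> H) w" unfolding rep_alg_def by blast
 show ?thesis
 proof
  show "dga_hom (rep_alg V R) (path_dg (rep_alg V S)) K" using K(1) R.rep_dga K1.S.dga by (simp add: dga_hom_iff)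
  fix X assume "X : carrier (rep_alg V R)"
  then obtain w where w: "w : carrier (root_alg V R)" "X = R.\<rho> w" by (auto simp: R.rep_carrier R.root_carrier)
  then have wT: "w : carrier R.P.T" by (auto simp: R.root_carrier R.C.cent_def)
  have Hw: "H w : carrier (path_dg (root_alg V S))" using Hroot w(1) by (auto simp: dga_hom_def galg_hom_def alg_hom_def linear_map_def)
  show "fst (K X) 0 = rep_map V S ?g0 X" using w wT path_map_ev(1)[OF S.rep_proj Hw] by (simp add: K(2) rep_map_class[OF V g0] e0)
  have "S.root.ev1 (fst (H w)) = dgalgebra.ev1 S.P.T (fst (H w))" using path_map_ev(2)[OF inc Hw] by (simp add: map_prod_def case_prod_beta)
  then show "rS.ev1 (fst (K X)) = rep_map V S ?g1 X"
   using w wT path_map_ev(2)[OF S.rep_proj Hw] by (simp add: K(2) rep_map_class[OF V g1] e1)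
 qed
qed

section \<open>Resolutions, lifts up to homotopy, and parts (a) and (b)\<close>

section \<open>Almost free resolutions\<close>

lemma conc_simps [simp]:
 "carrier (conc A) = carrier A" "monoid.mult (conc A) = monoid.mult A" "one (conc A) = one A"
 "ring.zero (conc A) = ring.zero A" "add (conc A) = add A" "smult (conc A) = smult A"
 "gr (conc A) n = (if n = 0 then carrier A else {\<zero>\<^sub>A})" "dif (conc A) x = \<zero>\<^sub>A" by (simp_all add: conc_def)

lemma conc_dga:
 assumes "kalg A"
 shows "dga (conc A)"
proof -
 interpret A: kalgebra A by unfold_locales fact
 have k: "kalg (conc A)" by (rule kalg_cong[OF assms]) simp_all
 interpret C: kalgebra "conc A" by unfold_locales (rule k)
 have s: "submodule (gr (conc A) n) ground (conc A)" for n by (rule C.submoduleI') auto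
 have l: "linear_map (conc A) (conc A) (%x. if n = (0::int) then x else \<zero>\<^sub>A)" for n by (intro linear_mapI) auto
 have "graded_module (conc A)"
 proof (rule gmodI_span[OF C.kmod s l])
  show "(if m = 0 then x else \<zero>\<^sub>A) = (if m = n then x else \<zero>\<^bsub>conc A\<^esub>)" if "x : gr (conc A) n" for x n m
   using that by (auto split: if_splits)
  show "Q x" if "x : carrier (conc A)" "!!n x. x : gr (conc A) n ==> Q x" for x Q using that(1) that(2)[of x 0] by simp
 qed
 then have "galg (conc A)" using k by (auto simp: galg_def split: if_splits)
 then show ?thesis by (auto simp: dga_iff pre_dga_def intro!: linear_mapI split: if_splits)
qed

lemma conc_coboundaries: "kalg A ==> coboundaries (conc A) = {\<zero>\<^sub>A}"
proof -
 assume "kalg A"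
 then interpret dgalgebra "conc A" using conc_dga by unfold_locales
 show ?thesis using zero_closed by (auto simp: coboundaries_def)
qed

lemma conc_cocycles: "cocycles (conc A) = carrier A"
 by (auto simp: cocycles_def)

locale afr =
 fixes A :: "('k::field, 'a) module" and R :: "('k, 'r) dg" and p
 assumes afr: "almost_free_res A (R, p)"
begin

lemma qi: "kalg A" "dga_hom R (conc A) p"
  "bij_betw (cohom_map (conc A) p) (carrier (cohom R)) (carrier (cohom (conc A)))"
 using afr by (auto simp: almost_free_res_def quasi_iso_def)

end

sublocale afr \<subseteq> p: dga_map R "conc A" p by unfold_locales (rule qi)

context afr
begin

lemma nonpos: "i > 0 ==> gr R i = {\<zero>\<^sub>R}"
 using afr by (auto simp: almost_free_res_def)

lemma free: "\<exists>X. nonpos_free R X"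
proof -
 obtain X where "X <= (\<Union>n. gr R n)" "bij_betw (free_eval R) {f. keys f <= lists X} (carrier R)"
  using afr by (auto simp: almost_free_res_def free_galg_def)
 then have "nonpos_free R X" by unfold_locales (use nonpos in auto)
 then show ?thesis ..
qed

lemma p_zero: "x : gr R n ==> n ~= 0 ==> p x = \<zero>\<^sub>A"
 using p.gr[of x n] by simp

lemma p_dif: "x : carrier R ==> p (dif R x) = \<zero>\<^sub>A"
 by (simp add: p.dif)

text \<open>Surjectivity on cohomology becomes surjectivity on elements because zero is the only
  coboundary of \<open>conc A\<close>; passing to the part of degree 0 does not change the
  image.\<close>

lemma surj: "b : carrier A ==> \<exists>z\<in>gr R 0. p z = b"
proof -
 assume b: "b : carrier A"
 have "coboundaries (conc A) +>\<^bsub>conc A\<^esub> b : carrier (cohom (conc A))"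
  using b by (simp add: p.S.cohom_carrier conc_cocycles)
 then have "coboundaries (conc A) +>\<^bsub>conc A\<^esub> b : cohom_map (conc A) p ` carrier (cohom R)"
  using qi(3) unfolding bij_betw_def by blast
 then obtain c where "c : carrier (cohom R)" "cohom_map (conc A) p c = coboundaries (conc A) +>\<^bsub>conc A\<^esub> b"
  by (elim imageE) simp
 then obtain z where z: "z : cocycles R"
  "coboundaries (conc A) +>\<^bsub>conc A\<^esub> p z = coboundaries (conc A) +>\<^bsub>conc A\<^esub> b"
  by (auto simp: p.R.cohom_carrier p.cohom_map_class)
 have zc: "z : carrier R" using z by (auto simp: cocycles_def)
 then have "p z \<ominus>\<^bsub>conc A\<^esub> b : coboundaries (conc A)"
  using z(2) b by (subst (asm) p.S.cohom_class_eq) (use p.closed[OF zc] in \<open>auto simp: conc_cocycles\<close>)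
 then have "p z = b" using b p.closed[OF zc] p.S.minus_eq_0_iff[of "p z" b] by (simp add: conc_coboundaries[OF qi(1)])
 moreover have "p (homog_part R z 0) = p z" using p.pr[OF zc, of 0] p.S.pr_homog[of "p z" 0 0] p.closed[OF zc] by simp
 ultimately show ?thesis using zc p.R.pr_gr[OF zc, of 0] by (intro bexI[of _ "homog_part R z 0"]) simp_all
qed

text \<open>Injectivity on cohomology yields a primitive. It lies in degree n - 1 and is killed by p
  for degree reasons unless n = 1, and then z itself is zero.\<close>

lemma acyclic:
 assumes z: "z : gr R n" "dif R z = \<zero>\<^sub>R" "p z = \<zero>\<^sub>A"
 shows "\<exists>u\<in>gr R (n - 1). p u = \<zero>\<^sub>A & dif R u = z"
proof (cases "n = 1")
 case True
 then have "z = \<zero>\<^sub>R" using z(1) nonpos[of 1] by simp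
 then show ?thesis using True p.zero by (intro bexI[of _ "\<zero>\<^sub>R"]) auto
next
 case False
 have zc: "z : cocycles R" "\<zero>\<^sub>R : cocycles R" "z : carrier R" using z by (auto simp: cocycles_def p.R.gr_carrier)
 have "cohom_map (conc A) p (coboundaries R +>\<^sub>R z) = cohom_map (conc A) p (coboundaries R +>\<^sub>R \<zero>\<^sub>R)"
  using zc z(3) p.zero by (simp add: p.cohom_map_class)
 then have "coboundaries R +>\<^sub>R z = coboundaries R +>\<^sub>R \<zero>\<^sub>R"
  by (rule inj_onD[OF bij_betw_imp_inj_on[OF qi(3)]]) (use zc in \<open>auto simp: p.R.cohom_carrier\<close>)
 then have "z : coboundaries R" using zc by (simp add: p.R.cohom_class_eq p.R.minus_eq)
 then obtain u where u: "u : carrier R" "z = dif R u" by (auto simp: coboundaries_def)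
 have "dif R (homog_part R u (n - 1)) = z" using p.R.pr_d[OF u(1), of n] p.R.pr_homog[OF z(1), of n] u(2) by simp
 then show ?thesis using u(1) False p_zero[OF p.R.pr_gr[OF u(1)], of "n - 1"] by (intro bexI[of _ "homog_part R u (n - 1)"]) auto
qed

end

text \<open>\<open>lift_exists\<close> for the relation q y = f (p x). The fibre over zero is the
  kernel of q, acyclic by \<open>acyclic\<close>.\<close>

lemma lift_exists_afr:
 assumes R: "almost_free_res A (R, p)" and S: "almost_free_res B (S, q)" and f: "alg_hom A B f"
 shows "\<exists>g. is_lift (R, p) (S, q) f g"
proof -
 interpret R: afr A R p by unfold_locales fact
 interpret S: afr B S q by unfold_locales fact
 interpret f: alg_map A B f by unfold_locales fact
 obtain X where "nonpos_free R X" using R.free by blast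
 then interpret F: nonpos_free R X .
 interpret F: free_target R X S ..
 have "\<exists>h. dga_hom R S h & (\<forall>x\<in>carrier R. q (h x) = f (p x))"
 proof (rule F.lift_exists)
  show "\<exists>y\<in>gr S n. q y = f (p x)" if "x : gr R n" for x n
  proof (cases "n = 0")
   case True
   have "f (p x) : carrier B" using R.p.closed[of x] that by (simp add: R.p.R.gr_carrier)
   then show ?thesis using S.surj True by simp
  next
   case False
   then show ?thesis using R.p_zero[OF that] S.p.zero by (intro bexI[of _ "\<zero>\<^sub>S"]) auto
  qed
  show "\<exists>u\<in>gr S (n - 1). q u = f (p \<zero>\<^sub>R) & dif S u = z"
   if "z : gr S n" "q z = f (p \<zero>\<^sub>R)" "dif S z = \<zero>\<^sub>S" for z n
   using S.acyclic[OF that(1,3)] that(2) R.p.zero by simp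
  show "q (dif S y) = f (p (dif R x))" if "x : carrier R" "y : carrier S" for x y using that by (simp add: R.p_dif S.p_dif)
 qed (use R.p.closed R.p.one S.p.one in \<open>simp_all add: R.p.add S.p.add f.add R.p.smult S.p.smult f.smult R.p.mult S.p.mult f.mult\<close>)
 then show ?thesis by (auto simp: is_lift_def)
qed

text \<open>\<open>lift_exists\<close> with the path object as target: y is admissible at x if it
  runs from g x to g' x and its image in the path object of \<open>conc B\<close> is the constant
  path at q (g x). The last condition confines the fibre over zero to paths with coefficients in the
  acyclic kernel of q.\<close>

lemma lift_homotopy:
 assumes R: "almost_free_res A (R, p)" and S: "almost_free_res B (S, q)"
  and g: "is_lift (R, p) (S, q) f g" and g': "is_lift (R, p) (S, q) f g'"
 shows "\<exists>h. dga_hom R (path_dg S) h &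
  (\<forall>x\<in>carrier R. fst (h x) 0 = g x & dgalgebra.ev1 S (fst (h x)) = g' x)"
proof -
 interpret R: afr A R p by unfold_locales fact
 interpret S: afr B S q by unfold_locales fact
 interpret B: kalgebra B by unfold_locales (rule S.qi(1))
 obtain X where "nonpos_free R X" using R.free by blast
 then interpret F: nonpos_free R X .
 interpret g: dga_map R S g by unfold_locales (use g in \<open>simp add: is_lift_def\<close>)
 interpret g': dga_map R S g' by unfold_locales (use g' in \<open>simp add: is_lift_def\<close>)
 have qg: "q (g x) = q (g' x)" if "x : carrier R" for x using g g' that by (simp add: is_lift_def)
 interpret e0: dga_map "path_dg S" S "%x. fst x 0" by unfold_locales (rule S.p.R.path_ev0)
 interpret e1: dga_map "path_dg S" S "%x. S.p.R.ev1 (fst x)" by unfold_locales (rule S.p.R.path_ev1)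
 interpret F: free_target R X "path_dg S" ..
 interpret D: derivation "poly_dg S" "pder S" by (rule S.p.R.pder_derivation)
 interpret L: dga_map "path_dg S" "path_dg (conc B)" "path_map q" by unfold_locales (rule path_map_hom[OF S.qi(2)])
 define k where "k x = (S.p.S.mono (q (g x)) 0, \<zero>\<^bsub>poly_dg (conc B)\<^esub>)" for x
 interpret K: dga_map R "path_dg (conc B)" k using dga_hom_comp[OF dga_hom_comp[OF g.dga_hom S.qi(2)] S.p.S.path_const]
  by unfold_locales (simp add: comp_def k_def[abs_def])
 note pa = S.p.R.poly_app and pb = S.p.S.poly_app
 have z: "c \<odot>\<^sub>B \<zero>\<^sub>B = \<zero>\<^sub>B" for c using S.p.S.sm_0r by auto
 have qc: "q x : carrier B" if "x : carrier S" for x using S.p.closed[OF that] by simp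
 have qsum: "q (\<Oplus>\<^sub>S i\<in>I. F i) = \<zero>\<^sub>B" if "!!i. i : I ==> F i : carrier S" "!!i. i : I ==> q (F i) = \<zero>\<^sub>B"
  for F and I :: "nat set"
 proof -
  have "q (\<Oplus>\<^sub>S i\<in>I. F i) = (\<Oplus>\<^bsub>conc B\<^esub>i\<in>I. q (F i))" by (rule S.p.finsum) (use that in auto)
  also have "... = (\<Oplus>\<^bsub>conc B\<^esub>i\<in>I. \<zero>\<^bsub>conc B\<^esub>)" by (rule S.p.S.finsum_cong') (use that in auto)
  also have "... = \<zero>\<^bsub>conc B\<^esub>" by (rule S.p.S.finsum_zero)
  finally show ?thesis by simp
 qed
 have K0: "k \<zero>\<^sub>R = (%_. \<zero>\<^sub>B, %_. \<zero>\<^sub>B)"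
  using S.p.zero by (auto simp: k_def S.p.S.mono_def fun_eq_iff pb)
 have "\<exists>h. dga_hom R (path_dg S) h & (\<forall>x\<in>carrier R. (fst (h x) 0 = g x & S.p.R.ev1 (fst (h x)) = g' x) &
   path_map q (h x) = k x)"
 proof (rule F.lift_exists)
  fix x n assume x: "x : gr R n"
  then have xc: "x : carrier R" by (simp add: R.p.R.gr_carrier)
  \<comment> \<open>The straight path g x + t (g' x - g x), later paired with zero dt component. Its
    image under q is constant since q (g x) = q (g' x).\<close>
  let ?a = "%i::nat. if i = 0 then g x else if i = 1 then g' x \<ominus>\<^sub>S g x else \<zero>\<^sub>S"
  have gx: "g x : gr S n" "g' x : gr S n" "g x : carrier S" "g' x : carrier S" using g.gr[OF x] g'.gr[OF x] xc by auto
  have a: "?a : up S" by (rule upI[of _ _ 1]) (use gx in auto)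
  have "S.p.R.ev1 ?a = (\<Oplus>\<^sub>S i\<in>{..Suc 0}. ?a i)" by (rule S.p.R.ev1_eq[OF a]) simp
  also have "... = (g' x \<ominus>\<^sub>S g x) \<oplus>\<^sub>S g x" using gx by (simp del: One_nat_def)
  also have "... = g' x" using gx by (simp add: S.p.R.minus_eq S.p.R.a_assoc S.p.R.l_neg)
  finally have e: "S.p.R.ev1 ?a = g' x" .
  have "q (g' x \<ominus>\<^sub>S g x) = \<zero>\<^sub>B"
   using gx qg[OF xc] qc[OF gx(3)] S.p.minus[of "g' x" "g x"] S.p.S.minus_eq_0_iff[of "q (g x)" "q (g x)"] by simp
  then have "path_map q (?a, \<zero>\<^bsub>poly_dg S\<^esub>) = k x" using S.p.zero by (auto simp: k_def fun_eq_iff S.p.S.mono_def pa pb)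
  moreover have "(?a, \<zero>\<^bsub>poly_dg S\<^esub>) : gr (path_dg S) n" using a gx by (auto simp: S.p.R.path_gr pa)
  ultimately show "\<exists>y\<in>gr (path_dg S) n. (fst y 0 = g x & S.p.R.ev1 (fst y) = g' x) &
    path_map q y = k x" using e by (intro bexI[of _ "(?a, \<zero>\<^bsub>poly_dg S\<^esub>)"]) auto
 next
  fix z n assume z1: "z : gr (path_dg S) n"
   and z2: "(fst z 0 = g \<zero>\<^sub>R & S.p.R.ev1 (fst z) = g' \<zero>\<^sub>R) &
    path_map q z = k \<zero>\<^sub>R" and z3: "dif (path_dg S) z = \<zero>\<^bsub>path_dg S\<^esub>"
  obtain a b where ab: "z = (a, b)" "a : up S" "b : up S" "!!i. a i : gr S n" "!!i. b i : gr S (n - 1)"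
   using z1 by (cases z) (auto simp: S.p.R.path_gr)
  have a0: "a 0 = \<zero>\<^sub>S" "S.p.R.ev1 a = \<zero>\<^sub>S" and qa: "!!i. q (a i) = \<zero>\<^sub>B" and qb: "!!i. q (b i) = \<zero>\<^sub>B"
   using z2 ab(1) unfolding K0 by (auto simp: fun_eq_iff)
  have dz: "dif S (a i) = \<zero>\<^sub>S" "of_nat (Suc i) \<odot>\<^sub>S a (Suc i) \<ominus>\<^sub>S dif S (b i) = \<zero>\<^sub>S" for i
  proof -
   have "(%i. dif S (a i)) = \<zero>\<^bsub>poly_dg S\<^esub>" "(%i. of_nat (Suc i) \<odot>\<^sub>S a (Suc i) \<ominus>\<^sub>S dif S (b i)) = \<zero>\<^bsub>poly_dg S\<^esub>"
    using z3 unfolding ab(1) S.p.R.path_dif[OF ab(2,3)] by (simp_all only: path_dg_def omega_simps prod.inject)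
   from this[THEN fun_cong, of i] show "dif S (a i) = \<zero>\<^sub>S" "of_nat (Suc i) \<odot>\<^sub>S a (Suc i) \<ominus>\<^sub>S dif S (b i) = \<zero>\<^sub>S"
    by (simp_all only: pa(4))
  qed
  obtain M where M: "!!i. i > M ==> a i = \<zero>\<^sub>S" using upE[OF ab(2)] by blast
  \<comment> \<open>Primitives are taken coefficient by coefficient; choosing 0 wherever a i = 0
    keeps the result a polynomial.\<close>
  have "\<exists>u. u : gr S (n - 1) & q u = \<zero>\<^sub>B & dif S u = a i & (a i = \<zero>\<^sub>S --> u = \<zero>\<^sub>S)" for i
   using S.acyclic[OF ab(4) dz(1) qa, of i] S.p.zero by (cases "a i = \<zero>\<^sub>S") auto
  then obtain c0 where c0: "!!i. c0 i : gr S (n - 1)" "!!i. q (c0 i) = \<zero>\<^sub>B" "!!i. dif S (c0 i) = a i"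
   "!!i. a i = \<zero>\<^sub>S ==> c0 i = \<zero>\<^sub>S" by metis
  have c0c: "c0 i : carrier S" for i using c0(1) by (rule S.p.R.gr_carrier)
  define s where "s = (\<Oplus>\<^sub>S i\<in>{..M}. c0 (Suc (Suc i)))"
  \<comment> \<open>The coefficient of t is adjusted so that c vanishes at t = 1. Its differential
    is still a 1, because the coefficients of a add up to zero and a 0 = 0.\<close>
  define c where "c i = (if i = 1 then \<ominus>\<^sub>S s else c0 i)" for i
  have s: "s : gr S (n - 1)" "s : carrier S" "q s = \<zero>\<^sub>B"
   unfolding s_def using c0 c0c by (auto intro!: S.p.R.finsum_gr qsum)
  have c00: "c0 0 = \<zero>\<^sub>S" using c0(4) a0 by simp
  have cg: "c i : gr S (n - 1)" "c i : carrier S" for i using c0 s c0c by (auto simp: c_def)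
  have cM: "c i = \<zero>\<^sub>S" if "i > Suc (Suc M)" for i using that c0(4)[OF M] by (simp add: c_def)
  have cu: "c : up S" by (rule upI[of _ _ "Suc (Suc M)"]) (use cg cM in auto)
  have sum2: "(\<Oplus>\<^sub>S i\<in>{..Suc (Suc M)}. F i) = ((\<Oplus>\<^sub>S i\<in>{..M}. F (Suc (Suc i))) \<oplus>\<^sub>S F 1) \<oplus>\<^sub>S F 0"
   if "!!i. F i : carrier S" for F :: "nat => _" using that by (subst S.p.R.finsum_Suc2, simp, subst S.p.R.finsum_Suc2) auto
  have "S.p.R.ev1 c = (\<Oplus>\<^sub>S i\<in>{..Suc (Suc M)}. c i)" by (rule S.p.R.ev1_eq[OF cu cM])
  also have "... = \<zero>\<^sub>S" unfolding sum2[OF cg(2)] using s c00 by (simp add: c_def s_def[symmetric] S.p.R.r_neg)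
  finally have ec: "S.p.R.ev1 c = \<zero>\<^sub>S" .
  have "dif S s = (\<Oplus>\<^sub>S i\<in>{..M}. a (Suc (Suc i)))" unfolding s_def using c0c by (simp add: S.p.R.d_finsum c0(3))
  moreover have "((\<Oplus>\<^sub>S i\<in>{..M}. a (Suc (Suc i))) \<oplus>\<^sub>S a 1) \<oplus>\<^sub>S a 0 = \<zero>\<^sub>S"
   using a0(2) S.p.R.ev1_eq[OF ab(2), of "Suc (Suc M)"] M sum2[of a] ab(2) by simp
  ultimately have "dif S s \<oplus>\<^sub>S a 1 = \<zero>\<^sub>S" using a0 ab(2) s by simp
  then have "\<ominus>\<^sub>S dif S s = a 1" using s ab(2) by (metis S.p.R.add.inv_equality S.p.R.a_comm S.p.R.d.closed S.p.R.up_car S.p.R.minus_equality)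
  then have dc: "dif S (c i) = a i" for i using s c0(3) by (simp add: c_def S.p.R.d.neg)
  have qc: "q (c i) = \<zero>\<^sub>B" for i
  proof -
   have "q (\<ominus>\<^sub>S s) = \<zero>\<^sub>B" using s(2,3) S.p.neg[OF s(2)] S.p.S.minus_zero by simp
   then show ?thesis using c0(2) by (simp add: c_def)
  qed
  \<comment> \<open>What remains of b after subtracting dc/dt: its coefficients are cycles in the
    kernel of q, hence again boundaries there.\<close>
  let ?\<beta> = "%i. b i \<ominus>\<^sub>S of_nat (Suc i) \<odot>\<^sub>S c (Suc i)"
  have bc: "b i : carrier S" "a i : carrier S" for i using ab by auto
  have \<beta>g: "?\<beta> i : gr S (n - 1)" for i using ab(5) cg(1) by auto
  have \<beta>d: "dif S (?\<beta> i) = \<zero>\<^sub>S" for i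
  proof -
   have "of_nat (Suc i) \<odot>\<^sub>S a (Suc i) = dif S (b i)" using dz(2)[of i] bc by (subst (asm) S.p.R.minus_eq_0_iff) auto
   moreover have "dif S (?\<beta> i) = dif S (b i) \<ominus>\<^sub>S of_nat (Suc i) \<odot>\<^sub>S a (Suc i)"
    using bc cg(2) by (subst S.p.R.d.minus) (auto simp: S.p.R.d.smult dc)
   ultimately show ?thesis using bc by (simp add: S.p.R.minus_eq S.p.R.r_neg)
  qed
  have \<beta>q: "q (?\<beta> i) = \<zero>\<^sub>B" for i
  proof -
   have "q (?\<beta> i) = q (b i) \<ominus>\<^bsub>conc B\<^esub> of_nat (Suc i) \<odot>\<^sub>B q (c (Suc i))"
    using bc cg(2) by (subst S.p.minus) (auto simp: S.p.smult)
   then show ?thesis using qb qc z S.p.S.minus_eq_0_iff[of "\<zero>\<^sub>B" "\<zero>\<^sub>B"] S.p.S.zero_closed by simp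
  qed
  obtain Mb where Mb: "!!i. i > Mb ==> b i = \<zero>\<^sub>S" using upE[OF ab(3)] by blast
  have "\<exists>u. u : gr S (n - 2) & q u = \<zero>\<^sub>B & dif S u = ?\<beta> i & (?\<beta> i = \<zero>\<^sub>S --> u = \<zero>\<^sub>S)" for i
   using S.acyclic[OF \<beta>g \<beta>d \<beta>q, of i] S.p.zero by (cases "?\<beta> i = \<zero>\<^sub>S") auto
  then obtain e where e: "!!i. e i : gr S (n - 2)" "!!i. q (e i) = \<zero>\<^sub>B" "!!i. dif S (e i) = ?\<beta> i"
   "!!i. ?\<beta> i = \<zero>\<^sub>S ==> e i = \<zero>\<^sub>S" by metis
  have ecar: "e i : carrier S" for i using e(1) by (rule S.p.R.gr_carrier)
  \<comment> \<open>The sign compensates the minus in d(c + dt b) = d c + dt (dc/dt - d b).\<close>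
  let ?e = "%i. \<ominus>\<^sub>S e i"
  have eu: "?e : up S"
  proof (rule upI[of _ _ "Mb + Suc (Suc M)"])
   fix i assume "i > Mb + Suc (Suc M)"
   then have "?\<beta> i = \<zero>\<^sub>S" using Mb[of i] cM[of "Suc i"] by (simp add: S.p.R.minus_eq)
   then show "?e i = \<zero>\<^sub>S" using e(4) by simp
  qed (use ecar in auto)
  have "dif (path_dg S) (c, ?e) = (a, b)" unfolding S.p.R.path_dif[OF cu eu]
  proof (rule prod.inject[THEN iffD2, OF conjI])
   show "(%i. dif S (c i)) = a" using dc by auto
   show "(%i. of_nat (Suc i) \<odot>\<^sub>S c (Suc i) \<ominus>\<^sub>S dif S (\<ominus>\<^sub>S e i)) = b"
   proof
    fix i
    have "of_nat (Suc i) \<odot>\<^sub>S c (Suc i) \<ominus>\<^sub>S dif S (\<ominus>\<^sub>S e i) = of_nat (Suc i) \<odot>\<^sub>S c (Suc i) \<oplus>\<^sub>S ?\<beta> i"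
     using ecar bc cg(2) e(3)[of i] by (simp add: S.p.R.d.neg S.p.R.minus_eq)
    also have "... = b i" using bc cg(2) by (simp add: S.p.R.minus_eq S.p.R.a_lcomm S.p.R.r_neg)
    finally show "of_nat (Suc i) \<odot>\<^sub>S c (Suc i) \<ominus>\<^sub>S dif S (\<ominus>\<^sub>S e i) = b i" .
   qed
  qed
  moreover have "(c, ?e) : gr (path_dg S) (n - 1)" using cu eu cg(1) e(1) by (auto simp: S.p.R.path_gr)
  moreover have "path_map q (c, ?e) = (%_. \<zero>\<^sub>B, %_. \<zero>\<^sub>B)"
   using ecar e(2) qc S.p.neg[of "e _"] S.p.S.minus_zero by (simp add: fun_eq_iff)
  ultimately show "\<exists>u\<in>gr (path_dg S) (n - 1).
    ((fst u 0 = g \<zero>\<^sub>R & S.p.R.ev1 (fst u) = g' \<zero>\<^sub>R) &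
     path_map q u = k \<zero>\<^sub>R) & dif (path_dg S) u = z"
   unfolding K0 using ec c00 by (intro bexI[of _ "(c, ?e)"]) (auto simp: c_def ab(1))
 qed (simp_all only: e0.add e1.add L.add K.add g.add g'.add e0.smult e1.smult L.smult K.smult g.smult g'.smult
   e0.mult e1.mult L.mult K.mult g.mult g'.mult e0.one e1.one L.one K.one g.one g'.one
   e0.dif e1.dif L.dif K.dif g.dif g'.dif)
 then show ?thesis by blast
qed

section \<open>Homotopy invariance of the cohomology of \<open>R\<^sub>V\<close>\<close>

text \<open>\<open>rep_map\<close> is defined by its action on letters; agreement on the carrier is
  turned into agreement of the two maps of free products by uniqueness.\<close>

lemma rep_map_cong:
 assumes V: "dg_complex V" "fin_total_dim V" and f: "dga_hom R S f"
  and eq: "!!x. x : carrier R ==> f' x = f x" and X: "X : carrier (rep_alg V R)"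
 shows "rep_map V S f' X = rep_map V S f X"
proof -
 interpret f: dga_map R S f by unfold_locales fact
 interpret R: rep_ctx V R by (rule rep_ctxI[OF V f.R.dga])
 have f': "dga_hom R S f'" by (rule dga_hom_cong[OF f eq])
 obtain w where w: "w : carrier (root_alg V R)" "X = R.\<rho> w" using X by (auto simp: R.rep_carrier R.root_carrier)
 then have wT: "w : carrier R.P.T" by (auto simp: R.root_carrier R.C.cent_def)
 note L = fp_map_hom[OF f R.E_dga] and L' = fp_map_hom[OF f' R.E_dga]
 have "fp_hom S R.E f' w = fp_hom S R.E f w"
 proof (rule R.P.fp_ext[OF _ _ _ _ wT, of "free_prod S R.E"])
  show "alg_hom R.P.T (free_prod S R.E) (fp_hom S R.E f')" "alg_hom R.P.T (free_prod S R.E) (fp_hom S R.E f)"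
   using L(1) L'(1) by (simp_all add: dga_hom_def galg_hom_def)
 qed (simp_all add: L(2,3) L'(2,3) eq)
 then show ?thesis using w by (simp add: rep_map_class[OF V f] rep_map_class[OF V f'])
qed

context
 fixes V :: "('k::field, 'v) dg"
 assumes V: "dg_complex V" "fin_total_dim V"
begin

lemma AV_lift_hom: 
 assumes "dga_hom R S g"
 shows "galg_hom (cohom (rep_alg V R)) (cohom (rep_alg V S)) (AV_lift_map V S g)"
proof -
 interpret dga_map "rep_alg V R" "rep_alg V S" "rep_map V S g" by unfold_locales (rule rep_map_hom[OF V assms])
 show ?thesis unfolding AV_lift_map_def by (rule cohom_map_hom)
qed

lemma AV_lift_class:
 assumes "dga_hom R S g" "z : cocycles (rep_alg V R)"
 shows "AV_lift_map V S g (coboundaries (rep_alg V R) +>\<^bsub>rep_alg V R\<^esub> z) =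
  coboundaries (rep_alg V S) +>\<^bsub>rep_alg V S\<^esub> rep_map V S g z"
proof -
 interpret dga_map "rep_alg V R" "rep_alg V S" "rep_map V S g" by unfold_locales (rule rep_map_hom[OF V assms(1)])
 show ?thesis unfolding AV_lift_map_def by (rule cohom_map_class[OF assms(2)])
qed

lemma cohom_repE:
 assumes "dga R" "c : carrier (cohom (rep_alg V R))"
 obtains z where "z : cocycles (rep_alg V R)" "z : carrier (rep_alg V R)"
  "c = coboundaries (rep_alg V R) +>\<^bsub>rep_alg V R\<^esub> z"
proof -
 interpret R: rep_ctx V R by (rule rep_ctxI[OF V assms(1)])
 interpret r: dgalgebra "rep_alg V R" by unfold_locales (rule R.rep_dga)
 show ?thesis using assms(2) that by (auto simp: r.cohom_carrier dest: r.cocyclesD)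
qed

lemma AV_lift_comp:
 assumes f: "dga_hom R S f" and g: "dga_hom S U g" and c: "c : carrier (cohom (rep_alg V R))"
 shows "AV_lift_map V U (g \<circ> f) c = AV_lift_map V U g (AV_lift_map V S f c)"
proof -
 interpret f: dga_map R S f by unfold_locales fact
 interpret F: dga_map "rep_alg V R" "rep_alg V S" "rep_map V S f" by unfold_locales (rule rep_map_hom[OF V f])
 obtain z where z: "z : cocycles (rep_alg V R)" "z : carrier (rep_alg V R)"
  "c = coboundaries (rep_alg V R) +>\<^bsub>rep_alg V R\<^esub> z" by (rule cohom_repE[OF f.R.dga c])
 show ?thesis unfolding z(3) AV_lift_class[OF dga_hom_comp[OF f g] z(1)] AV_lift_class[OF f z(1)]
   AV_lift_class[OF g F.cocycle[OF z(1)]] rep_map_comp[OF V f g z(2)] ..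
qed

lemma AV_lift_id:
 assumes R: "dga R" and c: "c : carrier (cohom (rep_alg V R))"
 shows "AV_lift_map V R id c = c"
proof -
 obtain z where z: "z : cocycles (rep_alg V R)" "z : carrier (rep_alg V R)"
  "c = coboundaries (rep_alg V R) +>\<^bsub>rep_alg V R\<^esub> z" by (rule cohom_repE[OF R c])
 show ?thesis unfolding z(3) AV_lift_class[OF dga_hom_id[OF R] z(1)] rep_map_id[OF V R z(2)] ..
qed

text \<open>A homotopy between the lifts gives the path K z in R_V over a cocycle z, and
  \<open>path_cohom\<close> says that its ends differ by a coboundary. The ends of the homotopy
  equal g and g' on the carrier only, hence the use of \<open>rep_map_cong\<close>.\<close>

lemma AV_lift_unique:
 assumes char: "CHAR('k) = 0"
  and R: "almost_free_res A (R, p)" and S: "almost_free_res B (S, q)"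
  and g: "is_lift (R, p) (S, q) f g" and g': "is_lift (R, p) (S, q) f g'"
  and c: "c : carrier (cohom (rep_alg V R))"
 shows "AV_lift_map V S g c = AV_lift_map V S g' c"
proof -
 have gh: "dga_hom R S g" and gh': "dga_hom R S g'" using g g' by (simp_all add: is_lift_def)
 interpret g: dga_map R S g by unfold_locales (rule gh)
 interpret S: rep_ctx V S by (rule rep_ctxI[OF V g.S.dga])
 interpret G: dga_map "rep_alg V R" "rep_alg V S" "rep_map V S g" by unfold_locales (rule rep_map_hom[OF V gh])
 interpret G': dga_map "rep_alg V R" "rep_alg V S" "rep_map V S g'" by unfold_locales (rule rep_map_hom[OF V gh'])
 obtain h where h: "dga_hom R (path_dg S) h"
  "!!x. x : carrier R ==> fst (h x) 0 = g x" "!!x. x : carrier R ==> dgalgebra.ev1 S (fst (h x)) = g' x"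
  using lift_homotopy[OF R S g g'] by blast
 obtain K where K: "dga_hom (rep_alg V R) (path_dg (rep_alg V S)) K"
  "!!X. X : carrier (rep_alg V R) ==> fst (K X) 0 = rep_map V S (%x. fst (h x) 0) X"
  "!!X. X : carrier (rep_alg V R) ==>
   dgalgebra.ev1 (rep_alg V S) (fst (K X)) = rep_map V S (%x. dgalgebra.ev1 S (fst (h x))) X"
  using rep_homotopy[OF V g.S.dga h(1)] by blast
 obtain z where z: "z : cocycles (rep_alg V R)" "z : carrier (rep_alg V R)"
  "c = coboundaries (rep_alg V R) +>\<^bsub>rep_alg V R\<^esub> z" by (rule cohom_repE[OF g.R.dga c])
 have "dgalgebra.ev1 (rep_alg V S) (fst (K z)) \<ominus>\<^bsub>rep_alg V S\<^esub> fst (K z) 0 : coboundaries (rep_alg V S)"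
  by (rule dgalgebra.path_cohom[OF dgalgebra.intro[OF S.rep_dga] char K(1) z(1)])
 moreover have e: "rep_map V S (%x. fst (h x) 0) z = rep_map V S g z"
  "rep_map V S (%x. dgalgebra.ev1 S (fst (h x))) z = rep_map V S g' z"
  using h(2,3) by (auto intro!: rep_map_cong[OF V gh _ z(2)] rep_map_cong[OF V gh' _ z(2)])
 ultimately have "rep_map V S g' z \<ominus>\<^bsub>rep_alg V S\<^esub> rep_map V S g z : coboundaries (rep_alg V S)"
  using K(2,3)[OF z(2)] e by (simp only:)
 then show ?thesis unfolding z(3) AV_lift_class[OF gh z(1)] AV_lift_class[OF gh' z(1)]
  using G.S.cohom_class_eq[OF G'.cocycle[OF z(1)] G.cocycle[OF z(1)]] by simp
qed

lemma is_lift_comp: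
 assumes "is_lift P Q f g" "is_lift Q U f' g'"
 shows "is_lift P U (f' \<circ> f) (g' \<circ> g)"
proof -
 interpret g: dga_map "fst P" "fst Q" g by unfold_locales (use assms in \<open>simp add: is_lift_def\<close>)
 show ?thesis using dga_hom_comp[of "fst P" "fst Q" g "fst U" g'] assms by (simp add: is_lift_def)
qed

lemma is_lift_id: "dga (fst P) ==> is_lift P P id id"
 by (simp add: is_lift_def dga_hom_id)

lemma alg_hom_id: "kalg A ==> alg_hom A A id"
 by (rule alg_homI) auto

lemma afr_dga: "almost_free_res A P ==> dga (fst P) & kalg A"
 by (auto simp: almost_free_res_def quasi_iso_def dga_hom_iff)

text \<open>The composite of g and g' and the identity both lift the identity of A, so they agree on
  cohomology. The quasi-isomorphism of (a) and the comparison of two choices of resolutions both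
  rest on this.\<close>

lemma AV_lift_inverse:
 assumes char: "CHAR('k) = 0" and P: "almost_free_res A P" and Q: "almost_free_res A Q"
  and g: "is_lift P Q id g" and g': "is_lift Q P id g'" and c: "c : carrier (cohom (rep_alg V (fst P)))"
 shows "AV_lift_map V (fst P) g' (AV_lift_map V (fst Q) g c) = c"
proof -
 have "AV_lift_map V (fst P) g' (AV_lift_map V (fst Q) g c) = AV_lift_map V (fst P) (g' \<circ> g) c"
  by (rule AV_lift_comp[symmetric]) (use g g' c in \<open>auto simp: is_lift_def\<close>)
 also have "... = AV_lift_map V (fst P) id c" by (rule AV_lift_unique[OF char, of A "fst P" "snd P" A "fst P" "snd P" id])
   (use is_lift_comp[OF g g'] is_lift_id[of P] afr_dga[OF P] P c in auto)
 also have "... = c" by (rule AV_lift_id) (use afr_dga[OF P] c in auto)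
 finally show ?thesis .
qed

lemma AV_lift_bij:
 assumes char: "CHAR('k) = 0" and P: "almost_free_res A P" and Q: "almost_free_res A Q"
  and g: "is_lift P Q id g"
 shows "bij_betw (AV_lift_map V (fst Q) g) (carrier (cohom (rep_alg V (fst P)))) (carrier (cohom (rep_alg V (fst Q))))"
proof -
 obtain g' where g': "is_lift Q P id g'"
  using lift_exists_afr[of A "fst Q" "snd Q" A "fst P" "snd P" id] alg_hom_id afr_dga[OF P] P Q by auto
 have cl: "AV_lift_map V (fst Y) f c : carrier (cohom (rep_alg V (fst Y)))"
  if "is_lift X Y i f" "c : carrier (cohom (rep_alg V (fst X)))" for X Y i f c using AV_lift_hom[of "fst X" "fst Y" f] that
  by (auto simp: is_lift_def galg_hom_def alg_hom_def linear_map_def)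
 show ?thesis by (rule bij_betw_byWitness[where f' = "AV_lift_map V (fst P) g'"])
   (use AV_lift_inverse[OF char P Q g g'] AV_lift_inverse[OF char Q P g' g] cl[OF g] cl[OF g'] in auto)
qed

lemma rep_quasi_iso:
 assumes char: "CHAR('k) = 0" and P: "almost_free_res A (R1, p1)" and Q: "almost_free_res A (R2, p2)"
 shows "\<exists>f. quasi_iso (rep_alg V R1) (rep_alg V R2) f"
proof -
 obtain g where g: "is_lift (R1, p1) (R2, p2) id g" using lift_exists_afr[OF P Q alg_hom_id] afr_dga[OF P] by blast
 have "quasi_iso (rep_alg V R1) (rep_alg V R2) (rep_map V R2 g)" using AV_lift_bij[OF char P Q g] rep_map_hom[OF V, of R1 R2 g] g
  by (simp add: quasi_iso_def is_lift_def AV_lift_map_def)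
 then show ?thesis by (rule exI[of "quasi_iso (rep_alg V R1) (rep_alg V R2)"])
qed

context
 assumes char: "CHAR('k) = 0"
begin

lemma choice_lift:
 assumes Q: "res_choice Q" and Q': "res_choice Q'" and f: "alg_hom A B f"
 shows "\<exists>g. is_lift (Q A) (Q' B) f g" using lift_exists_afr[of A "fst (Q A)" "snd (Q A)" B "fst (Q' B)" "snd (Q' B)" f] Q Q' f
 by (auto simp: res_choice_def alg_hom_def)

text \<open>\<open>AV_map\<close> selects a lift by \<open>SOME\<close>; replacing it by any
  convenient lift reduces functoriality to composition of lifts.\<close>

lemma AV_map_eq:
 assumes Q: "res_choice Q" and f: "alg_hom A B f" and g: "is_lift (Q A) (Q B) f g"
  and c: "c : carrier (AV V Q A)"
 shows "AV_map V Q A B f c = AV_lift_map V (fst (Q B)) g c"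
proof -
 have s: "is_lift (Q A) (Q B) f (SOME g. is_lift (Q A) (Q B) f g)" by (rule someI[of "is_lift (Q A) (Q B) f", OF g])
 have r: "almost_free_res A (Q A)" "almost_free_res B (Q B)" using Q f by (auto simp: res_choice_def alg_hom_def)
 show ?thesis unfolding AV_map_def by (rule AV_lift_unique[OF char, of A "fst (Q A)" "snd (Q A)" B "fst (Q B)" "snd (Q B)" f,
    unfolded prod.collapse, OF r s g c[unfolded AV_def]])
qed

lemma AV_hom:
 assumes Q: "res_choice Q" and f: "alg_hom A B f"
 shows "galg_hom (AV V Q A) (AV V Q B) (AV_map V Q A B f)"
proof -
 obtain g where "is_lift (Q A) (Q B) f g" using choice_lift[OF Q Q f] by blast
 then have "is_lift (Q A) (Q B) f (SOME g. is_lift (Q A) (Q B) f g)" by (rule someI[of "is_lift (Q A) (Q B) f"])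
 then have "dga_hom (fst (Q A)) (fst (Q B)) (SOME g. is_lift (Q A) (Q B) f g)" unfolding is_lift_def[of "Q A" "Q B" f "Eps _"] by (rule conjunct1)
 then show ?thesis unfolding AV_map_def AV_def by (rule AV_lift_hom)
qed

lemma AV_functor:
 assumes Q: "res_choice Q"
 shows "gc_functor (AV V Q) (AV_map V Q)" unfolding gc_functor_def
proof (intro conjI allI impI ballI)
 have Qd: "dga (fst (Q A))" if "kalg A" for A using Q that afr_dga[of A "Q A"] by (simp add: res_choice_def)
 show "gcalg (AV V Q A)" if A: "kalg A" for A
 proof -
  interpret R: rep_ctx V "fst (Q A)" by (rule rep_ctxI[OF V Qd[OF A]])
  interpret r: dgalgebra "rep_alg V (fst (Q A))" by unfold_locales (rule R.rep_dga)
  show ?thesis unfolding AV_def by (rule r.cohom_gcalg[OF R.rep_gcalg])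
 qed
 show "galg_hom (AV V Q A) (AV V Q B) (AV_map V Q A B f)" if "alg_hom A B f" for A B f by (rule AV_hom[OF Q that])
 show "AV_map V Q A B f x = AV_map V Q A B f' x"
  if a: "alg_hom A B f & alg_hom A B f' & (\<forall>a\<in>carrier A. f a = f' a)" and x: "x : carrier (AV V Q A)" for A B f f' x
 proof -
  obtain g where g: "is_lift (Q A) (Q B) f g" using choice_lift[OF Q Q] a by blast
  interpret p: afr A "fst (Q A)" "snd (Q A)" by unfold_locales (use Q a in \<open>auto simp: res_choice_def alg_hom_def\<close>)
  have "f (snd (Q A) y) = f' (snd (Q A) y)" if "y : carrier (fst (Q A))" for y using a p.p.closed[OF that] by simp
  then have g': "is_lift (Q A) (Q B) f' g" using g by (simp add: is_lift_def)
  have "AV_map V Q A B f x = AV_lift_map V (fst (Q B)) g x" by (rule AV_map_eq[OF Q conjunct1[OF a] g x])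
  also have "... = AV_map V Q A B f' x" by (rule AV_map_eq[OF Q conjunct1[OF conjunct2[OF a]] g' x, symmetric])
  finally show ?thesis .
 qed
 show "AV_map V Q A A id x = x" if A: "kalg A" and x: "x : carrier (AV V Q A)" for A x
  using AV_map_eq[OF Q alg_hom_id[OF A] is_lift_id[OF Qd[OF A]] x] AV_lift_id[OF Qd[OF A]] x by (simp add: AV_def)
 show "AV_map V Q A C (g \<circ> f) x = AV_map V Q B C g (AV_map V Q A B f x)"
  if a: "alg_hom A B f & alg_hom B C g" and x: "x : carrier (AV V Q A)" for A B C f g x
 proof -
  obtain f' where f': "is_lift (Q A) (Q B) f f'" using choice_lift[OF Q Q] a by blast
  obtain g' where g': "is_lift (Q B) (Q C) g g'" using choice_lift[OF Q Q] a by blast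
  have gf: "alg_hom A C (g \<circ> f)" using a alg_hom_comp by blast
  have y: "AV_map V Q A B f x : carrier (AV V Q B)"
   using AV_hom[OF Q, of A B f] a x by (auto simp: galg_hom_def alg_hom_def linear_map_def)
  show ?thesis using AV_map_eq[OF Q gf is_lift_comp[OF f' g'] x] AV_map_eq[OF Q _ f' x] AV_map_eq[OF Q _ g' y] a
    AV_lift_comp[of "fst (Q A)" "fst (Q B)" f' "fst (Q C)" g' x] f' g' x by (simp add: is_lift_def AV_def)
 qed
qed

text \<open>The components are induced by lifts of identities. For naturality, both ways around the
  square are induced by lifts of f from Q A to Q' B.\<close>

lemma AV_nat_iso:
 assumes Q: "res_choice Q" and Q': "res_choice Q'"
 shows "\<exists>\<eta>. gc_nat_iso (AV V Q) (AV_map V Q) (AV V Q') (AV_map V Q') \<eta>"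
proof -
 have "\<exists>l. kalg A --> is_lift (Q A) (Q' A) id l" for A using choice_lift[OF Q Q' alg_hom_id] by blast
 then obtain l where l: "!!A. kalg A ==> is_lift (Q A) (Q' A) id (l A)" by metis
 have "gc_nat_iso (AV V Q) (AV_map V Q) (AV V Q') (AV_map V Q') (%A. AV_lift_map V (fst (Q' A)) (l A))" unfolding gc_nat_iso_def
 proof (intro conjI allI impI ballI)
  fix A :: "('k, 'a) module" assume A: "kalg A"
  show "galg_hom (AV V Q A) (AV V Q' A) (AV_lift_map V (fst (Q' A)) (l A))"
   unfolding AV_def by (rule AV_lift_hom) (use l[OF A] in \<open>simp add: is_lift_def\<close>)
  show "bij_betw (AV_lift_map V (fst (Q' A)) (l A)) (carrier (AV V Q A)) (carrier (AV V Q' A))"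
   unfolding AV_def by (rule AV_lift_bij[OF char _ _ l[OF A]]) (use Q Q' A in \<open>auto simp: res_choice_def\<close>)
 next
  fix A B :: "('k, 'a) module" and f x assume f: "alg_hom A B f" and x: "x : carrier (AV V Q A)"
  have AB: "kalg A" "kalg B" using f by (auto simp: alg_hom_def)
  obtain g where g: "is_lift (Q A) (Q B) f g" using choice_lift[OF Q Q f] by blast
  obtain g' where g': "is_lift (Q' A) (Q' B) f g'" using choice_lift[OF Q' Q' f] by blast
  have y: "AV_lift_map V (fst (Q' A)) (l A) x : carrier (AV V Q' A)" using AV_lift_hom[of "fst (Q A)" "fst (Q' A)" "l A"] l[OF AB(1)] x
   by (auto simp: is_lift_def galg_hom_def alg_hom_def linear_map_def AV_def)
  have 1: "is_lift (Q A) (Q' B) f (l B \<circ> g)" using is_lift_comp[OF g l[OF AB(2)]] by simp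
  have 2: "is_lift (Q A) (Q' B) f (g' \<circ> l A)" using is_lift_comp[OF l[OF AB(1)] g'] by simp
  have "AV_lift_map V (fst (Q' B)) (l B) (AV_map V Q A B f x) = AV_lift_map V (fst (Q' B)) (l B \<circ> g) x"
   using AV_map_eq[OF Q f g x] AV_lift_comp[of "fst (Q A)" "fst (Q B)" g "fst (Q' B)" "l B" x] g l[OF AB(2)] x
   by (simp add: is_lift_def AV_def)
  also have "... = AV_lift_map V (fst (Q' B)) (g' \<circ> l A) x"
   by (rule AV_lift_unique[OF char, of A "fst (Q A)" "snd (Q A)" B "fst (Q' B)" "snd (Q' B)" f])
    (use 1 2 x Q Q' AB in \<open>auto simp: res_choice_def AV_def\<close>)
  also have "... = AV_map V Q' A B f (AV_lift_map V (fst (Q' A)) (l A) x)"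
   using AV_map_eq[OF Q' f g' y] AV_lift_comp[of "fst (Q A)" "fst (Q' A)" "l A" "fst (Q' B)" g' x] g' l[OF AB(1)] x
   by (simp add: is_lift_def AV_def)
  finally show "AV_lift_map V (fst (Q' B)) (l B) (AV_map V Q A B f x) =
   AV_map V Q' A B f (AV_lift_map V (fst (Q' A)) (l A) x)" .
 qed
 then show ?thesis by (rule exI[of "gc_nat_iso (AV V Q) (AV_map V Q) (AV V Q') (AV_map V Q')"])
qed

end

end

section \<open>A standard resolution and its coding by lists\<close>

section \<open>Existence of almost free resolutions\<close>

text \<open>Only homogeneous cycles need primitives: the homogeneous parts of a cycle killed by p
  are again cycles killed by p, and coboundaries form a subspace.\<close>

lemma quasi_iso_concI:
 assumes p: "dga_hom R (conc A) p"
  and surj: "!!a. a : carrier A ==> \<exists>z\<in>cocycles R. p z = a"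
  and acyc: "!!n z. z : gr R n ==> dif R z = \<zero>\<^sub>R ==> p z = \<zero>\<^sub>A ==> z : coboundaries R"
 shows "quasi_iso R (conc A) p"
proof -
 interpret p: dga_map R "conc A" p by unfold_locales fact
 have A: "kalg A" by (rule kalg_cong[OF p.S.kalg]) simp_all
 have Bs: "submodule (coboundaries R) ground R"
 proof (rule p.R.submoduleI')
  show "\<zero>\<^sub>R : coboundaries R" by (auto simp: coboundaries_def intro!: image_eqI[of _ _ "\<zero>\<^sub>R"])
 qed (auto simp: coboundaries_def p.R.d.add[symmetric] p.R.d.smult[symmetric])
 have ac: "w : coboundaries R" if w: "w : cocycles R" "p w = \<zero>\<^sub>A" for w
 proof -
  have wc: "w : carrier R" and dw: "dif R w = \<zero>\<^sub>R" using w by (auto dest: p.R.cocyclesD)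
  have "homog_part R w n : coboundaries R" for n
  proof (rule acyc)
   show "dif R (homog_part R w n) = \<zero>\<^sub>R" using p.R.pr_d[OF wc, of "n + 1"] dw p.R.pr_zero by simp
   show "p (homog_part R w n) = \<zero>\<^sub>A" using p.pr[OF wc, of n] w(2) p.S.pr_zero[of n] by simp
  qed (use wc in auto)
  then have "(\<Oplus>\<^sub>R n\<in>supp R w. homog_part R w n) : coboundaries R" by (intro p.R.finsum_in_submodule[OF Bs])
  then show ?thesis by (simp only: p.R.finsum_pr[OF wc p.R.finite_supp[OF wc] subset_refl])
 qed
 have "bij_betw (cohom_map (conc A) p) (carrier (cohom R)) (carrier (cohom (conc A)))" unfolding bij_betw_def
 proof (intro conjI inj_onI)
  fix c c' assume c: "c : carrier (cohom R)" "c' : carrier (cohom R)"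
   and e: "cohom_map (conc A) p c = cohom_map (conc A) p c'"
  obtain z z' where z: "z : cocycles R" "z' : cocycles R" "c = coboundaries R +>\<^sub>R z" "c' = coboundaries R +>\<^sub>R z'"
   using c by (auto simp: p.R.cohom_carrier)
  have zc: "z : carrier R" "z' : carrier R" using z by (auto dest: p.R.cocyclesD)
  have "p z \<ominus>\<^bsub>conc A\<^esub> p z' : coboundaries (conc A)"
   using e p.S.cohom_class_eq[OF p.cocycle[OF z(1)] p.cocycle[OF z(2)]]
   by (simp only: z(3,4) p.cohom_map_class[OF z(1)] p.cohom_map_class[OF z(2)])
  then have "p (z \<ominus>\<^sub>R z') = \<zero>\<^sub>A" using p.minus[OF zc] by (simp add: conc_coboundaries[OF A])
  moreover have "z \<ominus>\<^sub>R z' : cocycles R" using z zc by (auto simp: cocycles_def p.R.d.minus p.R.minus_eq_0_iff)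
  ultimately have "z \<ominus>\<^sub>R z' : coboundaries R" by (rule ac[rotated])
  then show "c = c'" using p.R.cohom_class_eq[OF z(1,2)] z by simp
 next
  have "c : cohom_map (conc A) p ` carrier (cohom R)" if c: "c : carrier (cohom (conc A))" for c
  proof -
   obtain a where a: "a : carrier A" "c = coboundaries (conc A) +>\<^bsub>conc A\<^esub> a"
    using c by (auto simp: p.S.cohom_carrier conc_cocycles)
   obtain z where z: "z : cocycles R" "p z = a" using surj[OF a(1)] by blast
   then have "c = cohom_map (conc A) p (coboundaries R +>\<^sub>R z)" by (simp add: a p.cohom_map_class)
   then show ?thesis using z(1) by (auto simp: p.R.cohom_carrier)
  qed
  moreover have "cohom_map (conc A) p c : carrier (cohom (conc A))" if "c : carrier (cohom R)" for c
   using p.cohom_map_hom that by (auto simp: galg_hom_def alg_hom_def linear_map_def)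
  ultimately show "cohom_map (conc A) p ` carrier (cohom R) = carrier (cohom (conc A))" by blast
 qed
 then show ?thesis using p by (simp add: quasi_iso_def)
qed

subsection \<open>Transport of structure along an injection\<close>

text \<open>The resolution is built on words in a recursive datatype, whereas it is wanted on lists
  over \<open>'a + 'k\<close>; this copies a DG algebra along an injection of types.\<close>

definition transport :: "('a => 'b) => ('k, 'a) dg => ('k, 'b) dg" where
 "transport h R = (let g = inv_into UNIV h in
  \<lparr>carrier = h ` carrier R, monoid.mult = (%x y. h (g x \<otimes>\<^sub>R g y)), one = h \<one>\<^sub>R, ring.zero = h \<zero>\<^sub>R,
   add = (%x y. h (g x \<oplus>\<^sub>R g y)), smult = (%c x. h (c \<odot>\<^sub>R g x)),
   gr = (%n. h ` gr R n), dif = (%x. h (dif R (g x)))\<rparr>)"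

lemma transport_simps [simp]:
 "carrier (transport h R) = h ` carrier R" "x \<otimes>\<^bsub>transport h R\<^esub> y = h (inv_into UNIV h x \<otimes>\<^sub>R inv_into UNIV h y)"
 "\<one>\<^bsub>transport h R\<^esub> = h \<one>\<^sub>R" "\<zero>\<^bsub>transport h R\<^esub> = h \<zero>\<^sub>R" "x \<oplus>\<^bsub>transport h R\<^esub> y = h (inv_into UNIV h x \<oplus>\<^sub>R inv_into UNIV h y)"
 "c \<odot>\<^bsub>transport h R\<^esub> x = h (c \<odot>\<^sub>R inv_into UNIV h x)" "gr (transport h R) n = h ` gr R n"
 "dif (transport h R) x = h (dif R (inv_into UNIV h x))" by (simp_all add: transport_def Let_def)

lemma transport_dga:
 fixes R :: "('k::field, 'a) dg"
 assumes R: "dga R" and h: "inj h"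
 shows "dga (transport h R)" "dga_hom R (transport h R) h" "dga_hom (transport h R) R (inv_into UNIV h)"
proof -
 interpret R: dgalgebra R by unfold_locales fact
 note [simp] = inv_f_f[OF h]
 let ?R = "transport h R"
 have ag: "abelian_group ?R"
 proof (rule abelian_groupI, goal_cases)
  case (6 x)
  then obtain y where y: "y : carrier R" "x = h y" by auto
  then show ?case by (intro bexI[of _ "h (\<ominus>\<^sub>R y)"]) (auto simp: R.l_neg)
 qed (auto simp: R.a_ac)
 have M: "module ground ?R" by (rule module_groundI[OF ag]) (auto simp: R.sm_ladd R.sm_radd)
 interpret M: kmod ?R by (rule kmod.intro) (rule M)
 have K: "kalg ?R"
 proof (rule kalgI[OF M])
  show "monoid ?R" by (rule monoidI) (auto simp: R.m_assoc)
 qed (auto simp: R.l_distr R.r_distr)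
 have s: "submodule (gr ?R n) ground ?R" for n by (rule M.submoduleI') auto
 have G: "graded_module ?R"
 proof (rule gmodI_span[OF M s])
  show "linear_map ?R ?R (%x. h (homog_part R (inv_into UNIV h x) n))" for n by (rule linear_mapI) (auto simp: R.pr_add R.pr_smult)
  show "h (homog_part R (inv_into UNIV h x) m) = (if m = n then x else \<zero>\<^sub>?R)" if x: "x : gr ?R n" for x n m
  proof -
   obtain y where y: "y : gr R n" "x = h y" using x by auto
   then show ?thesis by (simp add: R.pr_homog[OF y(1)])
  qed
  show "Q x" if x: "x : carrier ?R" and hg: "!!n x. x : gr ?R n ==> Q x"
   and ad: "!!x y. x : carrier ?R ==> y : carrier ?R ==> Q x ==> Q y ==> Q (x \<oplus>\<^sub>?R y)" for x Q
  proof -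
   obtain y where y: "y : carrier R" "x = h y" using x by auto
   have "Q (h y)" using y(1)
   proof (induct y rule: R.gr_induct)
    case (homog n y)
    then show ?case using hg[of "h y" n] by auto
   next
    case (add y z)
    then show ?case using ad[of "h y" "h z"] by simp
   qed
   then show ?thesis using y by simp
  qed
 qed
 show D: "dga ?R" unfolding dga_iff pre_dga_def galg_def
 proof (intro conjI K G allI ballI)
  show "linear_map ?R ?R (dif ?R)" by (rule linear_mapI) (auto simp: R.d.add R.d.smult)
  show "dif ?R ` gr ?R n <= gr ?R (n + 1)" for n by (auto simp: R.d_gr)
  show "dif ?R (x \<otimes>\<^sub>?R y) = dif ?R x \<otimes>\<^sub>?R y \<oplus>\<^sub>?R ksgn m \<odot>\<^sub>?R (x \<otimes>\<^sub>?R dif ?R y)"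
   if xy: "x : gr ?R m" "y : carrier ?R" for m x y
  proof -
   obtain x' y' where x: "x' : gr R m" "x = h x'" "y' : carrier R" "y = h y'" using xy by auto
   then show ?thesis by (simp add: R.leibniz_homog[OF x(1)])
  qed
  show "x \<otimes>\<^sub>?R y : gr ?R (m + n)" if "x : gr ?R m" "y : gr ?R n" for m n x y using that by (auto simp: R.mult_gr)
  show "\<one>\<^sub>?R : gr ?R 0" using R.galg by (auto simp: galg_def)
  show "dif ?R (dif ?R x) = \<zero>\<^sub>?R" if "x : carrier ?R" for x using that by auto
 qed
 show "dga_hom R ?R h" by (rule dga_homI[OF R D]) auto
 show "dga_hom ?R R (inv_into UNIV h)" by (rule dga_homI[OF D R]) auto
qed

subsection \<open>Adjoining generators for all cycles\<close>

text \<open>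
 The generator \<^term>\<open>Kill n l\<close> has degree \<open>-n - 1\<close> and its differential is the linear combination of words
 listed in \<open>l\<close>. Since generators are added for all cycles at once, no induction on the degree is needed.
\<close>

datatype ('a, 'k) gen = Gen 'a | Kill nat "('k \<times> ('a, 'k) gen list) list"

primrec gdeg :: "('a, 'k) gen => int" where
 "gdeg (Gen a) = 0"
| "gdeg (Kill n l) = - int n - 1"

text \<open>The linear combination denoted by the list inside \<open>Kill\<close>. Lists denoting
  the same element give different generators, which does no harm to the resolution.\<close>

definition lsum :: "('k::field \<times> 'x) list => ('x \<Rightarrow>\<^sub>0 'k)" where
 "lsum l = sum_list (map (%(c, w). single w c) l)"

primrec gdif :: "('a, 'k::field) gen => (('a, 'k) gen list \<Rightarrow>\<^sub>0 'k)" where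
 "gdif (Gen a) = 0"
| "gdif (Kill n l) = lsum l"

lemma keys_lsum: "snd ` set l <= K ==> keys (lsum l) <= K"
proof (induct l)
 case (Cons x l)
 obtain c w where x: "x = (c, w)" by (cases x)
 have "keys (single w c + lsum l) <= K" by (rule keys_add_subset) (use Cons x in auto)
 then show ?case by (simp add: x lsum_def)
qed (simp add: lsum_def)

lemma lsum_surj: "keys p <= K ==> \<exists>l. lsum l = p & snd ` set l <= K"
proof (induct p rule: pm_induct)
 case zero
 show ?case by (rule exI[of _ "[]"]) (simp add: lsum_def)
next
 case (single u c)
 then show ?case by (intro exI[of _ "[(c, u)]"]) (simp add: lsum_def)
next
 case (add p q)
 then obtain l m where "lsum l = p" "snd ` set l <= K" "lsum m = q" "snd ` set m <= K" by blast
 then show ?case by (intro exI[of _ "l @ m"]) (auto simp: lsum_def)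
qed

locale standard_res = kalgebra A for A :: "('k::field, 'a) module" (structure)
begin

primrec gval :: "('a, 'k) gen => 'a" where
 "gval (Gen a) = (if a : carrier A then a else \<zero>)"
| "gval (Kill n l) = \<zero>"

definition ev :: "(('a, 'k) gen list \<Rightarrow>\<^sub>0 'k) => 'a" where
 "ev = lext (wval gval)"

text \<open>A cycle of degree 0 may be killed only if it vanishes in A, hence the premise for n = 0;
  in negative degrees \<open>ev\<close> vanishes on its own. Since the words in the list use earlier
  generators, one inductive definition produces generators of all degrees.\<close>

inductive_set valid :: "('a, 'k) gen set" where
 Gen: "a : carrier A ==> Gen a : valid"
| Kill: "(!!c w x. (c, w) : set l ==> x : set w ==> x : valid) ==>
  (!!c w. (c, w) : set l ==> sum_list (map gdeg w) = - int n) ==>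
  lin_ext (wdif gdeg gdif) (lsum l) = 0 ==> (n = 0 ==> ev (lsum l) = \<zero>) ==> Kill n l : valid"

lemma gval_closed [simp]: "gval x : carrier A"
 by (cases x) auto

lemma Kill_iff: "Kill n l : valid \<longleftrightarrow> snd ` set l <= {w : lists valid. sum_list (map gdeg w) = - int n} &
  lin_ext (wdif gdeg gdif) (lsum l) = 0 & (n = 0 --> ev (lsum l) = \<zero>)"
proof
 assume "Kill n l : valid"
 then show "snd ` set l <= {w : lists valid. sum_list (map gdeg w) = - int n} &
  lin_ext (wdif gdeg gdif) (lsum l) = 0 & (n = 0 --> ev (lsum l) = \<zero>)" by cases auto
next
 assume *: "snd ` set l <= {w : lists valid. sum_list (map gdeg w) = - int n} &
  lin_ext (wdif gdeg gdif) (lsum l) = 0 & (n = 0 --> ev (lsum l) = \<zero>)"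
 then have w: "w : lists valid & sum_list (map gdeg w) = - int n" if "(c, w) : set l" for c w using that by force
 show "Kill n l : valid" by (rule Kill) (use * w in auto)
qed

sublocale fd: free_diff valid gdeg gdif
proof
 fix x assume x: "x : valid"
 show "keys (gdif x) <= {v : lists valid. sum_list (map gdeg v) = gdeg x + 1}"
 proof (cases x)
  case (Kill n l)
  then show ?thesis using x keys_lsum[of l "{v : lists valid. sum_list (map gdeg v) = - int n}"] by (simp add: Kill_iff)
 qed simp
qed

abbreviation "P \<equiv> free_alg valid gdeg gdif"

lemma dif_letter: "wdif gdeg gdif [x] = gdif x"
 by (simp add: conv_unit)

lemma dif_gdif: "x : valid ==> lin_ext (wdif gdeg gdif) (gdif x) = 0"
 by (cases x) (auto simp: Kill_iff)

lemma P_dga: "dga P"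
 unfolding dga_iff
proof (intro conjI ballI fd.F_predga)
 interpret P: predga P by unfold_locales (rule fd.F_predga)
 have w: "w : lists valid ==> dif P (dif P (basis_elt w)) = \<zero>\<^sub>P" for w
 proof (induct w)
  case (Cons x w)
  have c: "basis_elt [x] : carrier P" "basis_elt w : carrier P" using Cons by auto
  have "dif P (dif P (basis_elt [x])) = \<zero>\<^sub>P" using Cons dif_gdif by (simp add: dif_letter del: wdif.simps)
  then have "dif P (dif P (basis_elt [x] \<otimes>\<^sub>P basis_elt w)) = \<zero>\<^sub>P"
   unfolding P.dd_mult[OF c] using Cons c by (simp del: free_alg_simps)
  then show ?case by simp
 qed simp
 show "dif P (dif P x) = \<zero>\<^sub>P" if "x : carrier P" for x
 proof -
  have "keys x <= lists valid" using that by simp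
  then show ?thesis
  proof (induct x rule: pm_induct)
   case (single u c)
   have "lin_ext (wdif gdeg gdif) (lin_ext (wdif gdeg gdif) (basis_elt u)) = 0" using w[OF single] by simp
   then show ?case by (simp add: lin_ext_sc)
  qed (auto simp: lin_ext_add)
 qed
qed

lemma ev_mult: "ev (conv (@) f g) = ev f \<otimes> ev g"
 unfolding ev_def by (rule lext_conv[of _ _ UNIV _ UNIV]) (auto simp: wval_append)

lemma ev_add: "ev (f + g) = ev f \<oplus> ev g" and ev_sc: "ev (scale c f) = c \<odot> ev f"
  and ev_0 [simp]: "ev 0 = \<zero>" and ev_closed [simp]: "ev f : carrier A"
  and ev_single: "ev (single w c) = c \<odot> wval gval w" by (simp_all add: ev_def lext_add lext_sc)

lemma ev_basis: "ev (basis_elt w) = wval gval w"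
 by (simp add: ev_def)

lemma gdeg_sum_nonpos: "sum_list (map gdeg w) \<le> 0"
proof (induct w)
 case (Cons x w)
 then show ?case by (cases x) auto
qed simp

lemma wval_neg: "sum_list (map gdeg w) ~= 0 ==> wval gval w = \<zero>"
proof (induct w)
 case (Cons x w)
 then show ?case by (cases x) auto
qed simp

lemma ev_neg: "keys f <= {w : lists valid. sum_list (map gdeg w) = n} ==> n ~= 0 ==> ev f = \<zero>"
 by (induct f rule: pm_induct) (auto simp: ev_single ev_add wval_neg)

lemma ev_gdif: "x : valid ==> ev (gdif x) = \<zero>"
proof (cases x)
 case (Kill n l)
 assume x: "x : valid"
 then show ?thesis using Kill keys_lsum[of l "{w : lists valid. sum_list (map gdeg w) = - int n}"]
   ev_neg[of "lsum l" "- int n"] by (cases "n = 0") (auto simp: Kill_iff)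
qed simp

lemma ev_wdif: "w : lists valid ==> ev (wdif gdeg gdif w) = \<zero>"
 by (induct w) (auto simp: ev_add ev_mult ev_gdif)

lemma ev_hom: "dga_hom P (conc A) ev"
proof (rule dga_homI[OF P_dga conc_dga[OF kalg]])
 show "ev x : gr (conc A) n" if "x : gr P n" for n x using that ev_neg[of x n] by simp
 show "ev (dif P x) = dif (conc A) (ev x)" if "x : carrier P" for x
 proof -
  have "keys x <= lists valid" using that by simp
  then show ?thesis by (induct x rule: pm_induct) (auto simp: lin_ext_add ev_add ev_sc ev_wdif)
 qed
 show "ev \<one>\<^sub>P = \<one>\<^bsub>conc A\<^esub>" by (simp add: ev_basis)
qed (auto simp: ev_add ev_sc ev_mult)

lemma ev_surj: "a : carrier A ==> \<exists>z\<in>cocycles P. ev z = a"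
 by (intro bexI[of _ "basis_elt [Gen a]"]) (auto simp: ev_basis cocycles_def valid.Gen)

text \<open>A cycle z of degree -m killed by \<open>ev\<close> is the differential of the generator
  \<open>Kill m l\<close>, for any list l of words of that degree denoting z. In positive degrees
  there are no words.\<close>

lemma ev_acyclic:
 assumes "z : gr P n" "dif P z = \<zero>\<^sub>P" "ev z = \<zero>"
 shows "z : coboundaries P"
proof (cases "n > 0")
 case True
 then have "{w : lists valid. sum_list (map gdeg w) = n} = {}"
  using gdeg_sum_nonpos by (metis (mono_tags, lifting) empty_Collect_eq linorder_not_less)
 then have "keys z = {}" using assms(1) unfolding free_alg_simps by blast
 then have "z = 0" by simp
 then show ?thesis unfolding coboundaries_def by (intro image_eqI[of _ _ "0"]) auto
next
 case False
 then obtain m where m: "n = - int m" by (metis int_nat_eq minus_equation_iff neg_0_le_iff_le linorder_not_less)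
 obtain l where l: "lsum l = z" "snd ` set l <= {w : lists valid. sum_list (map gdeg w) = n}"
  using lsum_surj assms(1) unfolding free_alg_simps mem_Collect_eq by blast
 have "Kill m l : valid" unfolding Kill_iff using l assms m by simp
 then have "z = dif P (basis_elt [Kill m l])" "basis_elt [Kill m l] : carrier P"
  using l(1) by (simp_all add: dif_letter del: wdif.simps)
 then show ?thesis unfolding coboundaries_def by (rule image_eqI)
qed

lemma transport_res:
 assumes h: "inj (h :: (('a, 'k) gen list \<Rightarrow>\<^sub>0 'k) => 'r)"
 shows "almost_free_res A (transport h P, ev \<circ> inv_into UNIV h)"
proof -
 let ?R = "transport h P"
 note [simp] = inv_f_f[OF h]
 note T = transport_dga[OF P_dga h]
 interpret h: dga_map P ?R h by unfold_locales (rule T)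
 have "quasi_iso ?R (conc A) (ev \<circ> inv_into UNIV h)"
 proof (rule quasi_iso_concI[OF dga_hom_comp[OF T(3) ev_hom]])
  show "\<exists>z\<in>cocycles ?R. (ev \<circ> inv_into UNIV h) z = a" if "a : carrier A" for a
   using ev_surj[OF that] h.cocycle by (metis comp_apply inv_f_f[OF h])
  show "z : coboundaries ?R" if z: "z : gr ?R n" "dif ?R z = \<zero>\<^sub>?R" "(ev \<circ> inv_into UNIV h) z = \<zero>" for z n
  proof -
   obtain y where y: "y : gr P n" "z = h y" using z by auto
   have "dif P y = \<zero>\<^sub>P" using z(2) y(2) injD[OF h] by simp
   then have "y : coboundaries P" using z y ev_acyclic by simp
   then show ?thesis using y h.coboundary by blast
  qed
 qed
 moreover have "free_galg ?R" unfolding free_galg_def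
 proof (intro exI conjI)
  define \<iota> where "\<iota> x = h (basis_elt [x])" for x
  let ?lam = "inv_into UNIV \<iota>" and ?X = "\<iota> ` valid"
  have "inj \<iota>" unfolding \<iota>_def by (rule injI) (metis injD[OF h] keys_basis list.inject the_elem_eq)
  then have [simp]: "?lam (\<iota> x) = x" for x by (rule inv_f_f)
  \<comment> \<open>\<open>to\<close> and \<open>fr\<close> relabel words between the generators of
    P and their copies, the images of one-letter words under h. Up to h, \<open>free_eval\<close>
    will turn out to be \<open>to\<close>, so \<open>fr\<close> supplies its inverse.\<close>
  define to where "to = lin_ext (%w. basis_elt (map ?lam w) :: _ \<Rightarrow>\<^sub>0 'k)"
  define fr where "fr = lin_ext (%w. basis_elt (map \<iota> w) :: _ \<Rightarrow>\<^sub>0 'k)"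
  have tX: "map \<iota> (map ?lam w) = w" "map ?lam w : lists valid" if "w : lists ?X" for w using that by (induct w) auto
  have vX: "map ?lam (map \<iota> w) = w" "map \<iota> w : lists ?X" if "w : lists valid" for w using that by (induct w) auto
  have bs: "single v c = scale c (basis_elt v)" for v :: "'z list" and c :: 'k by simp
  have ft: "fr (to f) = f" "keys (to f) <= lists valid" if "keys f <= lists ?X" for f
  proof -
   show "fr (to f) = f" using that by (induct f rule: pm_induct) (auto simp: fr_def to_def lin_ext_add tX simp del: map_map)
   show "keys (to f) <= lists valid" unfolding to_def by (rule keys_lin_ext[OF that]) (use tX in auto)
  qed
  have tf: "to (fr f) = f" "keys (fr f) <= lists ?X" if "keys f <= lists valid" for f
  proof -
   show "to (fr f) = f" using that by (induct f rule: pm_induct) (auto simp: fr_def to_def lin_ext_add vX simp del: map_map)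
   show "keys (fr f) <= lists ?X" unfolding fr_def by (rule keys_lin_ext[OF that]) (use vX in auto)
  qed
  have [simp]: "inv_into UNIV h (\<iota> x) = basis_elt [x]" for x by (simp add: \<iota>_def)
  have wv: "foldr (%x y. x \<otimes>\<^sub>?R y) w \<one>\<^sub>?R = h (basis_elt (map ?lam w))" if "w : lists ?X" for w
   using that by (induct w) auto
  have fs: "finsum P g J = sum g J" if "finite J" "!!w. w : J ==> g w : carrier P" for g and J :: "'r list set"
   using that by (induct J rule: finite_induct) (auto simp: Pi_def simp del: free_alg_simps(1))
  have fe: "free_eval ?R f = h (to f)" if f: "keys f <= lists ?X" for f
  proof -
   let ?g = "%w. scale (lookup f w) (basis_elt (map ?lam w))"
   have g: "?g w : carrier P" if w: "w : keys f" for w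
    using tX(2)[of w] f w keys_sc_subset[of "basis_elt (map ?lam w)" "lists valid"] by (simp del: sc_basis lists_eq_set in_lists_conv_set) blast
   have "free_eval ?R f = (\<Oplus>\<^sub>?R w\<in>keys f. h (?g w))" unfolding free_eval_def
   proof (rule h.S.finsum_cong'[OF refl])
    show "(%w. h (?g w)) : keys f \<rightarrow> carrier ?R" using g by (auto simp del: sc_basis free_alg_simps)
    show "lookup f w \<odot>\<^sub>?R foldr (%x y. x \<otimes>\<^sub>?R y) w \<one>\<^sub>?R = h (?g w)" if "w : keys f" for w
     using wv[OF subsetD[OF f that]] by (simp only: transport_simps inv_f_f[OF h] free_alg_simps)
   qed
   also have "... = h (finsum P ?g (keys f))" by (rule h.finsum[symmetric]) (use g in blast)
   also have "finsum P ?g (keys f) = to f" unfolding to_def lin_ext_def by (rule fs) (use g in auto)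
   finally show ?thesis .
  qed
  show "?X <= (\<Union>n. gr ?R n)" by (auto simp: \<iota>_def intro!: exI[of _ "gdeg _"] imageI)
  show "bij_betw (free_eval ?R) {f. keys f <= lists ?X} (carrier ?R)"
   by (rule bij_betw_byWitness[where f' = "fr \<circ> inv_into UNIV h"]) (simp_all add: ft tf fe image_subset_iff)
 qed
 moreover have "\<forall>i>0. gr ?R i = {\<zero>\<^sub>?R}"
 proof (intro allI impI)
  fix i :: int assume "i > 0"
  then have "sum_list (map gdeg w) ~= i" for w :: "('a, 'k) gen list" using gdeg_sum_nonpos[of w] by simp
  then have "{w : lists valid. sum_list (map gdeg w) = i} = {}" by blast
  then have "gr P i = {f. keys f <= {}}" unfolding free_alg_simps by (rule arg_cong)
  then have "gr P i = {\<zero>\<^sub>P}" by simp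
  then show "gr ?R i = {\<zero>\<^sub>?R}" by (simp only: transport_simps image_insert image_empty)
 qed
 ultimately show ?thesis by (simp add: almost_free_res_def kalg)
qed

end

subsection \<open>Coding generators by lists\<close>

text \<open>Unary notation with a terminator, so that no code is a proper prefix of another; 0 and 1
  are distinct because \<open>'k\<close> is a field.\<close>

definition code_nat :: "nat => ('a + 'k::field) list" where
 "code_nat n = replicate n (Inr 1) @ [Inr 0]"

text \<open>A prefix-free code: the first symbol tells the constructors apart, and every list is
  preceded by its length. The recursive call is mapped over the nested lists before
  \<open>concat\<close> to stay within primitive recursion.\<close>

primrec code :: "('a, 'k::field) gen => ('a + 'k) list" where
 "code (Gen a) = [Inr 0, Inl a]"
| "code (Kill n l) = Inr 1 # code_nat n @ code_nat (length l) @
  concat (map (%(c, u). Inr c # code_nat (length u) @ concat u) (map (map_prod id (map code)) l))"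

lemma code_nat_prefix: "code_nat m @ r = code_nat n @ s ==> m = n & r = s"
proof (induct m arbitrary: n)
 case 0
 then show ?case by (cases n) (auto simp: code_nat_def)
next
 case (Suc m)
 then show ?case by (cases n) (auto simp: code_nat_def)
qed

text \<open>Codewords are peeled off one at a time; the common length makes both sequences end
  together.\<close>

lemma concat_prefix:
 assumes "!!x y r s. x : set xs ==> e x @ r = e y @ s ==> x = y & r = s"
 shows "length xs = length ys ==> concat (map e xs) @ r = concat (map e ys) @ s ==> xs = ys & r = s" using assms
proof (induct xs arbitrary: ys)
 case (Cons x xs)
 obtain y zs where ys: "ys = y # zs" using Cons(2) by (cases ys) auto
 have x: "x = y & concat (map e xs) @ r = concat (map e zs) @ s" by (rule Cons(4)) (use Cons(3) ys in simp_all)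
 moreover have "xs = zs & r = s"
 proof (rule Cons(1))
  show "length xs = length zs" using Cons(2) ys by simp
  show "x' = y' & r' = s'" if "x' : set xs" "e x' @ r' = e y' @ s'" for x' y' r' s' by (rule Cons(4)) (use that in simp_all)
 qed (use x in simp)
 ultimately show ?case using ys by simp
qed simp

text \<open>The arbitrary continuations r and s are needed for the induction, because inside a list
  a codeword is followed by the rest of the list. Injectivity is the case where both are
  empty.\<close>

lemma code_prefix: "code x @ r = code y @ s ==> x = y & r = s"
proof (induct x arbitrary: y r s)
 case (Gen a)
 then show ?case by (cases y) auto
next
 case (Kill n l)
 define e :: "'b \<times> ('a, 'b) gen list => ('a + 'b) list"
  where "e = (%(c, w). Inr c # code_nat (length w) @ concat (map code w))"
 have cK: "code (Kill n l) = Inr 1 # code_nat n @ code_nat (length l) @ concat (map e l)" for n l by (simp add: e_def comp_def split_def)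
 obtain n' l' where y: "y = Kill n' l'" using Kill(2) by (cases y) auto
 have "code_nat n @ code_nat (length l) @ concat (map e l) @ r = code_nat n' @ code_nat (length l') @ concat (map e l') @ s"
  using Kill(2) unfolding y cK by simp
 from code_nat_prefix[OF this] have n: "n = n'"
  and "code_nat (length l) @ concat (map e l) @ r = code_nat (length l') @ concat (map e l') @ s" by auto
 from code_nat_prefix[OF this(2)] have len: "length l = length l'"
  and c: "concat (map e l) @ r = concat (map e l') @ s" by auto
 have "l = l' & r = s"
 proof (rule concat_prefix[OF _ len c])
  fix x y r s assume x: "x : set l" and xy: "e x @ r = e y @ s"
  obtain c w d v where e: "x = (c, w)" "y = (d, v)" by (cases x; cases y)
  have cd: "c = d" and "code_nat (length w) @ concat (map code w) @ r = code_nat (length v) @ concat (map code v) @ s"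
   using xy by (auto simp: e_def e)
  from code_nat_prefix[OF this(2)] have len: "length w = length v"
   and c: "concat (map code w) @ r = concat (map code v) @ s" by auto
  have "w = v & r = s" by (rule concat_prefix[OF _ len c]) (use Kill(1) x e in force)
  then show "x = y & r = s" using e cd by simp
 qed
 then show ?case using n y by simp
qed

text \<open>An element is coded through some list presenting it; wrapping the list in
  \<open>Kill 0\<close> reuses the code of generators.\<close>

definition code_poly :: "(('a, 'k::field) gen list \<Rightarrow>\<^sub>0 'k) => ('a + 'k) list" where
 "code_poly p = code (Kill 0 (SOME l. lsum l = p))"

lemma inj_code_poly: "inj code_poly"
proof (rule injI)
 fix p q :: "('a, 'k::field) gen list \<Rightarrow>\<^sub>0 'k"
 assume "code_poly p = code_poly q"
 then have "(SOME l. lsum l = p) = (SOME l. lsum l = q)"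
  using code_prefix[of "Kill 0 (SOME l. lsum l = p)" "[]" "Kill 0 (SOME l. lsum l = q)" "[]"]
  by (simp only: code_poly_def append_Nil2 gen.inject)
 moreover have "lsum (SOME l. lsum l = p) = p" for p :: "('a, 'k) gen list \<Rightarrow>\<^sub>0 'k"
  by (rule someI_ex) (use lsum_surj[of p UNIV] in auto)
 ultimately show "p = q" by metis
qed

lemma res_choice_exists: "\<exists>Q :: ('k::field, 'a, ('a + 'k) list) res_choice. res_choice Q"
 unfolding res_choice_def
proof (intro exI allI impI)
 fix A :: "('k, 'a) module" assume "kalg A"
 then interpret standard_res A by unfold_locales
 show "almost_free_res A ((%A. (transport code_poly (free_alg (standard_res.valid A) gdeg gdif),
   standard_res.ev A \<circ> inv_into UNIV code_poly)) A)" using transport_res[OF inj_code_poly] by simp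
qed

section \<open>Matrix units and cohomology in degree zero\<close>

section \<open>Matrix units\<close>

context kmod
begin

lemma finsum_single:
 assumes "finite J" "i : J" "h i : carrier M" "!!k. k : J ==> k ~= i ==> h k = \<zero>"
 shows "finsum M h J = h i"
proof -
 have "finsum M h {i} = finsum M h J" by (rule finsum_mono_neutral) (use assms in fastforce)+
 then show ?thesis using assms(3) by simp
qed

text \<open>A spanning set of least cardinality will do: a nontrivial relation would allow one of
  its members to be dropped.\<close>

lemma basis_exists:
 assumes "fin_dim M (carrier M)"
 obtains B where "finite B" "B <= carrier M" "!!v. v : carrier M ==> \<exists>c. v = (\<Oplus>b\<in>B. c b \<odot> b)"
  "!!c c' b. (\<Oplus>b\<in>B. c b \<odot> b) = (\<Oplus>b\<in>B. c' b \<odot> b) ==> b : B ==> c b = c' b"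
proof -
 define sp where "sp B \<longleftrightarrow> finite B & B <= carrier M & (\<forall>v\<in>carrier M. \<exists>c. v = (\<Oplus>b\<in>B. c b \<odot> b))" for B
 have "\<exists>B. sp B" using assms by (auto simp: fin_dim_def sp_def)
 then obtain B where B: "sp B" "!!B'. sp B' ==> card B \<le> card B'" using ex_has_least_nat[of sp _ card] by blast
 have fB: "finite B" "B <= carrier M" using B(1) by (auto simp: sp_def)
 note Bc = subsetD[OF fB(2)]
 have "c b = c' b" if e: "(\<Oplus>b\<in>B. c b \<odot> b) = (\<Oplus>b\<in>B. c' b \<odot> b)" and b: "b : B" for c c' b
 proof (rule ccontr)
  assume ne: "c b ~= c' b"
  have "(\<Oplus>b\<in>B. c b \<odot> b) = (\<Oplus>b\<in>B. (c b - c' b) \<odot> b \<oplus> c' b \<odot> b)"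
   by (rule finsum_cong') (use Bc in \<open>auto simp: sm_ladd[symmetric]\<close>)
  also have "... = (\<Oplus>b\<in>B. (c b - c' b) \<odot> b) \<oplus> (\<Oplus>b\<in>B. c' b \<odot> b)"
   by (rule finsum_addf) (use Bc in auto)
  finally have 0: "(\<Oplus>b\<in>B. (c b - c' b) \<odot> b) = \<zero>" using e Bc by (simp add: Pi_def)
  have "sp (B - {b})" unfolding sp_def
  proof (intro conjI ballI)
   fix v assume "v : carrier M"
   then obtain a where a: "v = (\<Oplus>b\<in>B. a b \<odot> b)" using B(1) by (auto simp: sp_def)
   \<comment> \<open>Chosen so that adding t times the relation makes the coefficient of b
     vanish.\<close>
   define t where "t = - a b / (c b - c' b)"
   have "(\<Oplus>x\<in>B. (a x + t * (c x - c' x)) \<odot> x) = (\<Oplus>x\<in>B. a x \<odot> x \<oplus> t \<odot> ((c x - c' x) \<odot> x))"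
    by (rule finsum_cong') (use Bc in \<open>auto simp: sm_ladd\<close>)
   also have "... = v \<oplus> t \<odot> (\<Oplus>x\<in>B. (c x - c' x) \<odot> x)"
    unfolding a by (subst sm_finsum, use Bc in force, rule finsum_addf) (use Bc in auto)
   also have "... = v" unfolding 0 using \<open>v : carrier M\<close> by simp
   finally have "v = (\<Oplus>x\<in>B. (a x + t * (c x - c' x)) \<odot> x)" by simp
   also have "... = (\<Oplus>x\<in>B - {b}. (a x + t * (c x - c' x)) \<odot> x)"
    by (rule finsum_mono_neutral[symmetric]) (use fB(1) Bc b ne in \<open>auto simp: t_def\<close>)
   finally show "\<exists>c. v = (\<Oplus>b\<in>B - {b}. c b \<odot> b)" by (rule exI[of _ "%x. a x + t * (c x - c' x)"])
  qed (use fB in auto)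
  then show False using B(2)[of "B - {b}"] b fB(1) card_Diff1_less[of B b] by fastforce
 qed
 then show ?thesis using that[of B] B(1) by (auto simp: sp_def)
qed

end

text \<open>An algebra of matrices over k, described by its entries: \<open>co x i j\<close> is the
  entry at (i, j) and \<open>e i j\<close> the matrix unit. The products of units, the entries of 1
  and the sum of the diagonal units follow by comparing entries.\<close>

locale matrix_units = kalgebra E for E :: "('k::field, 'e, 'm) module_scheme" (structure) +
 fixes I :: "'i set" and e :: "'i => 'i => 'e" and co :: "'e => 'i => 'i => 'k"
 assumes fin_I: "finite I" and e_closed: "i : I ==> j : I ==> e i j : carrier E"
  and co_e: "i : I ==> j : I ==> k : I ==> l : I ==> co (e i j) k l = (if i = k & j = l then 1 else 0)"
  and co_add: "i : I ==> j : I ==> x : carrier E ==> y : carrier E ==> co (x \<oplus> y) i j = co x i j + co y i j"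
  and co_smult: "i : I ==> j : I ==> x : carrier E ==> co (c \<odot> x) i j = c * co x i j"
  and co_mult: "i : I ==> j : I ==> x : carrier E ==> y : carrier E ==>
   co (x \<otimes> y) i j = (\<Sum>l\<in>I. co x i l * co y l j)"
  and co_expand: "x : carrier E ==> x = (\<Oplus>i\<in>I. \<Oplus>j\<in>I. co x i j \<odot> e i j)"
begin

lemmas [simp] = fin_I e_closed

lemma co_eqI:
 assumes "x : carrier E" "y : carrier E" "!!i j. i : I ==> j : I ==> co x i j = co y i j"
 shows "x = y"
proof -
 have "x = (\<Oplus>i\<in>I. \<Oplus>j\<in>I. co x i j \<odot> e i j)" by (rule co_expand[OF assms(1)])
 also have "... = (\<Oplus>i\<in>I. \<Oplus>j\<in>I. co y i j \<odot> e i j)" by (intro finsum_cong' refl) (auto simp: assms(3))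
 also have "... = y" by (rule co_expand[OF assms(2), symmetric])
 finally show ?thesis .
qed

lemma co_zero: "i : I ==> j : I ==> co \<zero> i j = 0"
 using co_smult[of i j \<zero> 0] by simp

lemma e_mult:
 assumes "i : I" "j : I" "k : I" "l : I"
 shows "e i j \<otimes> e k l = (if j = k then e i l else \<zero>)"
proof (rule co_eqI)
 fix a b assume ab: "a : I" "b : I"
 have "(\<Sum>c\<in>I. co (e i j) a c * co (e k l) c b) = (\<Sum>c\<in>I. if c = j then (if i = a & k = j & l = b then 1 else 0) else 0)"
  by (rule sum.cong) (use assms ab in \<open>auto simp: co_e\<close>)
 also have "... = (if i = a & k = j & l = b then 1 else 0)" using assms by (simp only: sum.delta[OF fin_I] if_True)
 finally show "co (e i j \<otimes> e k l) a b = co (if j = k then e i l else \<zero>) a b"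
  using assms ab by (auto simp: co_mult co_e co_zero)
qed (use assms in auto)

text \<open>Compare the entries at (i, j) in 1 e_jj = e_jj, expanding the product.\<close>

lemma co_one: "i : I ==> j : I ==> co \<one> i j = (if i = j then 1 else 0)"
proof -
 assume ij: "i : I" "j : I"
 have "co (e j j) i j = (\<Sum>c\<in>I. co \<one> i c * co (e j j) c j)" using co_mult[OF ij, of \<one> "e j j"] ij by simp
 also have "... = (\<Sum>c\<in>I. if c = j then co \<one> i j else 0)" by (rule sum.cong) (use ij in \<open>auto simp: co_e\<close>)
 also have "... = co \<one> i j" using ij by (simp only: sum.delta[OF fin_I] if_True)
 finally show ?thesis using ij by (auto simp: co_e)
qed

lemma sum_e: "(\<Oplus>i\<in>I. e i i) = \<one>"
proof -
 have "\<one> = (\<Oplus>i\<in>I. \<Oplus>j\<in>I. co \<one> i j \<odot> e i j)" by (rule co_expand) simp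
 also have "... = (\<Oplus>i\<in>I. co \<one> i i \<odot> e i i)" by (intro finsum_cong' finsum_single refl) (auto simp: co_one)
 also have "... = (\<Oplus>i\<in>I. e i i)" by (intro finsum_cong') (auto simp: co_one)
 finally show ?thesis by simp
qed

end

locale deg0_complex = fin_complex V for V :: "('k::field, 'v) dg" (structure) +
 assumes deg0: "n ~= 0 ==> gr V n = {\<zero>}"
begin

lemma E_simps: "carrier E = carrier E0" "monoid.mult E = monoid.mult E0" "one E = one E0" "ring.zero E = ring.zero E0"
  "add E = add E0" "smult E = smult E0" "gr E = gr E0" by (simp_all add: dg_End_def)

lemma gr_V0: "gr V 0 = carrier V"
proof -
 have "x : gr V 0" if x: "x : carrier V" for x using x
 proof (induct x rule: gr_induct)
  case (homog n x)
  then show ?case using deg0[of n] by (cases "n = 0") auto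
 qed auto
 then show ?thesis by auto
qed

lemma gr_E: "gr E n = (if n = 0 then carrier E else {\<zero>\<^sub>E})"
proof -
 interpret E: dgalgebra E by unfold_locales (rule E_dga)
 have "f : gr E 0" if f: "f : carrier E" for f
 proof -
  have fV: "linear_map V V f" using f by (simp add: E_simps)
  interpret f: lin_map V V f by unfold_locales (rule fV)
  have "f x : gr V (i + 0)" if "x : gr V i" for x i using that deg0[of i] gr_V0 by (cases "i = 0") auto
  then show ?thesis using f unfolding E_simps E0_gr by blast
 qed
 then have "gr E 0 = carrier E" by (auto simp: E.gr_carrier)
 moreover have "gr E n = {\<zero>\<^sub>E}" if "n ~= 0"
  using E.gr_disj[of _ n 0] that \<open>gr E 0 = carrier E\<close> by (auto simp: E.gr_carrier)
 ultimately show ?thesis by simp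
qed

text \<open>The index set is a basis of V, and \<open>e b b'\<close> sends b' to b and the other
  basis vectors to zero. The second conclusion separates the case V = 0, where there are no
  indices.\<close>

lemma matrix_units_exist:
 obtains I and e :: "'v => 'v => 'v => 'v" and co where "matrix_units E I e co" "I ~= {} \<longleftrightarrow> carrier V ~= {\<zero>}"
proof -
 have "fin_dim V (carrier V)" using fin gr_V0 by (simp add: fin_total_dim_def) metis
 then obtain B where B: "finite B" "B <= carrier V" "!!v. v : carrier V ==> \<exists>c. v = (\<Oplus>b\<in>B. c b \<odot> b)"
  "!!c c' b. (\<Oplus>b\<in>B. c b \<odot> b) = (\<Oplus>b\<in>B. c' b \<odot> b) ==> b : B ==> c b = c' b" by (rule basis_exists) blast
 define bc where "bc v = (SOME c. v = (\<Oplus>b\<in>B. c b \<odot> b))" for v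
 have bc: "v = (\<Oplus>b\<in>B. bc v b \<odot> b)" if "v : carrier V" for v
  unfolding bc_def by (rule someI_ex[of "%c. v = (\<Oplus>b\<in>B. c b \<odot> b)", OF B(3)[OF that]])
 note Bc = subsetD[OF B(2)]
 have Bf: "(%b. c b \<odot> b) : B \<rightarrow> carrier V" for c using Bc by auto
 have bcI: "bc v b = c b" if "v = (\<Oplus>b\<in>B. c b \<odot> b)" "b : B" for v c b
 proof (rule B(4)[OF _ that(2)])
  have "v : carrier V" unfolding that(1) using Bf by simp
  then show "(\<Oplus>b\<in>B. bc v b \<odot> b) = (\<Oplus>b\<in>B. c b \<odot> b)" using bc[of v] that(1) by simp
 qed
 have bc_add: "bc (v \<oplus> w) b = bc v b + bc w b" if "v : carrier V" "w : carrier V" "b : B" for v w b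
 proof (rule bcI[OF _ that(3)])
  have "v \<oplus> w = (\<Oplus>b\<in>B. bc v b \<odot> b) \<oplus> (\<Oplus>b\<in>B. bc w b \<odot> b)" using bc[OF that(1)] bc[OF that(2)] by simp
  also have "... = (\<Oplus>b\<in>B. bc v b \<odot> b \<oplus> bc w b \<odot> b)" by (rule finsum_addf[symmetric]) (rule Bf)+
  also have "... = (\<Oplus>b\<in>B. (bc v b + bc w b) \<odot> b)" by (rule finsum_cong') (use Bc in \<open>auto simp: sm_ladd\<close>)
  finally show "v \<oplus> w = (\<Oplus>b\<in>B. (bc v b + bc w b) \<odot> b)" .
 qed
 have bc_smult: "bc (a \<odot> v) b = a * bc v b" if "v : carrier V" "b : B" for a v b
 proof (rule bcI[OF _ that(2)])
  have "a \<odot> v = a \<odot> (\<Oplus>b\<in>B. bc v b \<odot> b)" using bc[OF that(1)] by simp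
  also have "... = (\<Oplus>b\<in>B. a \<odot> (bc v b \<odot> b))" by (rule sm_finsum) (rule Bf)
  also have "... = (\<Oplus>b\<in>B. (a * bc v b) \<odot> b)" by (rule finsum_cong') (use Bc in auto)
  finally show "a \<odot> v = (\<Oplus>b\<in>B. (a * bc v b) \<odot> b)" .
 qed
 have bc_B: "bc b b' = (if b = b' then 1 else 0)" if "b : B" "b' : B" for b b'
 proof -
  have "(\<Oplus>b'\<in>B. (if b = b' then 1 else 0) \<odot> b') = (if b = b then 1 else 0) \<odot> b"
   by (rule finsum_single) (use B(1) that Bc in auto)
  then show ?thesis using bcI[of b "%b'. if b = b' then 1 else 0" b'] that Bc by simp
 qed
 define e where "e b b' = (\<lambda>v\<in>carrier V. bc v b' \<odot> b)" for b b'
 define co where "co f b b' = bc (f b') b" for f :: "'v => 'v" and b b'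
 interpret E: kalgebra E using E_dga by unfold_locales (simp add: dga_def galg_def)
 note [simp del] = graded_End_simps
 have e: "e b b' : carrier E" if "b : B" "b' : B" for b b'
  unfolding e_def E_simps by (rule E0_I) (use that Bc in \<open>auto simp: bc_add bc_smult sm_ladd\<close>)
 have app: "finsum E F J v = (\<Oplus>i\<in>J. F i v)" if "F : J \<rightarrow> carrier E" "v : carrier V" for F and J :: "'v set" and v
  using E0_finsum[of F J v] that by (simp add: finsum_def finprod_def E_simps)
 have fv: "f v = (\<Oplus>b'\<in>B. bc v b' \<odot> f b')" if f: "f : carrier E" and v: "v : carrier V" for f v
 proof -
  interpret f: lin_map V V f by unfold_locales (use f in \<open>simp add: E_simps graded_End_simps\<close>)
  have "f v = f (\<Oplus>b\<in>B. bc v b \<odot> b)" using bc[OF v] by simp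
  also have "... = (\<Oplus>b\<in>B. f (bc v b \<odot> b))" by (rule f.finsum) (rule Bf)
  also have "... = (\<Oplus>b'\<in>B. bc v b' \<odot> f b')" by (rule finsum_cong') (use Bc in \<open>auto simp: f.smult\<close>)
  finally show ?thesis .
 qed
 have bc_sum: "bc (\<Oplus>i\<in>J. F i) b = (\<Sum>i\<in>J. bc (F i) b)" if "finite J" "!!i. i : J ==> F i : carrier V" "b : B" for F b and J :: "'v set"
  using that
 proof (induct J rule: finite_induct)
  case empty
  show ?case using bc_smult[of \<zero> b 0] empty by simp
 next
  case (insert i J)
  then show ?case by (simp add: Pi_def bc_add)
 qed
 have appB: "f b : carrier V" if "f : carrier E" "b : B" for f b using that E0_D(1) Bc by (simp add: E_simps)
 have "matrix_units E B e co"
 proof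
  show "co (e i j) k l = (if i = k & j = l then 1 else 0)" if "i : B" "j : B" "k : B" "l : B" for i j k l
   using that Bc by (simp add: co_def e_def bc_smult bc_B)
  show "co (x \<oplus>\<^sub>E y) i j = co x i j + co y i j" if "i : B" "j : B" "x : carrier E" "y : carrier E" for i j x y
   using that Bc appB by (simp add: co_def E_simps bc_add)
  show "co (c \<odot>\<^sub>E x) i j = c * co x i j" if "i : B" "j : B" "x : carrier E" for c i j x
   using that Bc appB by (simp add: co_def E_simps bc_smult)
  show "co (x \<otimes>\<^sub>E y) i j = (\<Sum>l\<in>B. co x i l * co y l j)" if "i : B" "j : B" "x : carrier E" "y : carrier E" for i j x y
  proof -
   have "bc (x (y j)) i = bc (\<Oplus>b'\<in>B. bc (y j) b' \<odot> x b') i" using fv[OF that(3) appB[OF that(4,2)]] by simp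
   also have "... = (\<Sum>l\<in>B. bc (bc (y j) l \<odot> x l) i)" by (rule bc_sum) (use B(1) that appB in auto)
   also have "... = (\<Sum>l\<in>B. bc (x l) i * bc (y j) l)" by (rule sum.cong) (use that appB in \<open>auto simp: bc_smult\<close>)
   finally show ?thesis using that Bc by (simp add: co_def E_simps)
  qed
  show "x = (\<Oplus>\<^sub>E i\<in>B. \<Oplus>\<^sub>E j\<in>B. co x i j \<odot>\<^sub>E e i j)" if x: "x : carrier E" for x
  proof (rule E0_eqI)
   show "x : carrier E0" using x by (simp add: E_simps)
   have c: "co x i j \<odot>\<^sub>E e i j : carrier E" if "i : B" "j : B" for i j using that e by auto
   then have c2: "(\<Oplus>\<^sub>E i\<in>B. co x i j \<odot>\<^sub>E e i j) : carrier E" "(\<Oplus>\<^sub>E j\<in>B. co x i j \<odot>\<^sub>E e i j) : carrier E"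
    if "i : B" "j : B" for i j using that by (auto intro!: E.finsum_closed)
   then have c3: "(%i. \<Oplus>\<^sub>E j\<in>B. co x i j \<odot>\<^sub>E e i j) : B \<rightarrow> carrier E" by auto
   then show "(\<Oplus>\<^sub>E i\<in>B. \<Oplus>\<^sub>E j\<in>B. co x i j \<odot>\<^sub>E e i j) : carrier E0"
    using E.finsum_closed[OF c3] by (simp add: E_simps)
   fix v assume v: "v : carrier V"
   have "(\<Oplus>\<^sub>E i\<in>B. \<Oplus>\<^sub>E j\<in>B. co x i j \<odot>\<^sub>E e i j) v = (\<Oplus>i\<in>B. (\<Oplus>\<^sub>E j\<in>B. co x i j \<odot>\<^sub>E e i j) v)"
    by (rule app[OF c3 v])
   also have "... = (\<Oplus>i\<in>B. bc (x v) i \<odot> i)"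
   proof (rule finsum_cong'[OF refl])
    fix i assume i: "i : B"
    have "(\<Oplus>\<^sub>E j\<in>B. co x i j \<odot>\<^sub>E e i j) v = (\<Oplus>j\<in>B. (co x i j \<odot>\<^sub>E e i j) v)"
     by (rule app) (use c i v in auto)
    also have "... = (\<Oplus>j\<in>B. (bc v j * co x i j) \<odot> i)"
     by (rule finsum_cong') (use i v Bc in \<open>auto simp: E_simps e_def mult.commute\<close>)
    also have "... = (\<Sum>j\<in>B. bc v j * co x i j) \<odot> i" using B(1)
    proof (induct B rule: finite_induct)
     case (insert j J)
     then show ?case using i Bc by (simp add: Pi_def sm_ladd)
    qed (use i Bc in simp)
    also have "(\<Sum>j\<in>B. bc v j * co x i j) = (\<Sum>j\<in>B. bc (bc v j \<odot> x j) i)"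
     by (rule sum.cong) (use i x appB in \<open>auto simp: co_def bc_smult\<close>)
    also have "... = bc (\<Oplus>j\<in>B. bc v j \<odot> x j) i" by (rule bc_sum[symmetric]) (use B(1) i x appB in auto)
    also have "... = bc (x v) i" using fv[OF x v] by simp
    finally show "(\<Oplus>\<^sub>E j\<in>B. co x i j \<odot>\<^sub>E e i j) v = bc (x v) i \<odot> i" .
   qed (rule Bf)
   also have "... = x v" using bc[of "x v"] E0_D(1)[of x v] x v by (simp add: E_simps)
   finally show "x v = (\<Oplus>\<^sub>E i\<in>B. \<Oplus>\<^sub>E j\<in>B. co x i j \<odot>\<^sub>E e i j) v" by simp
  qed
 qed (use B(1) e in auto)
 moreover have "B ~= {} \<longleftrightarrow> carrier V ~= {\<zero>}"
 proof
  assume "carrier V ~= {\<zero>}"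
  then obtain v where "v : carrier V" "v ~= \<zero>" using zero_closed by blast
  then show "B ~= {}" using bc[of v] by auto
 next
  assume "B ~= {}"
  then obtain b where b: "b : B" by auto
  then have "b ~= \<zero>" using bc_B[of b b] bc_smult[of \<zero> b 0] by auto
  then show "carrier V ~= {\<zero>}" using b Bc by blast
 qed
 ultimately show ?thesis by (rule that)
qed

end

section \<open>Entries with respect to matrix units\<close>

text \<open>E sits in degree 0, so graded commutators with elements of E are plain commutators and d
  vanishes on E.\<close>

locale unit_map = matrix_units E I e co + j: dga_map E T j
 for E :: "('k::field, 'e) dg" and I :: "'i set" and e co and T :: "('k, 't) dg" and j +
 assumes gr_E0: "gr E 0 = carrier E"

sublocale unit_map \<subseteq> c: centralizer E T j ..

context unit_map
begin

lemma cent_eq: "c.cent = {w : carrier T. \<forall>m\<in>carrier E. w \<otimes>\<^sub>T j m = j m \<otimes>\<^sub>T w}" 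
proof -
 have "w : c.cent \<longleftrightarrow> w : carrier T & (\<forall>m\<in>carrier E. w \<otimes>\<^sub>T j m = j m \<otimes>\<^sub>T w)" for w
 proof
  assume w: "w : c.cent"
  have "w \<otimes>\<^sub>T j m = j m \<otimes>\<^sub>T w" if "m : carrier E" for m
   using c.cent_comm[OF w, of m 0] that gr_E0 by (simp add: j.S.sgp_def)
  then show "w : carrier T & (\<forall>m\<in>carrier E. w \<otimes>\<^sub>T j m = j m \<otimes>\<^sub>T w)"
   using w by (simp add: c.cent_def)
 next
  assume a: "w : carrier T & (\<forall>m\<in>carrier E. w \<otimes>\<^sub>T j m = j m \<otimes>\<^sub>T w)"
  have "w \<otimes>\<^sub>T j m = j m \<otimes>\<^sub>T j.S.sgp n w" if m: "m : gr E n" for n m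
  proof (cases "n = 0")
   case True
   then show ?thesis using a m by (simp add: j.S.sgp_def j.R.gr_carrier)
  next
   case False
   then have "m = \<zero>\<^sub>E" using j.R.gr_disj[OF m, of 0] gr_E0 m j.R.gr_carrier by auto
   then show ?thesis using a by simp
  qed
  then show "w : c.cent" using a by (auto simp: c.cent_iff)
 qed
 then show ?thesis by blast
qed

abbreviation "ee i l \<equiv> j (e i l)"

lemma ee_mult: "i : I ==> l : I ==> m : I ==> n : I ==> ee i l \<otimes>\<^sub>T ee m n = (if l = m then ee i n else \<zero>\<^sub>T)"
 using e_mult[of i l m n] j.mult[of "e i l" "e m n"] by auto

lemma ee_mult': "i : I ==> l : I ==> m : I ==> n : I ==> x : carrier T ==>
  ee i l \<otimes>\<^sub>T (ee m n \<otimes>\<^sub>T x) = (if l = m then ee i n \<otimes>\<^sub>T x else \<zero>\<^sub>T)"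
 using ee_mult[of i l m n] by (simp add: j.S.m_assoc[symmetric])

lemma sum_ee: "(\<Oplus>\<^sub>T i\<in>I. ee i i) = \<one>\<^sub>T"
 using j.finsum[of "%i. e i i" I] sum_e by simp

text \<open>The entry at (i, l) of x when T is regarded as the algebra of matrices over the
  centralizer of E. The sum over k spreads this entry along the diagonal, which makes it commute
  with the units.\<close>

definition ent :: "'i => 'i => 't => 't" where
 "ent i l x = (\<Oplus>\<^sub>T k\<in>I. ee k i \<otimes>\<^sub>T (x \<otimes>\<^sub>T ee l k))"

lemma ent_closed [simp]: "i : I ==> l : I ==> x : carrier T ==> ent i l x : carrier T"
 unfolding ent_def by (rule j.S.finsum_closed) auto

lemma ent_linear: 
 assumes "i : I" "l : I"
 shows "linear_map T T (ent i l)"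
proof (rule linear_mapI)
 show "ent i l (x \<oplus>\<^sub>T y) = ent i l x \<oplus>\<^sub>T ent i l y" if "x : carrier T" "y : carrier T" for x y
  unfolding ent_def using assms that
  by (subst j.S.finsum_addf[symmetric], force, force, intro j.S.finsum_cong') (auto simp: j.S.l_distr j.S.r_distr)
 show "ent i l (c \<odot>\<^sub>T x) = c \<odot>\<^sub>T ent i l x" if "x : carrier T" for c x unfolding ent_def using assms that
  by (subst j.S.sm_finsum, force, intro j.S.finsum_cong') auto
qed (use assms in auto)

text \<open>The elements of E that commute with the entry form a subspace, so the units
  \<open>e a b\<close> suffice; for these both products reduce to e_ai x e_lb.\<close>

lemma ent_cent:
 assumes "i : I" "l : I" and x: "x : carrier T"
 shows "ent i l x : c.cent"
proof -
 let ?y = "ent i l x"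
 have y: "?y : carrier T" using assms by simp
 define C where "C = {m : carrier E. ?y \<otimes>\<^sub>T j m = j m \<otimes>\<^sub>T ?y}"
 have C: "submodule C ground E" by (rule submoduleI')
   (use y in \<open>auto simp: C_def lin_map.add[OF j.lin_map_axioms] j.smult j.S.l_distr j.S.r_distr\<close>)
 have "e a b : C" if ab: "a : I" "b : I" for a b
 proof -
  have t: "ee k i \<otimes>\<^sub>T (x \<otimes>\<^sub>T ee l k) : carrier T" if "k : I" for k using that assms by auto
  have "?y \<otimes>\<^sub>T ee a b = (\<Oplus>\<^sub>T k\<in>I. ee k i \<otimes>\<^sub>T (x \<otimes>\<^sub>T ee l k) \<otimes>\<^sub>T ee a b)"
   unfolding ent_def by (rule j.S.finsum_ldistr) (use t ab in auto)
  also have "... = ee a i \<otimes>\<^sub>T (x \<otimes>\<^sub>T ee l a) \<otimes>\<^sub>T ee a b"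
   by (rule j.S.finsum_single) (use ab assms in \<open>auto simp: j.S.m_assoc ee_mult\<close>)
  also have "... = ee a i \<otimes>\<^sub>T (x \<otimes>\<^sub>T ee l b)" using ab assms by (simp add: j.S.m_assoc ee_mult)
  also have "... = ee a b \<otimes>\<^sub>T (ee b i \<otimes>\<^sub>T (x \<otimes>\<^sub>T ee l b))" using ab assms by (simp add: ee_mult')
  also have "... = (\<Oplus>\<^sub>T k\<in>I. ee a b \<otimes>\<^sub>T (ee k i \<otimes>\<^sub>T (x \<otimes>\<^sub>T ee l k)))"
   by (rule j.S.finsum_single[symmetric]) (use ab assms in \<open>auto simp: ee_mult'\<close>)
  also have "... = ee a b \<otimes>\<^sub>T ?y" unfolding ent_def by (rule j.S.finsum_rdistr[symmetric]) (use t ab in auto)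
  finally show ?thesis using ab by (simp add: C_def)
 qed
 then have "(\<Oplus>\<^sub>E i\<in>I. \<Oplus>\<^sub>E j\<in>I. co m i j \<odot>\<^sub>E e i j) : C" for m
  by (intro finsum_in_submodule[OF C] submoduleD(4)[OF C])
 then have "m : C" if "m : carrier E" for m by (subst co_expand[OF that])
 then show ?thesis using y by (auto simp: cent_eq C_def)
qed

text \<open>For x in the centralizer the units move past x, leaving x times sum_k e_kk = 1 if i = l
  and zero otherwise. So \<open>ent i i\<close> is a projection onto the centralizer; the next
  lemmas show that it preserves degrees, commutes with d and is natural.\<close>

lemma ent_of_cent:
 assumes il: "i : I" "l : I" and x: "x : c.cent"
 shows "ent i l x = (if i = l then x else \<zero>\<^sub>T)"
proof -
 have xc: "x : carrier T" and xe: "x \<otimes>\<^sub>T ee a b = ee a b \<otimes>\<^sub>T x" if "a : I" "b : I" for a b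
  using x that by (auto simp: cent_eq)
 have "ent i l x = (\<Oplus>\<^sub>T k\<in>I. (if i = l then ee k k else \<zero>\<^sub>T) \<otimes>\<^sub>T x)"
  unfolding ent_def by (rule j.S.finsum_cong') (use il xc in \<open>auto simp: xe ee_mult'\<close>)
 also have "... = (\<Oplus>\<^sub>T k\<in>I. if i = l then ee k k else \<zero>\<^sub>T) \<otimes>\<^sub>T x"
  by (rule j.S.finsum_ldistr[symmetric]) (use il xc in auto)
 also have "... = (if i = l then x else \<zero>\<^sub>T)" using il xc sum_ee by auto
 finally show ?thesis .
qed

lemma ent_gr: "i : I ==> l : I ==> x : gr T n ==> ent i l x : gr T n"
proof -
 assume a: "i : I" "l : I" "x : gr T n"
 have e0: "ee b c : gr T 0" if "b : I" "c : I" for b c using that j.gr[of "e b c" 0] gr_E0 by simp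
 show ?thesis unfolding ent_def
 proof (rule j.S.finsum_in_submodule[OF j.S.gr_submodule])
  fix k assume "k : I"
  then show "ee k i \<otimes>\<^sub>T (x \<otimes>\<^sub>T ee l k) : gr T n" using j.S.mult_gr[OF e0 j.S.mult_gr[OF a(3) e0]] a by simp
 qed
qed

lemma dif_E: "m : carrier E ==> dif E m = \<zero>\<^sub>E"
 using j.R.d_gr[of m 0] j.R.gr_disj[of "dif E m" 1 0] gr_E0 j.R.gr_carrier by auto

lemma dif_ent: "i : I ==> l : I ==> x : carrier T ==> dif T (ent i l x) = ent i l (dif T x)"
proof -
 assume a: "i : I" "l : I" "x : carrier T"
 have e0: "ee b c : gr T 0" "dif T (ee b c) = \<zero>\<^sub>T" if "b : I" "c : I" for b c
  using that j.gr[of "e b c" 0] gr_E0 j.dif[of "e b c"] dif_E by auto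
 have "dif T (ent i l x) = (\<Oplus>\<^sub>T k\<in>I. dif T (ee k i \<otimes>\<^sub>T (x \<otimes>\<^sub>T ee l k)))"
  unfolding ent_def by (rule j.S.d.finsum) (use a in auto)
 also have "... = ent i l (dif T x)" unfolding ent_def
  by (rule j.S.finsum_cong') (use a in \<open>auto simp: j.S.leibniz e0(2) j.S.sg_homog[OF e0(1)]\<close>)
 finally show ?thesis .
qed

lemma ent_map:
 assumes "unit_map E I e co T' j'" "alg_hom T T' H" "!!m. m : carrier E ==> H (j m) = j' m"
  and "i : I" "l : I" "x : carrier T"
 shows "H (ent i l x) = unit_map.ent I e T' j' i l (H x)"
proof -
 interpret U: unit_map E I e co T' j' by fact
 interpret H: alg_map T T' H by unfold_locales fact
 have "H (ent i l x) = (\<Oplus>\<^sub>T' k\<in>I. H (ee k i \<otimes>\<^sub>T (x \<otimes>\<^sub>T ee l k)))"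
  unfolding ent_def by (rule H.finsum) (use assms in auto)
 also have "... = U.ent i l (H x)" unfolding U.ent_def by (rule U.j.S.finsum_cong') (use assms in \<open>auto simp: H.mult\<close>)
 finally show ?thesis .
qed

end

section \<open>The degree zero cohomology for complexes concentrated in degree zero\<close>

lemma (in galgebra) pr_mult:
 assumes x: "x : carrier R" and y: "y : carrier R"
 shows "pr (x \<otimes> y) n = (\<Oplus>i\<in>supp R x. pr x i \<otimes> pr y (n - i))"
proof -
 interpret l: lin_map R R "%z. pr z n" by unfold_locales (rule pr_linear)
 have "x \<otimes> y = (\<Oplus>i\<in>supp R x. pr x i) \<otimes> y" using finsum_pr[OF x finite_supp[OF x] subset_refl] by simp
 also have "... = (\<Oplus>i\<in>supp R x. pr x i \<otimes> y)" by (rule finsum_ldistr) (use x y in auto)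
 finally have "pr (x \<otimes> y) n = pr (\<Oplus>i\<in>supp R x. pr x i \<otimes> y) n" by simp
 also have "... = (\<Oplus>i\<in>supp R x. pr (pr x i \<otimes> y) n)" by (rule l.finsum) (use x y in auto)
 also have "... = (\<Oplus>i\<in>supp R x. pr x i \<otimes> pr y (n - i))"
  by (rule finsum_cong') (use x y in \<open>auto simp: pr_mult_l[OF pr_gr]\<close>)
 finally show ?thesis .
qed

lemma (in alg_map) image_ideal:
 assumes I: "ideal I A" and surj: "f ` carrier A = carrier B"
 shows "ideal (f ` I) B"
proof (rule B.ideal_of_submodule)
 interpret I: ideal I A by fact
 note s = A.submoduleD[OF A.ideal_submodule[OF I]]
 have m: "f a \<oplus>\<^sub>B f b : f ` I" "c \<odot>\<^sub>B f a : f ` I" if "a : I" "b : I" for a b c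
  using imageI[OF s(3)[OF that], of f] imageI[OF s(4)[OF that(1)], of f c] that
  by (simp_all add: lin_map.add[OF lin_map_axioms] smult I.Icarr)
 show "submodule (f ` I) ground B"
 proof (rule B.submoduleI')
  show "\<zero>\<^sub>B : f ` I" using imageI[OF s(2), of f] by simp
 qed (use m I.Icarr in auto)
 fix a x assume "a : carrier B" "x : f ` I"
 then obtain b y where y: "b : carrier A" "a = f b" "y : I" "x = f y" unfolding surj[symmetric] by blast
 then show "a \<otimes>\<^sub>B x : f ` I" "x \<otimes>\<^sub>B a : f ` I"
  using imageI[OF I.I_l_closed[OF y(3,1)], of f] imageI[OF I.I_r_closed[OF y(3,1)], of f] by (simp_all add: mult I.Icarr)
qed

lemma two_dgaI: "dga R ==> dga S ==> two_dga R S"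
 by (intro two_dga.intro dgalgebra.intro)

text \<open>Products of homogeneous elements with degrees in D have degrees in D. Used with the
  nonpositive integers for a resolution and with {0} for A.\<close>

lemma fp_gr_zero:
 assumes dg: "dga R" "dga S" and D: "!!i j. i : D ==> j : D ==> i + j : D"
  and R: "!!n. n \<notin> D ==> gr R n = {\<zero>\<^sub>R}" and S: "!!n. n \<notin> D ==> gr S n = {\<zero>\<^sub>S}" and n: "n \<notin> D"
 shows "gr (free_prod R S) n = {\<zero>\<^bsub>free_prod R S\<^esub>}"
proof -
 let ?T = "free_prod R S"
 interpret T: dgalgebra ?T by unfold_locales (rule two_dga.T_dga[OF two_dgaI[OF dg]])
 interpret P: two_dga R S by (rule two_dgaI[OF dg])
 interpret l: dga_map R ?T "fp_inl R S" by unfold_locales (rule P.fp_inl_hom)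
 interpret r: dga_map S ?T "fp_inr R S" by unfold_locales (rule P.fp_inr_hom)
 have "\<forall>n. n \<notin> D --> homog_part ?T x n = \<zero>\<^sub>?T" if "x : carrier ?T" for x using that
 proof (induct x rule: P.fp_induct)
  case (inl k x)
  then show ?case using R[of k] l.zero by (cases "k : D") (auto simp: T.pr_homog[OF l.gr] T.pr_zero)
 next
  case (inr k x)
  then show ?case using S[of k] r.zero by (cases "k : D") (auto simp: T.pr_homog[OF r.gr] T.pr_zero)
 next
  case (add x y)
  then show ?case by (simp add: T.pr_add)
 next
  case (smult c x)
  then show ?case by (simp add: T.pr_smult)
 next
  case (mult x y)
  show ?case
  proof (intro allI impI)
   fix n assume n: "n \<notin> D"
   have "homog_part ?T x i \<otimes>\<^sub>?T homog_part ?T y (n - i) = \<zero>\<^sub>?T" for i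
   proof (cases "i : D")
    case True
    then have "homog_part ?T y (n - i) = \<zero>\<^sub>?T" using D[of i "n - i"] n mult(4) by auto
    then show ?thesis using T.r_null[OF T.pr_carrier[OF mult(1)]] by simp
   next
    case False
    then have "homog_part ?T x i = \<zero>\<^sub>?T" using mult(3) by auto
    then show ?thesis using T.l_null[OF T.pr_carrier[OF mult(2)]] by simp
   qed
   then show "homog_part ?T (x \<otimes>\<^sub>?T y) n = \<zero>\<^sub>?T" unfolding T.pr_mult[OF mult(1,2)] by simp
  qed
 qed
 then show ?thesis using n T.pr_homog[of _ n n] by (auto simp: T.gr_carrier)
qed

lemma (in dgalgebra) cohom_dga: "dga (cohom R)" and cohom_dif: "c : carrier (cohom R) ==> dif (cohom R) c = \<zero>\<^bsub>cohom R\<^esub>"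
proof -
 show "dga (cohom R)" unfolding cohom_def by (rule H.Q_dga) (auto simp: cocycles_def coboundaries_def intro!: image_eqI[of _ _ \<zero>])
 show "dif (cohom R) c = \<zero>\<^bsub>cohom R\<^esub>" if c: "c : carrier (cohom R)"
 proof -
  obtain z where z: "z : cocycles R" "c = coboundaries R +> z" using c by (auto simp: cohom_carrier)
  have "dif (cohom R) c = coboundaries R +> d z" unfolding cohom_def z(2) using H.Q_dif[of z] z(1) by simp
  then show ?thesis using z H.\<pi>_zero by (simp add: cocyclesD cohom_def)
 qed
qed

text \<open>As X vanishes in degree 1, every element of degree 0 is a cocycle, and f kills
  coboundaries because the differential of Y is zero. So f induces a map on the cohomology of degree
  0, which the last two hypotheses make bijective.\<close>

lemma H0_iso:
 assumes f: "dga_hom X Y f" and Y: "!!n. n ~= 0 ==> gr Y n = {\<zero>\<^sub>Y}" and X: "gr X 1 = {\<zero>\<^sub>X}"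
  and surj: "!!y. y : gr Y 0 ==> \<exists>x\<in>gr X 0. f x = y"
  and inj: "!!x. x : gr X 0 ==> f x = \<zero>\<^sub>Y ==> x : coboundaries X"
 shows "\<exists>\<phi>. alg_iso (sub (cohom X) (gr (cohom X) 0)) Y \<phi>"
proof -
 interpret f: dga_map X Y f by unfold_locales fact
 interpret H: galgebra "cohom X" by unfold_locales (rule f.R.cohom_galg)
 let ?B = "coboundaries X" and ?H = "sub (cohom X) (gr (cohom X) 0)"
 have Y0: "gr Y 0 = carrier Y"
 proof -
  have "y : gr Y 0" if "y : carrier Y" for y using that
  proof (induct y rule: f.S.gr_induct)
   case (homog n y)
   then show ?case using Y[of n] by (cases "n = 0") auto
  qed auto
  then show ?thesis by (auto simp: f.S.gr_carrier)
 qed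
 have dY: "dif Y y = \<zero>\<^sub>Y" if "y : carrier Y" for y using f.S.d_gr[of y 0] that Y0 Y[of 1] by simp
 have Xc: "z : cocycles X" "z : carrier X" if "z : gr X 0" for z
  using f.R.d_gr[OF that] X that by (auto simp: cocycles_def f.R.gr_carrier)
 have fB: "f b = \<zero>\<^sub>Y" if "b : ?B" for b using that dY by (auto simp: coboundaries_def f.dif)
 define \<phi> where "\<phi> c = f (SOME z. z : gr X 0 & c = ?B +>\<^sub>X z)" for c
 have \<phi>: "\<phi> (?B +>\<^sub>X z) = f z" if z: "z : gr X 0" for z
 proof -
  let ?P = "%z'. z' : gr X 0 & ?B +>\<^sub>X z = ?B +>\<^sub>X z'"
  define w where "w = (SOME z'. ?P z')"
  have w: "w : gr X 0 & ?B +>\<^sub>X z = ?B +>\<^sub>X w" unfolding w_def by (rule someI[of ?P z]) (use z in simp)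
  then have "z \<ominus>\<^sub>X w : ?B" using f.R.cohom_class_eq[of z w] Xc z by simp
  then have "f (z \<ominus>\<^sub>X w) = \<zero>\<^sub>Y" by (rule fB)
  then have "f z \<ominus>\<^sub>Y f w = \<zero>\<^sub>Y" using f.minus[OF Xc(2)[OF z] Xc(2)[OF conjunct1[OF w]]] by (simp only:)
  then have "f w = f z" using f.S.minus_eq_0_iff[of "f z" "f w"] Xc(2)[OF z] Xc(2)[of w] w by simp
  moreover have "\<phi> (?B +>\<^sub>X z) = f w" by (simp only: \<phi>_def w_def)
  ultimately show ?thesis by (simp only:)
 qed
 have H0: "\<exists>z\<in>gr X 0. c = ?B +>\<^sub>X z" if "c : gr (cohom X) 0" for c using that by (auto simp: f.R.cohom_gr)
 have H0I: "?B +>\<^sub>X z : gr (cohom X) 0" if "z : gr X 0" for z using that Xc by (auto simp: f.R.cohom_gr)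
 interpret s: subgalg "cohom X" "gr (cohom X) 0"
 proof unfold_locales
  show "homog_part (cohom X) x n : gr (cohom X) 0" if "x : gr (cohom X) 0" for x n using that by (simp add: H.pr_homog[OF that])
  show "x \<otimes>\<^bsub>cohom X\<^esub> y : gr (cohom X) 0" if "x : gr (cohom X) 0" "y : gr (cohom X) 0" for x y
   using H.mult_gr[OF that] by simp
  show "\<one>\<^bsub>cohom X\<^esub> : gr (cohom X) 0" using H.galg by (simp add: galg_def)
 qed (auto simp: H.gr_carrier)
 have "alg_hom ?H Y \<phi>"
 proof (rule alg_homI[OF s.sub_kalg f.S.kalg])
  show "\<phi> c : carrier Y" if "c : carrier ?H" for c using H0[of c] that \<phi> Xc by auto
  show "\<phi> (c \<oplus>\<^sub>?H c') = \<phi> c \<oplus>\<^sub>Y \<phi> c'" if c: "c : carrier ?H" "c' : carrier ?H" for c c'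
  proof -
   obtain z z' where z: "z : gr X 0" "c = ?B +>\<^sub>X z" "z' : gr X 0" "c' = ?B +>\<^sub>X z'" using H0[of c] H0[of c'] c by auto
   then show ?thesis using Xc by (simp add: f.R.cohom_ops \<phi> f.add)
  qed
  show "\<phi> (c \<otimes>\<^sub>?H c') = \<phi> c \<otimes>\<^sub>Y \<phi> c'" if c: "c : carrier ?H" "c' : carrier ?H" for c c'
  proof -
   obtain z z' where z: "z : gr X 0" "c = ?B +>\<^sub>X z" "z' : gr X 0" "c' = ?B +>\<^sub>X z'" using H0[of c] H0[of c'] c by auto
   then show ?thesis using Xc f.R.mult_gr[OF z(1,3)] by (simp add: f.R.cohom_ops \<phi> f.mult)
  qed
  show "\<phi> (a \<odot>\<^sub>?H c) = a \<odot>\<^sub>Y \<phi> c" if c: "c : carrier ?H" for a c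
  proof -
   obtain z where z: "z : gr X 0" "c = ?B +>\<^sub>X z" using H0[of c] c by auto
   then show ?thesis using Xc by (simp add: f.R.cohom_smult \<phi> f.smult)
  qed
  have "\<one>\<^sub>X : gr X 0" using f.R.galg by (simp add: galg_def)
  then show "\<phi> \<one>\<^sub>?H = \<one>\<^sub>Y" using \<phi>[of "\<one>\<^sub>X"] by (simp add: f.R.cohom_one)
 qed
 moreover have "bij_betw \<phi> (carrier ?H) (carrier Y)" unfolding bij_betw_def
 proof (intro conjI inj_onI)
  fix c c' assume c: "c : carrier ?H" "c' : carrier ?H" "\<phi> c = \<phi> c'"
  obtain z z' where z: "z : gr X 0" "c = ?B +>\<^sub>X z" "z' : gr X 0" "c' = ?B +>\<^sub>X z'" using H0[of c] H0[of c'] c by auto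
  have "f (z \<ominus>\<^sub>X z') = \<zero>\<^sub>Y" using c(3) z Xc by (simp add: \<phi> f.minus f.S.minus_eq_0_iff)
  then have "z \<ominus>\<^sub>X z' : ?B" by (rule inj[rotated]) (use z in auto)
  then show "c = c'" using f.R.cohom_class_eq[of z z'] Xc z by simp
 next
  show "\<phi> ` carrier ?H = carrier Y"
  proof
   show "\<phi> ` carrier ?H <= carrier Y"
   proof clarify
    fix c assume "c : carrier ?H"
    then obtain z where "z : gr X 0" "c = ?B +>\<^sub>X z" using H0[of c] by auto
    then show "\<phi> c : carrier Y" using Xc by (simp add: \<phi>)
   qed
   show "carrier Y <= \<phi> ` carrier ?H"
   proof
    fix y assume "y : carrier Y"
    then obtain x where x: "x : gr X 0" "f x = y" using surj Y0 by blast
    show "y : \<phi> ` carrier ?H" by (rule image_eqI[of _ _ "?B +>\<^sub>X x"]) (use x \<phi> H0I in auto)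
   qed
  qed
 qed
 ultimately show ?thesis by (auto simp: alg_iso_def)
qed

lemma (in deg0_complex) unit_map_fp:
 assumes "matrix_units E I e co" "dga R"
 shows "unit_map E I e co (free_prod R E) (fp_inr R E)"
proof -
 interpret m: matrix_units E I e co by fact
 interpret R: rep_ctx V R by (rule rep_ctxI[OF V fin assms(2)])
 interpret j: dga_map E "free_prod R E" "fp_inr R E" by unfold_locales (rule R.P.fp_inr_hom)
 show ?thesis by unfold_locales (simp add: gr_E)
qed

locale deg0_res = deg0_complex V + afr A R p
 for V :: "('k::field, 'v) dg" (structure) and A :: "('k, 'a) module" and R :: "('k, 'r) dg" and p

sublocale deg0_res \<subseteq> E: dgalgebra "dg_End V" by unfold_locales (rule E_dga)
sublocale deg0_res \<subseteq> T: dgalgebra "free_prod R (dg_End V)" by unfold_locales (rule two_dga.T_dga[OF two_dgaI[OF p.R.dga E_dga]])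
sublocale deg0_res \<subseteq> T0: dgalgebra "free_prod (conc A) (dg_End V)"
 by unfold_locales (rule two_dga.T_dga[OF two_dgaI[OF p.S.dga E_dga]])
sublocale deg0_res \<subseteq> M: rep_ctx V R by unfold_locales
sublocale deg0_res \<subseteq> N: rep_ctx V "conc A" by unfold_locales

context deg0_res
begin

abbreviation "T \<equiv> free_prod R E"
abbreviation "T0 \<equiv> free_prod (conc A) E"
abbreviation "\<Phi> \<equiv> fp_hom (conc A) E p"
abbreviation "HT \<equiv> cohom T"
abbreviation "cl z \<equiv> coboundaries T +>\<^sub>T z"

sublocale \<Phi>: dga_map T T0 \<Phi> by unfold_locales (rule fp_map_hom(1)[OF qi(2) E_dga])
sublocale il: dga_map R T "fp_inl R E" by unfold_locales (rule M.P.fp_inl_hom)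

lemma \<Phi>_inl: "x : carrier R ==> \<Phi> (fp_inl R E x) = fp_inl (conc A) E (p x)"
 and \<Phi>_inr: "m : carrier E ==> \<Phi> (fp_inr R E m) = fp_inr (conc A) E m" using fp_map_hom(2,3)[OF qi(2) E_dga] by auto

lemma T_nonpos: "n > 0 ==> gr T n = {\<zero>\<^sub>T}"
 by (rule fp_gr_zero[OF p.R.dga E_dga, of "{..0}"]) (auto simp: nonpos gr_E)

lemma T0_deg0: "n ~= 0 ==> gr T0 n = {\<zero>\<^sub>T0}"
 by (rule fp_gr_zero[OF p.S.dga E_dga, of "{0}"]) (auto simp: gr_E)

lemma T_cocycle: "x : gr T 0 ==> x : cocycles T"
 using T.d_gr[of x 0] T_nonpos[of 1] by (auto simp: cocycles_def T.gr_carrier)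

text \<open>Two elements of degree 0 over the same element of A differ by a cycle in the kernel of
  p, hence by a boundary in R, and the map from R to T carries this boundary along.\<close>

lemma inl_class:
 assumes "r : gr R 0" "r' : gr R 0" "p r = p r'"
 shows "cl (fp_inl R E r) = cl (fp_inl R E r')"
proof -
 have rc: "r : carrier R" "r' : carrier R" using assms p.R.gr_carrier by auto
 have g: "r \<ominus>\<^sub>R r' : gr R 0" using assms by auto
 have d0: "dif R (r \<ominus>\<^sub>R r') = \<zero>\<^sub>R" using p.R.d_gr[OF g] nonpos[of 1] by simp
 have "p (r \<ominus>\<^sub>R r') = \<zero>\<^sub>A" using p.minus[OF rc] assms(3) p.S.minus_eq_0_iff[of "p r" "p r'"] p.closed rc by simp
 then obtain u where u: "u : gr R (0 - 1)" "dif R u = r \<ominus>\<^sub>R r'" using acyclic[OF g d0] by blast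
 have "fp_inl R E r \<ominus>\<^sub>T fp_inl R E r' = dif T (fp_inl R E u)"
  using u rc p.R.gr_carrier[OF u(1)] by (simp add: il.dif[symmetric] il.minus)
 then have "fp_inl R E r \<ominus>\<^sub>T fp_inl R E r' : coboundaries T"
  unfolding coboundaries_def using u p.R.gr_carrier[OF u(1)] by auto
 then show ?thesis using T.cohom_class_eq[OF T_cocycle T_cocycle] il.gr assms by simp
qed

text \<open>The candidate for the inverse of \<Phi> on cohomology, a map from A * End V to the
  cohomology of R * End V. By the universal property it is enough to send a to the class of any lift
  of a to R^0; this is multiplicative because the class does not depend on the lift.\<close>

lemma class_map_exists:
 obtains \<kappa> where "dga_hom T0 HT \<kappa>" "!!r. r : gr R 0 ==> \<kappa> (fp_inl (conc A) E (p r)) = cl (fp_inl R E r)"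
  "!!m. m : carrier E ==> \<kappa> (fp_inr (conc A) E m) = cl (fp_inr R E m)"
proof -
 define s where "s a = (SOME r. r : gr R 0 & p r = a)" for a
 have s: "s a : gr R 0" "p (s a) = a" if "a : carrier A" for a
  using someI_ex[of "%r. r : gr R 0 & p r = a"] surj[OF that] unfolding s_def by blast+
 define f where "f a = cl (fp_inl R E (s a))" for a
 have f: "f (p r) = cl (fp_inl R E r)" if "r : gr R 0" for r
  unfolding f_def by (rule inl_class) (use s[of "p r"] p.closed[of r] that p.R.gr_carrier in auto)
 have r0: "\<exists>r\<in>gr R 0. a = p r" if "a : carrier A" for a using s[OF that] by metis
 have ilc: "fp_inl R E r : cocycles T" if "r : gr R 0" for r using T_cocycle il.gr[OF that] by simp
 have clH: "cl z : gr HT 0" if "z : gr T 0" for z using that T_cocycle by (auto simp: T.cohom_gr)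
 have clC: "cl z : carrier HT" if "z : gr T 0" for z using that T_cocycle by (auto simp: T.cohom_carrier)
 have z0: "cl \<zero>\<^sub>T = \<zero>\<^sub>HT" using T.H.\<pi>_zero by (simp add: cohom_def)
 interpret H: dgalgebra HT by unfold_locales (rule T.cohom_dga)
 have R1: "\<one>\<^sub>R : gr R 0" using p.R.galg by (simp add: galg_def)
 have gc: "r : carrier R" if "r : gr R 0" for r using that by (rule p.R.gr_carrier)
 have fg: "f a : gr HT 0" if "a : carrier A" for a using r0[OF that] f clH il.gr by auto
 have fh: "dga_hom (conc A) HT f"
 proof (rule dga_homI[OF conc_dga[OF qi(1)] H.dga])
  show "f x : carrier HT" if "x : carrier (conc A)" for x by (rule H.gr_carrier[OF fg]) (use that in simp)
  show "f (x \<oplus>\<^bsub>conc A\<^esub> y) = f x \<oplus>\<^sub>HT f y" if xy: "x : carrier (conc A)" "y : carrier (conc A)" for x y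
  proof -
   obtain r r' where r: "r : gr R 0" "x = p r" "r' : gr R 0" "y = p r'" using r0[of x] r0[of y] xy unfolding conc_simps by blast
   have "f (x \<oplus>\<^bsub>conc A\<^esub> y) = f (p (r \<oplus>\<^sub>R r'))"
    unfolding r(2,4) by (simp only: p.add[OF gc[OF r(1)] gc[OF r(3)]])
   also have "... = cl (fp_inl R E r \<oplus>\<^sub>T fp_inl R E r')"
    using f[OF p.R.gr_add[OF r(1,3)]] by (simp only: il.add[OF gc[OF r(1)] gc[OF r(3)]])
   also have "... = f x \<oplus>\<^sub>HT f y"
    unfolding r(2,4) f[OF r(1)] f[OF r(3)] by (rule T.cohom_ops(1)[OF ilc[OF r(1)] ilc[OF r(3)], symmetric])
   finally show ?thesis .
  qed
  show "f (x \<otimes>\<^bsub>conc A\<^esub> y) = f x \<otimes>\<^sub>HT f y" if xy: "x : carrier (conc A)" "y : carrier (conc A)" for x y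
  proof -
   obtain r r' where r: "r : gr R 0" "x = p r" "r' : gr R 0" "y = p r'" using r0[of x] r0[of y] xy unfolding conc_simps by blast
   have "f (x \<otimes>\<^bsub>conc A\<^esub> y) = f (p (r \<otimes>\<^sub>R r'))"
    unfolding r(2,4) by (simp only: p.mult[OF gc[OF r(1)] gc[OF r(3)]])
   also have "... = cl (fp_inl R E r \<otimes>\<^sub>T fp_inl R E r')"
    using f[OF p.R.mult_gr[OF r(1,3), simplified]] by (simp only: il.mult[OF gc[OF r(1)] gc[OF r(3)]])
   also have "... = f x \<otimes>\<^sub>HT f y"
    unfolding r(2,4) f[OF r(1)] f[OF r(3)] by (rule T.cohom_ops(2)[OF ilc[OF r(1)] ilc[OF r(3)], symmetric])
   finally show ?thesis .
  qed
  show "f (c \<odot>\<^bsub>conc A\<^esub> x) = c \<odot>\<^sub>HT f x" if x: "x : carrier (conc A)" for c x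
  proof -
   obtain r where r: "r : gr R 0" "x = p r" using r0[of x] x unfolding conc_simps by blast
   have "f (c \<odot>\<^bsub>conc A\<^esub> x) = f (p (c \<odot>\<^sub>R r))"  unfolding r(2) by (simp only: p.smult[OF gc[OF r(1)]])
   also have "... = cl (c \<odot>\<^sub>T fp_inl R E r)" using f[OF p.R.gr_smult[OF r(1)]] by (simp only: il.smult[OF gc[OF r(1)]])
   also have "... = c \<odot>\<^sub>HT f x" unfolding r(2) f[OF r(1)] by (rule T.cohom_smult[OF ilc[OF r(1)], symmetric])
   finally show ?thesis .
  qed
  show "f \<one>\<^bsub>conc A\<^esub> = \<one>\<^sub>HT" using f[OF R1] p.one by (simp add: T.cohom_one il.one)
  show fz: "f x : gr HT n" if "x : gr (conc A) n" for n x
  proof (cases "n = 0")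
   case False
   have "f \<zero>\<^sub>A = \<zero>\<^sub>HT" using f[of "\<zero>\<^sub>R"] p.zero il.zero z0 by simp
   then show ?thesis using that False by simp
  qed (use fg that in simp)
  show "f (dif (conc A) x) = dif HT (f x)" if "x : carrier (conc A)" for x
   using that fg[of x] f[of "\<zero>\<^sub>R"] p.zero il.zero z0 by (simp add: T.cohom_dif H.gr_carrier)
 qed
 have irg: "fp_inr R E m : gr T 0" if "m : carrier E" for m using that M.C.j.gr[of m 0] by (simp add: gr_E)
 have irc: "fp_inr R E m : cocycles T" if "m : carrier E" for m using T_cocycle irg[OF that] by simp
 have gh: "dga_hom E HT (%m. cl (fp_inr R E m))"
 proof (rule dga_homI[OF E_dga H.dga])
  show "cl (fp_inr R E (dif E m)) = dif HT (cl (fp_inr R E m))" if "m : carrier E" for m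
  proof -
   have "dif E m = \<zero>\<^sub>E" using E.d_gr[of m 0] that by (simp add: gr_E)
   then show ?thesis using clC[OF irg[OF that]] M.C.j.zero z0 by (simp add: T.cohom_dif)
  qed
  show "cl (fp_inr R E m) : gr HT n" if "m : gr E n" for m n using that clH irg M.C.j.zero z0 by (cases "n = 0") (auto simp: gr_E)
 qed (use irg clC irc in \<open>auto simp: T.cohom_ops T.cohom_smult T.cohom_one M.C.j.add M.C.j.smult M.C.j.mult M.C.j.one\<close>)
 obtain \<kappa> where "dga_hom T0 HT \<kappa>" "!!a. a : carrier (conc A) ==> \<kappa> (fp_inl (conc A) E a) = f a"
  "!!m. m : carrier E ==> \<kappa> (fp_inr (conc A) E m) = cl (fp_inr R E m)" by (rule N.P.fp_lift[OF fh gh]) blast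
 note k = this
 show ?thesis
 proof (rule that[OF k(1) _ k(3)])
  show "\<kappa> (fp_inl (conc A) E (p r)) = cl (fp_inl R E r)" if r: "r : gr R 0" for r
   using k(2)[of "p r"] f[OF r] p.closed[OF gc[OF r]] by simp
 qed
qed

text \<open>\<kappa> (\<Phi> x) is the class of the part of x of degree 0: this holds on the two
  factors and passes to products. So \<Phi> x = 0 makes the class of x vanish.\<close>

lemma \<Phi>_kernel:
 assumes x: "x : gr T 0" "\<Phi> x = \<zero>\<^sub>T0"
 shows "\<exists>u\<in>gr T (- 1). x = dif T u"
proof -
 obtain \<kappa> where k: "dga_hom T0 HT \<kappa>" "!!r. r : gr R 0 ==> \<kappa> (fp_inl (conc A) E (p r)) = cl (fp_inl R E r)"
  "!!m. m : carrier E ==> \<kappa> (fp_inr (conc A) E m) = cl (fp_inr R E m)" by (rule class_map_exists) blast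
 interpret \<kappa>: dga_map T0 HT \<kappa> by unfold_locales (rule k)
 have z0: "cl \<zero>\<^sub>T = \<zero>\<^sub>HT" using T.H.\<pi>_zero by (simp add: cohom_def)
 have pc: "homog_part T x 0 : cocycles T" if "x : carrier T" for x using that T_cocycle by simp
 have "\<kappa> (\<Phi> x) = cl (homog_part T x 0)" if "x : carrier T" for x using that
 proof (induct x rule: M.P.fp_induct)
  case (inl n r)
  then have rc: "r : carrier R" by (rule p.R.gr_carrier)
  show ?case
  proof (cases "n = 0")
   case True
   then show ?thesis using inl rc k(2) by (simp add: \<Phi>_inl T.pr_homog[OF il.gr[of r 0]])
  next
   case False
   have "\<Phi> (fp_inl R E r) = \<Phi> (fp_inl R E \<zero>\<^sub>R)"
    using p_zero[OF inl False] p.zero rc by (simp add: \<Phi>_inl del: il.zero)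
   then show ?thesis using False z0 \<kappa>.zero \<Phi>.zero il.zero T.pr_homog[OF il.gr[OF inl], of 0] by simp
  qed
 next
  case (inr n m)
  then have m: "m : carrier E" "fp_inr R E m : gr T 0" using E.gr_carrier M.C.j.gr[of m 0] by (auto simp: gr_E split: if_splits)
  then show ?case using k(3) by (simp add: \<Phi>_inr T.pr_homog[OF m(2)])
 next
  case (add x y)
  then show ?case using pc T.cohom_ops(1)[OF pc pc] by (simp add: \<Phi>.add \<kappa>.add T.pr_add)
 next
  case (smult c x)
  then show ?case using pc by (simp add: \<Phi>.smult \<kappa>.smult T.pr_smult T.cohom_smult)
 next
  case (mult x y)
  \<comment> \<open>T vanishes in positive degrees, and of i and -i one is positive; only i = 0
    contributes to the product in degree 0.\<close>
  have neg: "homog_part T y (0 - i) = \<zero>\<^sub>T \<or> homog_part T x i = \<zero>\<^sub>T" if "i ~= 0" for i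
   using T_nonpos[of i] T_nonpos[of "- i"] T.pr_gr[OF mult(1), of i] T.pr_gr[OF mult(2), of "- i"] that by (cases "i > 0") auto
  have "homog_part T (x \<otimes>\<^sub>T y) 0 = homog_part T x 0 \<otimes>\<^sub>T homog_part T y 0"
  proof -
   let ?h = "%i. homog_part T x i \<otimes>\<^sub>T homog_part T y (0 - i)"
   have hc: "?h i : carrier T" for i using mult by auto
   have h0: "?h i = \<zero>\<^sub>T" if "i ~= 0" for i
    using neg[OF that] T.pr_carrier[OF mult(1), of i] T.pr_carrier[OF mult(2), of "0 - i"]
    by (elim disjE) (simp_all only: T.l_null T.r_null)
   have "homog_part T (x \<otimes>\<^sub>T y) 0 = (\<Oplus>\<^sub>T i\<in>supp T x. ?h i)" by (rule T.pr_mult[OF mult(1,2)])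
   also have "... = (\<Oplus>\<^sub>T i\<in>insert 0 (supp T x). ?h i)"
    by (rule T.finsum_mono_neutral) (use mult hc in \<open>auto simp: T.pr_notin\<close>)
   also have "... = ?h 0" by (rule T.finsum_single) (use mult hc h0 in auto)
   finally show ?thesis by simp
  qed
  then show ?case using mult pc by (simp add: \<Phi>.mult \<kappa>.mult T.cohom_ops)
 qed
 from this[OF T.gr_carrier[OF x(1)]] have "cl x = cl \<zero>\<^sub>T" using x \<kappa>.zero z0 T.pr_homog[OF x(1), of 0] by simp
 then have "x : coboundaries T"
  using T.cohom_class_eq[OF T_cocycle[OF x(1)] T_cocycle[of "\<zero>\<^sub>T"]] x(1) by (simp add: T.minus_eq T.gr_carrier)
 then obtain u where u: "u : carrier T" "x = dif T u" by (auto simp: coboundaries_def)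
 then have "x = dif T (homog_part T u (- 1))" using T.pr_d[OF u(1), of 0] T.pr_homog[OF x(1), of 0] by simp
 then show ?thesis using u(1) by blast
qed

lemma \<Phi>_surj: "w : carrier T0 ==> \<exists>x\<in>gr T 0. \<Phi> x = w"
proof (induct w rule: N.P.fp_induct)
 case (inl n a)
 then have "a : carrier A" using p.S.zero_closed by (auto split: if_splits)
 then obtain r where "r : gr R 0" "p r = a" using surj by blast
 then show ?case using il.gr[of r 0] p.R.gr_carrier[of r 0] by (intro bexI[of _ "fp_inl R E r"]) (auto simp: \<Phi>_inl)
next
 case (inr n m)
 then have "m : carrier E" by (rule E.gr_carrier)
 then show ?case using M.C.j.gr[of m 0] by (intro bexI[of _ "fp_inr R E m"]) (auto simp: \<Phi>_inr gr_E)
next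
 case (add x y)
 then obtain x' y' where "x' : gr T 0" "\<Phi> x' = x" "y' : gr T 0" "\<Phi> y' = y" by blast
 then show ?case by (intro bexI[of _ "x' \<oplus>\<^sub>T y'"]) (auto simp: \<Phi>.add T.gr_carrier)
next
 case (smult c x)
 then obtain x' where "x' : gr T 0" "\<Phi> x' = x" by blast
 then show ?case by (intro bexI[of _ "c \<odot>\<^sub>T x'"]) (auto simp: \<Phi>.smult T.gr_carrier)
next
 case (mult x y)
 then obtain x' y' where "x' : gr T 0" "\<Phi> x' = x" "y' : gr T 0" "\<Phi> y' = y" by blast
 then show ?case using T.mult_gr[of x' 0 y' 0] by (intro bexI[of _ "x' \<otimes>\<^sub>T y'"]) (auto simp: \<Phi>.mult T.gr_carrier)
qed

text \<open>Preimages and primitives exist in T, and the projection \<open>ent i i\<close> moves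
  them into the centralizer: it is compatible with \<Phi> and d and fixes the elements that are to
  be lifted.\<close>

lemma root_lift:
 shows root_surj: "w : N.C.cent ==> \<exists>x\<in>gr T 0 \<inter> M.C.cent. \<Phi> x = w"
  and root_kernel: "x : gr T 0 ==> x : M.C.cent ==> \<Phi> x = \<zero>\<^sub>T0 ==> \<exists>u\<in>gr T (- 1) \<inter> M.C.cent. x = dif T u"
proof -
 obtain I and e :: "'v => 'v => 'v => 'v" and co where mu: "matrix_units E I e co" by (rule matrix_units_exist)
 interpret U: unit_map E I e co T "fp_inr R E" by (rule unit_map_fp[OF mu p.R.dga])
 interpret U0: unit_map E I e co T0 "fp_inr (conc A) E" by (rule unit_map_fp[OF mu p.S.dga])
 show "\<exists>x\<in>gr T 0 \<inter> M.C.cent. \<Phi> x = w" if w: "w : N.C.cent"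
 \<comment> \<open>Without indices the sum of the diagonal units is empty, so 1 = 0 and the algebra
   is zero.\<close>
 proof (cases "I = {}")
  case True
  then have "\<one>\<^sub>T0 = \<zero>\<^sub>T0" using U0.sum_ee by simp
  then have "w = \<zero>\<^sub>T0" using w T0.l_one[of w] by (simp add: N.C.cent_def)
  then show ?thesis using M.C.C.S_zero \<Phi>.zero by (intro bexI[of _ "\<zero>\<^sub>T"]) auto
 next
  case False
  then obtain i where i: "i : I" by blast
  obtain x where x: "x : gr T 0" "\<Phi> x = w" using \<Phi>_surj[of w] w by (auto simp: N.C.cent_def)
  have "\<Phi> (U.ent i i x) = U0.ent i i (\<Phi> x)"
   by (rule U.ent_map[OF U0.unit_map_axioms \<Phi>.ah \<Phi>_inr i i T.gr_carrier[OF x(1)]])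
  also have "... = w" using U0.ent_of_cent[OF i i w] x by simp
  finally show ?thesis using U.ent_cent[OF i i T.gr_carrier[OF x(1)]] U.ent_gr[OF i i x(1)] by blast
 qed
 show "\<exists>u\<in>gr T (- 1) \<inter> M.C.cent. x = dif T u" if x: "x : gr T 0" "x : M.C.cent" "\<Phi> x = \<zero>\<^sub>T0"
 proof (cases "I = {}")
  case True
  then have "\<one>\<^sub>T = \<zero>\<^sub>T" using U.sum_ee by simp
  then have "x = \<zero>\<^sub>T" using x T.l_one[of x] by (simp add: T.gr_carrier)
  then show ?thesis using M.C.C.S_zero by (intro bexI[of _ "\<zero>\<^sub>T"]) auto
 next
  case False
  then obtain i where i: "i : I" by blast
  obtain u where u: "u : gr T (- 1)" "x = dif T u" using \<Phi>_kernel[OF x(1,3)] by blast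
  have uc: "u : carrier T" using u by auto
  have "x = dif T (U.ent i i u)" using U.dif_ent[OF i i uc] U.ent_of_cent[OF i i x(2)] u(2) by simp
  then show ?thesis using U.ent_cent[OF i i uc] U.ent_gr[OF i i u(1)] by blast
 qed
qed

text \<open>For injectivity: if the class of w dies over A, then \<Phi> w lies in the commutator
  ideal there, which is covered by the one over R because \<Phi> is onto between the centralizers.
  Subtracting a preimage of degree 0 from w leaves an element of the kernel of \<Phi>, which is d u
  with u in the centralizer. Hence w equals d u modulo commutators.\<close>

lemma H0_rep_iso:
 "\<exists>\<phi>. alg_iso (sub (cohom (rep_alg V R)) (gr (cohom (rep_alg V R)) 0)) (rep_alg V (conc A)) \<phi>"
proof (rule H0_iso)
 let ?X = "rep_alg V R" and ?Y = "rep_alg V (conc A)" and ?f = "rep_map V (conc A) p"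
 show "dga_hom ?X ?Y ?f" by (rule rep_map_hom[OF V fin qi(2)])
 interpret X: dgalgebra ?X by unfold_locales (rule M.rep_dga)
 interpret Y: dgalgebra ?Y by unfold_locales (rule N.rep_dga)
 interpret q: dga_map "root_alg V R" ?X M.\<rho> by unfold_locales (rule M.rep_proj)
 interpret q0: dga_map "root_alg V (conc A)" ?Y N.\<rho> by unfold_locales (rule N.rep_proj)
 interpret r: dga_map "root_alg V R" "root_alg V (conc A)" \<Phi> by unfold_locales (rule root_map_hom[OF V fin qi(2)])
 have grX: "gr ?X n = M.\<rho> ` (gr T n \<inter> M.C.cent)" for n by (simp add: rep_alg_def M.root_alg_eq)
 have grY: "gr ?Y n = N.\<rho> ` (gr T0 n \<inter> N.C.cent)" for n by (simp add: rep_alg_def N.root_alg_eq)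
 have f: "?f (M.\<rho> w) = N.\<rho> (\<Phi> w)" if "w : M.C.cent" for w
  by (rule rep_map_class[OF V fin qi(2)]) (simp add: M.root_carrier that)
 show "gr ?Y n = {\<zero>\<^sub>?Y}" if "n ~= 0" for n using T0_deg0[OF that] N.C.C.S_zero q0.zero by (auto simp: grY N.root_alg_eq)
 show "gr ?X 1 = {\<zero>\<^sub>?X}" using T_nonpos[of 1] M.C.C.S_zero q.zero by (auto simp: grX M.root_alg_eq)
 show "\<exists>x\<in>gr ?X 0. ?f x = y" if y: "y : gr ?Y 0" for y
 proof -
  obtain w where w: "w : N.C.cent" "y = N.\<rho> w" using y by (auto simp: grY)
  obtain x where "x : gr T 0 \<inter> M.C.cent" "\<Phi> x = w" using root_surj[OF w(1)] by blast
  then show ?thesis using f w by (auto simp: grX)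
 qed
 show "x : coboundaries ?X" if x: "x : gr ?X 0" "?f x = \<zero>\<^sub>?Y" for x
 proof -
  obtain w where w: "w : gr T 0" "w : M.C.cent" "x = M.\<rho> w" using x by (auto simp: grX)
  have ci: "v : comm_ideal (root_alg V R) ==> v : M.C.cent" for v using M.root.A.I_car M.root_carrier by auto
  have vT: "v : carrier T" if "v : gr T 0" for v using that by auto
  have sj: "\<Phi> ` carrier (root_alg V R) = carrier (root_alg V (conc A))"
  proof
   show "\<Phi> ` carrier (root_alg V R) <= carrier (root_alg V (conc A))" using r.closed by blast
   show "carrier (root_alg V (conc A)) <= \<Phi> ` carrier (root_alg V R)"
    unfolding M.root_carrier N.root_carrier using root_surj by blast
  qed
  have "comm_ideal (root_alg V (conc A)) <= \<Phi> ` comm_ideal (root_alg V R)"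
  proof (rule N.root.comm_ideal_minimal[OF r.image_ideal[OF M.root.A.ideal_axioms sj]])
   fix a b assume "a : carrier (root_alg V (conc A))" "b : carrier (root_alg V (conc A))"
   then obtain u v where u: "u : carrier (root_alg V R)" "\<Phi> u = a" "v : carrier (root_alg V R)" "\<Phi> v = b"
    unfolding sj[symmetric] by blast
   then have "gcomm (root_alg V (conc A)) a b = \<Phi> (gcomm (root_alg V R) u v)" using r.gcomm by simp
   then show "gcomm (root_alg V (conc A)) a b : \<Phi> ` comm_ideal (root_alg V R)" using M.root.gcomm_comm_ideal[OF u(1,3)] by blast
  qed
  moreover have "\<Phi> w : comm_ideal (root_alg V (conc A))"
  proof -
   have "\<Phi> w : carrier (root_alg V (conc A))" using w(2) by (intro r.closed) (simp add: M.root_carrier)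
   moreover have "N.\<rho> (\<Phi> w) = comm_ideal (root_alg V (conc A))" using x(2) f[OF w(2)] w(3) by (simp add: rep_alg_def)
   ultimately show ?thesis using N.root.A.\<pi>_eq_0 by simp
  qed
  ultimately obtain v0 where v0: "v0 : comm_ideal (root_alg V R)" "\<Phi> w = \<Phi> v0" by blast
  \<comment> \<open>w has degree 0, so the part of v0 of degree 0 has the same image \<Phi> w, and
    the ideal is homogeneous.\<close>
  define v where "v = homog_part (root_alg V R) v0 0"
  have v0c: "v0 : carrier (root_alg V R)" and wc: "w : carrier (root_alg V R)"
   using ci[OF v0(1)] w(2) by (simp_all add: M.root_carrier)
  have "w : gr (root_alg V R) 0" using w by (simp add: M.root_alg_eq)
  then have v: "v : comm_ideal (root_alg V R)" "v : gr T 0" "\<Phi> w = \<Phi> v"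
   using M.root.A.I_pr[OF v0(1), of 0] M.root.pr_gr[OF v0c, of 0] r.pr[OF v0c, of 0] r.pr[OF wc, of 0]
    M.root.pr_homog[of w 0 0] v0(2) by (simp_all add: v_def) (simp add: M.root_alg_eq)
  have vc: "v : M.C.cent" by (rule ci[OF v(1)])
  have "\<Phi> (w \<ominus>\<^sub>T v) = \<zero>\<^sub>T0"
   using v w vT T0.minus_eq_0_iff[of "\<Phi> w" "\<Phi> v"] by (simp add: \<Phi>.minus)
  then obtain u where u: "u : gr T (- 1)" "u : M.C.cent" "w \<ominus>\<^sub>T v = dif T u"
   using root_kernel[of "w \<ominus>\<^sub>T v"] w v vc by auto
  have uc: "u : carrier (root_alg V R)" using u by (simp add: M.root_carrier)
  have "w \<ominus>\<^sub>T dif T u = v"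
  proof -
   have "w = (w \<ominus>\<^sub>T v) \<oplus>\<^sub>T v" using w v vT by (simp add: T.minus_eq T.a_assoc T.l_neg)
   then show ?thesis using u(3) w v vT T.gr_carrier[OF u(1)] by (metis T.a_comm T.add.inv_solve_right T.minus_closed T.minus_eq)
  qed
  then have "w \<ominus>\<^bsub>root_alg V R\<^esub> dif (root_alg V R) u : comm_ideal (root_alg V R)"
   using v(1) M.C.C.sub_minus[OF w(2) M.C.cent_d[OF u(2)]] by (simp add: M.root_alg_eq)
  then have "M.\<rho> w = M.\<rho> (dif (root_alg V R) u)"
   by (rule M.root.A.\<pi>_eq_iff[THEN iffD2, rotated 2]) (use w(2) uc M.root.d.closed[OF uc] in \<open>simp_all only: M.root_carrier\<close>)
  then have "x = dif ?X (M.\<rho> u)" using q.dif[OF uc] w(3) by simp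
  then show "x : coboundaries ?X" unfolding coboundaries_def using q.closed[OF uc] by blast
 qed
qed

end

section \<open>The representation functor and its coordinate ring\<close>

section \<open>Tensor products with matrix algebras\<close>

lemma (in kmod) finsum_scalar:
 assumes "finite J" "x : carrier M"
 shows "(\<Oplus>i\<in>J. c i \<odot> x) = (\<Sum>i\<in>J. c i) \<odot> x"
 using assms by (induct J rule: finite_induct) (auto simp: Pi_def sm_ladd)

locale tensor_alg = B: kalgebra B + C: kalgebra C for B :: "('k::field, 'b, 'm) module_scheme" and C :: "('k, 'c, 'n) module_scheme"
begin

abbreviation "F \<equiv> tensor_free B C"
abbreviation "K \<equiv> carrier B \<times> carrier C"
abbreviation "opn \<equiv> %(b, c) (b', c'). (b \<otimes>\<^sub>B b', c \<otimes>\<^sub>C c')"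
abbreviation "X \<equiv> tensor B C"

lemma F_simps [simp]:
 "carrier F = {f. keys f <= K}" "monoid.mult F = conv opn"
 "one F = basis_elt (\<one>\<^sub>B, \<one>\<^sub>C)" "ring.zero F = 0" "add F = (+)"
 "smult F = (%a. scale a)" by (simp_all add: tensor_free_def)

lemma F_kalg: "kalg F"
 by (rule conv_kalg[OF F_simps]) (auto simp: B.m_assoc C.m_assoc)

sublocale F: kalgebra F by unfold_locales (rule F_kalg)

definition rels :: "('b \<times> 'c \<Rightarrow>\<^sub>0 'k) set" where
 "rels = {basis_elt (b \<oplus>\<^sub>B b', c) - basis_elt (b, c) - basis_elt (b', c) | b b' c.
    b : carrier B & b' : carrier B & c : carrier C} \<union>
   {basis_elt (b, c \<oplus>\<^sub>C c') - basis_elt (b, c) - basis_elt (b, c') | b c c'.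
    b : carrier B & c : carrier C & c' : carrier C} \<union>
   {basis_elt (a \<odot>\<^sub>B b, c) - single (b, c) a | a b c. b : carrier B & c : carrier C} \<union>
   {basis_elt (b, a \<odot>\<^sub>C c) - single (b, c) a | a b c. b : carrier B & c : carrier C}"

lemma relsE:
 assumes "r : rels"
 obtains b b' c where "r = basis_elt (b \<oplus>\<^sub>B b', c) - (basis_elt (b, c) + basis_elt (b', c))"
   "b : carrier B" "b' : carrier B" "c : carrier C"
 | b c c' where "r = basis_elt (b, c \<oplus>\<^sub>C c') - (basis_elt (b, c) + basis_elt (b, c'))"
   "b : carrier B" "c : carrier C" "c' : carrier C"
 | a b c where "r = basis_elt (a \<odot>\<^sub>B b, c) - single (b, c) a" "b : carrier B" "c : carrier C"
 | a b c where "r = basis_elt (b, a \<odot>\<^sub>C c) - single (b, c) a" "b : carrier B" "c : carrier C"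
 using assms unfolding rels_def diff_diff_add by blast

lemma tensor_ideal_eq: "tensor_ideal B C = genideal F rels"
 by (simp only: tensor_ideal_def rels_def)

lemma rels_carrier: "rels <= carrier F"
proof
 fix r assume "r : rels"
 have d: "x - y : carrier F" if "x : carrier F" "y : carrier F" for x y using that by (simp add: keys_diff_subset)
 have a: "x + y : carrier F" if "x : carrier F" "y : carrier F" for x y using that by (simp add: keys_add_subset)
 from \<open>r : rels\<close> show "r : carrier F" by (cases rule: relsE; hypsubst; intro d a; auto)
qed

lemma relsI:
 "b : carrier B ==> b' : carrier B ==> c : carrier C ==>
  basis_elt (b \<oplus>\<^sub>B b', c) - (basis_elt (b, c) + basis_elt (b', c)) : rels"
 "b : carrier B ==> c : carrier C ==> c' : carrier C ==>
  basis_elt (b, c \<oplus>\<^sub>C c') - (basis_elt (b, c) + basis_elt (b, c')) : rels"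
 "b : carrier B ==> c : carrier C ==> basis_elt (x \<odot>\<^sub>B b, c) - single (b, c) x : rels"
 "b : carrier B ==> c : carrier C ==> basis_elt (b, x \<odot>\<^sub>C c) - single (b, c) x : rels"
 unfolding rels_def diff_diff_add by blast+

sublocale Q: kquot F "tensor_ideal B C" unfolding tensor_ideal_eq by (intro kquot.intro F.kalgebra_axioms F.genideal_ideal rels_carrier)

lemma tensor_eq: "X = alg_quot F (tensor_ideal B C)"
 by (simp add: tensor_def)

sublocale X: kalgebra X unfolding tensor_eq by unfold_locales (rule Q.q_kalg)

lemma X_carrier: "carrier X = Q.\<pi> ` carrier F"
 by (simp only: tensor_eq Q.q_carrier)

lemma \<pi>_hom: "alg_hom F X Q.\<pi>"
 unfolding tensor_eq by (rule Q.q_hom)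

sublocale \<pi>: alg_map F X Q.\<pi> by unfold_locales (rule \<pi>_hom)

lemma F_minus: "x : carrier F ==> y : carrier F ==> x \<ominus>\<^sub>F y = x - y"
 using F.minus_equality[of "- y" y] by (auto simp: F.minus_eq in_keys_iff subset_iff)

lemma \<pi>_eqI:
 assumes "x - y : rels" "x : carrier F" "y : carrier F"
 shows "Q.\<pi> x = Q.\<pi> y" using assms F.genideal_self[OF rels_carrier] Q.\<pi>_eq_iff[OF assms(2,3)] F_minus[OF assms(2,3)]
 by (auto simp: tensor_ideal_eq)

definition tp :: "'b => 'c => ('b \<times> 'c \<Rightarrow>\<^sub>0 'k) set" where
 "tp b c = Q.\<pi> (basis_elt (b, c))"

context
 notes F_simps(1) [simp del]
begin

lemma basis_F [simp]: "b : carrier B ==> c : carrier C ==> basis_elt (b, c) : carrier F"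
 and single_F [simp]: "b : carrier B ==> c : carrier C ==> single (b, c) a : carrier F" by (simp_all add: F_simps)

lemma tp_closed [simp]: "b : carrier B ==> c : carrier C ==> tp b c : carrier X"
 by (simp add: tp_def)

lemma \<pi>_single: "b : carrier B ==> c : carrier C ==> Q.\<pi> (single (b, c) a) = a \<odot>\<^sub>X tp b c"
 using \<pi>.smult[of "basis_elt (b, c)" a] by (simp add: tp_def)

lemma tp_add_l: "b : carrier B ==> b' : carrier B ==> c : carrier C ==> tp (b \<oplus>\<^sub>B b') c = tp b c \<oplus>\<^sub>X tp b' c"
proof -
 assume a: "b : carrier B" "b' : carrier B" "c : carrier C"
 have "Q.\<pi> (basis_elt (b \<oplus>\<^sub>B b', c)) = Q.\<pi> (basis_elt (b, c) \<oplus>\<^sub>F basis_elt (b', c))"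
  by (rule \<pi>_eqI) (use a relsI F.a_closed[of "basis_elt _" "basis_elt _"] in simp_all)
 then show ?thesis using a \<pi>.add[of "basis_elt (b, c)" "basis_elt (b', c)"] by (simp add: tp_def)
qed

lemma tp_add_r: "b : carrier B ==> c : carrier C ==> c' : carrier C ==> tp b (c \<oplus>\<^sub>C c') = tp b c \<oplus>\<^sub>X tp b c'"
proof -
 assume a: "b : carrier B" "c : carrier C" "c' : carrier C"
 have "Q.\<pi> (basis_elt (b, c \<oplus>\<^sub>C c')) = Q.\<pi> (basis_elt (b, c) \<oplus>\<^sub>F basis_elt (b, c'))"
  by (rule \<pi>_eqI) (use a relsI F.a_closed[of "basis_elt _" "basis_elt _"] in simp_all)
 then show ?thesis using a \<pi>.add[of "basis_elt (b, c)" "basis_elt (b, c')"] by (simp add: tp_def)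
qed

lemma tp_smult_l: "b : carrier B ==> c : carrier C ==> tp (a \<odot>\<^sub>B b) c = a \<odot>\<^sub>X tp b c"
 using \<pi>_eqI[OF relsI(3)[of b c a]] \<pi>_single[of b c a] by (simp add: tp_def)

lemma tp_smult_r: "b : carrier B ==> c : carrier C ==> tp b (a \<odot>\<^sub>C c) = a \<odot>\<^sub>X tp b c"
 using \<pi>_eqI[OF relsI(4)[of b c a]] \<pi>_single[of b c a] by (simp add: tp_def)

lemma tp_mult: "b : carrier B ==> c : carrier C ==> b' : carrier B ==> c' : carrier C ==>
  tp b c \<otimes>\<^sub>X tp b' c' = tp (b \<otimes>\<^sub>B b') (c \<otimes>\<^sub>C c')"
 using \<pi>.mult[of "basis_elt (b, c)" "basis_elt (b', c')"] by (simp add: tp_def)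

lemma tp_one: "\<one>\<^sub>X = tp \<one>\<^sub>B \<one>\<^sub>C"
 using \<pi>.one by (simp add: tp_def)

text \<open>There is no case for scalar multiples: a scalar is absorbed into the left factor of a
  pure tensor.\<close>

lemma X_induct [consumes 1, case_names tp add]:
 assumes "Z : carrier X" "!!b c. b : carrier B ==> c : carrier C ==> P (tp b c)"
  "!!x y. x : carrier X ==> y : carrier X ==> P x ==> P y ==> P (x \<oplus>\<^sub>X y)"
 shows "P Z"
proof -
 obtain z where z: "z : carrier F" "Z = Q.\<pi> z" using assms(1) by (auto simp: X_carrier)
 have s: "P (a \<odot>\<^sub>X tp b c)" if "b : carrier B" "c : carrier C" for a b c
  using assms(2)[of "a \<odot>\<^sub>B b" c] that by (simp add: tp_smult_l)
 have "keys z <= K" using z by (simp add: F_simps)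
 then have "P (Q.\<pi> z)"
 proof (induct z rule: pm_induct)
  case zero
  show ?case using s[of "\<zero>\<^sub>B" "\<zero>\<^sub>C" 0] \<pi>.zero by simp
 next
  case (single u a)
  then show ?case using s by (cases u) (auto simp: \<pi>_single)
 next
  case (add p q)
  then show ?case using assms(3) \<pi>.add[of p q] by (simp add: F_simps(1))
 qed
 then show ?thesis using z by simp
qed

lemma tp_lin: "b : carrier B ==> linear_map C X (tp b)"
 by (rule linear_mapI) (auto simp: tp_add_r tp_smult_r)

lemma tp_one_hom: "alg_hom C X (tp \<one>\<^sub>B)"
 by (rule alg_homI) (auto simp: tp_add_r tp_smult_r tp_mult tp_one C.kalg X.kalg)

end

end

lemma tensor_map_hom:
 fixes B :: "('k::field, 'b, 'm) module_scheme" and B' :: "('k, 'c, 'n) module_scheme"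
  and C :: "('k, 'd, 'o) module_scheme"
 assumes h: "alg_hom B B' h" and C: "kalg C"
 shows "alg_hom (tensor B C) (tensor B' C) (tensor_map B' C h)"
  and "b : carrier B ==> c : carrier C ==>
   tensor_map B' C h (tensor_alg.tp B C b c) = tensor_alg.tp B' C (h b) c"
proof -
 interpret h: alg_map B B' h by unfold_locales fact
 interpret S: tensor_alg B C by unfold_locales fact
 interpret S': tensor_alg B' C by unfold_locales fact
 define L where "L = lin_ext (%(b, c). basis_elt (h b, c) :: 'c \<times> 'd \<Rightarrow>\<^sub>0 'k)"
 have L: "alg_hom S.F S'.F L"
 proof (rule alg_homI[OF S.F_kalg S'.F_kalg])
  show "L x : carrier S'.F" if "x : carrier S.F" for x
   using keys_lin_ext[of x S.K "%(b, c). basis_elt (h b, c)" S'.K] that by (auto simp: L_def)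
  show "L (x \<otimes>\<^sub>S.F y) = L x \<otimes>\<^sub>S'.F L y" if "x : carrier S.F" "y : carrier S.F" for x y
  proof -
   have "keys x <= S.K" "keys y <= S.K" using that by simp_all
   note y = this(2) and x = this(1)
   have "L (conv S.opn x y) = conv S'.opn (L x) (L y)" using x
   proof (induct x rule: pm_induct)
    case u: (single u a)
    show ?case using y by (induct y rule: pm_induct) (use u in \<open>auto simp: L_def lin_ext_add conv_add_r h.mult\<close>)
   qed (auto simp: L_def lin_ext_add conv_add_l)
   then show ?thesis by simp
  qed
 qed (auto simp: L_def lin_ext_add lin_ext_sc h.one)
 interpret L: alg_map S.F S'.F L by unfold_locales (rule L)
 interpret q: alg_map S.F S'.X "%x. S'.Q.\<pi> (L x)"
  by unfold_locales (use alg_hom_comp[OF L S'.\<pi>_hom] in \<open>simp add: comp_def\<close>)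
 have "S.rels <= {x : carrier S.F. S'.Q.\<pi> (L x) = \<zero>\<^sub>S'.X}"
 proof
  fix r assume r: "r : S.rels"
  have "L r : S'.rels" using r by (cases rule: S.relsE) (simp_all add: L_def lin_ext_minus lin_ext_add h.add h.smult S'.relsI)
  then have "L r : tensor_ideal B' C" unfolding S'.tensor_ideal_eq by (rule S'.F.genideal_self[OF S'.rels_carrier, THEN subsetD])
  then have "S'.Q.\<pi> (L r) = \<zero>\<^sub>S'.X" using S'.Q.\<pi>_eq_0[OF S'.Q.Icarr] by (simp add: S'.tensor_eq)
  then show "r : {x : carrier S.F. S'.Q.\<pi> (L x) = \<zero>\<^sub>S'.X}" using r S.rels_carrier by auto
 qed
 then have "tensor_ideal B C <= {x : carrier S.F. S'.Q.\<pi> (L x) = \<zero>\<^sub>S'.X}"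
  unfolding S.tensor_ideal_eq by (rule S.F.genideal_minimal[OF q.kernel_ideal])
 then have z: "S'.Q.\<pi> (L x) = \<zero>\<^sub>S'.X" if "x : tensor_ideal B C" for x using that by auto
 have tm: "tensor_map B' C h (S.Q.\<pi> x) = S'.Q.\<pi> (L x)" if "x : carrier S.F" for x unfolding tensor_map_def L_def[symmetric]
 proof (rule S.Q.q_map[OF that])
  fix x y assume xy: "x : carrier S.F" "y : carrier S.F" "x \<ominus>\<^sub>S.F y : tensor_ideal B C"
  show "S'.Q.\<pi> (L x) = S'.Q.\<pi> (L y)"
   using z[OF xy(3)] q.minus[OF xy(1,2)] S'.X.minus_eq_0_iff[OF q.closed[OF xy(1)] q.closed[OF xy(2)]] by simp
 qed
 obtain g where g: "alg_hom S.X S'.X g" "!!x. x : carrier S.F ==> g (S.Q.\<pi> x) = S'.Q.\<pi> (L x)"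
  using S.Q.q_lift[OF q.ah z] unfolding S.tensor_eq[symmetric] by blast
 interpret g: alg_map S.X S'.X g by unfold_locales (rule g)
 have eq: "tensor_map B' C h Z = g Z" if "Z : carrier S.X" for Z using that tm g(2) by (auto simp: S.X_carrier)
 show "alg_hom S.X S'.X (tensor_map B' C h)"
  by (rule alg_homI[OF S.X.kalg S'.X.kalg]) (simp_all add: eq g.add g.smult g.mult g.one del: S.F_simps)
 show "b : carrier B ==> c : carrier C ==> tensor_map B' C h (S.tp b c) = S'.tp (h b) c"
  using tm[of "basis_elt (b, c)"] by (simp add: S.tp_def S'.tp_def L_def)
qed

text \<open>B \<otimes> E is the algebra of matrices over B: \<open>c i j\<close> reads off entries
  and \<open>mk\<close> assembles a matrix, so equality in the tensor product can be tested on
  entries.\<close>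

locale tensor_units = tensor_alg B E + mu: matrix_units E I e co
 for B :: "('k::field, 'b, 'm) module_scheme" and E :: "('k, 'e, 'n) module_scheme"
  and I :: "'i set" and e co
begin

definition \<beta> :: "'i => 'i => 'b \<times> 'e => 'b" where
 "\<beta> i j = (%(b, m). if b : carrier B & m : carrier E then co m i j \<odot>\<^sub>B b else \<zero>\<^sub>B)"

definition c0 :: "'i => 'i => ('b \<times> 'e \<Rightarrow>\<^sub>0 'k) => 'b" where
 "c0 i j = B.lext (\<beta> i j)"

lemma \<beta>_closed [simp]: "\<beta> i j u : carrier B"
 by (cases u) (auto simp: \<beta>_def)

lemma c0_simps:
 "c0 i j f : carrier B" "c0 i j 0 = \<zero>\<^sub>B" "c0 i j (f + g) = c0 i j f \<oplus>\<^sub>B c0 i j g"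
 "c0 i j (f - g) = c0 i j f \<ominus>\<^sub>B c0 i j g"
 "c0 i j (scale a f) = a \<odot>\<^sub>B c0 i j f"
 "b : carrier B ==> m : carrier E ==> c0 i j (single (b, m) a) = a \<odot>\<^sub>B (co m i j \<odot>\<^sub>B b)"
 by (simp_all add: c0_def B.lext_add B.lext_sc B.lext_minus \<beta>_def[of i j, symmetric]) (simp add: \<beta>_def)

lemma c0_basis: "b : carrier B ==> m : carrier E ==> c0 i j (basis_elt (b, m)) = co m i j \<odot>\<^sub>B b"
 by (simp add: basis_elt_def c0_simps)

lemma c0_mult:
 assumes ij: "i : I" "j : I" and f: "f : carrier F" and g: "g : carrier F"
 shows "c0 i j (conv opn f g) = (\<Oplus>\<^sub>B l\<in>I. c0 i l f \<otimes>\<^sub>B c0 l j g)"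
proof -
 have "keys f <= K" "keys g <= K" using f g by simp_all
 note g = this(2) and f = this(1)
 note [simp] = c0_simps(1)
 show ?thesis using f
 proof (induct f rule: pm_induct)
  case u: (single u a)
  obtain b m where bm: "u = (b, m)" "b : carrier B" "m : carrier E" using u by auto
  show ?case using g
  proof (induct g rule: pm_induct)
   case v: (single v a')
   obtain b' m' where bm': "v = (b', m')" "b' : carrier B" "m' : carrier E" using v by auto
   have "(\<Oplus>\<^sub>B l\<in>I. c0 i l (single u a) \<otimes>\<^sub>B c0 l j (single v a')) =
     (\<Oplus>\<^sub>B l\<in>I. (a * a' * (co m i l * co m' l j)) \<odot>\<^sub>B (b \<otimes>\<^sub>B b'))"
    by (rule B.finsum_cong') (use bm bm' in \<open>auto simp: c0_simps mult.assoc mult.left_commute mult.commute\<close>)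
   also have "... = (a * a' * co (m \<otimes>\<^sub>E m') i j) \<odot>\<^sub>B (b \<otimes>\<^sub>B b')"
    using bm bm' ij by (subst B.finsum_scalar) (auto simp: mu.co_mult sum_distrib_left)
   finally show ?case using bm bm' by (simp add: c0_simps)
  next
   case (add p q)
   then show ?case by (simp add: c0_simps conv_add_r B.r_distr Pi_def)
  qed (auto simp: c0_simps)
 next
  case (add p q)
  then show ?case by (simp add: c0_simps conv_add_l B.l_distr Pi_def)
 qed (auto simp: c0_simps)
qed

text \<open>The elements with all entries zero form an ideal by the product formula
  \<open>c0_mult\<close>, and the bilinearity relations lie in it.\<close>

lemma c0_ideal: "i : I ==> j : I ==> z : tensor_ideal B E ==> c0 i j z = \<zero>\<^sub>B"
proof -
 define N where "N = {z : carrier F. \<forall>i\<in>I. \<forall>j\<in>I. c0 i j z = \<zero>\<^sub>B}"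
 have sm: "(\<Oplus>\<^sub>B l\<in>I. \<zero>\<^sub>B) = \<zero>\<^sub>B" by simp
 have "ideal N F"
 proof (rule F.ideal_of_submodule)
  show "submodule N ground F"
  proof (rule F.submoduleI')
   show "N <= carrier F" by (auto simp: N_def)
  qed (simp_all add: N_def c0_simps keys_add_subset keys_sc_subset)
  show "a \<otimes>\<^sub>F x : N" if a: "a : carrier F" and x: "x : N" for a x
  proof -
   have "c0 i j (conv opn a x) = \<zero>\<^sub>B" if ij: "i : I" "j : I" for i j
   proof -
    have "c0 i j (conv opn a x) = (\<Oplus>\<^sub>B l\<in>I. c0 i l a \<otimes>\<^sub>B c0 l j x)"
     by (rule c0_mult[OF ij]) (use a x in \<open>auto simp: N_def\<close>)
    also have "... = (\<Oplus>\<^sub>B l\<in>I. \<zero>\<^sub>B)"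
     by (rule B.finsum_cong'[OF refl]) (use x ij in \<open>auto simp: N_def c0_simps\<close>)
    finally have "c0 i j (conv opn a x) = (\<Oplus>\<^sub>B l\<in>I. \<zero>\<^sub>B)" .
    then show ?thesis by simp
   qed
   moreover have "a \<otimes>\<^sub>F x : carrier F" using a x unfolding N_def by (intro F.m_closed) blast+
   ultimately show ?thesis by (simp add: N_def)
  qed
  show "x \<otimes>\<^sub>F a : N" if a: "a : carrier F" and x: "x : N" for a x
  proof -
   have "c0 i j (conv opn x a) = \<zero>\<^sub>B" if ij: "i : I" "j : I" for i j
   proof -
    have "c0 i j (conv opn x a) = (\<Oplus>\<^sub>B l\<in>I. c0 i l x \<otimes>\<^sub>B c0 l j a)"
     by (rule c0_mult[OF ij]) (use a x in \<open>auto simp: N_def\<close>)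
    also have "... = (\<Oplus>\<^sub>B l\<in>I. \<zero>\<^sub>B)"
     by (rule B.finsum_cong'[OF refl]) (use x ij in \<open>auto simp: N_def c0_simps\<close>)
    finally have "c0 i j (conv opn x a) = (\<Oplus>\<^sub>B l\<in>I. \<zero>\<^sub>B)" .
    then show ?thesis by simp
   qed
   moreover have "x \<otimes>\<^sub>F a : carrier F" using a x unfolding N_def by (intro F.m_closed) blast+
   ultimately show ?thesis by (simp add: N_def)
  qed
 qed
 moreover have "rels <= N"
 proof
  fix r assume r: "r : rels"
  have "c0 i j r = \<zero>\<^sub>B" if ij: "i : I" "j : I" for i j using r by (cases rule: relsE)
    (use ij in \<open>auto simp: c0_simps c0_basis mu.co_add mu.co_smult B.sm_radd B.sm_ladd B.minus_eq_0_iff mult.commute\<close>)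
  then show "r : N" using r rels_carrier by (auto simp: N_def)
 qed
 ultimately have "tensor_ideal B E <= N" unfolding tensor_ideal_eq by (rule F.genideal_minimal)
 then show "i : I ==> j : I ==> z : tensor_ideal B E ==> c0 i j z = \<zero>\<^sub>B" by (auto simp: N_def)
qed

definition c :: "'i => 'i => ('b \<times> 'e \<Rightarrow>\<^sub>0 'k) set => 'b" where
 "c i j Z = c0 i j (SOME z. z : carrier F & Q.\<pi> z = Z)"

lemma c_\<pi>: "i : I ==> j : I ==> z : carrier F ==> c i j (Q.\<pi> z) = c0 i j z"
proof -
 assume ij: "i : I" "j : I" and z: "z : carrier F"
 define w where "w = (SOME w. w : carrier F & Q.\<pi> w = Q.\<pi> z)"
 have w: "w : carrier F & Q.\<pi> w = Q.\<pi> z" unfolding w_def by (rule someI) (use z in simp)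
 then have "w - z : tensor_ideal B E" using Q.\<pi>_eq_iff[of w z] z F_minus[of w z] by simp
 then have "c0 i j w \<ominus>\<^sub>B c0 i j z = \<zero>\<^sub>B" using c0_ideal[OF ij] c0_simps(4)[of i j w z] by metis
 then have "c0 i j w = c0 i j z" using B.minus_eq_0_iff[of "c0 i j w" "c0 i j z"] c0_simps(1) by simp
 then show ?thesis by (simp only: c_def w_def)
qed

context
 notes F_simps(1) [simp del]
begin

lemma c_linear: "i : I ==> j : I ==> linear_map X B (c i j)"
proof -
 assume ij: "i : I" "j : I"
 have a: "c i j (Q.\<pi> x \<oplus>\<^sub>X Q.\<pi> y) = c i j (Q.\<pi> x) \<oplus>\<^sub>B c i j (Q.\<pi> y)"
  if "x : carrier F" "y : carrier F" for x y
  using that ij c_\<pi>[OF ij, of "x \<oplus>\<^sub>F y"] F.a_closed[OF that] by (simp only: \<pi>.add[OF that, symmetric] c_\<pi> F_simps c0_simps)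
 have s: "c i j (a \<odot>\<^sub>X Q.\<pi> x) = a \<odot>\<^sub>B c i j (Q.\<pi> x)" if "x : carrier F" for a x
  using that ij c_\<pi>[OF ij, of "a \<odot>\<^sub>F x"] F.sm_closed[OF that] by (simp only: \<pi>.smult[OF that, symmetric] c_\<pi> F_simps c0_simps)
 show ?thesis by (rule linear_mapI) (use a s ij in \<open>auto simp: X_carrier c_\<pi> c0_simps\<close>)
qed

lemma c_lin: "i : I ==> j : I ==> lin_map X B (c i j)"
 by (intro lin_map.intro lin_map_axioms.intro c_linear X.kmod_axioms B.kmod_axioms)

lemma c_closed [simp]: "i : I ==> j : I ==> Z : carrier X ==> c i j Z : carrier B"
 using lin_map.closed[OF c_lin] by blast

lemma c_tp: "i : I ==> j : I ==> b : carrier B ==> m : carrier E ==> c i j (tp b m) = co m i j \<odot>\<^sub>B b"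
 by (simp add: tp_def c_\<pi> c0_basis)

lemma c_mult:
 assumes "i : I" "j : I" "Y : carrier X" "Z : carrier X"
 shows "c i j (Y \<otimes>\<^sub>X Z) = (\<Oplus>\<^sub>B l\<in>I. c i l Y \<otimes>\<^sub>B c l j Z)"
proof -
 obtain y z where yz: "y : carrier F" "Y = Q.\<pi> y" "z : carrier F" "Z = Q.\<pi> z" using assms(3,4) by (auto simp: X_carrier)
 have "c i j (Y \<otimes>\<^sub>X Z) = c i j (Q.\<pi> (y \<otimes>\<^sub>F z))" using yz by (simp only: \<pi>.mult)
 also have "... = c0 i j (conv opn y z)" using c_\<pi>[OF assms(1,2) F.m_closed[OF yz(1,3)]] by simp
 also have "... = (\<Oplus>\<^sub>B l\<in>I. c0 i l y \<otimes>\<^sub>B c0 l j z)" by (rule c0_mult[OF assms(1,2) yz(1,3)])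
 also have "... = (\<Oplus>\<^sub>B l\<in>I. c i l Y \<otimes>\<^sub>B c l j Z)"
  by (rule B.finsum_cong') (use yz assms in \<open>auto simp: c_\<pi> c0_simps\<close>)
 finally show ?thesis .
qed

definition mk :: "('i => 'i => 'b) => ('b \<times> 'e \<Rightarrow>\<^sub>0 'k) set" where
 "mk \<gamma> = (\<Oplus>\<^sub>X i\<in>I. \<Oplus>\<^sub>X j\<in>I. tp (\<gamma> i j) (e i j))"

lemma mk_closed [simp]: "(!!i j. i : I ==> j : I ==> \<gamma> i j : carrier B) ==> mk \<gamma> : carrier X"
 unfolding mk_def by (intro X.finsum_closed) (auto intro!: X.finsum_closed)

lemma c_mk:
 assumes ab: "a : I" "b : I" and \<gamma>: "!!i j. i : I ==> j : I ==> \<gamma> i j : carrier B"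
 shows "c a b (mk \<gamma>) = \<gamma> a b"
proof -
 interpret c: lin_map X B "c a b" by (rule c_lin[OF ab])
 have in2: "(\<Oplus>\<^sub>X j\<in>I. tp (\<gamma> i j) (e i j)) : carrier X" if "i : I" for i
  using that \<gamma> by (auto intro!: X.finsum_closed)
 have "c a b (mk \<gamma>) = (\<Oplus>\<^sub>B i\<in>I. c a b (\<Oplus>\<^sub>X j\<in>I. tp (\<gamma> i j) (e i j)))"
  unfolding mk_def by (rule c.finsum) (use in2 in auto)
 also have "... = (\<Oplus>\<^sub>B i\<in>I. \<Oplus>\<^sub>B j\<in>I. c a b (tp (\<gamma> i j) (e i j)))"
  by (rule B.finsum_cong'[OF refl _ c.finsum]) (use \<gamma> ab in \<open>auto intro!: B.finsum_closed\<close>)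
 also have "... = (\<Oplus>\<^sub>B i\<in>I. \<Oplus>\<^sub>B j\<in>I. (if i = a & j = b then \<gamma> a b else \<zero>\<^sub>B))"
  by (intro B.finsum_cong' refl) (use \<gamma> ab in \<open>auto simp: c_tp mu.co_e intro!: B.finsum_closed\<close>)
 also have "... = (\<Oplus>\<^sub>B j\<in>I. (if a = a & j = b then \<gamma> a b else \<zero>\<^sub>B))"
  by (rule B.finsum_single) (use \<gamma> ab in \<open>auto intro!: B.finsum_closed\<close>)
 also have "... = (if a = a & b = b then \<gamma> a b else \<zero>\<^sub>B)" by (rule B.finsum_single) (use \<gamma> ab in auto)
 finally show ?thesis by simp
qed

text \<open>On a pure tensor b \<otimes> m this is the expansion of m in matrix units, with the
  scalars moved across the tensor sign; the general case is additive.\<close>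

lemma mk_c: "Z : carrier X ==> mk (%i j. c i j Z) = Z"
proof (induct Z rule: X_induct)
 case (tp b m)
 interpret t: lin_map E X "tp b" by (intro lin_map.intro lin_map_axioms.intro tp_lin C.kmod_axioms X.kmod_axioms tp)
 have ii: "(\<Oplus>\<^sub>E j\<in>I. co m i j \<odot>\<^sub>E e i j) : carrier E" if "i : I" for i
  using that by (auto intro!: C.finsum_closed)
 have "mk (%i j. c i j (tp b m)) = (\<Oplus>\<^sub>X i\<in>I. \<Oplus>\<^sub>X j\<in>I. tp b (co m i j \<odot>\<^sub>E e i j))"
  unfolding mk_def by (intro X.finsum_cong' refl) (use tp in \<open>auto simp: c_tp tp_smult_l tp_smult_r intro!: X.finsum_closed\<close>)
 also have "... = (\<Oplus>\<^sub>X i\<in>I. tp b (\<Oplus>\<^sub>E j\<in>I. co m i j \<odot>\<^sub>E e i j))"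
  by (rule X.finsum_cong'[OF refl _ t.finsum[symmetric]]) (use tp ii in auto)
 also have "... = tp b (\<Oplus>\<^sub>E i\<in>I. \<Oplus>\<^sub>E j\<in>I. co m i j \<odot>\<^sub>E e i j)"
  by (rule t.finsum[symmetric]) (use ii in auto)
 also have "... = tp b m" using mu.co_expand[OF tp(2)] by simp
 finally show ?case .
next
 case (add x y)
 have cc: "tp (c i j z) (e i j) : carrier X" if "i : I" "j : I" "z : carrier X" for i j z using that by simp
 have cs: "(\<Oplus>\<^sub>X j\<in>I. tp (c i j z) (e i j)) : carrier X" if "i : I" "z : carrier X" for i z
  using that cc by (auto intro!: X.finsum_closed)
 have "mk (%i j. c i j (x \<oplus>\<^sub>X y)) =
   (\<Oplus>\<^sub>X i\<in>I. (\<Oplus>\<^sub>X j\<in>I. tp (c i j x) (e i j)) \<oplus>\<^sub>X (\<Oplus>\<^sub>X j\<in>I. tp (c i j y) (e i j)))"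
  unfolding mk_def
 proof (rule X.finsum_cong'[OF refl])
  fix i assume i: "i : I"
  have "(\<Oplus>\<^sub>X j\<in>I. tp (c i j (x \<oplus>\<^sub>X y)) (e i j)) =
    (\<Oplus>\<^sub>X j\<in>I. tp (c i j x) (e i j) \<oplus>\<^sub>X tp (c i j y) (e i j))"
   by (rule X.finsum_cong') (use i add cc in \<open>auto simp: lin_map.add[OF c_lin] tp_add_l\<close>)
  also have "... = (\<Oplus>\<^sub>X j\<in>I. tp (c i j x) (e i j)) \<oplus>\<^sub>X (\<Oplus>\<^sub>X j\<in>I. tp (c i j y) (e i j))"
   by (rule X.finsum_addf) (use i add cc in auto)
  finally show "(\<Oplus>\<^sub>X j\<in>I. tp (c i j (x \<oplus>\<^sub>X y)) (e i j)) =
   (\<Oplus>\<^sub>X j\<in>I. tp (c i j x) (e i j)) \<oplus>\<^sub>X (\<Oplus>\<^sub>X j\<in>I. tp (c i j y) (e i j))" .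
 qed (use add cs in auto)
 also have "... = mk (%i j. c i j x) \<oplus>\<^sub>X mk (%i j. c i j y)"
  unfolding mk_def by (rule X.finsum_addf) (use add cs in auto)
 finally show ?case using add by simp
qed

lemma c_eqI:
 assumes "Y : carrier X" "Z : carrier X" "!!i j. i : I ==> j : I ==> c i j Y = c i j Z"
 shows "Y = Z"
proof -
 have "mk (%i j. c i j Y) = mk (%i j. c i j Z)"
  unfolding mk_def by (intro X.finsum_cong' refl) (use assms in \<open>auto intro!: X.finsum_closed\<close>)
 then show ?thesis using mk_c assms(1,2) by simp
qed

abbreviation "\<iota> \<equiv> tp \<one>\<^sub>B"

lemma c_unit_l:
 assumes "a : I" "b : I" "k : I" "i : I" "Z : carrier X"
 shows "c a b (\<iota> (e k i) \<otimes>\<^sub>X Z) = (if a = k then c i b Z else \<zero>\<^sub>B)"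
proof -
 have "c a b (\<iota> (e k i) \<otimes>\<^sub>X Z) = (\<Oplus>\<^sub>B l\<in>I. c a l (\<iota> (e k i)) \<otimes>\<^sub>B c l b Z)"
  by (rule c_mult) (use assms in auto)
 also have "... = c a i (\<iota> (e k i)) \<otimes>\<^sub>B c i b Z"
  by (rule B.finsum_single) (use assms in \<open>auto simp: c_tp mu.co_e\<close>)
 finally show ?thesis using assms by (simp add: c_tp mu.co_e)
qed

lemma c_unit_r:
 assumes "a : I" "b : I" "k : I" "i : I" "Z : carrier X"
 shows "c a b (Z \<otimes>\<^sub>X \<iota> (e i k)) = (if b = k then c a i Z else \<zero>\<^sub>B)"
proof -
 have "c a b (Z \<otimes>\<^sub>X \<iota> (e i k)) = (\<Oplus>\<^sub>B l\<in>I. c a l Z \<otimes>\<^sub>B c l b (\<iota> (e i k)))"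
  by (rule c_mult) (use assms in auto)
 also have "... = c a i Z \<otimes>\<^sub>B c i b (\<iota> (e i k))"
  by (rule B.finsum_single) (use assms in \<open>auto simp: c_tp mu.co_e\<close>)
 finally show ?thesis using assms by (simp add: c_tp mu.co_e)
qed

end

end

section \<open>Representability\<close>

context unit_map
begin

lemma ee_ent:
 assumes "m : I" "k : I" "i : I" "l : I" "y : carrier T"
 shows "ee m k \<otimes>\<^sub>T ent i l y = ee m i \<otimes>\<^sub>T (y \<otimes>\<^sub>T ee l k)"
proof -
 have "ee m k \<otimes>\<^sub>T ent i l y = (\<Oplus>\<^sub>T n\<in>I. ee m k \<otimes>\<^sub>T (ee n i \<otimes>\<^sub>T (y \<otimes>\<^sub>T ee l n)))"
  unfolding ent_def by (rule j.S.finsum_rdistr) (use assms in auto)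
 also have "... = ee m k \<otimes>\<^sub>T (ee k i \<otimes>\<^sub>T (y \<otimes>\<^sub>T ee l k))"
  by (rule j.S.finsum_single) (use assms in \<open>auto simp: ee_mult'\<close>)
 also have "... = ee m i \<otimes>\<^sub>T (y \<otimes>\<^sub>T ee l k)" using assms by (simp add: ee_mult')
 finally show ?thesis .
qed

text \<open>Insert 1 = sum_m e_mm between x and y; the entries thus multiply like those of
  matrices.\<close>

lemma ent_mult:
 assumes il: "i : I" "l : I" and x: "x : carrier T" and y: "y : carrier T"
 shows "ent i l (x \<otimes>\<^sub>T y) = (\<Oplus>\<^sub>T m\<in>I. ent i m x \<otimes>\<^sub>T ent m l y)"
proof -
 interpret n: lin_map T T "ent i l" by (intro lin_map.intro lin_map_axioms.intro ent_linear il j.S.kmod_axioms)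
 have "x \<otimes>\<^sub>T y = (x \<otimes>\<^sub>T (\<Oplus>\<^sub>T m\<in>I. ee m m)) \<otimes>\<^sub>T y" using x y by (simp add: sum_ee)
 also have "... = (\<Oplus>\<^sub>T m\<in>I. x \<otimes>\<^sub>T ee m m) \<otimes>\<^sub>T y" by (subst j.S.finsum_rdistr) (use x in auto)
 also have "... = (\<Oplus>\<^sub>T m\<in>I. x \<otimes>\<^sub>T ee m m \<otimes>\<^sub>T y)" by (rule j.S.finsum_ldistr) (use x y in auto)
 finally have "ent i l (x \<otimes>\<^sub>T y) = ent i l (\<Oplus>\<^sub>T m\<in>I. x \<otimes>\<^sub>T ee m m \<otimes>\<^sub>T y)" by simp
 also have "... = (\<Oplus>\<^sub>T m\<in>I. ent i l (x \<otimes>\<^sub>T ee m m \<otimes>\<^sub>T y))" by (rule n.finsum) (use x y in auto)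
 also have "... = (\<Oplus>\<^sub>T m\<in>I. ent i m x \<otimes>\<^sub>T ent m l y)"
 proof (rule j.S.finsum_cong'[OF refl])
  fix m assume m: "m : I"
  have "ent i m x \<otimes>\<^sub>T ent m l y = (\<Oplus>\<^sub>T k\<in>I. ee k i \<otimes>\<^sub>T (x \<otimes>\<^sub>T ee m k) \<otimes>\<^sub>T ent m l y)"
   unfolding ent_def[of i m x] by (rule j.S.finsum_ldistr) (use m il x y in auto)
  also have "... = (\<Oplus>\<^sub>T k\<in>I. ee k i \<otimes>\<^sub>T ((x \<otimes>\<^sub>T ee m m \<otimes>\<^sub>T y) \<otimes>\<^sub>T ee l k))"
   by (rule j.S.finsum_cong') (use m il x y in \<open>auto simp: j.S.m_assoc ee_ent\<close>)
  finally show "ent i l (x \<otimes>\<^sub>T ee m m \<otimes>\<^sub>T y) = ent i m x \<otimes>\<^sub>T ent m l y" by (simp add: ent_def)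
 qed (use il x y in auto)
 finally show ?thesis .
qed

lemma ent_one: "i : I ==> l : I ==> ent i l \<one>\<^sub>T = (if i = l then \<one>\<^sub>T else \<zero>\<^sub>T)"
 by (rule ent_of_cent) (auto simp: cent_eq)

text \<open>Both sides are linear in m, and the entries of a matrix unit are 1 or 0.\<close>

lemma ent_j:
 assumes il: "i : I" "l : I" and m: "m : carrier E"
 shows "ent i l (j m) = co m i l \<odot>\<^sub>T \<one>\<^sub>T"
proof -
 interpret n: lin_map T T "ent i l" by (intro lin_map.intro lin_map_axioms.intro ent_linear il j.S.kmod_axioms)
 interpret nj: lin_map E T "%m. ent i l (j m)" by (intro lin_map.intro lin_map_axioms.intro linear_mapI kmod_axioms j.S.kmod_axioms)
   (auto simp: il lin_map.add[OF j.lin_map_axioms] n.add j.smult n.smult)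
 have e1: "ent i l (ee a b) = (if i = a & l = b then \<one>\<^sub>T else \<zero>\<^sub>T)" if ab: "a : I" "b : I" for a b
 proof -
  have "ent i l (ee a b) = (\<Oplus>\<^sub>T k\<in>I. if i = a & l = b then ee k k else \<zero>\<^sub>T)"
   unfolding ent_def by (rule j.S.finsum_cong') (use il ab in \<open>auto simp: ee_mult'  ee_mult\<close>)
  then show ?thesis by (cases "i = a & l = b") (auto simp: sum_ee)
 qed
 have ii: "(\<Oplus>\<^sub>E b\<in>I. co m a b \<odot>\<^sub>E e a b) : carrier E" if "a : I" for a
  using that by (auto intro!: finsum_closed)
 have "ent i l (j m) = ent i l (j (\<Oplus>\<^sub>E a\<in>I. \<Oplus>\<^sub>E b\<in>I. co m a b \<odot>\<^sub>E e a b))"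
  using co_expand[OF m] by simp
 also have "... = (\<Oplus>\<^sub>T a\<in>I. ent i l (j (\<Oplus>\<^sub>E b\<in>I. co m a b \<odot>\<^sub>E e a b)))"
  by (rule nj.finsum) (use ii in auto)
 also have "... = (\<Oplus>\<^sub>T a\<in>I. \<Oplus>\<^sub>T b\<in>I. ent i l (j (co m a b \<odot>\<^sub>E e a b)))"
  by (rule j.S.finsum_cong'[OF refl _ nj.finsum]) (use il in \<open>auto intro!: j.S.finsum_closed\<close>)
 also have "... = (\<Oplus>\<^sub>T a\<in>I. \<Oplus>\<^sub>T b\<in>I. if i = a & l = b then co m i l \<odot>\<^sub>T \<one>\<^sub>T else \<zero>\<^sub>T)"
  by (intro j.S.finsum_cong' refl) (auto simp: nj.smult e1 intro!: j.S.finsum_closed)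
 also have "... = (\<Oplus>\<^sub>T b\<in>I. if i = i & l = b then co m i l \<odot>\<^sub>T \<one>\<^sub>T else \<zero>\<^sub>T)"
  by (rule j.S.finsum_single) (use il in \<open>auto intro!: j.S.finsum_closed\<close>)
 also have "... = (if i = i & l = l then co m i l \<odot>\<^sub>T \<one>\<^sub>T else \<zero>\<^sub>T)"
  by (rule j.S.finsum_single) (use il in auto)
 finally show ?thesis by simp
qed

end

lemma algebra_kalg:
 fixes B :: "('k::field, 'b) module"
 assumes "algebra ground B"
 shows "kalg B"
proof -
 interpret algebra ground B by fact
 have "x \<otimes>\<^sub>B (c \<odot>\<^sub>B y) = c \<odot>\<^sub>B (x \<otimes>\<^sub>B y)" if "x : carrier B" "y : carrier B" for c x y
  using smult_assoc2[of c y x] smult_closed[of c y] that m_comm[of x "c \<odot>\<^sub>B y"] m_comm[of x y] by (simp add: ground_def)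
 then show ?thesis using smult_assoc2 module_axioms ring_axioms by (simp add: kalg_def ground_def)
qed

lemma kalg_algebra:
 fixes C :: "('k::field, 'c) dg"
 assumes "kalg C" "!!x y. x : carrier C ==> y : carrier C ==> x \<otimes>\<^sub>C y = y \<otimes>\<^sub>C x"
 shows "algebra ground C"
proof -
 interpret kalgebra C by unfold_locales fact
 have "cring C" by unfold_locales (rule assms(2))
 then show ?thesis by (intro algebra.intro algebra_axioms.intro kmod) simp_all
qed

lemma conc_hom: "alg_hom A B f ==> dga_hom (conc A) (conc B) f"
proof -
 assume "alg_hom A B f"
 then interpret f: alg_map A B f by unfold_locales
 show ?thesis by (rule dga_homI[OF conc_dga[OF f.A.kalg] conc_dga[OF f.B.kalg]])
   (auto simp: f.add f.smult f.mult f.one f.zero split: if_splits)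
qed

lemma finsum_conc: "finsum (conc X) f J = finsum X f J"
 by (simp add: finsum_def finprod_def)

text \<open>An index i0 exists only for V \<noteq> 0. For V = 0 the algebra \<open>rep_alg\<close>
  is zero, while B \<otimes> End V = 0 receives exactly one map from A for every B; the zero algebra
  does not represent this functor.\<close>

locale unit_rep = deg0_complex V + mu: matrix_units "dg_End V" I e co + A: kalgebra A
 for V :: "('k::field, 'v) dg" (structure) and I :: "'v set" and e co and A :: "('k, 'a) module" +
 fixes i0 assumes i0: "i0 : I"
begin

lemma cA_dga: "dga (conc A)"
 by (rule conc_dga[OF A.kalg])

end

sublocale unit_rep \<subseteq> E: dgalgebra "dg_End V" by unfold_locales (rule E_dga)
sublocale unit_rep \<subseteq> T: dgalgebra "free_prod (conc A) (dg_End V)"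
 by unfold_locales (rule two_dga.T_dga[OF two_dgaI[OF cA_dga E_dga]])
sublocale unit_rep \<subseteq> N: rep_ctx V "conc A" by (rule rep_ctxI[OF V fin cA_dga])
sublocale unit_rep \<subseteq> U: unit_map "dg_End V" I e co "free_prod (conc A) (dg_End V)" "fp_inr (conc A) (dg_End V)"
 by (rule unit_map_fp[OF mu.matrix_units_axioms cA_dga])

context unit_rep
begin

abbreviation "T \<equiv> free_prod (conc A) E"
abbreviation "C \<equiv> rep_alg V (conc A)"
abbreviation "rt \<equiv> root_alg V (conc A)"
abbreviation "il \<equiv> fp_inl (conc A) E"
abbreviation "ir \<equiv> fp_inr (conc A) E"

lemma T_gr: "n ~= 0 ==> gr T n = {\<zero>\<^sub>T}"
 by (rule fp_gr_zero[OF cA_dga E_dga, of "{0}"]) (auto simp: gr_E)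

lemma T_gr0: "gr T 0 = carrier T"
proof -
 have "x : gr T 0" if "x : carrier T" for x using that
 proof (induct x rule: T.gr_induct)
  case (homog n x)
  then show ?case using T_gr[of n] by (cases "n = 0") auto
 qed auto
 then show ?thesis by (auto simp: T.gr_carrier)
qed

lemma C_algebra: "algebra ground C"
proof (rule kalg_algebra)
 show "kalg C" using N.rep_dga by (simp add: dga_def galg_def)
 have g: "x : gr C 0" if x: "x : carrier C" for x
 proof -
  obtain w where w: "w : N.C.cent" "x = N.\<rho> w" using x by (auto simp: N.rep_carrier)
  then have "w : gr T 0 \<inter> N.C.cent" using T_gr0 by (simp add: N.C.cent_def)
  then show ?thesis using w by (simp add: rep_alg_def N.root_alg_eq)
 qed
 interpret C: dgalgebra C by unfold_locales (rule N.rep_dga)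
 show "x \<otimes>\<^sub>C y = y \<otimes>\<^sub>C x" if "x : carrier C" "y : carrier C" for x y
 proof -
  have "x \<otimes>\<^sub>C y = ksgn (0 * 0) \<odot>\<^sub>C (y \<otimes>\<^sub>C x)"
   using N.rep_gcalg g[OF that(1)] g[OF that(2)] unfolding gcalg_def by blast
  then show ?thesis using that by simp
 qed
qed

lemma gcomm_rt: "x : carrier rt ==> y : carrier rt ==> gcomm rt x y = x \<otimes>\<^sub>T y \<ominus>\<^sub>T y \<otimes>\<^sub>T x"
proof -
 assume "x : carrier rt" "y : carrier rt"
 then have xy: "x : N.C.cent" "y : N.C.cent" "x : gr T 0" "y : gr T 0" "x : carrier T" "y : carrier T"
  using T_gr0 by (auto simp: N.root_carrier N.C.cent_def)
 have "gcomm rt x y = gcomm T x y" using N.C.C.sub_gcomm[OF xy(1,2)] by (simp add: N.root_alg_eq)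
 then show ?thesis using T.gcomm_homog[OF xy(3,4)] xy by simp
qed

text \<open>The universal representation followed by f: the entries of a in A * End V lie in the
  centralizer and so have classes in C, and the matrix is formed from the values of f on these
  classes.\<close>

definition Phi :: "('k, 'b) module => (('k, 'v, 'a) rep_elt => 'b) => 'a => ('b \<times> ('v => 'v) \<Rightarrow>\<^sub>0 'k) set" where
 "Phi B f = (\<lambda>a\<in>carrier A. tensor_units.mk B E I e (%i j. f (N.\<rho> (U.ent i j (il a)))))"

end

locale unit_rep_alg = unit_rep V I e co A i0 + X: tensor_units B "dg_End V" I e co
 for V :: "('k::field, 'v) dg" (structure) and I :: "'v set" and e co and A :: "('k, 'a) module" and i0
  and B :: "('k, 'b) module" +
 assumes B_alg: "algebra ground B"
begin

lemma il_hom: "dga_hom (conc A) T il" and ir_hom: "dga_hom E T ir"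
 by (rule N.P.fp_inl_hom, rule N.P.fp_inr_hom)

text \<open>The same matrix for every element of A * End V. As this algebra is generated by A and
  End V, homomorphisms out of it can be compared on the two factors.\<close>

definition Psi :: "(('k, 'v, 'a) rep_elt => 'b) => (('a, 'v => 'v) letter list \<Rightarrow>\<^sub>0 'k) set => ('b \<times> ('v => 'v) \<Rightarrow>\<^sub>0 'k) set" where
 "Psi f w = X.mk (%i j. f (N.\<rho> (U.ent i j w)))"

lemma ent_rt: "i : I ==> l : I ==> x : carrier T ==> U.ent i l x : carrier rt"
 using U.ent_cent by (simp add: N.root_carrier)

text \<open>All equations are checked on entries. For products, entries multiply like matrices on
  both sides, by \<open>ent_mult\<close> and \<open>X.c_mult\<close>.\<close>

lemma Psi:
 assumes f: "alg_hom C B f"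
 shows Psi_hom: "alg_hom T X.X (Psi f)" 
  and Psi_c: "i : I ==> j : I ==> w : carrier T ==> X.c i j (Psi f w) = f (N.\<rho> (U.ent i j w))"
  and Psi_ir: "m : carrier E ==> Psi f (ir m) = X.\<iota> m"
proof -
 have "alg_hom rt C N.\<rho>" using N.rep_proj by (simp add: dga_hom_def galg_hom_def)
 then have "alg_hom rt B (f \<circ> N.\<rho>)" by (rule alg_hom_comp[OF _ f])
 then interpret F: alg_map rt B "%w. f (N.\<rho> w)" by unfold_locales (simp add: comp_def)
 have Fc: "f (N.\<rho> (U.ent i j w)) : carrier B" if "i : I" "j : I" "w : carrier T" for i j w
  using F.closed[OF ent_rt[OF that]] .
 show c: "X.c i j (Psi f w) = f (N.\<rho> (U.ent i j w))" if "i : I" "j : I" "w : carrier T" for i j w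
  unfolding Psi_def by (rule X.c_mk) (use that Fc in auto)
 have cl: "Psi f w : carrier X.X" if "w : carrier T" for w unfolding Psi_def by (rule X.mk_closed) (use that Fc in auto)
 have lin: "U.ent i j (x \<oplus>\<^sub>T y) = U.ent i j x \<oplus>\<^sub>T U.ent i j y" "U.ent i j (a \<odot>\<^sub>T x) = a \<odot>\<^sub>T U.ent i j x"
  if "i : I" "j : I" "x : carrier T" "y : carrier T" for i j x y a
  using U.ent_linear[OF that(1,2)] that by (auto simp: linear_map_def)
 have rt: "x \<oplus>\<^sub>rt y = x \<oplus>\<^sub>T y" "x \<otimes>\<^sub>rt y = x \<otimes>\<^sub>T y" "a \<odot>\<^sub>rt x = a \<odot>\<^sub>T x" "\<one>\<^sub>rt = \<one>\<^sub>T" "\<zero>\<^sub>rt = \<zero>\<^sub>T" for x y a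
  by (simp_all add: N.root_alg_eq)
 have Fa: "f (N.\<rho> (u \<oplus>\<^sub>T v)) = f (N.\<rho> u) \<oplus>\<^sub>B f (N.\<rho> v)" if "u : carrier rt" "v : carrier rt" for u v
  using F.add[OF that] by (simp only: rt)
 have Fs: "f (N.\<rho> (a \<odot>\<^sub>T u)) = a \<odot>\<^sub>B f (N.\<rho> u)" if "u : carrier rt" for a u
  using F.smult[OF that] by (simp only: rt)
 show "alg_hom T X.X (Psi f)"
 proof (rule alg_homI[OF T.kalg X.X.kalg cl])
  fix x y a assume x: "x : carrier T"
  show "Psi f (a \<odot>\<^sub>T x) = a \<odot>\<^sub>X.X Psi f x"
   by (rule X.c_eqI) (use x cl c in \<open>simp_all add: lin(2) lin_map.smult[OF X.c_lin] Fs ent_rt\<close>)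
  assume y: "y : carrier T"
  show "Psi f (x \<oplus>\<^sub>T y) = Psi f x \<oplus>\<^sub>X.X Psi f y"
   by (rule X.c_eqI) (use x y cl c in \<open>simp_all add: lin(1) lin_map.add[OF X.c_lin] Fa ent_rt\<close>)
  show "Psi f (x \<otimes>\<^sub>T y) = Psi f x \<otimes>\<^sub>X.X Psi f y"
  proof (rule X.c_eqI)
   fix i j assume ij: "i : I" "j : I"
   have ec: "U.ent i m x \<otimes>\<^sub>T U.ent m j y : N.C.cent" if "m : I" for m
    using U.ent_cent[OF ij(1) that x] U.ent_cent[OF that ij(2) y] by (rule N.C.C.S_mult)
   have "X.c i j (Psi f (x \<otimes>\<^sub>T y)) = f (N.\<rho> (\<Oplus>\<^sub>T m\<in>I. U.ent i m x \<otimes>\<^sub>T U.ent m j y))"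
    using c[OF ij] x y U.ent_mult[OF ij x y] by simp
   also have "... = f (N.\<rho> (\<Oplus>\<^sub>rt m\<in>I. U.ent i m x \<otimes>\<^sub>rt U.ent m j y))"
    using N.C.C.sub_finsum[of "%m. U.ent i m x \<otimes>\<^sub>T U.ent m j y" I] ec by (simp add: N.root_alg_eq)
   also have "... = (\<Oplus>\<^sub>B m\<in>I. f (N.\<rho> (U.ent i m x \<otimes>\<^sub>rt U.ent m j y)))"
    by (rule F.finsum) (use ec in \<open>auto simp: rt N.root_carrier\<close>)
   also have "... = (\<Oplus>\<^sub>B m\<in>I. X.c i m (Psi f x) \<otimes>\<^sub>B X.c m j (Psi f y))"
    by (rule X.B.finsum_cong') (use ij x y c cl ent_rt in \<open>auto simp: F.mult\<close>)
   also have "... = X.c i j (Psi f x \<otimes>\<^sub>X.X Psi f y)" by (rule X.c_mult[symmetric]) (use ij x y cl in auto)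
   finally show "X.c i j (Psi f (x \<otimes>\<^sub>T y)) = X.c i j (Psi f x \<otimes>\<^sub>X.X Psi f y)" .
  qed (use x y cl in auto)
 next
  show "Psi f \<one>\<^sub>T = \<one>\<^sub>X.X"
  proof (rule X.c_eqI)
   fix i j assume ij: "i : I" "j : I"
   have "f (N.\<rho> \<one>\<^sub>T) = \<one>\<^sub>B" "f (N.\<rho> \<zero>\<^sub>T) = \<zero>\<^sub>B" using F.one F.zero by (simp_all add: rt)
   then show "X.c i j (Psi f \<one>\<^sub>T) = X.c i j \<one>\<^sub>X.X" using ij by (simp add: c U.ent_one X.tp_one X.c_tp mu.co_one)
  qed (use cl in auto)
 qed
 show "Psi f (ir m) = X.\<iota> m" if m: "m : carrier E"
 proof (rule X.c_eqI)
  have irm: "ir m : carrier T" using m by simp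
  show "Psi f (ir m) : carrier X.X" by (rule cl[OF irm])
  show "X.\<iota> m : carrier X.X" using m by simp
  fix i j assume ij: "i : I" "j : I"
  have 1: "\<one>\<^sub>T : carrier rt" using N.C.C.S_one by (simp add: N.root_carrier)
  have "X.c i j (Psi f (ir m)) = f (N.\<rho> (co m i j \<odot>\<^sub>rt \<one>\<^sub>rt))"
   using c[OF ij irm] U.ent_j[OF ij m] by (simp add: rt)
  also have "... = co m i j \<odot>\<^sub>B \<one>\<^sub>B" using F.smult[of "\<one>\<^sub>rt" "co m i j"] F.one by simp
  finally show "X.c i j (Psi f (ir m)) = X.c i j (X.\<iota> m)" using ij m by (simp add: X.c_tp)
 qed
qed

lemma Phi_Psi: "a : carrier A ==> Phi B f a = Psi f (il a)"
 by (simp add: Phi_def Psi_def)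

lemma Phi_Rep:
 assumes f: "alg_hom C B f"
 shows "Phi B f : Rep V A B"
proof -
 interpret P: alg_map T X.X "Psi f" by unfold_locales (rule Psi_hom[OF f])
 interpret i: dga_map "conc A" T il by unfold_locales (rule il_hom)
 have "alg_hom A X.X (Phi B f)" by (rule alg_homI[OF A.kalg X.X.kalg])
   (use i.add i.smult i.mult i.one i.closed in \<open>auto simp: Phi_Psi P.add P.smult P.mult P.one\<close>)
 then show ?thesis by (simp add: Rep_def Hom_alg_def Phi_def)
qed

text \<open>\<open>Psi f\<close> is determined on A by \<open>Phi B f\<close> and on End V by
  \<open>Psi_ir\<close>, hence everywhere; for w in the centralizer the entry of
  \<open>Psi f w\<close> at (i0, i0) is the value of f at the class of w.\<close>

lemma Phi_inj:
 assumes f: "alg_hom C B f" and f': "alg_hom C B f'" and eq: "Phi B f = Phi B f'" and x: "x : carrier C"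
 shows "f x = f' x"
proof -
 obtain w where w: "w : N.C.cent" "x = N.\<rho> w" using x by (auto simp: N.rep_carrier)
 have wT: "w : carrier T" using w by (simp add: N.C.cent_def)
 have "Psi f w = Psi f' w"
 proof (rule N.P.fp_ext[OF Psi_hom[OF f] Psi_hom[OF f'] _ _ wT])
  show "Psi f (il a) = Psi f' (il a)" if "a : carrier (conc A)" for a using Phi_Psi[of a f] Phi_Psi[of a f'] that eq by simp
  show "Psi f (ir m) = Psi f' (ir m)" if "m : carrier E" for m using Psi_ir[OF f that] Psi_ir[OF f' that] by simp
 qed
 then have "f (N.\<rho> (U.ent i0 i0 w)) = f' (N.\<rho> (U.ent i0 i0 w))" using Psi_c[OF f i0 i0 wT] Psi_c[OF f' i0 i0 wT] by simp
 then show ?thesis using U.ent_of_cent[OF i0 i0 w(1)] w by simp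
qed

text \<open>The tensor product is viewed as a DG algebra in degree 0, since the universal property
  of the free product speaks of DG algebra maps.\<close>

lemma iota_hom: "dga_hom E (conc X.X) X.\<iota>"
proof -
 interpret i: alg_map E X.X X.\<iota> by unfold_locales (rule X.tp_one_hom)
 show ?thesis
 proof (rule dga_homI[OF E_dga conc_dga[OF X.X.kalg]])
  show "X.\<iota> (dif E m) = dif (conc X.X) (X.\<iota> m)" if "m : carrier E" for m using that i.zero by (simp add: U.dif_E)
  show "X.\<iota> m : gr (conc X.X) n" if "m : gr E n" for m n using that i.zero by (auto simp: gr_E split: if_splits)
 qed (auto simp: i.add i.smult i.mult i.one)
qed

lemma X_unit_map: "unit_map E I e co (conc X.X) X.\<iota>"
proof -
 interpret i: dga_map E "conc X.X" X.\<iota> by unfold_locales (rule iota_hom)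
 show ?thesis by unfold_locales (simp add: gr_E)
qed

text \<open>\<open>ent i l Z\<close> is the scalar matrix whose diagonal value is the entry of Z at
  (i, l), so any diagonal position a recovers that entry.\<close>

lemma c_ent:
 assumes "a : I" "i : I" "l : I" "Z : carrier X.X"
 shows "X.c a a (unit_map.ent I e (conc X.X) X.\<iota> i l Z) = X.c i l Z"
proof -
 interpret c: lin_map X.X B "X.c a a" by (rule X.c_lin[OF assms(1,1)])
 have cl: "X.\<iota> (e k i) \<otimes>\<^sub>X.X (Z \<otimes>\<^sub>X.X X.\<iota> (e l k)) : carrier X.X" "Z \<otimes>\<^sub>X.X X.\<iota> (e l k) : carrier X.X" if "k : I" for k
  using that assms by simp_all
 have "X.c a a (unit_map.ent I e (conc X.X) X.\<iota> i l Z) =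
   X.c a a (\<Oplus>\<^sub>X.X k\<in>I. X.\<iota> (e k i) \<otimes>\<^sub>X.X (Z \<otimes>\<^sub>X.X X.\<iota> (e l k)))"
  unfolding unit_map.ent_def[OF X_unit_map] finsum_conc by simp
 also have "... = (\<Oplus>\<^sub>B k\<in>I. X.c a a (X.\<iota> (e k i) \<otimes>\<^sub>X.X (Z \<otimes>\<^sub>X.X X.\<iota> (e l k))))"
  by (rule c.finsum) (use cl in auto)
 also have "... = X.c a a (X.\<iota> (e a i) \<otimes>\<^sub>X.X (Z \<otimes>\<^sub>X.X X.\<iota> (e l a)))"
  by (rule X.B.finsum_single) (use assms cl in \<open>auto simp: X.c_unit_l\<close>)
 also have "... = X.c i l Z" using assms cl by (simp add: X.c_unit_l X.c_unit_r)
 finally show ?thesis .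
qed

text \<open>g and the inclusion of End V extend to a map G on A * End V. On the centralizer G takes
  values in scalar matrices, so its entry at (i0, i0) is multiplicative there; it kills commutators
  because B is commutative, and descends to the required f.\<close>

lemma Phi_surj:
 assumes g: "g : Rep V A B"
 shows "\<exists>f\<in>Hom_alg C B. Phi B f = g"
proof -
 have gh: "alg_hom A X.X g" and ge: "g : extensional (carrier A)" using g by (auto simp: Rep_def Hom_alg_def)
 interpret B: algebra ground B by (rule B_alg)
 obtain G where G: "dga_hom T (conc X.X) G" "!!a. a : carrier (conc A) ==> G (il a) = g a"
  "!!m. m : carrier E ==> G (ir m) = X.\<iota> m" by (rule N.P.fp_lift[OF conc_hom[OF gh] iota_hom]) blast
 interpret G: dga_map T "conc X.X" G by unfold_locales (rule G)
 interpret UX: unit_map E I e co "conc X.X" X.\<iota> by (rule X_unit_map)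
 define r where "r w = X.c i0 i0 (G w)" for w
 have Gc: "G w : carrier X.X" if "w : carrier T" for w using G.closed[OF that] by simp
 have ent: "X.c i l (G w) = r (U.ent i l w)" if "i : I" "l : I" "w : carrier T" for i l w
 proof -
  have "G (U.ent i l w) = UX.ent i l (G w)" by (rule U.ent_map[OF X_unit_map G.ah G(3) that])
  then show ?thesis using c_ent[OF i0 that(1,2) Gc[OF that(3)]] by (simp add: r_def)
 qed
 have wT: "w : carrier T" if "w : N.C.cent" for w using that by (simp add: N.C.cent_def)
 have cent: "X.c i l (G w) = (if i = l then r w else \<zero>\<^sub>B)" if "i : I" "l : I" "w : N.C.cent" for i l w
  using ent[OF that(1,2) wT[OF that(3)]] U.ent_of_cent[OF that] G.zero lin_map.zero[OF X.c_lin[OF i0 i0]] by (auto simp: r_def)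
 have rh: "alg_hom rt B r"
 proof (rule alg_homI)
  show "kalg rt" by (rule N.root.kalg)
  show "kalg B" by (rule X.B.kalg)
  show "r w : carrier B" if "w : carrier rt" for w using that wT Gc i0 by (simp add: r_def N.root_carrier)
  have rtT: "x : carrier T" if "x : carrier rt" for x using wT that by (simp add: N.root_carrier)
  show "r (x \<oplus>\<^sub>rt y) = r x \<oplus>\<^sub>B r y" if "x : carrier rt" "y : carrier rt" for x y
   using G.add[OF rtT[OF that(1)] rtT[OF that(2)]]
    lin_map.add[OF X.c_lin[OF i0 i0] Gc[OF rtT[OF that(1)]] Gc[OF rtT[OF that(2)]]] by (simp only: r_def N.root_alg_eq sub_simps conc_simps)
  show "r (a \<odot>\<^sub>rt x) = a \<odot>\<^sub>B r x" if "x : carrier rt" for a x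
   using G.smult[OF rtT[OF that]] lin_map.smult[OF X.c_lin[OF i0 i0] Gc[OF rtT[OF that]]]
   by (simp only: r_def N.root_alg_eq sub_simps conc_simps)
  show "r \<one>\<^sub>rt = \<one>\<^sub>B"
  proof -
   have "r \<one>\<^sub>rt = X.c i0 i0 (X.\<iota> \<one>\<^sub>E)"
    using G.one by (simp only: r_def N.root_alg_eq sub_simps conc_simps X.tp_one)
   also have "... = \<one>\<^sub>B" by (subst X.c_tp) (use i0 in \<open>simp_all add: mu.co_one\<close>)
   finally show ?thesis .
  qed
  show "r (x \<otimes>\<^sub>rt y) = r x \<otimes>\<^sub>B r y" if "x : carrier rt" "y : carrier rt" for x y
  proof -
   have xy: "x : N.C.cent" "y : N.C.cent" using that by (simp_all add: N.root_carrier)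
   have rc: "r x : carrier B" "r y : carrier B" using xy wT Gc i0 by (simp_all add: r_def)
   have "r (x \<otimes>\<^sub>rt y) = X.c i0 i0 (G x \<otimes>\<^sub>X.X G y)" using G.mult[of x y] xy wT by (simp add: r_def N.root_alg_eq)
   also have "... = (\<Oplus>\<^sub>B l\<in>I. X.c i0 l (G x) \<otimes>\<^sub>B X.c l i0 (G y))"
    by (rule X.c_mult) (use i0 xy wT Gc in auto)
   also have "... = X.c i0 i0 (G x) \<otimes>\<^sub>B X.c i0 i0 (G y)" by (rule X.B.finsum_single) (use i0 xy rc cent in auto)
   finally show ?thesis by (simp add: r_def)
  qed
 qed
 interpret r: alg_map rt B r by unfold_locales (rule rh)
 have "comm_ideal rt <= {x : carrier rt. r x = \<zero>\<^sub>B}"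
 proof (rule N.root.comm_ideal_minimal[OF r.kernel_ideal])
  fix x y assume xy: "x : carrier rt" "y : carrier rt"
  have m: "x \<otimes>\<^sub>rt y : carrier rt" "y \<otimes>\<^sub>rt x : carrier rt" using xy by simp_all
  have "gcomm rt x y = x \<otimes>\<^sub>rt y \<ominus>\<^sub>rt y \<otimes>\<^sub>rt x"
   using gcomm_rt[OF xy] N.C.C.sub_minus[of "x \<otimes>\<^sub>T y" "y \<otimes>\<^sub>T x"] m by (simp add: N.root_alg_eq)
  then have "r (gcomm rt x y) = r x \<otimes>\<^sub>B r y \<ominus>\<^sub>B r y \<otimes>\<^sub>B r x"
   using r.minus[OF m] xy by (simp add: r.mult)
  also have "... = \<zero>\<^sub>B"
   using B.m_comm[of "r x" "r y"] xy X.B.minus_eq_0_iff[of "r x \<otimes>\<^sub>B r y" "r y \<otimes>\<^sub>B r x"] by simp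
  finally show "gcomm rt x y : {x : carrier rt. r x = \<zero>\<^sub>B}" using xy by simp
 qed
 then have rz: "r x = \<zero>\<^sub>B" if "x : comm_ideal rt" for x using that by auto
 obtain f where f: "alg_hom (alg_quot rt (comm_ideal rt)) B f" "!!x. x : carrier rt ==> f (N.\<rho> x) = r x"
  using N.root.A.q_lift[OF rh rz] by blast
 interpret f: alg_map "alg_quot rt (comm_ideal rt)" B f by unfold_locales (rule f)
 \<comment> \<open>\<open>Hom_alg\<close> consists of extensional functions, so f is cut off outside
   the carrier.\<close>
 define f' where "f' = (\<lambda>x\<in>carrier C. f x)"
 have Cq: "carrier C = carrier (alg_quot rt (comm_ideal rt))" by (simp add: rep_alg_def)
 interpret Ck: dgalgebra C by unfold_locales (rule N.rep_dga)
 have fC: "alg_hom C B f" by (rule alg_homI[OF Ck.kalg X.B.kalg])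
   (use f.add f.smult f.mult f.one f.closed in \<open>simp_all add: rep_alg_def del: quot_simps(1-3)\<close>)
 interpret fC: alg_map C B f by unfold_locales (rule fC)
 have f'h: "alg_hom C B f'" by (rule alg_homI[OF Ck.kalg X.B.kalg]) (auto simp: f'_def fC.add fC.smult fC.mult fC.one)
 have "Phi B f' a = g a" if a: "a : carrier A" for a
 proof -
  have ia: "il a : carrier T" using a dga_map.intro[OF il_hom] N.P.fp_inl_hom
   by (auto simp: dga_hom_def galg_hom_def alg_hom_def linear_map_def)
  have ga: "g a : carrier X.X" "G (il a) = g a" using G(2)[of a] Gc[OF ia] a by auto
  have "f' (N.\<rho> (U.ent i j (il a))) = X.c i j (g a)" if ij: "i : I" "j : I" for i j
  proof -
   have er: "U.ent i j (il a) : carrier rt" using ent_rt[OF ij ia] .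
   then have "N.\<rho> (U.ent i j (il a)) : carrier C" by (simp add: N.rep_carrier N.root_carrier)
   then show ?thesis using f(2)[OF er] ent[OF ij ia] ga by (simp add: f'_def)
  qed
  then have "Phi B f' a = X.mk (%i j. X.c i j (g a))" unfolding Phi_Psi[OF a] Psi_def X.mk_def
   by (intro X.X.finsum_cong' refl) (use ga in \<open>auto intro!: X.X.finsum_closed\<close>)
  then show ?thesis using X.mk_c[OF ga(1)] by simp
 qed
 then have "Phi B f' = g" by (intro extensionalityI[OF _ ge]) (auto simp: Phi_def)
 moreover have "f' : Hom_alg C B" using f'h by (simp add: Hom_alg_def f'_def)
 ultimately show ?thesis by blast
qed

lemma Phi_bij: "bij_betw (Phi B) (Hom_alg C B) (Rep V A B)"
 unfolding bij_betw_def
proof (intro conjI inj_onI)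
 show "f = f'" if "f : Hom_alg C B" "f' : Hom_alg C B" "Phi B f = Phi B f'" for f f'
  using that Phi_inj[of f f'] by (auto simp: Hom_alg_def intro: extensionalityI)
 show "Phi B ` Hom_alg C B = Rep V A B" using Phi_Rep Phi_surj by (auto simp: Hom_alg_def) 
qed

end

context unit_rep
begin

lemma unit_rep_algI:
 fixes B :: "('k, 'b) module"
 assumes B: "algebra ground B"
 shows "unit_rep_alg V I e co A i0 B" by (intro unit_rep_alg.intro unit_rep_axioms tensor_units.intro tensor_alg.intro kalgebra.intro
   algebra_kalg[OF B] mu.kalg mu.matrix_units_axioms unit_rep_alg_axioms.intro B)

text \<open>Both sides are sums of pure tensors with matrix units on the right, and
  \<open>tensor_map\<close> acts on the left factors.\<close>

lemma Phi_natural: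
 fixes B :: "('k, 'b) module" and B' :: "('k, 'c) module"
 assumes B: "algebra ground B" and B': "algebra ground B'" and h: "h : Hom_alg B B'" and f: "f : Hom_alg C B"
 shows "Phi B' (compose (carrier C) h f) = compose (carrier A) (tensor_map B' E h) (Phi B f)"
proof
 fix a
 interpret S: unit_rep_alg V I e co A i0 B by (rule unit_rep_algI[OF B])
 interpret S': unit_rep_alg V I e co A i0 B' by (rule unit_rep_algI[OF B'])
 have hh: "alg_hom B B' h" and fh: "alg_hom C B f" using h f by (simp_all add: Hom_alg_def)
 interpret h: alg_map B B' h by unfold_locales (rule hh)
 interpret f: alg_map C B f by unfold_locales (rule fh)
 note tm = tensor_map_hom[OF hh mu.kalg]
 interpret t: alg_map S.X.X S'.X.X "tensor_map B' E h" by unfold_locales (rule tm)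
 show "Phi B' (compose (carrier C) h f) a = compose (carrier A) (tensor_map B' E h) (Phi B f) a"
 proof (cases "a : carrier A")
  case True
  have ia: "il a : carrier T" using True S.il_hom by (auto simp: dga_hom_def galg_hom_def alg_hom_def linear_map_def)
  define \<gamma> where "\<gamma> i j = f (N.\<rho> (U.ent i j (il a)))" for i j
  have eC: "N.\<rho> (U.ent i j (il a)) : carrier C" if "i : I" "j : I" for i j
   using S.ent_rt[OF that ia] by (simp add: N.rep_carrier N.root_carrier)
  have \<gamma>c: "\<gamma> i j : carrier B" if "i : I" "j : I" for i j unfolding \<gamma>_def using eC[OF that] by (rule f.closed)
  have in1: "(\<Oplus>\<^bsub>S.X.X\<^esub>j\<in>I. S.X.tp (\<gamma> i j) (e i j)) : carrier S.X.X" if "i : I" for i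
   using that \<gamma>c by (auto intro!: S.X.X.finsum_closed)
  have "compose (carrier A) (tensor_map B' E h) (Phi B f) a = tensor_map B' E h (S.X.mk \<gamma>)"
   using True by (simp add: compose_def Phi_def \<gamma>_def[abs_def])
  also have "... = (\<Oplus>\<^bsub>S'.X.X\<^esub>i\<in>I. tensor_map B' E h (\<Oplus>\<^bsub>S.X.X\<^esub>j\<in>I. S.X.tp (\<gamma> i j) (e i j)))"
   unfolding S.X.mk_def by (rule t.finsum) (use in1 in auto)
  also have "... = (\<Oplus>\<^bsub>S'.X.X\<^esub>i\<in>I. \<Oplus>\<^bsub>S'.X.X\<^esub>j\<in>I. tensor_map B' E h (S.X.tp (\<gamma> i j) (e i j)))"
   by (rule S'.X.X.finsum_cong'[OF refl _ t.finsum]) (use \<gamma>c in \<open>auto intro!: S'.X.X.finsum_closed\<close>)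
  also have "... = S'.X.mk (%i j. compose (carrier C) h f (N.\<rho> (U.ent i j (il a))))" unfolding S'.X.mk_def
   by (intro S'.X.X.finsum_cong' refl)
    (use \<gamma>c eC in \<open>auto simp: tm(2) compose_def \<gamma>_def[symmetric] intro!: S'.X.X.finsum_closed\<close>)
  also have "... = Phi B' (compose (carrier C) h f) a" using True by (simp add: Phi_def)
  finally show ?thesis by simp
 qed (simp add: Phi_def compose_def)
qed

lemma Phi_represents: "represents_Rep V A C (Phi :: ('k, 'b) module => _)"
 unfolding represents_Rep_def using C_algebra unit_rep_alg.Phi_bij[OF unit_rep_algI] Phi_natural by blast

end

theorem theorem1:
  fixes V :: "('k::field, 'v) dg"
  assumes "dg_complex V" and "fin_total_dim V"
  shows "(CHAR('k) = 0 \<longrightarrow>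
      (\<forall>(A::('k, 'a) module) (R1::('k, 'r) dg) p1 (R2::('k, 's) dg) p2.
        almost_free_res A (R1, p1) \<and> almost_free_res A (R2, p2) \<longrightarrow>
        (\<exists>f. quasi_iso (rep_alg V R1) (rep_alg V R2) f)))
    \<and>
     ((\<exists>Q::('k, 'a, ('a + 'k) list) res_choice. res_choice Q) \<and>
      (\<forall>Q::('k, 'a, 'r) res_choice. res_choice Q \<longrightarrow>
        (\<forall>A B f. alg_hom A B f \<longrightarrow> (\<exists>g. is_lift (Q A) (Q B) f g)) \<and>
        (CHAR('k) = 0 \<longrightarrow>
          (\<forall>A B f g. alg_hom A B f \<and> is_lift (Q A) (Q B) f g \<longrightarrow>
            (\<forall>x\<in>carrier (AV V Q A). AV_map V Q A B f x = AV_lift_map V (fst (Q B)) g x)) \<and>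
          gc_functor (AV V Q) (AV_map V Q) \<and>
          (\<forall>Q'::('k, 'a, 's) res_choice. res_choice Q' \<longrightarrow>
            (\<exists>\<eta>. gc_nat_iso (AV V Q) (AV_map V Q) (AV V Q') (AV_map V Q') \<eta>)))))
    \<and>
     ((\<forall>n. n \<noteq> 0 \<longrightarrow> gr V n = {\<zero>\<^bsub>V\<^esub>}) \<longrightarrow>
      (\<forall>(A::('k, 'a) module) (R::('k, 'r) dg) p. almost_free_res A (R, p) \<longrightarrow>
        (\<exists>\<phi>. alg_iso (sub (cohom (rep_alg V R)) (gr (cohom (rep_alg V R)) 0))
                (rep_alg V (conc A)) \<phi>)) \<and>
      (\<forall>A::('k, 'a) module. kalg A \<and> carrier V \<noteq> {\<zero>\<^bsub>V\<^esub>} \<longrightarrow>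
        (\<exists>\<Phi> :: ('k, 'b) module \<Rightarrow> _. represents_Rep V A (rep_alg V (conc A)) \<Phi>)))"
proof (intro conjI impI allI ballI)
  show "\<exists>f. quasi_iso (rep_alg V R1) (rep_alg V R2) f"
    if "CHAR('k) = 0" "almost_free_res A (R1, p1) \<and> almost_free_res A (R2, p2)"
    for A :: "('k, 'a) module" and R1 :: "('k, 'r) dg" and p1 and R2 :: "('k, 's) dg" and p2
    using rep_quasi_iso[OF assms that(1)] that(2) by blast
  show "\<exists>Q::('k, 'a, ('a + 'k) list) res_choice. res_choice Q" by (rule res_choice_exists)
  have dc: "deg0_complex V" if "\<forall>n. n \<noteq> 0 \<longrightarrow> gr V n = {\<zero>\<^bsub>V\<^esub>}"
    using that by (intro deg0_complex.intro fin_complex.intro assms deg0_complex_axioms.intro) simp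
  show "\<exists>\<phi>. alg_iso (sub (cohom (rep_alg V R)) (gr (cohom (rep_alg V R)) 0)) (rep_alg V (conc A)) \<phi>"
    if "\<forall>n. n \<noteq> 0 \<longrightarrow> gr V n = {\<zero>\<^bsub>V\<^esub>}" "almost_free_res A (R, p)"
    for A :: "('k, 'a) module" and R :: "('k, 'r) dg" and p
    by (rule deg0_res.H0_rep_iso[OF deg0_res.intro[OF dc[OF that(1)] afr.intro[OF that(2)]]])
  show "\<exists>\<Phi> :: ('k, 'b) module \<Rightarrow> _. represents_Rep V A (rep_alg V (conc A)) \<Phi>"
    if V0: "\<forall>n. n \<noteq> 0 \<longrightarrow> gr V n = {\<zero>\<^bsub>V\<^esub>}" and A: "kalg A \<and> carrier V \<noteq> {\<zero>\<^bsub>V\<^esub>}" for A :: "('k, 'a) module"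
  proof -
    obtain I and e :: "'v \<Rightarrow> 'v \<Rightarrow> 'v \<Rightarrow> 'v" and co
      where mu: "matrix_units (dg_End V) I e co" "I \<noteq> {} \<longleftrightarrow> carrier V \<noteq> {\<zero>\<^bsub>V\<^esub>}"
      by (rule deg0_complex.matrix_units_exist[OF dc[OF V0]])
    then obtain i0 where "i0 \<in> I" using A by blast
    then have "unit_rep V I e co A i0"
      using A by (intro unit_rep.intro dc[OF V0] mu(1) kalgebra.intro unit_rep_axioms.intro) simp_all
    then show ?thesis by (intro exI) (rule unit_rep.Phi_represents)
  qed
next
  fix Q :: "('k, 'a, 'r) res_choice" and A B :: "('k, 'a) module" and f
  assume Q: "res_choice Q" and f: "alg_hom A B f"
  show "\<exists>g. is_lift (Q A) (Q B) f g"
    using lift_exists_afr[of A "fst (Q A)" "snd (Q A)" B "fst (Q B)" "snd (Q B)" f] Q f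
    by (auto simp: res_choice_def alg_hom_def)
next
  fix Q :: "('k, 'a, 'r) res_choice"
  assume Q: "res_choice Q" and char: "CHAR('k) = 0"
  show "AV_map V Q A B f x = AV_lift_map V (fst (Q B)) g x"
    if "alg_hom A B f \<and> is_lift (Q A) (Q B) f g" "x \<in> carrier (AV V Q A)" for A B f g x
    using AV_map_eq[OF assms char Q _ _ that(2)] that(1) by blast
  show "gc_functor (AV V Q) (AV_map V Q)" by (rule AV_functor[OF assms char Q])
  show "\<exists>\<eta>. gc_nat_iso (AV V Q) (AV_map V Q) (AV V Q') (AV_map V Q') \<eta>"
    if "res_choice Q'" for Q' :: "('k, 'a, 's) res_choice"
    by (rule AV_nat_iso[OF assms char Q that])
qed

end
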